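(* Let $\{\mathbf{S}_N\}_{N\ge1}$ be the vectors of sample inclusion indicators of a sequence of measurable Poisson sampling designs with first order inclusion probabilities $\pi_{i,N}$, let $\mathcal{F}$ be a $P_y$-Donsker class of measurable functions $f:\mathcal{Y}\to\mathbb{R}$, and let $\{\mathbb{G}_N''\}_{N\ge1}$ be the corresponding sequence of Hájek empirical processes. Assume: (1) $\mathcal{F}$ contains a function $f$ with $f\equiv C$ $P_y$-almost surely for some constant $C\ne0$; (2) there is a function $\Sigma':\mathcal{F}^2\to\mathbb{R}$ such that $E_d[\mathbb{G}_N'f\,\mathbb{G}_N'g]\to\Sigma'(f,g)$ in probability for all $f,g\in\mathcal{F}$, where $\mathbb{G}_N'$ is the Horvitz-Thompson empirical process; (3) there is a constant $L>0$ such that $\min_{1\le i\le N}\pi_{i,N}\ge L$ with probability tending to $1$ as $N\to\infty$. Let $\Sigma''(f,g)$ be the limit in probability of $\Sigma_N''(f,g):=E_d[\widetilde{\mathbb{G}}_N''f\,\widetilde{\mathbb{G}}_N''g]$, $f,g\in\mathcal{F}$ (which exists under these assumptions). Then: (i) there exists a zero-mean Gaussian process $\{\mathbb{G}''f:f\in\mathcal{F}\}$ with covariance function $\Sigma''$ which is a Borel measurable and tight random element of $l^\infty(\mathcal{F})$ such that $\mathbb{G}_N''\rightsquigarrow\mathbb{G}''$ in $l^\infty(\mathcal{F})$; (ii) the sample paths $f\mapsto\mathbb{G}''f$ are, with probability $1$, uniformly continuous with respect to the semimetric $\rho_c(f,g):=\sqrt{P_y[(f-P_yf)-(g-P_yg)]^2}$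 on $\mathcal{F}$.
   Context: Setting. $\mathcal{Y},\mathcal{X}$ are separable Banach spaces. The underlying probability space is the product $\prod_{i=1}^\infty(\Omega_{y,x},\mathcal{A}_{y,x},P_{y,x})\times(\Omega_d,\mathcal{A}_d,P_d)\times\prod_{i=1}^\infty(\Omega_\varepsilon,\mathcal{A}_\varepsilon,P_\varepsilon)$ with product measure $P$; outer probabilities and expectations $P^*,E^*$ refer to it. The pairs $(Y_i,X_i)$, $i\ge1$, are the coordinate projections of the first factor: they are i.i.d. with values in $\mathcal{Y}\times\mathcal{X}$ and law $P_{y,x}$; $P_y$ is the law of $Y_1$. (The third factor carries an auxiliary i.i.d. Rademacher sequence.) Write $Qf:=\int f\,dQ$, $\mathbf{Y}_N=(Y_1,\dots,Y_N)$, $\mathbf{X}_N=(X_1,\dots,X_N)$. Poisson design. $D$ is a uniform-$[0,1]$ random variable depending only on the $\Omega_d$-coordinate. For each $N$ the inclusion probabilities $\pi_{i,N}\in(0,1]$, $i\le N$, are functions of $\mathbf{X}_N$; put $\mathfrak{p}_N(\mathbf{s})=\prod_{i=1}^N\pi_{i,N}^{s_i}(1-\pi_{i,N})^{1-s_i}$ for $\mathbf{s}\in\{0,1\}^N$. With a fixed enumeration $\mathbf{s}^{(1)},\dots,\mathbf{s}^{(2^N)}$ of $\{0,1\}^N$, $\mathbf{S}_N=(S_{1,N},\dots,S_{N,N}):=\mathbf{s}^{(1)}$ if $D\le\mathfrak{p}_N(\mathbf{s}^{(1)})$ and $:=\mathbf{s}^{(k)}$ if $\sum_{j<k}\mathfrak{p}_N(\mathbf{s}^{(j)})<D\le\sum_{j\le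 k}\mathfrak{p}_N(\mathbf{s}^{(j)})$. Thus, given $\mathbf{X}_N$, the indicators are independent Bernoulli($\pi_{i,N}$) and conditionally independent of $\mathbf{Y}_N$. The design is measurable if each $\mathfrak{p}_N(\mathbf{s})$ is a measurable function of $\mathbf{X}_N$. $E_d$ denotes expectation over $D$ with all else fixed: for any function $g$, $E_dg(\mathbf{S}_N,\mathbf{Y}_N,\mathbf{X}_N)=\sum_{\mathbf{s}}g(\mathbf{s},\mathbf{Y}_N,\mathbf{X}_N)\mathfrak{p}_N(\mathbf{s})$. Processes ($f\in\mathcal{F}$), with $\mathbb{P}_{y,N}f:=\frac1N\sum_{i=1}^Nf(Y_i)$ and $\widehat N:=\sum_{i=1}^NS_{i,N}/\pi_{i,N}$: Horvitz-Thompson process $\mathbb{G}_N'f:=\frac1{\sqrt N}\sum_{i=1}^N\left(\frac{S_{i,N}}{\pi_{i,N}}-1\right)f(Y_i)$; Hájek process $\mathbb{G}_N''f:=\sqrt N\left(\frac1{\widehat N}\sum_{i=1}^N\frac{S_{i,N}}{\pi_{i,N}}f(Y_i)-\mathbb{P}_{y,N}f\right)$ (when $\widehat N=0$ this is undefined; set it to $0$ by convention); and $\widetilde{\mathbb{G}}_N''f:=\frac1{\sqrt N}\sum_{i=1}^N\left(\frac{S_{i,N}}{\pi_{i,N}}-1\right)[f(Y_i)-\mathbb{P}_{y,N}f]$. $l^\infty(\mathcal{F})$ is the space of bounded functions $z:\mathcal{F}\to\mathbb{R}$ with norm $\|z\|_{\mathcal{F}}=\sup_{f\in\mathcal{F}}|z(f)|$.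 $\mathbb{G}_N''\rightsquigarrow\mathbb{G}''$ means $E^*h(\mathbb{G}_N'')\to Eh(\mathbb{G}'')$ for every bounded continuous $h:l^\infty(\mathcal{F})\to\mathbb{R}$. A class $\mathcal{H}$ of measurable functions is $Q$-Donsker (usual sense) if $\sup_{f\in\mathcal{H}}|f(z)-Qf|<\infty$ for every $z$ and, for $Z_1,Z_2,\dots$ i.i.d. with law $Q$ (coordinate projections), the processes $f\mapsto N^{-1/2}\sum_{i=1}^N(f(Z_i)-Qf)$ converge weakly in $l^\infty(\mathcal{H})$ to a tight Borel measurable random element. *)

theory Defs
  imports "HOL-Probability.Probability"
begin

text \<open>
  Sequences, and the coordinates of an \<open>N\<close>-vector, are indexed from \<open>0\<close>: the units of the
  population of size \<open>N\<close> are \<open>{..<N}\<close>.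
\<close>

text \<open>
  Bounded functions on \<open>F\<close> with the supremum metric. As everywhere in the library's function
  spaces, the elements are extensional, i.e. equal to \<open>undefined\<close> outside \<open>F\<close>.
\<close>

definition linf :: "'a set \<Rightarrow> ('a \<Rightarrow> real) metric" where
  "linf F = funspace F euclidean_metric"

definition linf_borel :: "'a set \<Rightarrow> ('a \<Rightarrow> real) measure" where
  "linf_borel F = sigma (mspace (linf F)) {U. openin (mtopology_of (linf F)) U}"

text \<open>
  Only used for bounded \<open>T\<close> on a probability space; there, restricting the majorants to
  integrable real-valued functions (instead of measurable extended real-valued functions whose
  expectation exists) does not change the infimum.
\<close>

definition outer_expectation :: "'o measure \<Rightarrow> ('o \<Rightarrow> real) \<Rightarrow> real" where
  "outer_expectation M T =
     Inf {integral\<^sup>L M U | U. integrable M U \<and> (\<forall>\<omega>\<in>space M. T \<omega> \<le> U \<omega>)}"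

definition tight_borel_element ::
  "'o measure \<Rightarrow> 'a set \<Rightarrow> ('o \<Rightarrow> 'a \<Rightarrow> real) \<Rightarrow> bool" where
  "tight_borel_element M F G \<longleftrightarrow>
     G \<in> M \<rightarrow>\<^sub>M linf_borel F \<and>
     (\<forall>\<epsilon>>0. \<exists>K. compactin (mtopology_of (linf F)) K \<and>
        measure M (G -` K \<inter> space M) \<ge> 1 - \<epsilon>)"

definition weakly_converges ::
  "'o measure \<Rightarrow> 'a set \<Rightarrow> (nat \<Rightarrow> 'o \<Rightarrow> 'a \<Rightarrow> real) \<Rightarrow> 'p measure \<Rightarrow> ('p \<Rightarrow> 'a \<Rightarrow> real) \<Rightarrow> bool" where
  "weakly_converges M F X M' G \<longleftrightarrow>
     (\<forall>N. \<forall>\<omega>\<in>space M. X N \<omega> \<in> mspace (linf F)) \<and>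
     (\<forall>h. continuous_map (mtopology_of (linf F)) euclideanreal h \<and>
          bounded (h ` mspace (linf F)) \<longrightarrow>
        (\<lambda>N. outer_expectation M (\<lambda>\<omega>. h (X N \<omega>))) \<longlonglongrightarrow> (\<integral>\<omega>. h (G \<omega>) \<partial>M'))"

text \<open>
  The limit is a random element on some probability space; since all conditions on it depend only
  on its law, the points of that space can be taken to be functions \<open>H \<rightarrow> \<real>\<close>.
\<close>

definition donsker :: "'z measure \<Rightarrow> ('z \<Rightarrow> real) set \<Rightarrow> bool" where
  "donsker Q H \<longleftrightarrow>
     (\<forall>f\<in>H. integrable Q f) \<and>
     (\<forall>z\<in>space Q. bdd_above ((\<lambda>f. \<bar>f z - integral\<^sup>L Q f\<bar>) ` H)) \<and>
     (\<exists>(M :: (('z \<Rightarrow> real) \<Rightarrow> real) measure) G.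
        prob_space M \<and> tight_borel_element M H G \<and>
        weakly_converges (Pi\<^sub>M UNIV (\<lambda>_::nat. Q)) H
          (\<lambda>N z. \<lambda>f\<in>H. 1 / sqrt (real N) * (\<Sum>i<N. f (z i) - integral\<^sup>L Q f)) M G)"

definition converges_in_probability :: "'o measure \<Rightarrow> (nat \<Rightarrow> 'o \<Rightarrow> real) \<Rightarrow> real \<Rightarrow> bool" where
  "converges_in_probability M T c \<longleftrightarrow>
     (\<forall>N. T N \<in> borel_measurable M) \<and>
     (\<forall>\<epsilon>>0. (\<lambda>N. measure M {\<omega>\<in>space M. \<bar>T N \<omega> - c\<bar> > \<epsilon>}) \<longlonglongrightarrow> 0)"

text \<open>Univariate normal laws include the degenerate ones (variance \<open>0\<close>).\<close>

definition normal_rv :: "'o measure \<Rightarrow> ('o \<Rightarrow> real) \<Rightarrow> bool" where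
  "normal_rv M X \<longleftrightarrow> X \<in> borel_measurable M \<and>
     ((\<exists>\<mu>. AE \<omega> in M. X \<omega> = \<mu>) \<or>
      (\<exists>\<mu> \<sigma>. \<sigma> > 0 \<and> distributed M lborel X (normal_density \<mu> \<sigma>)))"

definition gaussian_process :: "'o measure \<Rightarrow> 'a set \<Rightarrow> ('o \<Rightarrow> 'a \<Rightarrow> real) \<Rightarrow> bool" where
  "gaussian_process M F G \<longleftrightarrow>
     (\<forall>A a. finite A \<and> A \<subseteq> F \<longrightarrow> normal_rv M (\<lambda>\<omega>. \<Sum>f\<in>A. a f * G \<omega> f))"

definition zero_mean_gaussian_process ::
  "'o measure \<Rightarrow> 'a set \<Rightarrow> ('o \<Rightarrow> 'a \<Rightarrow> real) \<Rightarrow> ('a \<Rightarrow> 'a \<Rightarrow> real) \<Rightarrow> bool" where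
  "zero_mean_gaussian_process M F G C \<longleftrightarrow>
     gaussian_process M F G \<and>
     (\<forall>f\<in>F. (\<integral>\<omega>. G \<omega> f \<partial>M) = 0) \<and>
     (\<forall>f\<in>F. \<forall>g\<in>F. (\<integral>\<omega>. G \<omega> f * G \<omega> g \<partial>M) = C f g)"

definition rho_c :: "'z measure \<Rightarrow> ('z \<Rightarrow> real) \<Rightarrow> ('z \<Rightarrow> real) \<Rightarrow> real" where
  "rho_c Q f g = sqrt (\<integral>z. ((f z - integral\<^sup>L Q f) - (g z - integral\<^sup>L Q g))\<^sup>2 \<partial>Q)"

text \<open>\<open>uniformly_continuous_on\<close> needs a metric, whereas \<^const>\<open>rho_c\<close> is only a semimetric.\<close>

definition uniformly_continuous_wrt ::
  "('a \<Rightarrow> 'a \<Rightarrow> real) \<Rightarrow> 'a set \<Rightarrow> ('a \<Rightarrow> real) \<Rightarrow> bool" where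
  "uniformly_continuous_wrt \<rho> F z \<longleftrightarrow>
     (\<forall>\<epsilon>>0. \<exists>\<delta>>0. \<forall>f\<in>F. \<forall>g\<in>F. \<rho> f g < \<delta> \<longrightarrow> \<bar>z f - z g\<bar> < \<epsilon>)"

definition design_prob :: "nat \<Rightarrow> (nat \<Rightarrow> real) \<Rightarrow> (nat \<Rightarrow> nat) \<Rightarrow> real" where
  "design_prob N p s = (\<Prod>i<N. p i ^ s i * (1 - p i) ^ (1 - s i))"

text \<open>
  \<open>\<pi> N i x\<close> is the inclusion probability of unit \<open>i\<close> given the vector \<open>x\<close> of the first \<open>N\<close>
  auxiliary values, an extensional function on \<open>{..<N}\<close>.
\<close>

definition measurable_poisson_design ::
  "(nat \<Rightarrow> nat \<Rightarrow> (nat \<Rightarrow> 'x::topological_space) \<Rightarrow> real) \<Rightarrow> bool" where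
  "measurable_poisson_design \<pi> \<longleftrightarrow>
     (\<forall>N. \<forall>i<N. \<forall>x\<in>{..<N} \<rightarrow>\<^sub>E UNIV. 0 < \<pi> N i x \<and> \<pi> N i x \<le> 1) \<and>
     (\<forall>N. \<forall>s\<in>{..<N} \<rightarrow>\<^sub>E {0, 1}.
        (\<lambda>x. design_prob N (\<lambda>i. \<pi> N i x) s) \<in> borel_measurable (Pi\<^sub>M {..<N} (\<lambda>_. borel)))"

text \<open>
  \<open>en 0, \<dots>, en (2 ^ N - 1)\<close> enumerates the 0-1-vectors and \<open>d\<close> is the value of the uniform
  variable. The selected index is unique for \<open>d \<le> 1\<close>; the event \<open>d > 1\<close> is null.
\<close>

definition poisson_sample ::
  "nat \<Rightarrow> (nat \<Rightarrow> nat \<Rightarrow> nat) \<Rightarrow> (nat \<Rightarrow> real) \<Rightarrow> real \<Rightarrow> nat \<Rightarrow> nat" where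
  "poisson_sample N en p d = en (THE k. k < 2 ^ N \<and>
     (k = 0 \<or> (\<Sum>j<k. design_prob N p (en j)) < d) \<and> d \<le> (\<Sum>j\<le>k. design_prob N p (en j)))"

definition emp_mean :: "nat \<Rightarrow> (nat \<Rightarrow> 'y) \<Rightarrow> ('y \<Rightarrow> real) \<Rightarrow> real" where
  "emp_mean N y f = 1 / real N * (\<Sum>i<N. f (y i))"

definition N_hat :: "nat \<Rightarrow> (nat \<Rightarrow> real) \<Rightarrow> (nat \<Rightarrow> nat) \<Rightarrow> real" where
  "N_hat N p s = (\<Sum>i<N. real (s i) / p i)"

definition HT_process ::
  "nat \<Rightarrow> (nat \<Rightarrow> real) \<Rightarrow> (nat \<Rightarrow> nat) \<Rightarrow> (nat \<Rightarrow> 'y) \<Rightarrow> ('y \<Rightarrow> real) \<Rightarrow> real" where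
  "HT_process N p s y f = 1 / sqrt (real N) * (\<Sum>i<N. (real (s i) / p i - 1) * f (y i))"

definition hajek_process ::
  "nat \<Rightarrow> (nat \<Rightarrow> real) \<Rightarrow> (nat \<Rightarrow> nat) \<Rightarrow> (nat \<Rightarrow> 'y) \<Rightarrow> ('y \<Rightarrow> real) \<Rightarrow> real" where
  "hajek_process N p s y f =
     (if N_hat N p s = 0 then 0
      else sqrt (real N) *
        (1 / N_hat N p s * (\<Sum>i<N. real (s i) / p i * f (y i)) - emp_mean N y f))"

definition centred_HT_process ::
  "nat \<Rightarrow> (nat \<Rightarrow> real) \<Rightarrow> (nat \<Rightarrow> nat) \<Rightarrow> (nat \<Rightarrow> 'y) \<Rightarrow> ('y \<Rightarrow> real) \<Rightarrow> real" where
  "centred_HT_process N p s y f =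
     1 / sqrt (real N) * (\<Sum>i<N. (real (s i) / p i - 1) * (f (y i) - emp_mean N y f))"

text \<open>
  A sample point is \<open>(z, d, e)\<close>, where \<open>z i = (Y i, X i)\<close>.
\<close>

definition full_space ::
  "('y \<times> 'x) measure \<Rightarrow> 'd measure \<Rightarrow> 'e measure \<Rightarrow>
     ((nat \<Rightarrow> 'y \<times> 'x) \<times> 'd \<times> (nat \<Rightarrow> 'e)) measure" where
  "full_space Pyx Pd Pe = Pi\<^sub>M UNIV (\<lambda>_. Pyx) \<Otimes>\<^sub>M (Pd \<Otimes>\<^sub>M Pi\<^sub>M UNIV (\<lambda>_. Pe))"

definition uniform01_rv :: "'d measure \<Rightarrow> ('d \<Rightarrow> real) \<Rightarrow> bool" where
  "uniform01_rv M D \<longleftrightarrow> D \<in> borel_measurable M \<and> distr M borel D = uniform_measure lborel {0..1}"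

definition rademacher_rv :: "'e measure \<Rightarrow> ('e \<Rightarrow> real) \<Rightarrow> bool" where
  "rademacher_rv M r \<longleftrightarrow> r \<in> borel_measurable M \<and>
     measure M {e\<in>space M. r e = 1} = 1 / 2 \<and> measure M {e\<in>space M. r e = -1} = 1 / 2"

definition Y_of :: "(nat \<Rightarrow> 'y \<times> 'x) \<Rightarrow> nat \<Rightarrow> 'y" where
  "Y_of z i = fst (z i)"

definition X_vec :: "nat \<Rightarrow> (nat \<Rightarrow> 'y \<times> 'x) \<Rightarrow> nat \<Rightarrow> 'x" where
  "X_vec N z = (\<lambda>i\<in>{..<N}. snd (z i))"

definition incl_prob ::
  "(nat \<Rightarrow> nat \<Rightarrow> (nat \<Rightarrow> 'x) \<Rightarrow> real) \<Rightarrow> nat \<Rightarrow> (nat \<Rightarrow> 'y \<times> 'x) \<Rightarrow> nat \<Rightarrow> real" where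
  "incl_prob \<pi> N z i = \<pi> N i (X_vec N z)"

definition inclusion_indicators ::
  "('d \<Rightarrow> real) \<Rightarrow> (nat \<Rightarrow> nat \<Rightarrow> nat \<Rightarrow> nat) \<Rightarrow> (nat \<Rightarrow> nat \<Rightarrow> (nat \<Rightarrow> 'x) \<Rightarrow> real) \<Rightarrow>
     nat \<Rightarrow> (nat \<Rightarrow> 'y \<times> 'x) \<Rightarrow> 'd \<Rightarrow> nat \<Rightarrow> nat" where
  "inclusion_indicators D en \<pi> N z d = poisson_sample N (en N) (incl_prob \<pi> N z) (D d)"

text \<open>\<open>E\<^sub>d\<close> of the product of the values at \<open>f\<close> and \<open>g\<close> of a process \<open>G\<close>, as a function of the
  \<open>(Y i, X i)\<close>.\<close>

definition design_cov ::
  "(nat \<Rightarrow> (nat \<Rightarrow> real) \<Rightarrow> (nat \<Rightarrow> nat) \<Rightarrow> (nat \<Rightarrow> 'y) \<Rightarrow> ('y \<Rightarrow> real) \<Rightarrow> real) \<Rightarrow>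
     'd measure \<Rightarrow> ('d \<Rightarrow> real) \<Rightarrow> (nat \<Rightarrow> nat \<Rightarrow> nat \<Rightarrow> nat) \<Rightarrow>
     (nat \<Rightarrow> nat \<Rightarrow> (nat \<Rightarrow> 'x) \<Rightarrow> real) \<Rightarrow> ('y \<Rightarrow> real) \<Rightarrow> ('y \<Rightarrow> real) \<Rightarrow>
     nat \<Rightarrow> (nat \<Rightarrow> 'y \<times> 'x) \<Rightarrow> real" where
  "design_cov G Pd D en \<pi> f g N z =
     (\<integral>d. G N (incl_prob \<pi> N z) (inclusion_indicators D en \<pi> N z d) (Y_of z) f *
          G N (incl_prob \<pi> N z) (inclusion_indicators D en \<pi> N z d) (Y_of z) g \<partial>Pd)"

definition hajek_element ::
  "('y \<Rightarrow> real) set \<Rightarrow> ('d \<Rightarrow> real) \<Rightarrow> (nat \<Rightarrow> nat \<Rightarrow> nat \<Rightarrow> nat) \<Rightarrow>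
     (nat \<Rightarrow> nat \<Rightarrow> (nat \<Rightarrow> 'x) \<Rightarrow> real) \<Rightarrow> nat \<Rightarrow>
     (nat \<Rightarrow> 'y \<times> 'x) \<times> 'd \<times> (nat \<Rightarrow> 'e) \<Rightarrow> ('y \<Rightarrow> real) \<Rightarrow> real" where
  "hajek_element F D en \<pi> N = (\<lambda>(z, d, e). \<lambda>f\<in>F.
     hajek_process N (incl_prob \<pi> N z) (inclusion_indicators D en \<pi> N z d) (Y_of z) f)"

end

theory Submission
  imports Defs
begin

text \<open>
  Given the population, the Hajek process is a sum of independent centred variables, up to a
  remainder of order \<open>1 / sqrt N\<close>. Its characteristic function, conditionally on the
  population, is close to \<open>exp (- q / 2)\<close>, where \<open>q\<close> is the design variance, which gives the
  finite-dimensional limits. Equicontinuity in outer probability is inherited from the Donsker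
  class without symmetrization by conditioning: splitting the indices into two blocks shows that
  for every fixed sign vector the signed sums are small over pairs at small \<open>rho_c\<close>-distance,
  outside a set of small outer probability; hence for most populations this holds for most sign
  vectors, and by hypercontractivity on the cube the supremum over all sums compatible with this
  has a small mean. This majorant is measurable, and by convexity it also dominates sums with the
  design variables in place of random signs. The limit process is constructed from a Gaussian
  sequence on a countable dense subset, to which the equicontinuity is transferred, and weak
  convergence is first obtained for Lipschitz functionals.
\<close>

subsection \<open>Random signs\<close>

text \<open>Therefore each of the finitely many sign vectors gets a measurable cover of its
  exceptional populations, and from then on a population enters only through the set of sign vectors
  whose covers contain it. Integrating the uniform mass of that set and applying Markov's inequality
  exchanges the quantifiers between sign vectors and populations.

  The assumption on a constant function serves the covariance: almost surely \<open>f0\<close>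
  equals \<open>C\<close> at all observations, so dividing by \<open>C\<close> turns design
  covariances with \<open>f0\<close> into design covariances with 1, and centred functions get a
  limit covariance by bilinearity.

  Second moments are not part of the definition of a Donsker class; they are recovered from the
  one-dimensional weak limits. Total boundedness for \<open>rho_c\<close>, which supplies the dense
  subset, follows from tightness because the limit increments are normal with standard deviation
  \<open>rho_c\<close>.\<close>

definition cube :: "nat \<Rightarrow> (nat \<Rightarrow> nat) set" where
  "cube N = {..<N} \<rightarrow>\<^sub>E {0, 1}"

text \<open>Expectation under independent Bernoulli(\<open>p i\<close>) coordinates, as a finite
  sum. The values may lie in any real vector space, since both real functions and complex
  exponentials are averaged.\<close>

definition bexp :: "nat \<Rightarrow> (nat \<Rightarrow> real) \<Rightarrow> ((nat \<Rightarrow> nat) \<Rightarrow> 'b::real_vector) \<Rightarrow> 'b" where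
  "bexp N p g = (\<Sum>s\<in>cube N. design_prob N p s *\<^sub>R g s)"

lemma finite_cube [simp]: "finite (cube N)"
  by (simp add: cube_def finite_PiE)

lemma cube_values: "s \<in> cube N \<Longrightarrow> i < N \<Longrightarrow> s i = 0 \<or> s i = 1"
  by (auto simp: cube_def PiE_iff)

lemma cube_0 [simp]: "cube 0 = {\<lambda>_. undefined}"
  by (simp add: cube_def)

lemma design_prob_cong:
  "(\<And>i. i < N \<Longrightarrow> p i = q i) \<Longrightarrow> (\<And>i. i < N \<Longrightarrow> s i = s' i) \<Longrightarrow>
    design_prob N p s = design_prob N q s'"
  by (simp add: design_prob_def)

lemma design_prob_nonneg:
  "(\<And>i. i < N \<Longrightarrow> 0 \<le> p i \<and> p i \<le> 1) \<Longrightarrow> 0 \<le> design_prob N p s"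
  by (auto simp: design_prob_def intro!: prod_nonneg)

lemma bexp_cong:
  assumes "\<And>i. i < N \<Longrightarrow> p i = q i" "\<And>s. s \<in> cube N \<Longrightarrow> g s = h s"
  shows "bexp N p g = bexp N q h"
  unfolding bexp_def using assms by (auto intro!: sum.cong design_prob_cong arg_cong2[where f=scaleR])

lemma bexp_0 [simp]: "bexp 0 p g = g (\<lambda>_. undefined)"
  by (simp add: bexp_def design_prob_def)

lemma cube_Suc: "cube (Suc N) = (\<lambda>s. s(N := 1)) ` cube N \<union> (\<lambda>s. s(N := 0)) ` cube N"
proof -
  have "cube (Suc N) = (\<lambda>(y, g). g(N := y)) ` ({0,1} \<times> cube N)"
    unfolding cube_def by (simp add: lessThan_Suc PiE_insert_eq)
  then show ?thesis by (auto simp: image_iff)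
qed

lemma inj_on_upd_cube: "inj_on (\<lambda>s. s(N := v)) (cube N)"
proof (rule inj_onI)
  fix s s' assume s: "s \<in> cube N" "s' \<in> cube N" and eq: "s(N := v) = s'(N := v)"
  have "s N = undefined" "s' N = undefined" using s by (auto simp: cube_def)
  then show "s = s'" using eq by (metis fun_upd_triv fun_upd_upd)
qed

text \<open>Conditioning on the last coordinate; inductions over \<open>N\<close> go through this
  recursion.\<close>

lemma bexp_Suc:
  "bexp (Suc N) p g =
     p N *\<^sub>R bexp N p (\<lambda>s. g (s(N := 1))) + (1 - p N) *\<^sub>R bexp N p (\<lambda>s. g (s(N := 0)))"
proof -
  have dis: "(\<lambda>s. s(N := 1)) ` cube N \<inter> (\<lambda>s. s(N := 0::nat)) ` cube N = {}"
    by (auto simp: image_iff) (metis fun_upd_same nat.distinct(1))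
  have d: "design_prob (Suc N) p (s(N := v)) = design_prob N p s * (p N ^ v * (1 - p N) ^ (1 - v))" for s v
  proof -
    have "design_prob N p (s(N := v)) = design_prob N p s"
      by (rule design_prob_cong) auto
    then show ?thesis by (simp add: design_prob_def)
  qed
  show ?thesis
    unfolding bexp_def cube_Suc using dis
    by (subst sum.union_disjoint)
       (auto simp: sum.reindex[OF inj_on_upd_cube] o_def d scaleR_sum_right algebra_simps)
qed

lemma bexp_add: "bexp N p (\<lambda>s. g s + h s) = bexp N p g + bexp N p h"
  by (simp add: bexp_def scaleR_add_right sum.distrib)

lemma bexp_diff: "bexp N p (\<lambda>s. g s - h s) = bexp N p g - bexp N p h"
  by (simp add: bexp_def scaleR_diff_right sum_subtractf)

lemma bexp_cmult: "bexp N p (\<lambda>s. c * g s) = c * bexp N p g" for c :: "'a::real_algebra"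
  by (simp add: bexp_def sum_distrib_left)

lemma bexp_sum: "bexp N p (\<lambda>s. \<Sum>i\<in>A. g i s) = (\<Sum>i\<in>A. bexp N p (g i))"
  unfolding bexp_def scaleR_sum_right by (rule sum.swap)

text \<open>Independence of the coordinates. The algebra is general so that the formula also factors
  characteristic functions.\<close>

lemma bexp_prod:
  fixes \<phi> :: "nat \<Rightarrow> nat \<Rightarrow> 'a::{comm_ring_1,real_algebra_1}"
  shows "bexp N p (\<lambda>s. \<Prod>i<N. \<phi> i (s i)) = (\<Prod>i<N. p i *\<^sub>R \<phi> i 1 + (1 - p i) *\<^sub>R \<phi> i 0)"
proof (induction N)
  case (Suc N)
  have *: "bexp N p (\<lambda>s. \<Prod>i<Suc N. \<phi> i ((s(N := v)) i)) = \<phi> N v * bexp N p (\<lambda>s. \<Prod>i<N. \<phi> i (s i))" for v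
    by (subst bexp_cmult[symmetric]) (auto intro!: bexp_cong simp: mult.commute)
  show ?case
    unfolding bexp_Suc * Suc by (simp add: algebra_simps)
qed simp

lemma bexp_const: "bexp N p (\<lambda>_. c) = c"
  by (induction N) (auto simp: bexp_Suc algebra_simps)

lemma bexp_mono:
  fixes g h :: "(nat \<Rightarrow> nat) \<Rightarrow> real"
  assumes "\<And>i. i < N \<Longrightarrow> 0 \<le> p i \<and> p i \<le> 1" "\<And>s. s \<in> cube N \<Longrightarrow> g s \<le> h s"
  shows "bexp N p g \<le> bexp N p h"
  unfolding bexp_def using assms
  by (auto intro!: sum_mono mult_left_mono design_prob_nonneg)

lemma bexp_nonneg:
  fixes g :: "(nat \<Rightarrow> nat) \<Rightarrow> real"
  assumes "\<And>i. i < N \<Longrightarrow> 0 \<le> p i \<and> p i \<le> 1" "\<And>s. s \<in> cube N \<Longrightarrow> 0 \<le> g s"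
  shows "0 \<le> bexp N p g"
  using bexp_mono[OF assms(1), where g="\<lambda>_. 0" and h=g] assms(2) by (simp add: bexp_const)

lemma bexp_abs:
  fixes g :: "(nat \<Rightarrow> nat) \<Rightarrow> real"
  assumes "\<And>i. i < N \<Longrightarrow> 0 \<le> p i \<and> p i \<le> 1"
  shows "\<bar>bexp N p g\<bar> \<le> bexp N p (\<lambda>s. \<bar>g s\<bar>)"
  unfolding bexp_def
  by (rule order_trans[OF sum_abs]) (auto intro!: sum_mono simp: abs_mult design_prob_nonneg assms)

lemma bexp_coordinate:
  "i < N \<Longrightarrow> bexp N p (\<lambda>s. \<phi> (s i)) = p i *\<^sub>R \<phi> 1 + (1 - p i) *\<^sub>R \<phi> 0"
proof (induction N)
  case (Suc N)
  show ?case
  proof (cases "i = N")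
    case True
    then show ?thesis by (simp add: bexp_Suc bexp_const)
  next
    case False
    with Suc show ?thesis by (simp add: bexp_Suc) (simp add: algebra_simps)
  qed
qed simp

text \<open>Two-stage randomization: if, given \<open>s\<close>, the coordinates are drawn
  independently with parameters \<open>w i (s i)\<close>, the mixture is again a product law,
  because the parameter of coordinate \<open>i\<close> depends on \<open>s i\<close> alone.\<close>

lemma bexp_mix:
  "bexp N p (\<lambda>s. bexp N (\<lambda>i. w i (s i)) g) =
   bexp N (\<lambda>i. p i * w i 1 + (1 - p i) * w i 0) g"
proof -
  have "bexp N p (\<lambda>s. design_prob N (\<lambda>i. w i (s i)) e) =
      design_prob N (\<lambda>i. p i * w i 1 + (1 - p i) * w i 0) e" if e: "e \<in> cube N" for e
    unfolding design_prob_def bexp_prod[where \<phi>="\<lambda>i v. w i v ^ e i * (1 - w i v) ^ (1 - e i)"]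
    by (rule prod.cong) (use cube_values[OF e] in \<open>force simp: algebra_simps\<close>)+
  note * = this
  have "bexp N p (\<lambda>s. bexp N (\<lambda>i. w i (s i)) g)
     = (\<Sum>e\<in>cube N. bexp N p (\<lambda>s. design_prob N (\<lambda>i. w i (s i)) e *\<^sub>R g e))"
    by (simp add: bexp_def[where g=g] bexp_sum)
  also have "\<dots> = (\<Sum>e\<in>cube N. bexp N p (\<lambda>s. design_prob N (\<lambda>i. w i (s i)) e) *\<^sub>R g e)"
    by (simp add: bexp_def scaleR_sum_left)
  also have "\<dots> = bexp N (\<lambda>i. p i * w i 1 + (1 - p i) * w i 0) g"
    by (simp add: * bexp_def[where g=g])
  finally show ?thesis .
qed

text \<open>Signs are encoded by 0-1-vectors through \<open>2 * e i - 1\<close>, so that sign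
  vectors and samples range over the same cube and \<open>bexp\<close> serves for both.\<close>

definition sgn_sum :: "nat \<Rightarrow> (nat \<Rightarrow> nat) \<Rightarrow> (nat \<Rightarrow> real) \<Rightarrow> real" where
  "sgn_sum N e h = (\<Sum>i<N. (2 * real (e i) - 1) * h i)"

lemma bexp_sgn_sum: "bexp N p (\<lambda>e. sgn_sum N e h) = (\<Sum>i<N. (2 * p i - 1) * h i)"
proof -
  have "bexp N p (\<lambda>e. sgn_sum N e h) = (\<Sum>i<N. bexp N p (\<lambda>e. (2 * real (e i) - 1) * h i))"
    by (simp add: sgn_sum_def bexp_sum)
  also have "\<dots> = (\<Sum>i<N. (2 * p i - 1) * h i)"
  proof (rule sum.cong)
    fix i assume "i \<in> {..<N}"
    then show "bexp N p (\<lambda>e. (2 * real (e i) - 1) * h i) = (2 * p i - 1) * h i"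
      using bexp_coordinate[of i N p "\<lambda>v. (2 * real v - 1) * h i"] by (simp add: algebra_simps)
  qed simp
  finally show ?thesis .
qed

section \<open>The uniform cube: noise operator and hypercontractivity\<close>

abbreviation cube_mean :: "nat \<Rightarrow> ((nat \<Rightarrow> nat) \<Rightarrow> real) \<Rightarrow> real" where
  "cube_mean N \<equiv> bexp N (\<lambda>_. 1/2)"

lemma cube_mean_Suc:
  "cube_mean (Suc N) g = (cube_mean N (\<lambda>s. g (s(N := 1))) + cube_mean N (\<lambda>s. g (s(N := 0)))) / 2"
  by (simp add: bexp_Suc)

lemma design_prob_half: "s \<in> cube N \<Longrightarrow> design_prob N (\<lambda>_. 1/2) s = (1/2) ^ N"
proof -
  assume s: "s \<in> cube N"
  have "design_prob N (\<lambda>_. 1/2) s = (\<Prod>i<N. 1/2)"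
    unfolding design_prob_def by (rule prod.cong) (use cube_values[OF s] in force)+
  then show ?thesis by simp
qed

text \<open>A point has mass \<open>(1/2) ^ N\<close>. The crude factor is harmless, since the bound
  only serves to make suprema over infinite families finite.\<close>

lemma cube_mean_ge:
  assumes "s \<in> cube N" "\<And>s. s \<in> cube N \<Longrightarrow> 0 \<le> g s"
  shows "g s \<le> 2 ^ N * cube_mean N g"
proof -
  have "(1/2) ^ N * g s \<le> cube_mean N g"
    unfolding bexp_def
    using member_le_sum[of s "cube N" "\<lambda>s. design_prob N (\<lambda>_. 1/2) s *\<^sub>R g s"] assms
    by (auto simp: design_prob_half)
  then show ?thesis by (simp add: power_one_over field_simps)
qed

lemma cube_mean_Cauchy_Schwarz:
  "(cube_mean N (\<lambda>s. g s * h s))\<^sup>2 \<le> cube_mean N (\<lambda>s. (g s)\<^sup>2) * cube_mean N (\<lambda>s. (h s)\<^sup>2)"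
proof -
  let ?c = "(1/2::real) ^ N"
  have e: "cube_mean N u = ?c * (\<Sum>s\<in>cube N. u s)" for u :: "(nat \<Rightarrow> nat) \<Rightarrow> real"
    by (simp add: bexp_def design_prob_half sum_distrib_left)
  show ?thesis
    unfolding e power_mult_distrib power2_eq_square[of ?c]
    using Cauchy_Schwarz_ineq_sum[of g h "cube N"]
    by (simp add: mult.assoc mult.left_commute)
qed

text \<open>The noise operator with correlation \<open>\<sigma>\<close>: coordinates are flipped independently.\<close>

definition noise :: "nat \<Rightarrow> real \<Rightarrow> ((nat \<Rightarrow> nat) \<Rightarrow> real) \<Rightarrow> (nat \<Rightarrow> nat) \<Rightarrow> real" where
  "noise N \<sigma> g s = bexp N (\<lambda>i. (1 + \<sigma> * (2 * real (s i) - 1)) / 2) g"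

text \<open>Bonami's inequality from L2 to L4 for correlation \<open>1 / sqrt 3\<close>. On the two
  faces of the last coordinate \<open>g\<close> is \<open>a + b\<close> and \<open>a - b\<close>;
  the operator acts on \<open>a\<close> and \<open>b\<close> in one dimension less and multiplies
  \<open>b\<close> by \<open>\<sigma>\<close>.\<close>

lemma noise_hypercontractive:
  assumes \<sigma>: "3 * \<sigma>\<^sup>2 = 1"
  shows "cube_mean N (\<lambda>s. (noise N \<sigma> g s)^4) \<le> (cube_mean N (\<lambda>s. (g s)\<^sup>2))\<^sup>2"
proof (induction N arbitrary: g)
  case 0
  then show ?case by (simp add: noise_def)
next
  case (Suc N)
  define a where "a s = (g (s(N := 1)) + g (s(N := 0))) / 2" for s
  define b where "b s = (g (s(N := 1)) - g (s(N := 0))) / 2" for s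
  have g1: "g (s(N := 1)) = a s + b s" and g0: "g (s(N := 0)) = a s - b s" for s
    by (simp_all add: a_def b_def field_simps)
  define A where "A = noise N \<sigma> a"
  define B where "B = noise N \<sigma> b"
  have np: "noise (Suc N) \<sigma> g (s(N := v)) = A s + \<sigma> * (2 * real v - 1) * B s" for s v
  proof -
    define q where "q = (\<lambda>i. (1 + \<sigma> * (2 * real (s i) - 1)) / 2)"
    have *: "bexp N (\<lambda>i. (1 + \<sigma> * (2 * real ((s(N := v)) i) - 1)) / 2) u = bexp N q u" for u :: "_ \<Rightarrow> real"
      unfolding q_def by (rule bexp_cong) auto
    define c where "c = \<sigma> * (2 * real v - 1)"
    have "noise (Suc N) \<sigma> g (s(N := v))
        = (1 + c) / 2 * bexp N q (\<lambda>s. g (s(N := 1))) + (1 - (1 + c) / 2) * bexp N q (\<lambda>s. g (s(N := 0)))"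
      unfolding noise_def bexp_Suc * by (simp add: c_def)
    also have "\<dots> = (1 + c) / 2 * (A s + B s) + (1 - (1 + c) / 2) * (A s - B s)"
      unfolding g1 g0 bexp_add bexp_diff by (simp add: A_def B_def noise_def q_def)
    also have "\<dots> = A s + c * B s" by (simp add: field_simps)
    finally show ?thesis by (simp add: c_def)
  qed
  \<comment> \<open>Odd powers cancel between the two faces. The mixed coefficient
    \<open>6 * \<sigma>\<^sup>2\<close> equals 2, the coefficient of the mixed term in
    \<open>(\<alpha> + \<beta>)\<^sup>2\<close>; this fixes the admissible
    \<open>\<sigma>\<close>.\<close>
  have L: "cube_mean (Suc N) (\<lambda>s. (noise (Suc N) \<sigma> g s)^4)
      = cube_mean N (\<lambda>s. (A s)^4) + 2 * cube_mean N (\<lambda>s. (A s)\<^sup>2 * (B s)\<^sup>2) + cube_mean N (\<lambda>s. (B s)^4) / 9"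
  proof -
    have s4: "\<sigma> ^ 4 = 1/9"
    proof -
      have "\<sigma> ^ 4 = (\<sigma>\<^sup>2)\<^sup>2" by (simp flip: power_mult)
      also have "\<sigma>\<^sup>2 = 1/3" using \<sigma> by simp
      finally show ?thesis by (simp add: power2_eq_square)
    qed
    have "cube_mean (Suc N) (\<lambda>s. (noise (Suc N) \<sigma> g s)^4)
       = cube_mean N (\<lambda>s. ((A s + \<sigma> * B s)^4 + (A s - \<sigma> * B s)^4)) / 2"
      unfolding cube_mean_Suc np by (simp add: bexp_add)
    also have "(\<lambda>s. ((A s + \<sigma> * B s)^4 + (A s - \<sigma> * B s)^4))
      = (\<lambda>s. 2 * (A s)^4 + (12 * \<sigma>\<^sup>2) * ((A s)\<^sup>2 * (B s)\<^sup>2) + (2 * \<sigma>^4) * (B s)^4)"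
      by (rule ext) (simp add: power2_eq_square power4_eq_xxxx algebra_simps)
    also have "cube_mean N \<dots> / 2 = cube_mean N (\<lambda>s. (A s)^4) + (6*\<sigma>\<^sup>2) * cube_mean N (\<lambda>s. (A s)\<^sup>2 * (B s)\<^sup>2) + \<sigma>^4 * cube_mean N (\<lambda>s. (B s)^4)"
      unfolding bexp_add bexp_cmult by simp
    finally show ?thesis using \<sigma> s4 by simp
  qed
  have R: "cube_mean (Suc N) (\<lambda>s. (g s)\<^sup>2) = cube_mean N (\<lambda>s. (a s)\<^sup>2) + cube_mean N (\<lambda>s. (b s)\<^sup>2)"
  proof -
    have "cube_mean (Suc N) (\<lambda>s. (g s)\<^sup>2) = cube_mean N (\<lambda>s. (a s + b s)\<^sup>2 + (a s - b s)\<^sup>2) / 2"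
      unfolding cube_mean_Suc g1 g0 by (simp add: bexp_add)
    also have "(\<lambda>s. (a s + b s)\<^sup>2 + (a s - b s)\<^sup>2) = (\<lambda>s. 2 * (a s)\<^sup>2 + 2 * (b s)\<^sup>2)"
      by (rule ext) (simp add: power2_eq_square algebra_simps)
    finally show ?thesis unfolding bexp_add bexp_cmult by simp
  qed
  define \<alpha> where "\<alpha> = cube_mean N (\<lambda>s. (a s)\<^sup>2)"
  define \<beta> where "\<beta> = cube_mean N (\<lambda>s. (b s)\<^sup>2)"
  have nn: "\<alpha> \<ge> 0" "\<beta> \<ge> 0" by (auto simp: \<alpha>_def \<beta>_def intro!: bexp_nonneg)
  have A4: "cube_mean N (\<lambda>s. (A s)^4) \<le> \<alpha>\<^sup>2" and B4: "cube_mean N (\<lambda>s. (B s)^4) \<le> \<beta>\<^sup>2"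
    unfolding A_def B_def \<alpha>_def \<beta>_def by (rule Suc)+
  have B0: "0 \<le> cube_mean N (\<lambda>s. (B s)^4)" by (auto intro!: bexp_nonneg)
  \<comment> \<open>The mixed term is at most \<open>\<alpha> * \<beta>\<close>, by Cauchy-Schwarz
    and the induction hypothesis for \<open>a\<close> and \<open>b\<close>.\<close>
  have "(cube_mean N (\<lambda>s. (A s)\<^sup>2 * (B s)\<^sup>2))\<^sup>2 \<le> cube_mean N (\<lambda>s. (A s)^4) * cube_mean N (\<lambda>s. (B s)^4)"
    using cube_mean_Cauchy_Schwarz[of N "\<lambda>s. (A s)\<^sup>2" "\<lambda>s. (B s)\<^sup>2"] by (simp flip: power_mult)
  also have "\<dots> \<le> \<alpha>\<^sup>2 * \<beta>\<^sup>2" using A4 B4 B0 by (intro mult_mono) auto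
  finally have "cube_mean N (\<lambda>s. (A s)\<^sup>2 * (B s)\<^sup>2) \<le> \<alpha> * \<beta>"
    using nn unfolding power_mult_distrib[symmetric] by (elim power2_le_imp_le) simp
  then have "cube_mean (Suc N) (\<lambda>s. (noise (Suc N) \<sigma> g s)^4) \<le> \<alpha>\<^sup>2 + 2 * (\<alpha> * \<beta>) + \<beta>\<^sup>2"
    unfolding L using A4 B4 B0 by simp
  then show ?case unfolding R \<alpha>_def[symmetric] \<beta>_def[symmetric] by (simp add: power2_sum)
qed

text \<open>The hypothesis on \<open>noise\<close> bounds the L4 norm of \<open>q\<close> by
  \<open>sqrt 3\<close> times its L2 norm, so the fourth moment is at most
  \<open>9 * m\<^sup>2\<close>. By Cauchy-Schwarz a set of mass 1/36 then carries at most
  \<open>m / 2\<close> of the second moment \<open>m\<close>, and this half is absorbed on the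
  left.\<close>

lemma cube_mean_square_bound:
  assumes \<sigma>: "3 * \<sigma>\<^sup>2 = 1" and q0: "\<And>s. s \<in> cube N \<Longrightarrow> 0 \<le> q s"
    and q: "\<And>s. s \<in> cube N \<Longrightarrow> \<bar>\<sigma>\<bar> * q s \<le> noise N \<sigma> q s"
    and t: "t \<ge> 0" and B: "cube_mean N (\<lambda>s. if s \<in> B then 1 else 0) \<le> 1/36"
    and qB: "\<And>s. s \<in> cube N \<Longrightarrow> s \<notin> B \<Longrightarrow> q s \<le> t"
  shows "cube_mean N (\<lambda>s. (q s)\<^sup>2) \<le> 2 * t\<^sup>2"
proof -
  define m where "m = cube_mean N (\<lambda>s. (q s)\<^sup>2)"
  have m0: "m \<ge> 0" by (auto simp: m_def intro!: bexp_nonneg)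
  have s4: "\<bar>\<sigma>\<bar> ^ 4 = 1/9"
  proof -
    have "\<bar>\<sigma>\<bar> ^ 4 = (\<sigma>\<^sup>2)\<^sup>2" by (simp flip: power_mult)
    also have "\<sigma>\<^sup>2 = 1/3" using \<sigma> by simp
    finally show ?thesis by (simp add: power2_eq_square)
  qed
  have "(1/9) * cube_mean N (\<lambda>s. (q s)^4) = cube_mean N (\<lambda>s. (\<bar>\<sigma>\<bar> * q s)^4)"
    unfolding power_mult_distrib s4 bexp_cmult ..
  also have "\<dots> \<le> cube_mean N (\<lambda>s. (noise N \<sigma> q s)^4)"
    using q q0 by (intro bexp_mono power_mono) auto
  also have "\<dots> \<le> m\<^sup>2" unfolding m_def by (rule noise_hypercontractive[OF \<sigma>])
  finally have q4: "cube_mean N (\<lambda>s. (q s)^4) \<le> 9 * m\<^sup>2" by simp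
  let ?I = "\<lambda>s. if s \<in> B then 1 else 0 :: real"
  have I0: "0 \<le> cube_mean N ?I" by (intro bexp_nonneg) auto
  have "(cube_mean N (\<lambda>s. (q s)\<^sup>2 * ?I s))\<^sup>2 \<le> cube_mean N (\<lambda>s. (q s)^4) * cube_mean N ?I"
    using cube_mean_Cauchy_Schwarz[of N "\<lambda>s. (q s)\<^sup>2" ?I]
    by (simp flip: power_mult add: if_distrib[where f="\<lambda>x. x\<^sup>2"] cong: if_cong)
  also have "\<dots> \<le> 9 * m\<^sup>2 * (1/36)"
    using q4 B I0 by (intro mult_mono) auto
  also have "\<dots> = (m/2)\<^sup>2" by (simp add: power2_eq_square)
  finally have h: "cube_mean N (\<lambda>s. (q s)\<^sup>2 * ?I s) \<le> m/2"
    by (rule power2_le_imp_le) (use m0 in simp)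
  have "m \<le> cube_mean N (\<lambda>s. t\<^sup>2 + (q s)\<^sup>2 * ?I s)"
    unfolding m_def using qB q0 by (intro bexp_mono) (auto intro!: power_mono)
  also have "\<dots> \<le> t\<^sup>2 + m/2" using h by (simp add: bexp_add bexp_const)
  finally show ?thesis by (simp add: m_def)
qed

text \<open>Linear forms in the signs are eigenfunctions of the noise operator with eigenvalue
  \<open>\<sigma>\<close>, and the supremum of averages is at most the average of suprema.\<close>

lemma noise_Sup:
  assumes "H \<noteq> {}" and bdd: "\<And>h s. h \<in> H \<Longrightarrow> s \<in> cube N \<Longrightarrow> \<bar>sgn_sum N s h\<bar> \<le> K"
    and \<sigma>: "\<bar>\<sigma>\<bar> \<le> 1" and s: "s \<in> cube N"
  shows "\<bar>\<sigma>\<bar> * (SUP h\<in>H. \<bar>sgn_sum N s h\<bar>) \<le> noise N \<sigma> (\<lambda>s. SUP h\<in>H. \<bar>sgn_sum N s h\<bar>) s"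
proof -
  let ?p = "\<lambda>i. (1 + \<sigma> * (2 * real (s i) - 1)) / 2"
  have p: "0 \<le> ?p i \<and> ?p i \<le> 1" if "i < N" for i
    using cube_values[OF s that] \<sigma> by auto
  have bddH: "bdd_above ((\<lambda>h. \<bar>sgn_sum N e h\<bar>) ` H)" if "e \<in> cube N" for e
    using bdd[OF _ that] by (auto intro!: bdd_aboveI2)
  have le: "\<bar>\<sigma>\<bar> * \<bar>sgn_sum N s h\<bar> \<le> noise N \<sigma> (\<lambda>s. SUP h\<in>H. \<bar>sgn_sum N s h\<bar>) s" if h: "h \<in> H" for h
  proof -
    have "\<sigma> * sgn_sum N s h = noise N \<sigma> (\<lambda>e. sgn_sum N e h) s"
      unfolding noise_def bexp_sgn_sum unfolding sgn_sum_def sum_distrib_left by (intro sum.cong) (simp_all add: algebra_simps add_divide_distrib diff_divide_distrib)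
    then have "\<bar>\<sigma>\<bar> * \<bar>sgn_sum N s h\<bar> = \<bar>bexp N ?p (\<lambda>e. sgn_sum N e h)\<bar>"
      by (simp add: noise_def flip: abs_mult)
    also have "\<dots> \<le> bexp N ?p (\<lambda>e. \<bar>sgn_sum N e h\<bar>)" by (rule bexp_abs[OF p])
    also have "\<dots> \<le> noise N \<sigma> (\<lambda>s. SUP h\<in>H. \<bar>sgn_sum N s h\<bar>) s"
      unfolding noise_def by (intro bexp_mono p cSUP_upper bddH h) auto
    finally show ?thesis .
  qed
  show ?thesis
  proof (cases "\<sigma> = 0")
    case True
    then show ?thesis using le assms(1) by auto
  next
    case False
    have "(SUP h\<in>H. \<bar>sgn_sum N s h\<bar>) \<le> noise N \<sigma> (\<lambda>s. SUP h\<in>H. \<bar>sgn_sum N s h\<bar>) s / \<bar>\<sigma>\<bar>"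
      using le False by (intro cSUP_least assms(1)) (auto simp: field_simps)
    then show ?thesis using False by (simp add: field_simps)
  qed
qed

text \<open>The majorant is taken over all vectors compatible with the exceptional set \<open>B\<close>, so that it
  depends on \<open>B\<close> only. This is what keeps the later conditional estimates measurable.\<close>

lemma sign_majorant:
  assumes t: "t \<ge> 0" and B: "cube_mean N (\<lambda>s. if s \<in> B then 1 else 0) \<le> 1/36"
  shows "\<exists>W. (\<forall>s. 0 \<le> W s) \<and> cube_mean N W \<le> 2 * t \<and>
    (\<forall>h. (\<forall>s\<in>cube N - B. \<bar>sgn_sum N s h\<bar> \<le> t) \<longrightarrow> (\<forall>s\<in>cube N. \<bar>sgn_sum N s h\<bar> \<le> W s))"
proof -
  define \<sigma> where "\<sigma> = sqrt (1/3)"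
  have \<sigma>: "3 * \<sigma>\<^sup>2 = 1" "\<bar>\<sigma>\<bar> \<le> 1" by (simp_all add: \<sigma>_def)
  define H where "H = {h. \<forall>s\<in>cube N - B. \<bar>sgn_sum N s h\<bar> \<le> t}"
  \<comment> \<open>The moment bound is first shown for subfamilies with an a priori bound
    \<open>K\<close>, because the suprema have to be finite.\<close>
  have main: "cube_mean N (\<lambda>s. (SUP h\<in>J. \<bar>sgn_sum N s h\<bar>)\<^sup>2) \<le> 2 * t\<^sup>2"
    if J: "J \<noteq> {}" "J \<subseteq> H" and bd: "\<And>h s. h \<in> J \<Longrightarrow> s \<in> cube N \<Longrightarrow> \<bar>sgn_sum N s h\<bar> \<le> K" for J K
  proof (rule cube_mean_square_bound[OF \<sigma>(1) _ noise_Sup[OF J(1) bd \<sigma>(2)] t B])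
    fix s assume s: "s \<in> cube N"
    obtain j where "j \<in> J" using J by auto
    show "0 \<le> (SUP h\<in>J. \<bar>sgn_sum N s h\<bar>)"
      by (rule cSUP_upper2[OF _ \<open>j \<in> J\<close>]) (use bd[OF _ s] in \<open>auto intro!: bdd_aboveI2\<close>)
    show "(SUP h\<in>J. \<bar>sgn_sum N s h\<bar>) \<le> t" if "s \<notin> B"
      by (rule cSUP_least[OF J(1)]) (use J(2) s that in \<open>auto simp: H_def\<close>)
  qed auto
  \<comment> \<open>A single \<open>h\<close> is bounded by the sum of its absolute values. The
    moment bound for \<open>{h}\<close> then turns into a bound that is uniform over
    \<open>H\<close>, after which \<open>main\<close> applies to \<open>H\<close> itself.\<close>
  have bd: "\<bar>sgn_sum N s h\<bar> \<le> sqrt (2 ^ N * (2 * t\<^sup>2))" if "h \<in> H" "s \<in> cube N" for h s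
  proof -
    define K where "K = (\<Sum>i<N. \<bar>h i\<bar>)"
    have "\<bar>sgn_sum N s' h\<bar> \<le> K" if "s' \<in> cube N" for s'
      unfolding sgn_sum_def K_def
      by (rule order_trans[OF sum_abs]) (use cube_values[OF that] in \<open>force intro!: sum_mono simp: abs_mult\<close>)
    then have "cube_mean N (\<lambda>s. \<bar>sgn_sum N s h\<bar>\<^sup>2) \<le> 2 * t\<^sup>2"
      using main[of "{h}" K] that(1) by auto
    moreover have "\<bar>sgn_sum N s h\<bar>\<^sup>2 \<le> 2 ^ N * cube_mean N (\<lambda>s. \<bar>sgn_sum N s h\<bar>\<^sup>2)"
      by (rule cube_mean_ge[OF that(2)]) auto
    ultimately have "\<bar>sgn_sum N s h\<bar>\<^sup>2 \<le> 2 ^ N * (2 * t\<^sup>2)"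
      by (meson mult_left_mono order_trans zero_le_numeral zero_le_power)
    then show ?thesis by (rule real_le_rsqrt)
  qed
  have H0: "(\<lambda>_. 0) \<in> H" using t by (auto simp: H_def sgn_sum_def)
  \<comment> \<open>The maximum with 0 matters off the cube, where the values need not be bounded
    and the supremum has no known sign.\<close>
  define W where "W s = max 0 (SUP h\<in>H. \<bar>sgn_sum N s h\<bar>)" for s
  have WH: "\<bar>sgn_sum N s h\<bar> \<le> W s" if "h \<in> H" "s \<in> cube N" for h s
  proof -
    have "\<bar>sgn_sum N s h\<bar> \<le> (SUP h\<in>H. \<bar>sgn_sum N s h\<bar>)"
      by (rule cSUP_upper[OF that(1)]) (use bd[OF _ that(2)] in \<open>auto intro!: bdd_aboveI2\<close>)
    then show ?thesis by (simp add: W_def)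
  qed
  have W2: "cube_mean N (\<lambda>s. (W s)\<^sup>2) \<le> 2 * t\<^sup>2"
  proof -
    have "cube_mean N (\<lambda>s. (W s)\<^sup>2) = cube_mean N (\<lambda>s. (SUP h\<in>H. \<bar>sgn_sum N s h\<bar>)\<^sup>2)"
    proof (rule bexp_cong)
      fix s assume s: "s \<in> cube N"
      have "0 \<le> (SUP h\<in>H. \<bar>sgn_sum N s h\<bar>)"
        by (rule cSUP_upper2[OF _ H0]) (use bd[OF _ s] in \<open>auto intro!: bdd_aboveI2\<close>)
      then show "(W s)\<^sup>2 = (SUP h\<in>H. \<bar>sgn_sum N s h\<bar>)\<^sup>2" by (simp add: W_def)
    qed simp
    also have "\<dots> \<le> 2 * t\<^sup>2" by (rule main[OF _ _ bd]) (use H0 in auto)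
    finally show ?thesis .
  qed
  have "(cube_mean N W)\<^sup>2 \<le> cube_mean N (\<lambda>s. (W s)\<^sup>2)"
    using cube_mean_Cauchy_Schwarz[of N W "\<lambda>_. 1"] by (simp add: bexp_const)
  also have "\<dots> \<le> (2 * t)\<^sup>2" using W2 by (simp add: power2_eq_square) (smt (verit) zero_le_square)
  finally have "cube_mean N W \<le> 2 * t" using t by (elim power2_le_imp_le) simp
  moreover have "\<forall>s. 0 \<le> W s" by (simp add: W_def)
  ultimately show ?thesis using WH unfolding H_def by blast
qed

text \<open>Average of \<open>c * W\<close> over independent signs with means
  \<open>(real (s i) / p i - 1) / c\<close>; a sign with mean \<open>x\<close> has Bernoulli
  parameter \<open>(1 + x) / 2\<close>.\<close>

definition mult_majorant :: "nat \<Rightarrow> real \<Rightarrow> (nat \<Rightarrow> real) \<Rightarrow> ((nat \<Rightarrow> nat) \<Rightarrow> real) \<Rightarrow> (nat \<Rightarrow> nat) \<Rightarrow> real" where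
  "mult_majorant N c p W s = c * bexp N (\<lambda>i. (1 + (real (s i) / p i - 1) / c) / 2) W"

text \<open>A centred variable with values in \<open>[-c, c]\<close> is below the symmetric variable with values
  \<open>\<plusminus>c\<close> in the convex order, by linear interpolation; no symmetrization is needed.\<close>

lemma mult_majorant:
  assumes p: "\<And>i. i < N \<Longrightarrow> L \<le> p i \<and> p i \<le> 1" and L: "L > 0" and s: "s \<in> cube N"
    and W: "\<And>e. e \<in> cube N \<Longrightarrow> \<bar>sgn_sum N e h\<bar> \<le> W e"
  shows "\<bar>\<Sum>i<N. (real (s i) / p i - 1) * h i\<bar> \<le> mult_majorant N (1/L) p W s"
proof -
  let ?x = "\<lambda>i. real (s i) / p i - 1"
  let ?w = "\<lambda>i. (1 + ?x i / (1/L)) / 2"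
  \<comment> \<open>Inclusion probabilities of at least \<open>L\<close> put the weights into
    \<open>[- 1, 1 / L - 1]\<close>. As \<open>L \<le> 1\<close>, their multiples by
    \<open>L\<close> are admissible means of signs.\<close>
  have x: "-1 \<le> ?x i * L \<and> ?x i * L \<le> 1" if i: "i < N" for i
  proof -
    have pi: "L \<le> p i" "p i \<le> 1" "p i > 0" "L \<le> 1" using p[OF i] L by auto
    show ?thesis
    proof (cases "s i = 0")
      case True with pi L show ?thesis by simp
    next
      case False
      then have "s i = 1" using cube_values[OF s i] by simp
      moreover have "(1 / p i - 1) * L \<le> 1 / p i * L" using L by (intro mult_right_mono) auto
      moreover have "1 / p i * L \<le> 1" using pi by (simp add: field_simps)
      moreover have "(1 / p i - 1) * L \<ge> 0" using pi L by (simp add: field_simps)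
      ultimately show ?thesis by simp
    qed
  qed
  have w: "0 \<le> ?w i \<and> ?w i \<le> 1" if "i < N" for i
    using x[OF that] by (simp add: field_simps)
  have "(\<Sum>i<N. ?x i * h i) = (1/L) * bexp N ?w (\<lambda>e. sgn_sum N e h)"
    unfolding bexp_sgn_sum sum_distrib_left using L by (auto intro!: sum.cong simp: field_simps)
  then have "\<bar>\<Sum>i<N. ?x i * h i\<bar> = (1/L) * \<bar>bexp N ?w (\<lambda>e. sgn_sum N e h)\<bar>"
    using L by (simp add: abs_mult)
  also have "\<dots> \<le> (1/L) * bexp N ?w (\<lambda>e. \<bar>sgn_sum N e h\<bar>)"
    using L bexp_abs[where p="?w", OF w] by (intro mult_left_mono) auto
  also have "\<dots> \<le> (1/L) * bexp N ?w W"
    using L by (intro mult_left_mono bexp_mono w W) auto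
  finally show ?thesis by (simp add: mult_majorant_def)
qed

text \<open>The weights have mean zero under the design, so by \<open>bexp_mix\<close> the two-stage
  signs are uniform.\<close>

lemma bexp_mult_majorant:
  assumes "\<And>i. i < N \<Longrightarrow> p i > 0"
  shows "bexp N p (mult_majorant N c p W) = c * cube_mean N W"
  unfolding mult_majorant_def bexp_cmult
    bexp_mix[where w="\<lambda>i v. (1 + (real v / p i - 1) / c) / 2" and p=p]
proof (rule arg_cong[where f="(*) c"], rule bexp_cong)
  fix i assume i: "i < N"
  have "p i \<noteq> 0" using assms[OF i] by simp
  \<comment> \<open>For \<open>c = 0\<close> the inner division gives 0, and the parameter is 1/2
    again.\<close>
  then show "p i * ((1 + (real 1 / p i - 1) / c) / 2) + (1 - p i) * ((1 + (real 0 / p i - 1) / c) / 2) = 1 / 2"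
    by (cases "c = 0") (auto simp: field_simps)
qed simp

subsection \<open>Poisson sampling\<close>

text \<open>The minimum makes the distribution function constant from the last index on, hence
  monotone on all of \<open>nat\<close>.\<close>

definition design_cdf :: "nat \<Rightarrow> (nat \<Rightarrow> nat \<Rightarrow> nat) \<Rightarrow> (nat \<Rightarrow> real) \<Rightarrow> nat \<Rightarrow> real" where
  "design_cdf N en p k = (\<Sum>j<min (Suc k) (2 ^ N). design_prob N p (en j))"

text \<open>Quantile function of the enumerated design. For \<open>d > 1\<close> it repeats the
  unspecified description into which \<open>poisson_sample\<close> degenerates, so that the two
  agree for every \<open>d\<close> and not only almost surely.\<close>

definition sample_index :: "nat \<Rightarrow> (nat \<Rightarrow> nat \<Rightarrow> nat) \<Rightarrow> (nat \<Rightarrow> real) \<Rightarrow> real \<Rightarrow> nat" where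
  "sample_index N en p d = (if d \<le> 1 then LEAST k. d \<le> design_cdf N en p k else (THE k. False))"

lemma sum_design_prob: "(\<Sum>s\<in>cube N. design_prob N p s) = 1"
  using bexp_const[of N p "1::real"] by (simp add: bexp_def)

lemma sum_enum:
  assumes "bij_betw en {..<2 ^ N} (cube N)"
  shows "(\<Sum>k<2 ^ N. f (en k)) = (\<Sum>s\<in>cube N. f s)"
  using sum.reindex_bij_betw[OF assms] .

lemma design_cdf_last:
  assumes "bij_betw en {..<2 ^ N} (cube N)"
  shows "design_cdf N en p (2 ^ N - 1) = 1"
  using sum_enum[OF assms, of "design_prob N p"] by (simp add: design_cdf_def sum_design_prob)

lemma design_cdf_mono:
  assumes "\<And>i. i < N \<Longrightarrow> 0 \<le> p i \<and> p i \<le> 1" "j \<le> k"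
  shows "design_cdf N en p j \<le> design_cdf N en p k"
  unfolding design_cdf_def using assms(2)
  by (intro sum_mono2) (auto intro!: design_prob_nonneg assms(1))

lemma design_cdf_bounds:
  assumes en: "bij_betw en {..<2 ^ N} (cube N)" and p: "\<And>i. i < N \<Longrightarrow> 0 \<le> p i \<and> p i \<le> 1"
  shows "0 \<le> design_cdf N en p k" "design_cdf N en p k \<le> 1"
proof -
  show "0 \<le> design_cdf N en p k"
    unfolding design_cdf_def by (auto intro!: sum_nonneg design_prob_nonneg p)
  have "design_cdf N en p k \<le> (\<Sum>j<2 ^ N. design_prob N p (en j))"
    unfolding design_cdf_def by (intro sum_mono2) (auto intro!: design_prob_nonneg p)
  then show "design_cdf N en p k \<le> 1" by (simp add: sum_enum[OF en] sum_design_prob)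
qed

lemma sample_index_less:
  assumes en: "bij_betw en {..<2 ^ N} (cube N)" and d: "d \<le> 1"
  shows "sample_index N en p d < 2 ^ N"
proof -
  have "(LEAST k. d \<le> design_cdf N en p k) \<le> 2 ^ N - 1"
    by (rule Least_le) (use design_cdf_last[OF en, of p] d in simp)
  then show ?thesis using d by (simp add: sample_index_def) (simp add: le_less_trans)
qed

text \<open>The Galois connection between distribution function and quantile function, from which
  the selection rule and the law of the index follow.\<close>

lemma sample_index_le_iff:
  assumes en: "bij_betw en {..<2 ^ N} (cube N)" and p: "\<And>i. i < N \<Longrightarrow> 0 \<le> p i \<and> p i \<le> 1"
    and d: "d \<le> 1"
  shows "sample_index N en p d \<le> k \<longleftrightarrow> d \<le> design_cdf N en p k"
proof
  have "d \<le> design_cdf N en p (LEAST k. d \<le> design_cdf N en p k)"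
    by (rule LeastI[of _ "2 ^ N - 1"]) (use design_cdf_last[OF en, of p] d in simp)
  moreover assume "sample_index N en p d \<le> k"
  then have "(LEAST k. d \<le> design_cdf N en p k) \<le> k" using d by (simp add: sample_index_def)
  then have "design_cdf N en p (LEAST k. d \<le> design_cdf N en p k) \<le> design_cdf N en p k"
    by (intro design_cdf_mono p)
  ultimately show "d \<le> design_cdf N en p k" by linarith
next
  assume "d \<le> design_cdf N en p k"
  then show "sample_index N en p d \<le> k"
    using d by (simp add: sample_index_def Least_le)
qed

lemma poisson_sample_eq:
  assumes en: "bij_betw en {..<2 ^ N} (cube N)" and p: "\<And>i. i < N \<Longrightarrow> 0 \<le> p i \<and> p i \<le> 1"
  shows "poisson_sample N en p d = en (sample_index N en p d)"
proof (cases "d \<le> 1")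
  case True
  let ?k = "sample_index N en p d"
  have cdf: "(\<Sum>j\<le>k. design_prob N p (en j)) = design_cdf N en p k" if "k < 2 ^ N" for k
    using that by (simp add: design_cdf_def min_def lessThan_Suc_atMost)
  have cdf': "(\<Sum>j<k. design_prob N p (en j)) = design_cdf N en p (k - 1)" if "k < 2 ^ N" "k > 0" for k
    using that by (simp add: design_cdf_def min_def)
  have "(THE k. k < 2 ^ N \<and> (k = 0 \<or> (\<Sum>j<k. design_prob N p (en j)) < d) \<and>
      d \<le> (\<Sum>j\<le>k. design_prob N p (en j))) = ?k"
  proof (rule the_equality)
    have k: "?k < 2 ^ N" by (rule sample_index_less[OF en True])
    have "?k = 0 \<or> design_cdf N en p (?k - 1) < d"
      using sample_index_le_iff[where p=p, OF en p True, of "?k - 1"] by auto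
    then have "?k = 0 \<or> (\<Sum>j<?k. design_prob N p (en j)) < d"
      using cdf'[OF k] by (cases "?k = 0") auto
    moreover have "d \<le> (\<Sum>j\<le>?k. design_prob N p (en j))"
      unfolding cdf[OF k] by (subst sample_index_le_iff[where p=p and N=N, OF en p True, symmetric]) auto
    ultimately show "?k < 2 ^ N \<and> (?k = 0 \<or> (\<Sum>j<?k. design_prob N p (en j)) < d) \<and>
        d \<le> (\<Sum>j\<le>?k. design_prob N p (en j))"
      using k by blast
  next
    fix k assume k: "k < 2 ^ N \<and> (k = 0 \<or> (\<Sum>j<k. design_prob N p (en j)) < d) \<and>
        d \<le> (\<Sum>j\<le>k. design_prob N p (en j))"
    then have "?k \<le> k" using sample_index_le_iff[where p=p, OF en p True, of k] cdf[of k] by auto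
    moreover have "k = 0 \<or> \<not> ?k \<le> k - 1"
      using sample_index_le_iff[where p=p, OF en p True, of "k - 1"] cdf'[of k] k by auto
    ultimately show "k = ?k" by linarith
  qed
  then show ?thesis by (simp add: poisson_sample_def)
next
  \<comment> \<open>The distribution function never exceeds 1, so no index qualifies and the
    description collapses to \<open>THE k. False\<close>.\<close>
  case False
  have "\<not> d \<le> (\<Sum>j\<le>k. design_prob N p (en j))" if "k < 2 ^ N" for k
  proof -
    have "(\<Sum>j\<le>k. design_prob N p (en j)) = design_cdf N en p k"
      using that by (simp add: design_cdf_def min_def lessThan_Suc_atMost)
    then show ?thesis using design_cdf_bounds(2)[where p=p, OF en p, of k] False by linarith
  qed
  then have "(THE k. k < 2 ^ N \<and> (k = 0 \<or> (\<Sum>j<k. design_prob N p (en j)) < d) \<and>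
      d \<le> (\<Sum>j\<le>k. design_prob N p (en j))) = (THE k. False)"
    by (intro arg_cong[where f=The] ext) auto
  then show ?thesis using False by (simp add: poisson_sample_def sample_index_def)
qed

context
  fixes Pd :: "'d measure" and D :: "'d \<Rightarrow> real"
  assumes Pd: "prob_space Pd" and D: "uniform01_rv Pd D"
begin

interpretation Pd: prob_space Pd by (rule Pd)

lemma D_measurable [measurable]: "D \<in> borel_measurable Pd"
  using D by (simp add: uniform01_rv_def)

lemma D_distr: "measure Pd {x\<in>space Pd. D x \<in> A} = measure (uniform_measure lborel {0..1}) A"
  if "A \<in> sets borel"
proof -
  have "measure (distr Pd borel D) A = measure Pd (D -` A \<inter> space Pd)"
    using that by (intro measure_distr) auto
  moreover have "D -` A \<inter> space Pd = {x\<in>space Pd. D x \<in> A}" by auto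
  ultimately show ?thesis using D by (simp add: uniform01_rv_def)
qed

lemma D_le: "0 \<le> a \<Longrightarrow> a \<le> 1 \<Longrightarrow> measure Pd {x\<in>space Pd. D x \<le> a} = a"
proof -
  assume a: "0 \<le> a" "a \<le> 1"
  have "measure Pd {x\<in>space Pd. D x \<in> {..a}} = measure lborel ({0..1} \<inter> {..a}) / measure lborel {0..1::real}"
    by (subst D_distr) (auto simp: measure_uniform_measure)
  also have "{0..1} \<inter> {..a} = {0..a}" using a by auto
  finally show ?thesis using a by simp
qed

lemma AE_D_le_1: "AE x in Pd. D x \<le> 1"
proof -
  have "measure Pd {x\<in>space Pd. D x \<le> 1} = 1" using D_le[of 1] by simp
  then show ?thesis by (subst (asm) Pd.prob_Collect_eq_1) auto
qed

text \<open>The index is \<open>k\<close> when \<open>D\<close> falls between two consecutive values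
  of the distribution function. For \<open>k = 0\<close> there is no lower value, and the event is
  \<open>D x \<le> design_cdf N en p 0\<close>.\<close>

lemma prob_sample_index:
  assumes en: "bij_betw en {..<2 ^ N} (cube N)" and p: "\<And>i. i < N \<Longrightarrow> 0 \<le> p i \<and> p i \<le> 1"
    and k: "k < 2 ^ N"
  shows "measure Pd {x\<in>space Pd. D x \<le> 1 \<and> sample_index N en p (D x) = k} = design_prob N p (en k)"
proof -
  have le: "measure Pd {x\<in>space Pd. D x \<le> design_cdf N en p j} = design_cdf N en p j" for j
    by (rule D_le) (auto intro!: design_cdf_bounds en p)
  show ?thesis
  proof (cases "k = 0")
    case True
    have "{x\<in>space Pd. D x \<le> 1 \<and> sample_index N en p (D x) = k} = {x\<in>space Pd. D x \<le> design_cdf N en p 0}"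
      using sample_index_le_iff[where p=p, OF en p, of _ 0] design_cdf_bounds(2)[where p=p, OF en p, of 0] True by fastforce
    then show ?thesis using le[of 0] True k by (simp add: design_cdf_def min_def)
  next
    case False
    have "{x\<in>space Pd. D x \<le> 1 \<and> sample_index N en p (D x) = k} =
        {x\<in>space Pd. D x \<le> design_cdf N en p k} - {x\<in>space Pd. D x \<le> design_cdf N en p (k - 1)}"
    proof -
      have "D x \<le> 1 \<and> sample_index N en p (D x) = k \<longleftrightarrow>
          D x \<le> design_cdf N en p k \<and> \<not> D x \<le> design_cdf N en p (k - 1)" for x
      proof (cases "D x \<le> 1")
        case True
        have I: "D x \<le> design_cdf N en p j \<longleftrightarrow> sample_index N en p (D x) \<le> j" for j
          by (rule sample_index_le_iff[symmetric]) (use en p True in auto)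
        have "sample_index N en p (D x) = k \<longleftrightarrow> sample_index N en p (D x) \<le> k \<and> \<not> sample_index N en p (D x) \<le> k - 1"
          using False by linarith
        then show ?thesis unfolding I using True by blast
      next
        case F: False
        then show ?thesis using design_cdf_bounds(2)[where p=p, OF en p, of k] by linarith
      qed
      then show ?thesis by auto
    qed
    also have "measure Pd \<dots> = design_cdf N en p k - design_cdf N en p (k - 1)"
      using design_cdf_mono[where p=p and N=N and en=en, OF p, of "k - 1" k]
      by (subst Pd.finite_measure_Diff) (auto simp: le)
    also have "\<dots> = design_prob N p (en k)"
      using k False by (cases k) (simp_all add: design_cdf_def min_def)
    finally show ?thesis .
  qed
qed

lemma sample_index_measurable:
  assumes p: "\<And>s. s \<in> cube N \<Longrightarrow> (\<lambda>z. design_prob N (p z) s) \<in> borel_measurable M"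
    and en: "bij_betw en {..<2 ^ N} (cube N)"
  shows "(\<lambda>(z, x). sample_index N en (p z) (D x)) \<in> M \<Otimes>\<^sub>M Pd \<rightarrow>\<^sub>M count_space UNIV"
proof -
  have "en j \<in> cube N" if "j < 2 ^ N" for j
    using en that by (auto simp: bij_betw_def)
  then have [measurable]: "(\<lambda>z. design_cdf N en (p z) k) \<in> borel_measurable M" for k
    unfolding design_cdf_def by (intro borel_measurable_sum p) auto
  show ?thesis unfolding sample_index_def split_beta by measurable
qed

text \<open>Outside the null event \<open>D x > 1\<close> the sample runs through a finite set, so
  \<open>\<phi>\<close> may be arbitrary.\<close>

lemma integral_poisson_sample:
  fixes \<phi> :: "(nat \<Rightarrow> nat) \<Rightarrow> real"
  assumes en: "bij_betw en {..<2 ^ N} (cube N)" and p: "\<And>i. i < N \<Longrightarrow> 0 \<le> p i \<and> p i \<le> 1"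
  shows "(\<integral>x. \<phi> (poisson_sample N en p (D x)) \<partial>Pd) = bexp N p \<phi>"
proof -
  have [measurable]: "(\<lambda>x. sample_index N en p (D x)) \<in> Pd \<rightarrow>\<^sub>M count_space UNIV"
    using measurable_compose[OF measurable_Pair1' sample_index_measurable[of N "\<lambda>_. p" "count_space UNIV" en]] en
    by (auto simp: o_def)
  let ?A = "\<lambda>k. {x\<in>space Pd. D x \<le> 1 \<and> sample_index N en p (D x) = k}"
  have [measurable]: "?A k \<in> sets Pd" for k by measurable
  have "(\<integral>x. \<phi> (poisson_sample N en p (D x)) \<partial>Pd) = (\<integral>x. (\<Sum>k<2^N. \<phi> (en k) * indicator (?A k) x) \<partial>Pd)"
  proof (rule integral_cong_AE)
    show "(\<lambda>x. \<phi> (poisson_sample N en p (D x))) \<in> borel_measurable Pd"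
      by (subst poisson_sample_eq[where p=p, OF en p]) measurable
    show "AE x in Pd. \<phi> (poisson_sample N en p (D x)) = (\<Sum>k<2^N. \<phi> (en k) * indicator (?A k) x)"
      using AE_D_le_1 AE_space
    proof eventually_elim
      case (elim x)
      have "(\<Sum>k<2^N. \<phi> (en k) * indicator (?A k) x)
          = (\<Sum>k<2^N. if k = sample_index N en p (D x) then \<phi> (en k) else 0)"
        using elim by (intro sum.cong) (auto simp: indicator_def)
      then show ?case using sample_index_less[OF en elim(1), of p]
        by (simp add: poisson_sample_eq[where p=p, OF en p])
    qed
  qed measurable
  also have "\<dots> = (\<Sum>k<2^N. \<phi> (en k) * measure Pd (?A k))"
    by (subst Bochner_Integration.integral_sum) (auto intro!: integrable_mult_right integrable_real_indicator simp: Pd.emeasure_eq_measure)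
  also have "\<dots> = (\<Sum>k<2^N. design_prob N p (en k) * \<phi> (en k))"
    by (intro sum.cong) (simp_all add: prob_sample_index[where p=p, OF en p])
  also have "\<dots> = bexp N p \<phi>"
    using sum_enum[OF en, of "\<lambda>s. design_prob N p s * \<phi> s"] by (simp add: bexp_def)
  finally show ?thesis .
qed

text \<open>The sample enters through an index in \<open>nat\<close>, so measurability in
  \<open>z\<close> for each fixed \<open>s\<close> gives joint measurability.\<close>

lemma sampled_measurable:
  fixes u :: "'z \<Rightarrow> (nat \<Rightarrow> nat) \<Rightarrow> real"
  assumes dp: "\<And>s. s \<in> cube N \<Longrightarrow> (\<lambda>z. design_prob N (p z) s) \<in> borel_measurable M"
    and en: "bij_betw en {..<2 ^ N} (cube N)"
    and p: "\<And>z i. z \<in> space M \<Longrightarrow> i < N \<Longrightarrow> 0 \<le> p z i \<and> p z i \<le> 1"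
    and u: "\<And>s. (\<lambda>z. u z s) \<in> borel_measurable M"
  shows "(\<lambda>(z, x). u z (poisson_sample N en (p z) (D x))) \<in> borel_measurable (M \<Otimes>\<^sub>M Pd)"
proof -
  have [measurable]: "(\<lambda>w. sample_index N en (p (fst w)) (D (snd w))) \<in> M \<Otimes>\<^sub>M Pd \<rightarrow>\<^sub>M count_space UNIV"
    using sample_index_measurable[OF dp en] by (simp add: split_beta)
  have "(\<lambda>w. u (fst w) (en (sample_index N en (p (fst w)) (D (snd w))))) \<in> borel_measurable (M \<Otimes>\<^sub>M Pd)"
    by (rule measurable_compose_countable[where f="\<lambda>k w. u (fst w) (en k)"])
       (auto intro!: measurable_compose[OF measurable_fst u])
  then show ?thesis
    by (rule measurable_cong[THEN iffD1, rotated])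
       (auto simp: split_beta poisson_sample_eq[OF en p] space_pair_measure)
qed

text \<open>Fubini's theorem with the population outside: for fixed \<open>z\<close> the integral
  over the design coordinate is the finite sum \<open>bexp\<close>.\<close>

lemma integral_full_space:
  fixes u :: "'z \<Rightarrow> (nat \<Rightarrow> nat) \<Rightarrow> real" and Pe' :: "'f measure"
  assumes M: "prob_space M" and Pe': "prob_space Pe'"
    and dp: "\<And>s. s \<in> cube N \<Longrightarrow> (\<lambda>z. design_prob N (p z) s) \<in> borel_measurable M"
    and en: "bij_betw en {..<2 ^ N} (cube N)"
    and p: "\<And>z i. z \<in> space M \<Longrightarrow> i < N \<Longrightarrow> 0 \<le> p z i \<and> p z i \<le> 1"
    and u: "\<And>s. (\<lambda>z. u z s) \<in> borel_measurable M" and B: "\<And>z s. z \<in> space M \<Longrightarrow> \<bar>u z s\<bar> \<le> B"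
  defines "P \<equiv> M \<Otimes>\<^sub>M (Pd \<Otimes>\<^sub>M Pe')"
  shows "(\<lambda>(z, x, e). u z (poisson_sample N en (p z) (D x))) \<in> borel_measurable P"
    and "integrable P (\<lambda>(z, x, e). u z (poisson_sample N en (p z) (D x)))"
    and "(\<integral>\<omega>. (case \<omega> of (z, x, e) \<Rightarrow> u z (poisson_sample N en (p z) (D x))) \<partial>P) = (\<integral>z. bexp N (p z) (u z) \<partial>M)"
proof -
  interpret M: prob_space M by (rule M)
  interpret E: prob_space Pe' by (rule Pe')
  interpret DE: pair_prob_space Pd Pe' ..
  interpret P: pair_prob_space M "Pd \<Otimes>\<^sub>M Pe'" ..
  have [measurable]: "(\<lambda>w. u (fst w) (poisson_sample N en (p (fst w)) (D (snd w)))) \<in> borel_measurable (M \<Otimes>\<^sub>M Pd)"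
    using sampled_measurable[where M=M and p=p and u=u, OF dp en p u] by (simp add: split_beta)
  have "(\<lambda>w. u (fst (fst w, fst (snd w))) (poisson_sample N en (p (fst (fst w, fst (snd w)))) (D (snd (fst w, fst (snd w)))))) \<in> borel_measurable P"
    unfolding P_def by (rule measurable_compose[where g="\<lambda>w. u (fst w) (poisson_sample N en (p (fst w)) (D (snd w)))" and N="M \<Otimes>\<^sub>M Pd"]) measurable
  then show meas: "(\<lambda>(z, x, e). u z (poisson_sample N en (p z) (D x))) \<in> borel_measurable P"
    by (simp add: split_beta)
  show int: "integrable P (\<lambda>(z, x, e). u z (poisson_sample N en (p z) (D x)))"
    by (rule P.integrable_const_bound[of _ B, folded P_def, OF AE_I2 meas]) (auto simp: P_def space_pair_measure B)
  have "(\<integral>\<omega>. (case \<omega> of (z, x, e) \<Rightarrow> u z (poisson_sample N en (p z) (D x))) \<partial>P)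
      = (\<integral>z. (\<integral>w. u z (poisson_sample N en (p z) (D (fst w))) \<partial>(Pd \<Otimes>\<^sub>M Pe')) \<partial>M)"
    using P.integral_fst'[OF int[unfolded P_def split_beta'], symmetric] unfolding P_def split_beta' by simp
  also have "\<dots> = (\<integral>z. bexp N (p z) (u z) \<partial>M)"
  proof (rule Bochner_Integration.integral_cong[OF refl])
    fix z assume z: "z \<in> space M"
    have m: "(\<lambda>x. u z (poisson_sample N en (p z) (D x))) \<in> borel_measurable Pd"
      using measurable_compose[OF measurable_Pair1'[OF z] sampled_measurable[where M=M and p=p and u=u, OF dp en p u]] by simp
    have "(\<integral>w. u z (poisson_sample N en (p z) (D (fst w))) \<partial>(Pd \<Otimes>\<^sub>M Pe'))
        = (\<integral>x. u z (poisson_sample N en (p z) (D x)) \<partial>distr (Pd \<Otimes>\<^sub>M Pe') Pd fst)"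
      by (subst integral_distr) (auto intro!: m)
    also have "distr (Pd \<Otimes>\<^sub>M Pe') Pd fst = Pd"
      by (rule E.distr_pair_fst)
    also have "(\<integral>x. u z (poisson_sample N en (p z) (D x)) \<partial>Pd) = bexp N (p z) (u z)"
      by (rule integral_poisson_sample[OF en p[OF z]])
    finally show "(\<integral>w. u z (poisson_sample N en (p z) (D (fst w))) \<partial>(Pd \<Otimes>\<^sub>M Pe')) = bexp N (p z) (u z)" .
  qed
  finally show "(\<integral>\<omega>. (case \<omega> of (z, x, e) \<Rightarrow> u z (poisson_sample N en (p z) (D x))) \<partial>P) = (\<integral>z. bexp N (p z) (u z) \<partial>M)" .
qed

end

subsection \<open>Convergence in probability\<close>

lemma converges_in_probability_map2:
  assumes M: "prob_space M"
    and T: "converges_in_probability M T c" and U: "converges_in_probability M U d"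
    and h: "isCont (\<lambda>(x, y). h x y) (c, d)"
    and meas: "\<And>N. (\<lambda>\<omega>. h (T N \<omega>) (U N \<omega>)) \<in> borel_measurable M"
  shows "converges_in_probability M (\<lambda>N \<omega>. h (T N \<omega>) (U N \<omega>)) (h c d)"
  unfolding converges_in_probability_def
proof (intro conjI allI impI meas)
  interpret prob_space M by (rule M)
  have [measurable]: "T N \<in> borel_measurable M" "U N \<in> borel_measurable M" for N
    using T U by (auto simp: converges_in_probability_def)
  fix e :: real assume "e > 0"
  then obtain r where r: "r > 0" "\<And>z. dist z (c, d) < r \<Longrightarrow> dist (case z of (x, y) \<Rightarrow> h x y) (h c d) < e"
    using h unfolding continuous_at_eps_delta by fastforce
  \<comment> \<open>Two coordinates within \<open>r'\<close> of their limits give a pair strictly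
    within \<open>r\<close>, even if both deviations equal \<open>r'\<close>.\<close>
  define r' where "r' = r/4"
  have r': "r' > 0" "r' + r' < r" using r by (simp_all add: r'_def)
  have sub: "{\<omega>\<in>space M. e < \<bar>h (T N \<omega>) (U N \<omega>) - h c d\<bar>}
      \<subseteq> {\<omega>\<in>space M. \<bar>T N \<omega> - c\<bar> > r'} \<union> {\<omega>\<in>space M. \<bar>U N \<omega> - d\<bar> > r'}" for N
  proof (intro subsetI, rule ccontr)
    fix \<omega> assume "\<omega> \<in> {\<omega>\<in>space M. e < \<bar>h (T N \<omega>) (U N \<omega>) - h c d\<bar>}"
      "\<omega> \<notin> {\<omega>\<in>space M. \<bar>T N \<omega> - c\<bar> > r'} \<union> {\<omega>\<in>space M. \<bar>U N \<omega> - d\<bar> > r'}"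
    then have w: "e < \<bar>h (T N \<omega>) (U N \<omega>) - h c d\<bar>" "\<bar>T N \<omega> - c\<bar> \<le> r'" "\<bar>U N \<omega> - d\<bar> \<le> r'"
      by auto
    have "dist (T N \<omega>, U N \<omega>) (c, d) \<le> dist (T N \<omega>) c + dist (U N \<omega>) d"
      unfolding dist_Pair_Pair by (rule sqrt_sum_squares_le_sum) auto
    also have "\<dots> < r" using w r' by (simp add: dist_real_def)
    finally show False using r(2)[of "(T N \<omega>, U N \<omega>)"] w(1) by (simp add: dist_real_def)
  qed
  have "(\<lambda>N. measure M {\<omega>\<in>space M. \<bar>T N \<omega> - c\<bar> > r'} + measure M {\<omega>\<in>space M. \<bar>U N \<omega> - d\<bar> > r'}) \<longlonglongrightarrow> 0 + 0"
    using T U r' unfolding converges_in_probability_def by (intro tendsto_add) auto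
  then have lim: "(\<lambda>N. measure M {\<omega>\<in>space M. \<bar>T N \<omega> - c\<bar> > r'} + measure M {\<omega>\<in>space M. \<bar>U N \<omega> - d\<bar> > r'}) \<longlonglongrightarrow> 0"
    by simp
  show "(\<lambda>N. measure M {\<omega>\<in>space M. e < \<bar>h (T N \<omega>) (U N \<omega>) - h c d\<bar>}) \<longlonglongrightarrow> 0"
  proof (rule tendsto_sandwich[OF _ _ tendsto_const lim])
    show "\<forall>\<^sub>F N in sequentially. 0 \<le> measure M {\<omega>\<in>space M. e < \<bar>h (T N \<omega>) (U N \<omega>) - h c d\<bar>}"
      by simp
    show "\<forall>\<^sub>F N in sequentially. measure M {\<omega>\<in>space M. e < \<bar>h (T N \<omega>) (U N \<omega>) - h c d\<bar>}
       \<le> measure M {\<omega>\<in>space M. \<bar>T N \<omega> - c\<bar> > r'} + measure M {\<omega>\<in>space M. \<bar>U N \<omega> - d\<bar> > r'}"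
      by (intro always_eventually allI order_trans[OF finite_measure_mono[OF sub] measure_Un_le]) measurable
  qed
qed

lemma converges_in_probability_const:
  "converges_in_probability M (\<lambda>_ _. c) c"
  by (simp add: converges_in_probability_def)

lemma converges_in_probability_add:
  assumes "prob_space M" "converges_in_probability M T c" "converges_in_probability M U d"
  shows "converges_in_probability M (\<lambda>N \<omega>. T N \<omega> + U N \<omega>) (c + d)"
  using assms by (intro converges_in_probability_map2[where h="(+)"])
    (auto intro!: continuous_intros borel_measurable_add simp: split_beta' converges_in_probability_def)

lemma converges_in_probability_mult:
  assumes "prob_space M" "converges_in_probability M T c" "converges_in_probability M U d"
  shows "converges_in_probability M (\<lambda>N \<omega>. T N \<omega> * U N \<omega>) (c * d)"
  using assms by (intro converges_in_probability_map2[where h="(*)"])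
    (auto intro!: continuous_intros borel_measurable_times simp: split_beta' converges_in_probability_def)

lemma converges_in_probability_sum:
  assumes "prob_space M" "\<And>i. i \<in> A \<Longrightarrow> converges_in_probability M (T i) (c i)"
  shows "converges_in_probability M (\<lambda>N \<omega>. \<Sum>i\<in>A. T i N \<omega>) (\<Sum>i\<in>A. c i)"
  using assms(2)
  by (induction A rule: infinite_finite_induct)
     (auto intro!: converges_in_probability_const converges_in_probability_add assms(1))

lemma converges_in_probability_cong:
  assumes T: "converges_in_probability M T c" and U: "\<And>N. U N \<in> borel_measurable M"
    and eq: "\<And>N. AE \<omega> in M. U N \<omega> = T N \<omega>"
  shows "converges_in_probability M U c"
proof -
  have [measurable]: "T N \<in> borel_measurable M" "U N \<in> borel_measurable M" for N
    using T U by (auto simp: converges_in_probability_def)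
  have "measure M {\<omega>\<in>space M. \<bar>U N \<omega> - c\<bar> > e} = measure M {\<omega>\<in>space M. \<bar>T N \<omega> - c\<bar> > e}" for N e
    by (rule measure_eq_AE) (use eq[of N] in auto)
  then show ?thesis using T U by (simp add: converges_in_probability_def)
qed

text \<open>The deviation of \<open>g (T N \<omega>)\<close> from \<open>g c\<close> is below
  \<open>e / 2\<close> where \<open>T N \<omega>\<close> is close to \<open>c\<close>, and at most
  \<open>K\<close> on the remaining event, whose probability vanishes.\<close>

lemma converges_in_probability_integral:
  fixes g :: "real \<Rightarrow> real"
  assumes M: "prob_space M" and T: "converges_in_probability M T c"
    and g: "isCont g c" "g \<in> borel_measurable borel" and B: "\<And>N \<omega>. \<omega> \<in> space M \<Longrightarrow> \<bar>g (T N \<omega>)\<bar> \<le> B"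
  shows "(\<lambda>N. \<integral>\<omega>. g (T N \<omega>) \<partial>M) \<longlonglongrightarrow> g c"
proof (rule LIMSEQ_I)
  interpret prob_space M by (rule M)
  have T' [measurable]: "T N \<in> borel_measurable M" for N using T by (simp add: converges_in_probability_def)
  note g(2)[measurable]
  fix e :: real assume e: "e > 0"
  obtain r where r: "r > 0" "\<And>x. \<bar>x - c\<bar> < r \<Longrightarrow> \<bar>g x - g c\<bar> < e/2"
    using g(1) e unfolding continuous_at_eps_delta dist_real_def by (metis half_gt_zero)
  define r' where "r' = r/2"
  have r': "r' > 0" "r' < r" using r by (simp_all add: r'_def)
  define K where "K = B + \<bar>g c\<bar> + 1"
  obtain \<omega>0 where "\<omega>0 \<in> space M" using not_empty by blast
  then have K: "K > 0" "\<omega> \<in> space M \<Longrightarrow> \<bar>g (T N \<omega>) - g c\<bar> \<le> K" for N \<omega>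
    using B[of \<omega> N] B[of \<omega>0 0] unfolding K_def by auto
  have "(\<lambda>N. measure M {\<omega>\<in>space M. \<bar>T N \<omega> - c\<bar> > r'}) \<longlonglongrightarrow> 0"
    using T r' by (simp add: converges_in_probability_def)
  then have "\<forall>\<^sub>F N in sequentially. measure M {\<omega>\<in>space M. \<bar>T N \<omega> - c\<bar> > r'} < e / (2*K)"
    using e K by (intro order_tendstoD(2)[where a="e / (2*K)"]) auto
  then obtain N0 where N0: "\<And>N. N \<ge> N0 \<Longrightarrow> measure M {\<omega>\<in>space M. \<bar>T N \<omega> - c\<bar> > r'} < e / (2*K)"
    by (auto simp: eventually_sequentially)
  have "norm ((\<integral>\<omega>. g (T N \<omega>) \<partial>M) - g c) < e" if "N \<ge> N0" for N
  proof -
    have i1: "integrable M (\<lambda>\<omega>. g (T N \<omega>))"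
      by (rule integrable_const_bound[of _ B]) (use B in auto)
    let ?A = "{\<omega>\<in>space M. \<bar>T N \<omega> - c\<bar> > r'}"
    have "(\<integral>\<omega>. g (T N \<omega>) \<partial>M) - g c = (\<integral>\<omega>. g (T N \<omega>) - g c \<partial>M)"
      using i1 by (simp add: prob_space)
    also have "\<bar>\<dots>\<bar> \<le> (\<integral>\<omega>. \<bar>g (T N \<omega>) - g c\<bar> \<partial>M)"
      using integral_norm_bound[of M "\<lambda>\<omega>. g (T N \<omega>) - g c"] by simp
    also have "\<dots> \<le> (\<integral>\<omega>. e/2 + K * indicator ?A \<omega> \<partial>M)"
    proof (rule integral_mono)
      show "integrable M (\<lambda>\<omega>. \<bar>g (T N \<omega>) - g c\<bar>)" using i1 by simp
      show "integrable M (\<lambda>\<omega>. e/2 + K * indicator ?A \<omega>)"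
        by (intro Bochner_Integration.integrable_add integrable_mult_right integrable_real_indicator) (auto simp: emeasure_eq_measure)
      fix \<omega> assume w: "\<omega> \<in> space M"
      show "\<bar>g (T N \<omega>) - g c\<bar> \<le> e/2 + K * indicator ?A \<omega>"
        using K(2)[OF w, of N] r' r(2)[of "T N \<omega>"] w e by (cases "\<omega> \<in> ?A") (auto simp: indicator_def)
    qed
    also have "\<dots> = e/2 + K * measure M ?A"
      by (subst Bochner_Integration.integral_add) (auto simp: emeasure_eq_measure prob_space)
    also have "\<dots> < e" using N0[OF that] K by (simp add: field_simps)
    finally show ?thesis by simp
  qed
  then show "\<exists>no. \<forall>n\<ge>no. norm ((\<integral>\<omega>. g (T n \<omega>) \<partial>M) - g c) < e" by blast
qed

subsection \<open>Finite-dimensional convergence from trigonometric moments\<close>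

text \<open>Cosines with a phase suffice as generators: a sine is the phase \<open>- (pi/2)\<close>,
  and the product-to-sum formula keeps the class closed under multiplication.\<close>

inductive_set trig_polys :: "nat \<Rightarrow> ((nat \<Rightarrow> real) \<Rightarrow> real) set" for k where
  cos: "(\<lambda>x. c * cos ((\<Sum>j<k. a j * x j) + b)) \<in> trig_polys k"
| add: "f \<in> trig_polys k \<Longrightarrow> g \<in> trig_polys k \<Longrightarrow> (\<lambda>x. f x + g x) \<in> trig_polys k"

lemma trig_polys_const: "(\<lambda>_. c) \<in> trig_polys k"
  using trig_polys.cos[of c "\<lambda>_. 0" k 0] by simp

lemma trig_polys_sin: "j < k \<Longrightarrow> (\<lambda>x. sin (x j / R)) \<in> trig_polys k"
proof -
  assume j: "j < k"
  have "(\<Sum>i<k. (if i = j then 1 / R else 0) * x i) = x j / R" for x :: "nat \<Rightarrow> real"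
    using j by (simp add: if_distrib[where f="\<lambda>c. c * _"] cong: if_cong)
  then show ?thesis
    using trig_polys.cos[of 1 "\<lambda>i. if i = j then 1 / R else 0" k "- (pi/2)"]
    by (simp add: cos_diff)
qed

lemma trig_polys_mult:
  assumes "f \<in> trig_polys k" "g \<in> trig_polys k"
  shows "(\<lambda>x. f x * g x) \<in> trig_polys k"
  using assms
proof (induction arbitrary: g)
  case (cos c a b)
  from cos show ?case
  proof (induction g)
    case (cos c' a' b')
    have "(\<lambda>x. c * cos ((\<Sum>j<k. a j * x j) + b) * (c' * cos ((\<Sum>j<k. a' j * x j) + b')))
      = (\<lambda>x. (c*c'/2) * cos ((\<Sum>j<k. (a j - a' j) * x j) + (b - b')) + (c*c'/2) * cos ((\<Sum>j<k. (a j + a' j) * x j) + (b + b')))"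
      (is "?l = ?r")
    proof
      fix x :: "nat \<Rightarrow> real"
      define u where "u = (\<Sum>j<k. a j * x j) + b"
      define v where "v = (\<Sum>j<k. a' j * x j) + b'"
      have e: "(\<Sum>j<k. (a j - a' j) * x j) + (b - b') = u - v" "(\<Sum>j<k. (a j + a' j) * x j) + (b + b') = u + v"
        by (simp_all add: u_def v_def algebra_simps sum.distrib sum_subtractf)
      have "c * cos u * (c' * cos v) = c * c' * (cos u * cos v)" by simp
      also have "\<dots> = (c*c'/2) * cos (u - v) + (c*c'/2) * cos (u + v)"
        unfolding cos_times_cos by (simp add: field_simps)
      finally show "?l x = ?r x" unfolding e u_def[symmetric] v_def[symmetric] .
    qed
    then show ?case by (simp only:) (intro trig_polys.intros)
  next
    case (add f g)
    have "(\<lambda>x. c * cos ((\<Sum>j<k. a j * x j) + b) * (f x + g x)) =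
        (\<lambda>x. c * cos ((\<Sum>j<k. a j * x j) + b) * f x + c * cos ((\<Sum>j<k. a j * x j) + b) * g x)"
      by (simp add: distrib_left)
    then show ?case using trig_polys.add[OF add.IH] by simp
  qed
next
  case (add f h)
  have "(\<lambda>x. (f x + h x) * g x) = (\<lambda>x. f x * g x + h x * g x)"
    by (simp add: distrib_right)
  then show ?case using trig_polys.add[OF add.IH(1)[OF add.prems] add.IH(2)[OF add.prems]] by simp
qed

text \<open>The \<open>k\<close>-dimensional cube inside the sequence space, padded by zeros. It is
  compact in the product topology, and two different points differ in a coordinate below
  \<open>k\<close>.\<close>

definition cube_box :: "nat \<Rightarrow> (nat \<Rightarrow> real) set" where
  "cube_box k = {u. (\<forall>j<k. \<bar>u j\<bar> \<le> 1) \<and> (\<forall>j\<ge>k. u j = 0)}"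

lemma compact_cube_box: "compact (cube_box k)"
proof -
  have "cube_box k = (\<Pi>\<^sub>E i\<in>UNIV. if i < k then {-1..1} else {0::real})"
    by (auto simp: cube_box_def PiE_iff abs_le_iff split: if_splits)
  moreover have "compactin (product_topology (\<lambda>_::nat. euclideanreal) UNIV) (\<Pi>\<^sub>E i\<in>UNIV. if i < k then {-1..1} else {0::real})"
    unfolding compactin_PiE by auto
  ultimately show ?thesis by (simp add: euclidean_product_topology)
qed

text \<open>The substitution \<open>u j = sin (x j / R)\<close> maps everything into a compact box,
  turns polynomials in \<open>u\<close> into trigonometric polynomials in \<open>x\<close>, and is
  inverted by \<open>arcsin\<close> for \<open>\<bar>x j\<bar> \<le> R\<close> because 1 is below
  \<open>pi / 2\<close>. The approximant is close to \<open>Q\<close> on the whole box, which gives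
  its global bound.\<close>

lemma trig_approx:
  fixes H :: "(nat \<Rightarrow> real) \<Rightarrow> real"
  assumes H: "continuous_on UNIV H" and fin: "\<And>x. H x = H (\<lambda>j. if j < k then x j else 0)"
    and R: "R > 0" and e: "e > 0" and B: "\<And>x. \<bar>H x\<bar> \<le> B"
  obtains T where "T \<in> trig_polys k" "\<And>x. \<bar>T x\<bar> \<le> B + e" "\<And>x. (\<forall>j<k. \<bar>x j\<bar> \<le> R) \<Longrightarrow> \<bar>H x - T x\<bar> < e"
proof -
  let ?s = "\<lambda>x j. if j < k then sin (x j / R) else 0 :: real"
  let ?S = "cube_box k"
  let ?A = "{g. continuous_on ?S g \<and> (\<lambda>x. g (?s x)) \<in> trig_polys k}"
  interpret function_ring_on ?A ?S
  proof
    fix x y assume xy: "x \<in> ?S" "y \<in> ?S" "x \<noteq> y"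
    then obtain j where j: "x j \<noteq> y j" by auto
    have jk: "j < k" using xy j by (force simp: cube_box_def)
    have "(\<lambda>u. u j) \<in> ?A"
      using jk by (auto simp: trig_polys_sin intro: continuous_on_subset[OF continuous_on_product_coordinates])
    then show "\<exists>f\<in>?A. f x \<noteq> f y" using j by (intro bexI[of _ "\<lambda>u. u j"])
  next
    fix f g assume "f \<in> ?A" "g \<in> ?A"
    then have c: "continuous_on ?S f" "continuous_on ?S g"
      and t: "(\<lambda>x. f (?s x)) \<in> trig_polys k" "(\<lambda>x. g (?s x)) \<in> trig_polys k" by simp_all
    show "(\<lambda>x. f x + g x) \<in> ?A"
      unfolding mem_Collect_eq by (intro conjI continuous_on_add c trig_polys.add[OF t])
    show "(\<lambda>x. f x * g x) \<in> ?A"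
      unfolding mem_Collect_eq by (intro conjI continuous_on_mult c trig_polys_mult[OF t])
  qed (simp_all add: compact_cube_box trig_polys_const)
  \<comment> \<open>\<open>H\<close> in the coordinates of the box. Continuity holds up to the
    boundary since \<open>arcsin\<close> is continuous on the closed interval.\<close>
  define Q where "Q u = H (\<lambda>j. R * arcsin (u j))" for u
  have "continuous_on ?S Q"
  proof -
    have "continuous_on ?S (\<lambda>u. R * arcsin (u j))" for j
    proof -
      have "continuous_on ?S (\<lambda>u. u j)"
        by (rule continuous_on_subset[OF continuous_on_product_coordinates]) simp
      moreover have "\<forall>u\<in>?S. -1 \<le> u j \<and> u j \<le> 1"
        by (cases "j < k") (auto simp: cube_box_def abs_le_iff)
      ultimately show ?thesis by (intro continuous_intros) auto
    qed
    then have "continuous_on ?S (\<lambda>u j. R * arcsin (u j))"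
      by (rule continuous_on_coordinatewise_then_product)
    then show ?thesis unfolding Q_def
      by (rule continuous_on_compose2[OF H]) auto
  qed
  from Stone_Weierstrass_basic[OF this e] obtain g where g: "g \<in> ?A" "\<And>u. u \<in> ?S \<Longrightarrow> \<bar>Q u - g u\<bar> < e"
    by auto
  have s: "?s x \<in> ?S" for x by (auto simp: cube_box_def)
  show thesis
  proof
    show "(\<lambda>x. g (?s x)) \<in> trig_polys k" using g by simp
    show "\<bar>g (?s x)\<bar> \<le> B + e" for x
    proof -
      have "\<bar>Q (?s x)\<bar> \<le> B" by (simp add: Q_def B)
      then show ?thesis using g(2)[OF s[of x]] by linarith
    qed
    fix x assume x: "\<forall>j<k. \<bar>x j\<bar> \<le> R"
    have "R * arcsin (?s x j) = (if j < k then x j else 0)" for j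
    proof (cases "j < k")
      case True
      then have "\<bar>x j / R\<bar> \<le> 1" using True x R by (simp add: abs_divide)
      then have "arcsin (sin (x j / R)) = x j / R"
        using pi_gt3 by (intro arcsin_sin) linarith+
      then show ?thesis using True R by simp
    qed simp
    then have "Q (?s x) = H (\<lambda>j. if j < k then x j else 0)" unfolding Q_def by (intro arg_cong[where f=H] ext)
    also have "\<dots> = H x" by (rule fin[symmetric])
    finally show "\<bar>H x - g (?s x)\<bar> < e" using g(2)[OF s[of x]] by simp
  qed
qed

text \<open>The imaginary part is a cosine moment with phase \<open>- (pi/2)\<close>, so cosine
  moments with arbitrary phases carry the whole characteristic function.\<close>

lemma char_eq_cos:
  assumes M: "prob_space M" and [measurable]: "X \<in> borel_measurable M"
  shows "char (distr M borel X) t = complex_of_real (\<integral>\<omega>. cos (t * X \<omega>) \<partial>M) + \<i> * complex_of_real (\<integral>\<omega>. cos (t * X \<omega> + - (pi/2)) \<partial>M)"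
proof -
  interpret prob_space M by (rule M)
  have i: "integrable M (\<lambda>\<omega>. cos (t * X \<omega> + b))" for b
    by (rule integrable_const_bound[of _ 1]) auto
  have s: "cos (x + - (pi/2)) = sin x" for x by (simp add: cos_diff)
  have i': "integrable M (\<lambda>\<omega>. cos (t * X \<omega>))" "integrable M (\<lambda>\<omega>. sin (t * X \<omega>))"
    using i[of 0] i[of "-(pi/2)"] unfolding s by simp_all
  have "char (distr M borel X) t = (CLINT \<omega>|M. iexp (t * X \<omega>))"
    by (simp add: char_def integral_distr)
  also have "\<dots> = (CLINT \<omega>|M. complex_of_real (cos (t * X \<omega>)) + \<i> * complex_of_real (sin (t * X \<omega>)))"
    by (intro Bochner_Integration.integral_cong) (simp_all flip: exp_Euler cos_of_real sin_of_real del: of_real_mult)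
  also have "\<dots> = complex_of_real (\<integral>\<omega>. cos (t * X \<omega>) \<partial>M) + \<i> * complex_of_real (\<integral>\<omega>. sin (t * X \<omega>) \<partial>M)"
    using i' by (subst Bochner_Integration.integral_add) (auto intro!: integrable_mult_right simp: integrable_of_real)
  finally show ?thesis unfolding s .
qed

lemma real_distribution_distr:
  assumes "prob_space M" "X \<in> borel_measurable M"
  shows "real_distribution (distr M borel X)"
  using prob_space.real_distribution_distr[of M X] assms by simp

lemma trig_polys_measurable_bounded:
  assumes "T \<in> trig_polys k" and Y: "\<And>j. j < k \<Longrightarrow> (\<lambda>\<omega>. Y \<omega> j) \<in> borel_measurable M"
  shows "(\<lambda>\<omega>. T (Y \<omega>)) \<in> borel_measurable M" "\<exists>K. \<forall>x. \<bar>T x\<bar> \<le> K"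
proof -
  have "(\<lambda>\<omega>. T (Y \<omega>)) \<in> borel_measurable M \<and> (\<exists>K. \<forall>x. \<bar>T x\<bar> \<le> K)"
    using assms(1)
  proof induction
    case (cos c a b)
    have "(\<lambda>\<omega>. c * cos ((\<Sum>j<k. a j * Y \<omega> j) + b)) \<in> borel_measurable M"
      using Y by (intro borel_measurable_times borel_measurable_const borel_measurable_continuous_on[OF continuous_on_cos[OF continuous_on_id]] borel_measurable_add borel_measurable_sum) auto
    moreover have "\<bar>c * cos y\<bar> \<le> \<bar>c\<bar>" for y by (simp add: abs_mult mult_left_le)
    ultimately show ?case by blast
  next
    case (add f g)
    then obtain K L where "\<forall>x. \<bar>f x\<bar> \<le> K" "\<forall>x. \<bar>g x\<bar> \<le> L" by blast
    then have "\<forall>x. \<bar>f x + g x\<bar> \<le> K + L" by (metis abs_triangle_ineq add_mono order_trans)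
    then show ?case using add by (auto intro!: borel_measurable_add)
  qed
  then show "(\<lambda>\<omega>. T (Y \<omega>)) \<in> borel_measurable M" "\<exists>K. \<forall>x. \<bar>T x\<bar> \<le> K" by auto
qed

lemma trig_polys_integrable:
  assumes "prob_space M" "T \<in> trig_polys k" and Y: "\<And>j. j < k \<Longrightarrow> (\<lambda>\<omega>. Y \<omega> j) \<in> borel_measurable M"
  shows "integrable M (\<lambda>\<omega>. T (Y \<omega>))"
proof -
  interpret prob_space M by (rule assms(1))
  obtain K where "\<forall>x. \<bar>T x\<bar> \<le> K" using trig_polys_measurable_bounded(2)[of T k Y M] assms(2) Y by blast
  then show ?thesis
    by (intro integrable_const_bound[of _ K]) (use trig_polys_measurable_bounded(1)[of T k Y M] assms(2) Y in auto)
qed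

text \<open>Outside the box some coordinate exceeds \<open>R + 1\<close>, where its truncated excess
  over \<open>R\<close> equals 1. The excess replaces an indicator because it is continuous and
  therefore passes through weak limits.\<close>

lemma trig_approx_integral:
  fixes Y :: "'z \<Rightarrow> nat \<Rightarrow> real" and H :: "(nat \<Rightarrow> real) \<Rightarrow> real"
  assumes M: "prob_space M" and Y: "\<And>j. j < k \<Longrightarrow> (\<lambda>\<omega>. Y \<omega> j) \<in> borel_measurable M"
    and HY: "(\<lambda>\<omega>. H (Y \<omega>)) \<in> borel_measurable M"
    and tl: "\<And>j. j < k \<Longrightarrow> (\<integral>\<omega>. min 1 (max 0 (\<bar>Y \<omega> j\<bar> - R)) \<partial>M) < \<eta>"
    and e: "e > 0" and B: "\<And>x. \<bar>H x\<bar> \<le> B"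
    and \<eta>_def: "\<eta> = e / (8 * (B + 1 + e) * (real k + 1))"
    and T: "T \<in> trig_polys k" "\<And>x. \<bar>T x\<bar> \<le> B + e/8"
        "\<And>x. (\<forall>j<k. \<bar>x j\<bar> \<le> R + 1) \<Longrightarrow> \<bar>H x - T x\<bar> < e/8"
  shows "\<bar>(\<integral>\<omega>. H (Y \<omega>) \<partial>M) - (\<integral>\<omega>. T (Y \<omega>) \<partial>M)\<bar> \<le> 3*e/8"
proof -
  have B0: "B \<ge> 0" using B[of undefined] by linarith
  interpret M: prob_space M by (rule M)
  have iH: "integrable M (\<lambda>\<omega>. H (Y \<omega>))" by (rule M.integrable_const_bound[of _ B]) (use B HY in auto)
  have iT: "integrable M (\<lambda>\<omega>. T (Y \<omega>))"
    by (rule M.integrable_const_bound[of _ "B + e/8"]) (use T(2) trig_polys_measurable_bounded(1)[of T k Y M] T(1) Y in auto)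
  have im: "integrable M (\<lambda>\<omega>. min 1 (max 0 (\<bar>Y \<omega> j\<bar> - R)))" if "j < k" for j
  proof (rule M.integrable_const_bound[of _ 1])
    note Y[OF that, measurable]
    show "(\<lambda>\<omega>. min 1 (max 0 (\<bar>Y \<omega> j\<bar> - R))) \<in> borel_measurable M" by measurable
  qed auto
  \<comment> \<open>A bound for \<open>\<bar>H x - T x\<bar>\<close> everywhere. With
    \<open>\<eta>\<close> as given, \<open>C * \<eta>\<close> is
    \<open>e / (4 * (real k + 1))\<close>, so the \<open>k\<close> coordinates together cost at most
    \<open>e / 4\<close>.\<close>
  define C where "C = 2 * (B + 1 + e)"
  have C: "C \<ge> 0" using B0 e by (simp add: C_def)
  have "\<bar>(\<integral>\<omega>. H (Y \<omega>) \<partial>M) - (\<integral>\<omega>. T (Y \<omega>) \<partial>M)\<bar> = \<bar>\<integral>\<omega>. H (Y \<omega>) - T (Y \<omega>) \<partial>M\<bar>"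
    using iH iT by simp
  also have "\<dots> \<le> (\<integral>\<omega>. \<bar>H (Y \<omega>) - T (Y \<omega>)\<bar> \<partial>M)"
    using integral_norm_bound[of M "\<lambda>\<omega>. H (Y \<omega>) - T (Y \<omega>)"] by simp
  also have "\<dots> \<le> (\<integral>\<omega>. e/8 + (\<Sum>j<k. C * min 1 (max 0 (\<bar>Y \<omega> j\<bar> - R))) \<partial>M)"
  proof (rule integral_mono)
    show "integrable M (\<lambda>\<omega>. e/8 + (\<Sum>j<k. C * min 1 (max 0 (\<bar>Y \<omega> j\<bar> - R))))"
      using im by (intro Bochner_Integration.integrable_add integrable_sum integrable_mult_right) auto
    fix \<omega>
    show "\<bar>H (Y \<omega>) - T (Y \<omega>)\<bar> \<le> e/8 + (\<Sum>j<k. C * min 1 (max 0 (\<bar>Y \<omega> j\<bar> - R)))"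
    proof (cases "\<forall>j<k. \<bar>Y \<omega> j\<bar> \<le> R + 1")
      case True
      have "0 \<le> (\<Sum>j<k. C * min 1 (max 0 (\<bar>Y \<omega> j\<bar> - R)))" using C by (intro sum_nonneg) auto
      then show ?thesis using T(3)[OF True] by linarith
    next
      case False
      then obtain j where j: "j < k" "\<bar>Y \<omega> j\<bar> > R + 1" by auto
      have "C * min 1 (max 0 (\<bar>Y \<omega> j\<bar> - R)) \<le> (\<Sum>j<k. C * min 1 (max 0 (\<bar>Y \<omega> j\<bar> - R)))"
        using j C by (intro member_le_sum) auto
      moreover have "C * min 1 (max 0 (\<bar>Y \<omega> j\<bar> - R)) = C" using j by simp
      ultimately have "C \<le> (\<Sum>j<k. C * min 1 (max 0 (\<bar>Y \<omega> j\<bar> - R)))" by simp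
      then show ?thesis using B[of "Y \<omega>"] T(2)[of "Y \<omega>"] e by (simp add: C_def)
    qed
  qed (use iH iT in auto)
  also have "\<dots> = e/8 + (\<Sum>j<k. C * (\<integral>\<omega>. min 1 (max 0 (\<bar>Y \<omega> j\<bar> - R)) \<partial>M))"
    using im by (subst Bochner_Integration.integral_add) (auto simp: M.prob_space)
  also have "\<dots> \<le> e/8 + (\<Sum>j<k. C * \<eta>)"
    using tl C by (intro add_mono sum_mono mult_left_mono) (auto simp: less_imp_le)
  also have "\<dots> \<le> 3*e/8"
  proof -
    have "C * \<eta> = e / (4 * (real k + 1))"
      proof -
        define D where "D = B + 1 + e"
        define E where "E = real k + 1"
        have "D > 0" "E > 0" using B0 e by (simp_all add: D_def E_def)
        then show ?thesis unfolding C_def \<eta>_def D_def[symmetric] E_def[symmetric] by (simp add: field_simps)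
      qed
    then have "(\<Sum>j<k. C * \<eta>) = e/4 * (real k / (real k + 1))" by simp
    also have "\<dots> \<le> e/4 * 1" using e by (intro mult_left_mono) auto
    finally show ?thesis by linarith
  qed
  finally show ?thesis .
qed

text \<open>Tightness of the coordinates comes from the one-dimensional Levy theorem; on a large box
  a function of finitely many coordinates is a uniform limit of trigonometric polynomials.\<close>

lemma cramer_wold:
  fixes X :: "nat \<Rightarrow> 'o \<Rightarrow> nat \<Rightarrow> real" and Z :: "'p \<Rightarrow> nat \<Rightarrow> real" and H :: "(nat \<Rightarrow> real) \<Rightarrow> real"
  assumes P: "prob_space P" and Q: "prob_space Q"
    and X: "\<And>n j. j < k \<Longrightarrow> (\<lambda>\<omega>. X n \<omega> j) \<in> borel_measurable P"
    and Z: "\<And>j. j < k \<Longrightarrow> (\<lambda>\<omega>. Z \<omega> j) \<in> borel_measurable Q"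
    and conv: "\<And>a b. (\<lambda>n. \<integral>\<omega>. cos ((\<Sum>j<k. a j * X n \<omega> j) + b) \<partial>P)
        \<longlonglongrightarrow> (\<integral>\<omega>. cos ((\<Sum>j<k. a j * Z \<omega> j) + b) \<partial>Q)"
    and H: "continuous_on UNIV H" and fin: "\<And>x. H x = H (\<lambda>j. if j < k then x j else 0)"
    and B: "\<And>x. \<bar>H x\<bar> \<le> B"
    and HX: "\<And>n. (\<lambda>\<omega>. H (X n \<omega>)) \<in> borel_measurable P" and HZ: "(\<lambda>\<omega>. H (Z \<omega>)) \<in> borel_measurable Q"
  shows "(\<lambda>n. \<integral>\<omega>. H (X n \<omega>) \<partial>P) \<longlonglongrightarrow> (\<integral>\<omega>. H (Z \<omega>) \<partial>Q)"
proof -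
  interpret P: prob_space P by (rule P)
  interpret Q: prob_space Q by (rule Q)
  note trig_int = trig_polys_integrable[OF P _ X] trig_polys_integrable[OF Q _ Z]
  have trig_conv: "(\<lambda>n. \<integral>\<omega>. T (X n \<omega>) \<partial>P) \<longlonglongrightarrow> (\<integral>\<omega>. T (Z \<omega>) \<partial>Q)" if "T \<in> trig_polys k" for T
    using that
  proof induction
    case (cos c a b)
    then show ?case using conv[of a b] by (simp add: tendsto_mult_left)
  next
    case (add f g)
    then show ?case
      using trig_int(1)[OF add.hyps(1)] trig_int(1)[OF add.hyps(2)] trig_int(2)[OF add.hyps(1)] trig_int(2)[OF add.hyps(2)]
      by (simp add: tendsto_add)
  qed
  have weak: "weak_conv_m (\<lambda>n. distr P borel (\<lambda>\<omega>. X n \<omega> j)) (distr Q borel (\<lambda>\<omega>. Z \<omega> j))" if j: "j < k" for j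
  proof (rule levy_continuity)
    show "real_distribution (distr P borel (\<lambda>\<omega>. X n \<omega> j))" for n
      by (rule real_distribution_distr[OF P X[OF j]])
    show "real_distribution (distr Q borel (\<lambda>\<omega>. Z \<omega> j))"
      by (rule real_distribution_distr[OF Q Z[OF j]])
    fix t
    have s: "(\<Sum>i<k. (if i = j then t else 0) * x i) = t * x j" for x :: "nat \<Rightarrow> real"
      using j by (simp add: if_distrib[where f="\<lambda>c. c * _"] cong: if_cong)
    have "(\<lambda>n. \<integral>\<omega>. cos (t * X n \<omega> j + b) \<partial>P) \<longlonglongrightarrow> (\<integral>\<omega>. cos (t * Z \<omega> j + b) \<partial>Q)" for b
      using conv[of "\<lambda>i. if i = j then t else 0" b] unfolding s .
    from this[of 0] this[of "-(pi/2)"]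
    show "(\<lambda>n. char (distr P borel (\<lambda>\<omega>. X n \<omega> j)) t) \<longlonglongrightarrow> char (distr Q borel (\<lambda>\<omega>. Z \<omega> j)) t"
      unfolding char_eq_cos[OF P X[OF j]] char_eq_cos[OF Q Z[OF j]]
      by (intro tendsto_intros) simp_all
  qed
  have B0: "B \<ge> 0" using B[of undefined] by linarith
  show ?thesis
  proof (rule LIMSEQ_I)
    fix e :: real assume e: "e > 0"
    define \<eta> where "\<eta> = e / (8 * (B + 1 + e) * (real k + 1))"
    have \<eta>: "\<eta> > 0" using e B0 by (simp add: \<eta>_def)
    \<comment> \<open>The radius is determined by the limit law alone; dominated convergence makes
      the mean excess small.\<close>
    have "\<exists>R>0. \<forall>j<k. (\<integral>\<omega>. min 1 (max 0 (\<bar>Z \<omega> j\<bar> - R)) \<partial>Q) < \<eta>"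
    proof -
      have "\<forall>\<^sub>F R in sequentially. (\<integral>\<omega>. min 1 (max 0 (\<bar>Z \<omega> j\<bar> - real R)) \<partial>Q) < \<eta>" if j: "j < k" for j
      proof (rule order_tendstoD(2)[OF _ \<eta>])
        have "(\<lambda>R::nat. \<integral>\<omega>. min 1 (max 0 (\<bar>Z \<omega> j\<bar> - real R)) \<partial>Q) \<longlonglongrightarrow> (\<integral>\<omega>. 0 \<partial>Q)"
        proof (rule integral_dominated_convergence[where w="\<lambda>_. 1"])
          note Z[OF j, measurable]
          show "(\<lambda>\<omega>. min 1 (max 0 (\<bar>Z \<omega> j\<bar> - real R))) \<in> borel_measurable Q" for R by measurable
          show "AE \<omega> in Q. (\<lambda>R. min 1 (max 0 (\<bar>Z \<omega> j\<bar> - real R))) \<longlonglongrightarrow> 0"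
          proof (rule AE_I2)
            fix \<omega>
            have "\<forall>\<^sub>F R in sequentially. min 1 (max 0 (\<bar>Z \<omega> j\<bar> - real R)) = 0"
              using eventually_ge_at_top[of "nat \<lceil>\<bar>Z \<omega> j\<bar>\<rceil>"] by eventually_elim (auto simp: nat_le_iff ceiling_le_iff)
            then show "(\<lambda>R. min 1 (max 0 (\<bar>Z \<omega> j\<bar> - real R))) \<longlonglongrightarrow> 0" by (rule tendsto_eventually)
          qed
        qed auto
        then show "(\<lambda>R::nat. \<integral>\<omega>. min 1 (max 0 (\<bar>Z \<omega> j\<bar> - real R)) \<partial>Q) \<longlonglongrightarrow> 0" by simp
      qed
      then have "\<forall>\<^sub>F R in sequentially. \<forall>j\<in>{..<k}. (\<integral>\<omega>. min 1 (max 0 (\<bar>Z \<omega> j\<bar> - real R)) \<partial>Q) < \<eta>"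
        by (intro eventually_ball_finite) auto
      then obtain R where "\<forall>j\<in>{..<k}. (\<integral>\<omega>. min 1 (max 0 (\<bar>Z \<omega> j\<bar> - real (max R 1))) \<partial>Q) < \<eta>"
        unfolding eventually_sequentially by (meson max.cobounded1)
      then show ?thesis by (intro exI[of _ "real (max R 1)"]) auto
    qed
    then obtain R where R: "R > 0" "\<And>j. j < k \<Longrightarrow> (\<integral>\<omega>. min 1 (max 0 (\<bar>Z \<omega> j\<bar> - R)) \<partial>Q) < \<eta>" by blast
    \<comment> \<open>The excess is a bounded continuous function of the coordinate, so the bound
      passes to \<open>X n\<close> for all large \<open>n\<close>.\<close>
    have "\<forall>\<^sub>F n in sequentially. \<forall>j\<in>{..<k}. (\<integral>\<omega>. min 1 (max 0 (\<bar>X n \<omega> j\<bar> - R)) \<partial>P) < \<eta>"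
    proof (intro eventually_ball_finite ballI)
      fix j assume "j \<in> {..<k}"
      then have j: "j < k" by simp
      interpret PX: real_distribution "distr P borel (\<lambda>\<omega>. X n \<omega> j)" for n
        by (rule real_distribution_distr[OF P X[OF j]])
      interpret QZ: real_distribution "distr Q borel (\<lambda>\<omega>. Z \<omega> j)"
        by (rule real_distribution_distr[OF Q Z[OF j]])
      have "(\<lambda>n. integral\<^sup>L (distr P borel (\<lambda>\<omega>. X n \<omega> j)) (\<lambda>y. min 1 (max 0 (\<bar>y\<bar> - R))))
          \<longlonglongrightarrow> integral\<^sup>L (distr Q borel (\<lambda>\<omega>. Z \<omega> j)) (\<lambda>y. min 1 (max 0 (\<bar>y\<bar> - R)))"
        by (rule weak_conv_imp_integral_bdd_continuous_conv[OF _ _ weak[OF j], where B=1])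
           (auto intro!: continuous_intros PX.real_distribution_axioms QZ.real_distribution_axioms)
      then have "(\<lambda>n. \<integral>\<omega>. min 1 (max 0 (\<bar>X n \<omega> j\<bar> - R)) \<partial>P) \<longlonglongrightarrow> (\<integral>\<omega>. min 1 (max 0 (\<bar>Z \<omega> j\<bar> - R)) \<partial>Q)"
        using X[OF j] Z[OF j] by (simp add: integral_distr)
      then show "\<forall>\<^sub>F n in sequentially. (\<integral>\<omega>. min 1 (max 0 (\<bar>X n \<omega> j\<bar> - R)) \<partial>P) < \<eta>"
        using R(2)[OF j] by (rule order_tendstoD(2))
    qed simp
    then obtain N1 where N1: "\<And>n j. n \<ge> N1 \<Longrightarrow> j < k \<Longrightarrow> (\<integral>\<omega>. min 1 (max 0 (\<bar>X n \<omega> j\<bar> - R)) \<partial>P) < \<eta>"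
      unfolding eventually_sequentially by auto
    obtain T where T: "T \<in> trig_polys k" "\<And>x. \<bar>T x\<bar> \<le> B + e/8"
        "\<And>x. (\<forall>j<k. \<bar>x j\<bar> \<le> R + 1) \<Longrightarrow> \<bar>H x - T x\<bar> < e/8"
      using trig_approx[OF H fin _ _ B, of "R+1" "e/8"] R e by (metis add_pos_pos zero_less_one zero_less_divide_iff zero_less_numeral)
    have "(\<lambda>n. \<integral>\<omega>. T (X n \<omega>) \<partial>P) \<longlonglongrightarrow> (\<integral>\<omega>. T (Z \<omega>) \<partial>Q)" by (rule trig_conv[OF T(1)])
    then obtain N2 where N2: "\<And>n. n \<ge> N2 \<Longrightarrow> \<bar>(\<integral>\<omega>. T (X n \<omega>) \<partial>P) - (\<integral>\<omega>. T (Z \<omega>) \<partial>Q)\<bar> < e/8"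
      using e by (metis LIMSEQ_D real_norm_def zero_less_divide_iff zero_less_numeral)
    have "norm ((\<integral>\<omega>. H (X n \<omega>) \<partial>P) - (\<integral>\<omega>. H (Z \<omega>) \<partial>Q)) < e" if "n \<ge> max N1 N2" for n
    proof -
      have tl: "\<And>j. j < k \<Longrightarrow> (\<integral>\<omega>. min 1 (max 0 (\<bar>X n \<omega> j\<bar> - R)) \<partial>P) < \<eta>"
        using N1 that by simp
      show ?thesis
      proof -
        \<comment> \<open>The three errors add up to less than \<open>7 * e / 8\<close>.\<close>
        have "\<bar>(\<integral>\<omega>. H (X n \<omega>) \<partial>P) - (\<integral>\<omega>. T (X n \<omega>) \<partial>P)\<bar> \<le> 3*e/8"
          by (rule trig_approx_integral[OF P X HX tl e B \<eta>_def T])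
        moreover have "\<bar>(\<integral>\<omega>. H (Z \<omega>) \<partial>Q) - (\<integral>\<omega>. T (Z \<omega>) \<partial>Q)\<bar> \<le> 3*e/8"
          by (rule trig_approx_integral[OF Q Z HZ R(2) e B \<eta>_def T])
        moreover have "\<bar>(\<integral>\<omega>. T (X n \<omega>) \<partial>P) - (\<integral>\<omega>. T (Z \<omega>) \<partial>Q)\<bar> < e/8"
          using N2 that by simp
        ultimately show ?thesis using e unfolding real_norm_def by linarith
      qed
    qed
    then show "\<exists>no. \<forall>n\<ge>no. norm ((\<integral>\<omega>. H (X n \<omega>) \<partial>P) - (\<integral>\<omega>. H (Z \<omega>) \<partial>Q)) < e" by blast
  qed
qed

subsection \<open>Centred normal variables\<close>

text \<open>The centred normal law with variance \<open>v\<close>, a point mass for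
  \<open>v = 0\<close>, through its characteristic function: the phases 0 and
  \<open>- (pi/2)\<close> give the real and the imaginary part.\<close>

definition cos_normal :: "'o measure \<Rightarrow> ('o \<Rightarrow> real) \<Rightarrow> real \<Rightarrow> bool" where
  "cos_normal M X v \<longleftrightarrow> X \<in> borel_measurable M \<and> v \<ge> 0 \<and>
     (\<forall>t b. (\<integral>\<omega>. cos (t * X \<omega> + b) \<partial>M) = exp (- (t\<^sup>2 * v / 2)) * cos b)"

text \<open>Levy's uniqueness theorem identifies the law. The case \<open>v = 0\<close> is separate
  because a point mass has no density.\<close>

lemma cos_normal_imp:
  assumes M: "prob_space M" and X: "cos_normal M X v"
  shows "normal_rv M X" "integrable M (\<lambda>\<omega>. (X \<omega>)\<^sup>2)" "(\<integral>\<omega>. X \<omega> \<partial>M) = 0" "(\<integral>\<omega>. (X \<omega>)\<^sup>2 \<partial>M) = v"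
proof -
  interpret prob_space M by (rule M)
  have [measurable]: "X \<in> borel_measurable M" and v: "v \<ge> 0" using X by (auto simp: cos_normal_def)
  have ch: "char (distr M borel X) t = complex_of_real (exp (- (t\<^sup>2 * v / 2)))" for t
  proof -
    have "(\<integral>\<omega>. cos (t * X \<omega> + b) \<partial>M) = exp (- (t\<^sup>2 * v / 2)) * cos b" for b
      using X by (simp add: cos_normal_def)
    from this[of 0] this[of "-(pi/2)"] show ?thesis
      by (subst char_eq_cos[OF M]) simp_all
  qed
  have "normal_rv M X \<and> integrable M (\<lambda>\<omega>. (X \<omega>)\<^sup>2) \<and> (\<integral>\<omega>. X \<omega> \<partial>M) = 0 \<and> (\<integral>\<omega>. (X \<omega>)\<^sup>2 \<partial>M) = v"
  proof (cases "v = 0")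
    case True
    have "char (distr M borel X) = char (return borel 0)"
    proof
      fix t
      have "char (return borel 0) t = 1" unfolding char_def by (subst integral_return) auto
      then show "char (distr M borel X) t = char (return borel 0) t" by (simp add: ch True)
    qed
    moreover have "real_distribution (return borel (0::real))"
      by (intro real_distribution.intro real_distribution_axioms.intro prob_space_return) auto
    ultimately have eq: "distr M borel X = return borel 0"
      by (intro Levy_uniqueness real_distribution_distr M) auto
    have "AE x in distr M borel X. x = 0" unfolding eq by (subst AE_return) auto
    then have ae: "AE \<omega> in M. X \<omega> = 0" by (subst (asm) AE_distr_iff) auto
    have "integrable M (\<lambda>\<omega>. (X \<omega>)\<^sup>2) \<longleftrightarrow> integrable M (\<lambda>\<omega>. 0 :: real)"
      using ae by (intro integrable_cong_AE) auto
    moreover have "(\<integral>\<omega>. X \<omega> \<partial>M) = (\<integral>\<omega>. 0 \<partial>M)" "(\<integral>\<omega>. (X \<omega>)\<^sup>2 \<partial>M) = (\<integral>\<omega>. 0 \<partial>M)"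
      by (rule integral_cong_AE; use ae in auto)+
    ultimately show ?thesis using ae True by (auto simp: normal_rv_def)
  next
    case False
    then have v: "v > 0" using v by simp
    have "char (distr M borel (\<lambda>\<omega>. X \<omega> / sqrt v)) = char std_normal_distribution"
    proof
      fix t
      have "char (distr M borel (\<lambda>\<omega>. X \<omega> / sqrt v)) t = char (distr M borel X) (t / sqrt v)"
        by (simp add: char_def integral_distr)
      also have "\<dots> = char std_normal_distribution t"
        using v by (simp add: ch char_std_normal_distribution power_divide)
      finally show "char (distr M borel (\<lambda>\<omega>. X \<omega> / sqrt v)) t = char std_normal_distribution t" .
    qed
    then have "distr M borel (\<lambda>\<omega>. X \<omega> / sqrt v) = std_normal_distribution"
      by (intro Levy_uniqueness real_distribution_distr M real_dist_normal_dist) auto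
    then have "distributed M lborel (\<lambda>\<omega>. X \<omega> / sqrt v) std_normal_density"
      unfolding distributed_def by (auto cong: distr_cong)
    then have D: "distributed M lborel X (normal_density 0 (sqrt v))"
      using v by (subst normal_standard_normal_convert) auto
    then have "normal_rv M X" unfolding normal_rv_def using v
      by (intro conjI disjI2 exI[of _ 0] exI[of _ "sqrt v"]) auto
    moreover have "integrable M (\<lambda>\<omega>. (X \<omega>)\<^sup>2)"
      using integrable_normal_moment[of "sqrt v" 0 2] v
      by (subst distributed_integrable[OF D, symmetric]) auto
    moreover have "(\<integral>\<omega>. X \<omega> \<partial>M) = 0"
      using integral_normal_moment_nz_1[of "sqrt v" 0] v
      by (subst distributed_integral[OF D, symmetric]) auto
    moreover have "(\<integral>\<omega>. (X \<omega>)\<^sup>2 \<partial>M) = v"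
      using integral_normal_moment_even[of "sqrt v" 0 1] v
      by (subst distributed_integral[OF D, symmetric]) auto
    ultimately show ?thesis by blast
  qed
  then show "normal_rv M X" "integrable M (\<lambda>\<omega>. (X \<omega>)\<^sup>2)" "(\<integral>\<omega>. X \<omega> \<partial>M) = 0" "(\<integral>\<omega>. (X \<omega>)\<^sup>2 \<partial>M) = v"
    by auto
qed

subsection \<open>The space of bounded functions\<close>

lemma linf_mspace_iff: "z \<in> mspace (linf F) \<longleftrightarrow> z \<in> extensional F \<and> (\<exists>K. \<forall>f\<in>F. \<bar>z f\<bar> \<le> K)"
proof -
  have "mspace (linf F) = {f. f \<in> extensional F \<and> bounded (f ` F)}"
    unfolding linf_def mspace_funspace by (simp add: Met_TC.fspace_def)
  then show ?thesis by (auto simp: bounded_iff)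
qed

lemma topspace_linf: "topspace (mtopology_of (linf F)) = mspace (linf F)"
  by (simp add: mtopology_of_def Metric_space.topspace_mtopology[OF Metric_space_mspace_mdist])

lemma linf_restrict: "(\<And>f. f \<in> F \<Longrightarrow> \<bar>z f\<bar> \<le> K) \<Longrightarrow> (\<lambda>f\<in>F. z f) \<in> mspace (linf F)"
  by (auto simp: linf_mspace_iff)

lemma linf_mdist_le:
  assumes "z \<in> mspace (linf F)" "w \<in> mspace (linf F)" "F \<noteq> {}"
  shows "mdist (linf F) z w \<le> a \<longleftrightarrow> (\<forall>f\<in>F. \<bar>z f - w f\<bar> \<le> a)"
  using funspace_mdist_le[of z F euclidean_metric w a] assms by (simp add: linf_def dist_real_def)

lemma linf_coordinate:
  assumes "z \<in> mspace (linf F)" "w \<in> mspace (linf F)" "f \<in> F"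
  shows "\<bar>z f - w f\<bar> \<le> mdist (linf F) z w"
proof -
  have "F \<noteq> {}" using assms(3) by auto
  then show ?thesis using linf_mdist_le[OF assms(1,2), of "mdist (linf F) z w"] assms(3) by auto
qed

lemma Lipschitz_continuous_linf:
  assumes "\<And>z w. z \<in> mspace (linf F) \<Longrightarrow> w \<in> mspace (linf F) \<Longrightarrow> \<bar>h z - h w\<bar> \<le> C * mdist (linf F) z w"
  shows "continuous_map (mtopology_of (linf F)) euclideanreal h"
proof -
  have "Lipschitz_continuous_map (linf F) euclidean_metric h"
    using assms by (auto simp: Lipschitz_continuous_map_def dist_real_def)
  then have "continuous_map (mtopology_of (linf F)) (mtopology_of euclidean_metric) h"
    by (intro uniformly_continuous_imp_continuous_map Lipschitz_imp_uniformly_continuous_map)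
  then show ?thesis by simp
qed

lemma continuous_linf_coordinate:
  "f \<in> F \<Longrightarrow> continuous_map (mtopology_of (linf F)) euclideanreal (\<lambda>z. z f)"
  by (rule Lipschitz_continuous_linf[where C=1]) (simp add: linf_coordinate)

lemma space_linf_borel: "space (linf_borel F) = mspace (linf F)"
  unfolding linf_borel_def
  by (intro space_measure_of) (auto simp: topspace_linf dest!: openin_subset)

lemma openin_linf_borel: "openin (mtopology_of (linf F)) U \<Longrightarrow> U \<in> sets (linf_borel F)"
  unfolding linf_borel_def
  by (subst sets_measure_of) (auto simp: topspace_linf dest!: openin_subset)

lemma continuous_map_linf_borel_measurable:
  assumes "continuous_map (mtopology_of (linf F)) euclideanreal h"
  shows "h \<in> borel_measurable (linf_borel F)"
proof (rule borel_measurableI)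
  fix S :: "real set" assume "open S"
  then have "openin (mtopology_of (linf F)) {x \<in> topspace (mtopology_of (linf F)). h x \<in> S}"
    using assms by (intro openin_continuous_map_preimage[OF assms]) simp
  moreover have "{x \<in> topspace (mtopology_of (linf F)). h x \<in> S} = h -` S \<inter> space (linf_borel F)"
    by (auto simp: space_linf_borel topspace_linf)
  ultimately show "h -` S \<inter> space (linf_borel F) \<in> sets (linf_borel F)"
    using openin_linf_borel by metis
qed

subsection \<open>Outer probabilities\<close>

text \<open>An outer probability of at most \<open>\<eta>\<close>, expressed by a measurable cover.
  The intersection with the space allows \<open>A\<close> to be a comprehension over the whole
  type.\<close>

definition outer_le :: "'o measure \<Rightarrow> 'o set \<Rightarrow> real \<Rightarrow> bool" where
  "outer_le M A \<eta> \<longleftrightarrow> (\<exists>B\<in>sets M. A \<inter> space M \<subseteq> B \<and> measure M B \<le> \<eta>)"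

lemma outer_le_mono:
  "outer_le M A \<eta> \<Longrightarrow> A' \<inter> space M \<subseteq> A \<Longrightarrow> \<eta> \<le> \<eta>' \<Longrightarrow> outer_le M A' \<eta>'"
  unfolding outer_le_def by (meson IntE IntI order_trans subset_iff)

lemma outer_le_Un:
  assumes "prob_space M" "outer_le M A \<eta>" "outer_le M A' \<eta>'"
  shows "outer_le M (A \<union> A') (\<eta> + \<eta>')"
proof -
  interpret prob_space M by fact
  obtain B B' where "B \<in> sets M" "A \<inter> space M \<subseteq> B" "measure M B \<le> \<eta>"
    "B' \<in> sets M" "A' \<inter> space M \<subseteq> B'" "measure M B' \<le> \<eta>'"
    using assms(2,3) by (auto simp: outer_le_def)
  then show ?thesis unfolding outer_le_def
    by (intro bexI[of _ "B \<union> B'"]) (auto intro: order_trans[OF measure_Un_le])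
qed

lemma outer_le_sets:
  assumes "{\<omega>\<in>space M. \<omega> \<in> A} \<in> sets M" "measure M {\<omega>\<in>space M. \<omega> \<in> A} \<le> \<eta>"
  shows "outer_le M A \<eta>"
  unfolding outer_le_def using assms by (intro bexI[of _ "{\<omega>\<in>space M. \<omega> \<in> A}"]) auto

text \<open>A cover pulls back along a measure-preserving map.\<close>

lemma outer_le_distr:
  assumes "outer_le N A \<eta>" and t: "t \<in> M \<rightarrow>\<^sub>M N" and "distr M N t = N"
  shows "outer_le M (t -` A) \<eta>"
proof -
  obtain B where B: "B \<in> sets N" "A \<inter> space N \<subseteq> B" "measure N B \<le> \<eta>"
    using assms(1) by (auto simp: outer_le_def)
  have "measure M (t -` B \<inter> space M) = measure N B"
    using measure_distr[OF t B(1)] assms(3) by simp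
  then show ?thesis
    unfolding outer_le_def using B t measurable_space[OF t]
    by (intro bexI[of _ "t -` B \<inter> space M"]) (auto intro: measurable_sets)
qed

lemma outer_expectation_measurable:
  assumes "integrable M T"
  shows "outer_expectation M T = integral\<^sup>L M T"
  unfolding outer_expectation_def
  by (rule cInf_eq_minimum) (use assms in \<open>auto intro!: integral_mono\<close>)

text \<open>Boundedness of \<open>T\<close> makes the set of integrals of majorants nonempty and
  bounded below, so that \<open>Inf\<close> is a genuine infimum.\<close>

lemma
  assumes M: "prob_space M" and B: "\<And>\<omega>. \<omega> \<in> space M \<Longrightarrow> \<bar>T \<omega>\<bar> \<le> B"
  shows outer_expectation_le: "\<And>U. integrable M U \<Longrightarrow> (\<And>\<omega>. \<omega> \<in> space M \<Longrightarrow> T \<omega> \<le> U \<omega>) \<Longrightarrow> outer_expectation M T \<le> integral\<^sup>L M U"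
    and outer_expectation_ge: "\<And>c. (\<And>U. integrable M U \<Longrightarrow> (\<And>\<omega>. \<omega> \<in> space M \<Longrightarrow> T \<omega> \<le> U \<omega>) \<Longrightarrow> c \<le> integral\<^sup>L M U) \<Longrightarrow> c \<le> outer_expectation M T"
    and outer_expectation_less: "\<And>c. outer_expectation M T < c \<Longrightarrow> \<exists>U. integrable M U \<and> (\<forall>\<omega>\<in>space M. T \<omega> \<le> U \<omega>) \<and> integral\<^sup>L M U < c"
proof -
  interpret prob_space M by fact
  let ?S = "{integral\<^sup>L M U | U. integrable M U \<and> (\<forall>\<omega>\<in>space M. T \<omega> \<le> U \<omega>)}"
  have ne: "?S \<noteq> {}"
  proof -
    have "\<forall>\<omega>\<in>space M. T \<omega> \<le> B" using B by (auto simp: abs_le_iff)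
    then have "integral\<^sup>L M (\<lambda>_. B) \<in> ?S" by (intro CollectI exI[of _ "\<lambda>_. B"]) simp
    then show ?thesis by blast
  qed
  have bdd: "bdd_below ?S"
  proof (rule bdd_belowI)
    fix x assume "x \<in> ?S"
    then obtain U where U: "integrable M U" "\<forall>\<omega>\<in>space M. T \<omega> \<le> U \<omega>" "x = integral\<^sup>L M U" by auto
    have "integral\<^sup>L M (\<lambda>_. - B) \<le> integral\<^sup>L M U"
    proof (rule integral_mono)
      fix \<omega> assume "\<omega> \<in> space M"
      then show "- B \<le> U \<omega>" using B[of \<omega>] U(2) by (metis abs_le_D2 minus_le_iff order_trans)
    qed (use U in auto)
    then show "- B \<le> x" using U by (simp add: prob_space)
  qed
  show "outer_expectation M T \<le> integral\<^sup>L M U"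
    if "integrable M U" "\<And>\<omega>. \<omega> \<in> space M \<Longrightarrow> T \<omega> \<le> U \<omega>" for U
    unfolding outer_expectation_def by (rule cInf_lower[OF _ bdd]) (use that in auto)
  show "c \<le> outer_expectation M T"
    if "\<And>U. integrable M U \<Longrightarrow> (\<And>\<omega>. \<omega> \<in> space M \<Longrightarrow> T \<omega> \<le> U \<omega>) \<Longrightarrow> c \<le> integral\<^sup>L M U" for c
    unfolding outer_expectation_def by (rule cInf_greatest[OF ne]) (use that in auto)
  show "\<exists>U. integrable M U \<and> (\<forall>\<omega>\<in>space M. T \<omega> \<le> U \<omega>) \<and> integral\<^sup>L M U < c"
    if "outer_expectation M T < c" for c
    using cInf_lessD[OF ne that[unfolded outer_expectation_def]] by auto
qed

text \<open>Markov's inequality for a nearly optimal majorant \<open>U\<close>; the measurable event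
  \<open>U \<omega> \<ge> 1\<close> is the cover.\<close>

lemma outer_le_of_outer_expectation:
  assumes M: "prob_space M" and B: "\<And>\<omega>. \<omega> \<in> space M \<Longrightarrow> 0 \<le> T \<omega> \<and> T \<omega> \<le> B"
    and less: "outer_expectation M T < \<eta>" and A: "\<And>\<omega>. \<omega> \<in> space M \<Longrightarrow> \<omega> \<in> A \<Longrightarrow> 1 \<le> T \<omega>"
  shows "outer_le M A \<eta>"
proof -
  interpret prob_space M by fact
  obtain U where U: "integrable M U" "\<forall>\<omega>\<in>space M. T \<omega> \<le> U \<omega>" "integral\<^sup>L M U < \<eta>"
    using outer_expectation_less[OF M _ less, of B] B by (metis abs_of_nonneg)
  have U0: "AE \<omega> in M. 0 \<le> U \<omega>" using B U(2) by (intro AE_I2) (meson order_trans)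
  have [measurable]: "U \<in> borel_measurable M" using U by auto
  have "measure M {\<omega>\<in>space M. U \<omega> \<ge> 1} \<le> integral\<^sup>L M U / 1"
    by (rule integral_Markov_inequality_measure[OF U(1) sets.empty_sets U0]) simp
  moreover have "A \<inter> space M \<subseteq> {\<omega>\<in>space M. U \<omega> \<ge> 1}" using A U(2) by force
  ultimately show ?thesis
    unfolding outer_le_def using U(3) by (intro bexI[of _ "{\<omega>\<in>space M. U \<omega> \<ge> 1}"]) auto
qed

subsection \<open>Sums of independent coordinates\<close>

context
  fixes Q :: "'z measure"
  assumes Q: "prob_space Q"
begin

interpretation Q: prob_space Q by (rule Q)

abbreviation iid :: "(nat \<Rightarrow> 'z) measure" where
  "iid \<equiv> Pi\<^sub>M UNIV (\<lambda>_::nat. Q)"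

lemma prob_space_iid: "prob_space iid"
  by (intro prob_space_PiM Q)

interpretation I: prob_space iid by (rule prob_space_iid)

lemma distr_iid_component: "distr iid Q (\<lambda>z. z i) = Q"
  using distr_PiM_component[of UNIV "\<lambda>_. Q" i] Q by simp

lemma indep_vars_iid: "I.indep_vars (\<lambda>_. Q) (\<lambda>i z. z i) UNIV"
proof -
  have "distr iid iid (\<lambda>x. \<lambda>i\<in>UNIV. x i) = iid" by (simp add: restrict_UNIV)
  then show ?thesis
    by (subst I.indep_vars_iff_distr_eq_PiM) (auto simp: distr_iid_component)
qed

lemma indep_vars_iid_compose:
  assumes [measurable]: "g \<in> borel_measurable Q"
  shows "I.indep_vars (\<lambda>_. borel) (\<lambda>i z. g (z i)) UNIV"
  using I.indep_vars_compose[OF indep_vars_iid, of "\<lambda>_. g" "\<lambda>_. borel"] by (simp add: o_def)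

lemma distr_iid_compose:
  assumes [measurable]: "g \<in> borel_measurable Q"
  shows "distr iid borel (\<lambda>z. g (z i)) = distr Q borel g"
proof -
  have "distr Q borel g = distr (distr iid Q (\<lambda>z. z i)) borel g" by (simp add: distr_iid_component)
  also have "\<dots> = distr iid borel (\<lambda>z. g (z i))" by (subst distr_distr) (auto simp: o_def)
  finally show ?thesis by simp
qed

lemma integral_iid_component:
  fixes g :: "'z \<Rightarrow> real"
  assumes [measurable]: "g \<in> borel_measurable Q"
  shows "(\<integral>z. g (z i) \<partial>iid) = integral\<^sup>L Q g" "integrable iid (\<lambda>z. g (z i)) \<longleftrightarrow> integrable Q g"
  using integral_distr[of "\<lambda>z. z i" iid Q g] integrable_distr_eq[of "\<lambda>z. z i" iid Q g]
  by (simp_all add: distr_iid_component)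

lemma sum_iid_square:
  assumes g: "integrable Q g" "integrable Q (\<lambda>y. (g y)\<^sup>2)" and g0: "integral\<^sup>L Q g = (0::real)"
    and C: "finite C"
  shows "integrable iid (\<lambda>z. (\<Sum>i\<in>C. g (z i))\<^sup>2)"
    and "(\<integral>z. (\<Sum>i\<in>C. g (z i))\<^sup>2 \<partial>iid) = real (card C) * (\<integral>y. (g y)\<^sup>2 \<partial>Q)"
proof -
  have [measurable]: "g \<in> borel_measurable Q" using g by auto
  have ii: "integrable iid (\<lambda>z. (g (z i))\<^sup>2)" "integrable iid (\<lambda>z. g (z i))" for i
    using integral_iid_component(2)[of g i] integral_iid_component(2)[of "\<lambda>y. (g y)\<^sup>2" i] g by auto
  have cross: "integrable iid (\<lambda>z. g (z i) * g (z j)) \<and>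
      (\<integral>z. g (z i) * g (z j) \<partial>iid) = (if i = j then \<integral>y. (g y)\<^sup>2 \<partial>Q else 0)" for i j
  proof (cases "i = j")
    case True
    then show ?thesis using ii(1)[of j] integral_iid_component(1)[of "\<lambda>y. (g y)\<^sup>2" j] by (simp add: power2_eq_square)
  next
    case False
    have ind: "I.indep_vars (\<lambda>_. borel) (\<lambda>i z. g (z i)) {i, j}"
      by (rule I.indep_vars_subset[OF indep_vars_iid_compose]) auto
    show ?thesis
      using I.indep_vars_integrable[OF _ ind ii(2)] I.indep_vars_lebesgue_integral[OF _ ind ii(2)] False
        integral_iid_component(1)[of g] g0 by simp
  qed
  have sq: "(\<Sum>i\<in>C. g (z i))\<^sup>2 = (\<Sum>i\<in>C. \<Sum>j\<in>C. g (z i) * g (z j))" for z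
    by (simp add: power2_eq_square sum_product)
  show "integrable iid (\<lambda>z. (\<Sum>i\<in>C. g (z i))\<^sup>2)"
    unfolding sq using cross by (intro Bochner_Integration.integrable_sum) auto
  have "(\<integral>z. (\<Sum>i\<in>C. g (z i))\<^sup>2 \<partial>iid) = (\<Sum>i\<in>C. \<Sum>j\<in>C. if i = j then \<integral>y. (g y)\<^sup>2 \<partial>Q else 0)"
    unfolding sq using cross by (subst Bochner_Integration.integral_sum; (intro Bochner_Integration.integrable_sum)?; simp)+
  also have "\<dots> = real (card C) * (\<integral>y. (g y)\<^sup>2 \<partial>Q)" using C by simp
  finally show "(\<integral>z. (\<Sum>i\<in>C. g (z i))\<^sup>2 \<partial>iid) = real (card C) * (\<integral>y. (g y)\<^sup>2 \<partial>Q)" .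
qed

lemma iid_reindex:
  assumes "inj \<sigma>"
  shows "distr iid iid (\<lambda>z n. z (\<sigma> n)) = iid"
  using distr_PiM_reindex[of UNIV "\<lambda>_. Q" \<sigma> UNIV] assms Q by (simp add: restrict_UNIV)

text \<open>An injection of the indices preserves the product measure. The event is an arbitrary
  predicate of the functional \<open>f \<mapsto> \<Sum> f\<close>, so suprema over the class are
  covered without any measurability.\<close>

lemma outer_le_reindex:
  fixes R :: "(('z \<Rightarrow> real) \<Rightarrow> real) \<Rightarrow> bool"
  assumes A: "outer_le iid {z. R (\<lambda>f. \<Sum>i<card C. f (z i))} \<eta>" and C: "finite C"
  shows "outer_le iid {z. R (\<lambda>f. \<Sum>i\<in>C. f (z i))} \<eta>"
proof -
  obtain e where e: "bij_betw e {..<card C} C"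
    using ex_bij_betw_nat_finite[OF C] by (auto simp: atLeast0LessThan)
  \<comment> \<open>Indices from \<open>card C\<close> on are shifted beyond the maximum of
    \<open>C\<close>, which keeps the map injective; \<open>insert 0\<close> takes care of an empty
    \<open>C\<close>.\<close>
  define \<sigma> where "\<sigma> n = (if n < card C then e n else n + Suc (Max (insert 0 C)))" for n
  have "e n \<le> Max (insert 0 C)" if "n < card C" for n
    using e that C by (intro Max_ge) (auto simp: bij_betw_def)
  then have lt: "e n < m + Suc (Max (insert 0 C))" if "n < card C" for n m
    using that by (meson le_imp_less_Suc trans_less_add2)
  have "inj \<sigma>"
  proof (rule injI)
    fix a b assume ab: "\<sigma> a = \<sigma> b"
    have "e a = e b \<Longrightarrow> a < card C \<Longrightarrow> b < card C \<Longrightarrow> a = b"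
      using e by (auto simp: bij_betw_def inj_on_def)
    then show "a = b" using ab lt[of a b] lt[of b a] by (auto simp: \<sigma>_def split: if_splits)
  qed
  then have "outer_le iid ((\<lambda>z n. z (\<sigma> n)) -` {z. R (\<lambda>f. \<Sum>i<card C. f (z i))}) \<eta>"
    by (intro outer_le_distr[OF A _ iid_reindex]) (auto intro!: measurable_PiM_single' simp: space_PiM PiE_iff)
  moreover have "(\<Sum>i<card C. f (z (\<sigma> i))) = (\<Sum>i\<in>C. f (z i))" for f :: "'z \<Rightarrow> real" and z
    using sum.reindex_bij_betw[OF e, of "\<lambda>i. f (z i)"] by (simp add: \<sigma>_def)
  ultimately show ?thesis by (simp add: vimage_def)
qed

end

subsection \<open>Donsker classes\<close>

lemma one_minus_cos_limit: "(\<lambda>n. real n * (1 - cos (u / sqrt (real n)))) \<longlonglongrightarrow> u\<^sup>2 / 2"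
proof (cases "u = 0")
  case False
  define w where "w n = u / (2 * sqrt (real n))" for n :: nat
  have "(\<lambda>h. (sin (0 + h) - sin 0) / h) \<midarrow>0\<rightarrow> cos (0::real)"
    using DERIV_sin[of "0::real"] by (simp add: DERIV_def)
  then have s: "(\<lambda>h. sin h / h) \<midarrow>0\<rightarrow> (1::real)" by simp
  have w0: "w \<longlonglongrightarrow> 0"
    unfolding w_def by (intro tendsto_divide_0[OF tendsto_const] filterlim_at_top_imp_at_infinity
      filterlim_tendsto_pos_mult_at_top[OF tendsto_const] filterlim_compose[OF sqrt_at_top] filterlim_real_sequentially) auto
  have "(\<lambda>n. sin (w n) / w n) \<longlonglongrightarrow> 1"
  proof (rule tendsto_compose_eventually[OF s w0])
    show "\<forall>\<^sub>F n in sequentially. w n \<noteq> 0"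
      using eventually_gt_at_top[of 0] by eventually_elim (use False in \<open>auto simp: w_def\<close>)
  qed
  then have "(\<lambda>n. u\<^sup>2 / 2 * (sin (w n) / w n)\<^sup>2) \<longlonglongrightarrow> u\<^sup>2 / 2 * 1\<^sup>2" by (intro tendsto_intros)
  moreover have "\<forall>\<^sub>F n in sequentially. u\<^sup>2 / 2 * (sin (w n) / w n)\<^sup>2 = real n * (1 - cos (u / sqrt (real n)))"
    using eventually_gt_at_top[of 0]
  proof eventually_elim
    case (elim n)
    have "cos (2 * w n) = 1 - 2 * (sin (w n))\<^sup>2" by (simp add: cos_double_sin)
    moreover have "2 * w n = u / sqrt (real n)" by (simp add: w_def)
    ultimately have c: "1 - cos (u / sqrt (real n)) = 2 * (sin (w n))\<^sup>2" by simp
    have w2: "(w n)\<^sup>2 = u\<^sup>2 / (4 * real n)" by (simp add: w_def power_divide power_mult_distrib)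
    show ?case unfolding power_divide w2 c using elim False by (simp add: field_simps)
  qed
  ultimately show ?thesis by (auto intro: Lim_transform_eventually)
qed simp

section \<open>The Donsker property: second moments and increments of the limit\<close>

locale donsker_limit =
  fixes Q :: "'z measure" and H :: "('z \<Rightarrow> real) set" and M :: "'m measure" and G :: "'m \<Rightarrow> ('z \<Rightarrow> real) \<Rightarrow> real"
  assumes Q: "prob_space Q" and H_int: "\<And>f. f \<in> H \<Longrightarrow> integrable Q f" and M: "prob_space M"
    and tight: "tight_borel_element M H G"
    and weak: "weakly_converges (iid Q) H
          (\<lambda>N z. \<lambda>f\<in>H. 1 / sqrt (real N) * (\<Sum>i<N. f (z i) - integral\<^sup>L Q f)) M G"
begin

interpretation Q: prob_space Q by (rule Q)
interpretation M: prob_space M by (rule M)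
interpretation I: prob_space "iid Q" by (rule prob_space_iid[OF Q])

definition emp :: "nat \<Rightarrow> (nat \<Rightarrow> 'z) \<Rightarrow> ('z \<Rightarrow> real) \<Rightarrow> real" where
  "emp N z f = 1 / sqrt (real N) * (\<Sum>i<N. f (z i) - integral\<^sup>L Q f)"

lemma H_meas: "f \<in> H \<Longrightarrow> f \<in> borel_measurable Q"
  using H_int by auto

lemma emp_measurable: "f \<in> H \<Longrightarrow> (\<lambda>z. emp N z f) \<in> borel_measurable (iid Q)"
proof -
  assume "f \<in> H"
  note H_meas[OF this, measurable]
  show ?thesis unfolding emp_def by measurable
qed

lemma G_space: "\<omega> \<in> space M \<Longrightarrow> G \<omega> \<in> mspace (linf H)"
  using tight measurable_space[of G M "linf_borel H"] by (simp add: tight_borel_element_def space_linf_borel)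

lemma G_measurable: "G \<in> M \<rightarrow>\<^sub>M linf_borel H"
  using tight by (simp add: tight_borel_element_def)

lemma G_coordinate: "f \<in> H \<Longrightarrow> (\<lambda>\<omega>. G \<omega> f) \<in> borel_measurable M"
  by (rule measurable_compose[OF G_measurable continuous_map_linf_borel_measurable[OF continuous_linf_coordinate]])

lemma emp_space: "z \<in> space (iid Q) \<Longrightarrow> (\<lambda>f\<in>H. emp N z f) \<in> mspace (linf H)"
  using weak by (simp add: weakly_converges_def emp_def)

lemma emp_conv:
  assumes "continuous_map (mtopology_of (linf H)) euclideanreal h" "\<And>z. z \<in> mspace (linf H) \<Longrightarrow> \<bar>h z\<bar> \<le> B"
  shows "(\<lambda>N. outer_expectation (iid Q) (\<lambda>z. h (\<lambda>f\<in>H. emp N z f))) \<longlonglongrightarrow> (\<integral>\<omega>. h (G \<omega>) \<partial>M)"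
proof -
  have "bounded (h ` mspace (linf H))" using assms(2) by (auto simp: bounded_iff)
  then show ?thesis using weak assms(1) by (simp add: weakly_converges_def emp_def)
qed

lemma emp_conv_real:
  fixes \<phi> :: "real \<Rightarrow> real"
  assumes fg: "f \<in> H" "g \<in> H" and \<phi>: "continuous_on UNIV \<phi>" "\<And>x. \<bar>\<phi> x\<bar> \<le> B"
  shows "(\<lambda>N. \<integral>z. \<phi> (a * emp N z f + b * emp N z g) \<partial>iid Q) \<longlonglongrightarrow> (\<integral>\<omega>. \<phi> (a * G \<omega> f + b * G \<omega> g) \<partial>M)"
proof -
  have "continuous_map (mtopology_of (linf H)) euclideanreal (\<lambda>z. a * z f + b * z g)"
  proof (rule Lipschitz_continuous_linf[where C="\<bar>a\<bar> + \<bar>b\<bar>"])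
    fix z w assume zw: "z \<in> mspace (linf H)" "w \<in> mspace (linf H)"
    have "a * z f + b * z g - (a * w f + b * w g) = a * (z f - w f) + b * (z g - w g)" by (simp add: algebra_simps)
    also have "\<bar>\<dots>\<bar> \<le> \<bar>a\<bar> * \<bar>z f - w f\<bar> + \<bar>b\<bar> * \<bar>z g - w g\<bar>" by (simp add: abs_mult[symmetric])
    also have "\<dots> \<le> \<bar>a\<bar> * mdist (linf H) z w + \<bar>b\<bar> * mdist (linf H) z w"
      using linf_coordinate[OF zw] fg by (intro add_mono mult_left_mono) auto
    finally show "\<bar>a * z f + b * z g - (a * w f + b * w g)\<bar> \<le> (\<bar>a\<bar> + \<bar>b\<bar>) * mdist (linf H) z w"
      by (simp add: distrib_right)
  qed
  then have "continuous_map (mtopology_of (linf H)) euclideanreal (\<lambda>z. \<phi> (a * z f + b * z g))"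
    using continuous_map_compose[of _ _ "\<lambda>z. a * z f + b * z g" euclideanreal \<phi>] \<phi>(1)
    by (simp add: o_def)
  from emp_conv[OF this \<phi>(2)]
  have "(\<lambda>N. outer_expectation (iid Q) (\<lambda>z. \<phi> (a * emp N z f + b * emp N z g))) \<longlonglongrightarrow> (\<integral>\<omega>. \<phi> (a * G \<omega> f + b * G \<omega> g) \<partial>M)"
    using fg by simp
  moreover have "outer_expectation (iid Q) (\<lambda>z. \<phi> (a * emp N z f + b * emp N z g)) = (\<integral>z. \<phi> (a * emp N z f + b * emp N z g) \<partial>iid Q)" for N
  proof (rule outer_expectation_measurable, rule I.integrable_const_bound[of _ B])
    note emp_measurable[OF fg(1), measurable] emp_measurable[OF fg(2), measurable]
    have [measurable]: "\<phi> \<in> borel_measurable borel" using \<phi>(1) by (rule borel_measurable_continuous_onI)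
    show "(\<lambda>z. \<phi> (a * emp N z f + b * emp N z g)) \<in> borel_measurable (iid Q)" by measurable
  qed (use \<phi>(2) in auto)
  ultimately show ?thesis by simp
qed

lemma char_emp_conv:
  assumes f: "f \<in> H"
  shows "(\<lambda>N. char (distr (iid Q) borel (\<lambda>z. emp N z f)) t) \<longlonglongrightarrow> char (distr M borel (\<lambda>\<omega>. G \<omega> f)) t"
proof -
  have "(\<lambda>N. \<integral>z. cos (t * emp N z f + b) \<partial>iid Q) \<longlonglongrightarrow> (\<integral>\<omega>. cos (t * G \<omega> f + b) \<partial>M)" for b
    using emp_conv_real[OF f f, of "\<lambda>x. cos (t * x + b)" 1 1 0] by (simp add: continuous_intros)
  from this[of 0] this[of "-(pi/2)"] show ?thesis
    unfolding char_eq_cos[OF prob_space_iid[OF Q] emp_measurable[OF f]] char_eq_cos[OF M G_coordinate[OF f]]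
    by (intro tendsto_intros) simp_all
qed

text \<open>Tightness of the normalized sums bounds \<open>n (1 - |\<phi>(t / sqrt n)|\<^sup>2)\<close>, where \<open>|\<phi>|\<^sup>2\<close> is the
  characteristic function of the symmetrized variable; Fatou then bounds its variance.\<close>

lemma donsker_square_integrable:
  assumes f: "f \<in> H"
  shows "integrable Q (\<lambda>y. (f y - integral\<^sup>L Q f)\<^sup>2)"
proof -
  define g where "g y = f y - integral\<^sup>L Q f" for y
  have [measurable]: "g \<in> borel_measurable Q" unfolding g_def using H_meas[OF f] by measurable
  have g_int: "integrable Q g" unfolding g_def using H_int[OF f] by simp
  define c where "c s = char (distr Q borel g) s" for s
  have ch: "char (distr (iid Q) borel (\<lambda>z. emp N z f)) t = c (t / sqrt (real N)) ^ N" for N t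
  proof -
    have "(\<lambda>z. emp N z f) = (\<lambda>z. \<Sum>i<N. g (z i) / sqrt (real N))"
      by (simp add: emp_def g_def sum_divide_distrib)
    then have "char (distr (iid Q) borel (\<lambda>z. emp N z f)) t
        = (\<Prod>i<N. char (distr (iid Q) borel (\<lambda>z. g (z i) / sqrt (real N))) t)"
      using I.char_distr_sum[of "\<lambda>i z. g (z i) / sqrt (real N)" "{..<N}" t]
        I.indep_vars_subset[OF indep_vars_iid_compose[OF Q, of "\<lambda>y. g y / sqrt (real N)"], of "{..<N}"] by simp
    also have "\<dots> = (\<Prod>i<N. char (distr Q borel (\<lambda>y. g y / sqrt (real N))) t)"
      by (subst distr_iid_compose[OF Q, of "\<lambda>y. g y / sqrt (real N)"]) auto
    also have "char (distr Q borel (\<lambda>y. g y / sqrt (real N))) t = c (t / sqrt (real N))"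
      by (simp add: c_def char_def integral_distr)
    finally show ?thesis by simp
  qed
  define ch0 where "ch0 = char (distr M borel (\<lambda>\<omega>. G \<omega> f))"
  interpret ch0: real_distribution "distr M borel (\<lambda>\<omega>. G \<omega> f)"
    by (rule real_distribution_distr[OF M G_coordinate[OF f]])
  interpret g: real_distribution "distr Q borel g"
    by (rule real_distribution_distr[OF Q]) simp
  \<comment> \<open>Continuity of the limit characteristic function at 0 gives a fixed
    \<open>t\<close> at which the powers \<open>c (t / sqrt (real N)) ^ N\<close> eventually stay
    away from 0.\<close>
  obtain t where t: "t > 0" "norm (ch0 t) > 1/2"
  proof -
    have "isCont ch0 0" unfolding ch0_def by (rule ch0.isCont_char)
    then obtain d where d: "d > 0" "\<And>x. dist x 0 < d \<Longrightarrow> dist (ch0 x) (ch0 0) < 1/2"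
      unfolding continuous_at_eps_delta by (meson zero_less_divide_1_iff zero_less_numeral)
    have "dist (ch0 (d/2)) 1 < 1/2" using d(2)[of "d/2"] d(1) ch0.char_zero by (simp add: ch0_def dist_real_def)
    moreover have "norm (1::complex) \<le> norm (ch0 (d/2)) + dist (ch0 (d/2)) 1"
      by (metis dist_commute dist_norm norm_triangle_sub)
    ultimately have "norm (ch0 (d/2)) > 1/2" by simp
    then show thesis using that[of "d/2"] d(1) by simp
  qed
  define a where "a N = (norm (c (t / sqrt (real N))))\<^sup>2" for N
  \<comment> \<open>Squaring turns the lower bound into \<open>a N ^ N > 1/4\<close>; the logarithm
    and \<open>ln x \<le> x - 1\<close> then linearize it.\<close>
  have a_le: "real N * (1 - a N) \<le> ln 4" if "norm (c (t / sqrt (real N))) ^ N > 1/2" for N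
  proof -
    have aN: "a N ^ N > 1/4"
    proof -
      have "(1/2)\<^sup>2 < (norm (c (t / sqrt (real N))) ^ N)\<^sup>2" using that by (intro power_strict_mono) auto
      also have "\<dots> = a N ^ N" by (simp add: a_def mult.commute flip: power_mult)
      finally show ?thesis by (simp add: power2_eq_square)
    qed
    show ?thesis
    proof (cases "N = 0")
      case False
      have "a N > 0"
      proof (rule ccontr)
        assume "\<not> a N > 0"
        then have "a N = 0" by (simp add: a_def)
        then show False using aN False by (simp add: power_0_left)
      qed
      have "ln (1/4) \<le> ln (a N ^ N)" using aN by (intro ln_mono) auto
      then have "- ln 4 \<le> real N * ln (a N)"
        using \<open>a N > 0\<close> by (simp add: ln_realpow ln_div)
      also have "\<dots> \<le> real N * (a N - 1)"
        using ln_le_minus_one[OF \<open>a N > 0\<close>] by (intro mult_left_mono) auto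
      finally show ?thesis by (simp add: algebra_simps)
    qed simp
  qed
  interpret QQ: pair_prob_space Q Q ..
  \<comment> \<open>For independent \<open>x\<close> and \<open>y\<close>, \<open>a N\<close> is the
    characteristic function of \<open>g x - g y\<close> at \<open>t / sqrt (real N)\<close>. Hence
    \<open>\<kappa> N\<close> is a nonnegative integrand with integral
    \<open>real N * (1 - a N)\<close>, and its pointwise limit is half the square of
    \<open>t * (g x - g y)\<close>.\<close>
  define \<kappa> where "\<kappa> N w = real N * (1 - cos (t * (g (fst w) - g (snd w)) / sqrt (real N)))" for N w
  have [measurable]: "\<kappa> N \<in> borel_measurable (Q \<Otimes>\<^sub>M Q)" for N unfolding \<kappa>_def by measurable
  have \<kappa>0: "0 \<le> \<kappa> N w" for N w by (simp add: \<kappa>_def)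
  have int_\<kappa>: "(\<integral>\<^sup>+w. ennreal (\<kappa> N w) \<partial>(Q \<Otimes>\<^sub>M Q)) = ennreal (real N * (1 - a N))" for N
  proof -
    define s where "s = t / sqrt (real N)"
    define C where "C = (\<integral>y. cos (s * g y) \<partial>Q)"
    define S where "S = (\<integral>y. sin (s * g y) \<partial>Q)"
    have ci: "integrable Q (\<lambda>y. cos (s * g y))" and si: "integrable Q (\<lambda>y. sin (s * g y))"
      by (auto intro!: Q.integrable_const_bound[of _ 1])
    have "c s = complex_of_real C + \<i> * complex_of_real S"
      unfolding c_def char_eq_cos[OF Q \<open>g \<in> borel_measurable Q\<close>] C_def S_def by (simp add: cos_diff)
    then have aN: "a N = C\<^sup>2 + S\<^sup>2"
      unfolding a_def s_def[symmetric] by (simp add: cmod_power2)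
    have k: "\<kappa> N w = real N - real N * cos (s * g (fst w) - s * g (snd w))" for w
      by (simp add: \<kappa>_def s_def algebra_simps diff_divide_distrib)
    have ki: "integrable (Q \<Otimes>\<^sub>M Q) (\<lambda>w. cos (s * g (fst w) - s * g (snd w)))"
      by (rule QQ.integrable_const_bound[of _ 1]) auto
    have "(\<integral>w. cos (s * g (fst w) - s * g (snd w)) \<partial>(Q \<Otimes>\<^sub>M Q)) = (\<integral>x. \<integral>y. cos (s * g x - s * g y) \<partial>Q \<partial>Q)"
      using QQ.integral_fst'[OF ki] by simp
    also have "\<dots> = (\<integral>x. cos (s * g x) * C + sin (s * g x) * S \<partial>Q)"
      by (rule Bochner_Integration.integral_cong) (use ci si in \<open>auto simp: cos_diff C_def S_def\<close>)
    also have "\<dots> = C\<^sup>2 + S\<^sup>2"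
      using ci si by (simp add: C_def[symmetric] S_def[symmetric] power2_eq_square)
    finally have "(\<integral>w. \<kappa> N w \<partial>(Q \<Otimes>\<^sub>M Q)) = real N * (1 - a N)"
      unfolding k aN using ki by (simp add: QQ.prob_space algebra_simps)
    moreover have "integrable (Q \<Otimes>\<^sub>M Q) (\<kappa> N)" unfolding k[abs_def] using ki by auto
    ultimately show ?thesis using \<kappa>0 by (subst nn_integral_eq_integral) auto
  qed
  have "(\<lambda>N. norm (c (t / sqrt (real N))) ^ N) \<longlonglongrightarrow> norm (ch0 t)"
    using tendsto_norm[OF char_emp_conv[OF f, of t]] unfolding ch ch0_def[symmetric] norm_power .
  then have ev: "\<forall>\<^sub>F N in sequentially. norm (c (t / sqrt (real N))) ^ N > 1/2"
    using t(2) by (rule order_tendstoD(1))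
  have "(\<integral>\<^sup>+w. liminf (\<lambda>N. ennreal (\<kappa> N w)) \<partial>(Q \<Otimes>\<^sub>M Q)) \<le> liminf (\<lambda>N. \<integral>\<^sup>+w. ennreal (\<kappa> N w) \<partial>(Q \<Otimes>\<^sub>M Q))"
    by (rule nn_integral_liminf) simp
  also have "\<dots> \<le> ennreal (ln 4)"
  proof (rule Liminf_le)
    show "\<forall>\<^sub>F N in sequentially. (\<integral>\<^sup>+w. ennreal (\<kappa> N w) \<partial>(Q \<Otimes>\<^sub>M Q)) \<le> ennreal (ln 4)"
      using ev by eventually_elim (unfold int_\<kappa>, intro ennreal_leI a_le)
  qed simp
  also have "(\<lambda>w. liminf (\<lambda>N. ennreal (\<kappa> N w))) = (\<lambda>w. ennreal ((t * (g (fst w) - g (snd w)))\<^sup>2 / 2))"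
  proof
    fix w
    have "(\<lambda>N. \<kappa> N w) \<longlonglongrightarrow> (t * (g (fst w) - g (snd w)))\<^sup>2 / 2"
      unfolding \<kappa>_def by (rule one_minus_cos_limit)
    then show "liminf (\<lambda>N. ennreal (\<kappa> N w)) = ennreal ((t * (g (fst w) - g (snd w)))\<^sup>2 / 2)"
      by (intro lim_imp_Liminf tendsto_ennrealI) auto
  qed
  finally have fin: "(\<integral>\<^sup>+w. ennreal ((t * (g (fst w) - g (snd w)))\<^sup>2 / 2) \<partial>(Q \<Otimes>\<^sub>M Q)) < \<infinity>"
    by (simp add: le_less_trans)
  have "integrable (Q \<Otimes>\<^sub>M Q) (\<lambda>w. (t * (g (fst w) - g (snd w)))\<^sup>2 / 2)"
    by (rule integrableI_nonneg) (use fin in auto)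
  \<comment> \<open>Fubini's theorem yields one \<open>x\<close> for which the squared difference is
    integrable in \<open>y\<close>; integrability of \<open>g\<close> then removes the terms that
    contain \<open>g x\<close>.\<close>
  from QQ.AE_integrable_fst'[OF this]
  have "AE x in Q. integrable Q (\<lambda>y. (t * (g x - g y))\<^sup>2 / 2)" by simp
  then have "\<exists>x. integrable Q (\<lambda>y. (t * (g x - g y))\<^sup>2 / 2)"
  proof (rule contrapos_pp)
    assume "\<not> (\<exists>x. integrable Q (\<lambda>y. (t * (g x - g y))\<^sup>2 / 2))"
    then show "\<not> (AE x in Q. integrable Q (\<lambda>y. (t * (g x - g y))\<^sup>2 / 2))" by simp
  qed
  then obtain x where "integrable Q (\<lambda>y. (t * (g x - g y))\<^sup>2 / 2)" by blast
  then have "integrable Q (\<lambda>y. (2 / t\<^sup>2) * ((t * (g x - g y))\<^sup>2 / 2))" by (rule integrable_mult_right)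
  also have "(\<lambda>y. (2 / t\<^sup>2) * ((t * (g x - g y))\<^sup>2 / 2)) = (\<lambda>y. (g x - g y)\<^sup>2)"
    using t(1) by (simp add: power_mult_distrib)
  finally have "integrable Q (\<lambda>y. (g x - g y)\<^sup>2 - (g x)\<^sup>2 + 2 * g x * g y)"
    using g_int by auto
  also have "(\<lambda>y. (g x - g y)\<^sup>2 - (g x)\<^sup>2 + 2 * g x * g y) = (\<lambda>y. (g y)\<^sup>2)"
    by (simp add: power2_eq_square algebra_simps)
  finally show ?thesis by (simp add: g_def)
qed

lemma donsker_diff:
  assumes fg: "f \<in> H" "g \<in> H"
    and k_def: "k = (\<lambda>y. (f y - integral\<^sup>L Q f) - (g y - integral\<^sup>L Q g))"
  shows "integrable Q k" "integrable Q (\<lambda>y. (k y)\<^sup>2)" "integral\<^sup>L Q k = 0" "(\<integral>y. (k y)\<^sup>2 \<partial>Q) = (rho_c Q f g)\<^sup>2"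
    "emp N z f - emp N z g = 1 / sqrt (real N) * (\<Sum>i<N. k (z i))"
proof -
  note H_meas[OF fg(1), measurable] H_meas[OF fg(2), measurable]
  show "integrable Q k" unfolding k_def using H_int fg by auto
  show "integrable Q (\<lambda>y. (k y)\<^sup>2)"
  proof (rule Bochner_Integration.integrable_bound)
    show "integrable Q (\<lambda>y. 2 * (f y - integral\<^sup>L Q f)\<^sup>2 + 2 * (g y - integral\<^sup>L Q g)\<^sup>2)"
      using donsker_square_integrable fg by auto
    show "AE y in Q. norm ((k y)\<^sup>2) \<le> norm (2 * (f y - integral\<^sup>L Q f)\<^sup>2 + 2 * (g y - integral\<^sup>L Q g)\<^sup>2)"
    proof (rule AE_I2)
      fix y
      have "(u - v)\<^sup>2 \<le> 2 * u\<^sup>2 + 2 * v\<^sup>2" for u v :: real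
        using zero_le_power2[of "u + v"] by (simp add: power2_eq_square algebra_simps)
      then show "norm ((k y)\<^sup>2) \<le> norm (2 * (f y - integral\<^sup>L Q f)\<^sup>2 + 2 * (g y - integral\<^sup>L Q g)\<^sup>2)"
        by (simp add: k_def)
    qed
  qed (simp add: k_def)
  show "integral\<^sup>L Q k = 0" unfolding k_def using H_int fg by (simp add: Q.prob_space)
  show "(\<integral>y. (k y)\<^sup>2 \<partial>Q) = (rho_c Q f g)\<^sup>2"
    by (simp add: rho_c_def k_def)
  show "emp N z f - emp N z g = 1 / sqrt (real N) * (\<Sum>i<N. k (z i))"
    unfolding emp_def k_def
    by (simp only: right_diff_distrib[symmetric] sum_subtractf[of "\<lambda>i. f (z i) - integral\<^sup>L Q f" "\<lambda>i. g (z i) - integral\<^sup>L Q g"])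
qed

text \<open>For every \<open>N \<ge> 1\<close> the increment of the normalized sum has second moment
  \<open>(rho_c Q f g)\<^sup>2\<close>, so its first absolute moment is at most
  \<open>rho_c Q f g\<close>. Truncation by 1 makes the functional bounded, and the inequality
  passes to the limit.\<close>

lemma G_diff_mean:
  assumes fg: "f \<in> H" "g \<in> H"
  shows "(\<integral>\<omega>. min 1 \<bar>G \<omega> f - G \<omega> g\<bar> \<partial>M) \<le> rho_c Q f g"
proof (rule LIMSEQ_le_const2)
  show "(\<lambda>N. \<integral>z. min 1 \<bar>emp N z f - emp N z g\<bar> \<partial>iid Q) \<longlonglongrightarrow> (\<integral>\<omega>. min 1 \<bar>G \<omega> f - G \<omega> g\<bar> \<partial>M)"
    using emp_conv_real[OF fg, of "\<lambda>x. min 1 \<bar>x\<bar>" 1 1 "-1"] by (simp add: continuous_intros)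
  have "(\<integral>z. min 1 \<bar>emp N z f - emp N z g\<bar> \<partial>iid Q) \<le> rho_c Q f g" if N: "N \<ge> 1" for N
  proof -
    define k where "k = (\<lambda>y. (f y - integral\<^sup>L Q f) - (g y - integral\<^sup>L Q g))"
    note k = donsker_diff[OF fg k_def]
    note emp_measurable[OF fg(1), measurable] emp_measurable[OF fg(2), measurable]
    let ?Y = "\<lambda>z. emp N z f - emp N z g"
    have sq: "integrable (iid Q) (\<lambda>z. (?Y z)\<^sup>2)" "(\<integral>z. (?Y z)\<^sup>2 \<partial>iid Q) = (rho_c Q f g)\<^sup>2"
      using sum_iid_square[OF Q k(1,2,3), of "{..<N}"] N k(4)
      by (simp_all add: k(5) power_mult_distrib power_divide)
    have i1: "integrable (iid Q) (\<lambda>z. \<bar>?Y z\<bar>)"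
      using I.square_integrable_imp_integrable[OF _ sq(1)] by auto
    have "(\<integral>z. min 1 \<bar>?Y z\<bar> \<partial>iid Q) \<le> (\<integral>z. \<bar>?Y z\<bar> \<partial>iid Q)"
    proof (rule integral_mono[OF _ i1])
      show "integrable (iid Q) (\<lambda>z. min 1 \<bar>?Y z\<bar>)" by (rule I.integrable_const_bound[of _ 1]) auto
    qed simp
    also have "\<dots> \<le> rho_c Q f g"
    proof (rule power2_le_imp_le)
      have "(\<integral>z. \<bar>?Y z\<bar> \<partial>iid Q)\<^sup>2 \<le> (\<integral>z. \<bar>?Y z\<bar>\<^sup>2 \<partial>iid Q)"
        using I.variance_eq[of "\<lambda>z. \<bar>?Y z\<bar>"] I.variance_positive[of "\<lambda>z. \<bar>?Y z\<bar>"] i1 sq(1) by simp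
      then show "(\<integral>z. \<bar>?Y z\<bar> \<partial>iid Q)\<^sup>2 \<le> (rho_c Q f g)\<^sup>2" using sq(2) by simp
      show "0 \<le> rho_c Q f g" by (simp add: rho_c_def)
    qed
    finally show ?thesis .
  qed
  then show "\<exists>N. \<forall>n\<ge>N. (\<integral>z. min 1 \<bar>emp n z f - emp n z g\<bar> \<partial>iid Q) \<le> rho_c Q f g" by blast
qed

text \<open>The central limit theorem identifies the law of the limit increment. Unlike
  \<open>G_diff_mean\<close>, this bounds the spread of the increments from below, which is what
  total boundedness requires.\<close>

lemma G_diff_cos:
  assumes fg: "f \<in> H" "g \<in> H" and \<rho>: "rho_c Q f g > 0"
  shows "(\<integral>\<omega>. cos (s * (G \<omega> f - G \<omega> g)) \<partial>M) = exp (- ((s * rho_c Q f g)\<^sup>2 / 2))"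
proof -
  define k where "k = (\<lambda>y. (f y - integral\<^sup>L Q f) - (g y - integral\<^sup>L Q g))"
  note k = donsker_diff[OF fg k_def]
  let ?r = "rho_c Q f g"
  have [measurable]: "k \<in> borel_measurable Q" using k(1) by auto
  have mean: "(\<integral>z. k (z n) \<partial>iid Q) = 0" for n using integral_iid_component(1)[OF Q, of k n] k(3) by simp
  have w: "weak_conv_m (\<lambda>n. distr (iid Q) borel (\<lambda>z. (\<Sum>i<n. k (z i)) / sqrt (real n * ?r\<^sup>2))) std_normal_distribution"
  proof (rule I.central_limit_theorem_zero_mean)
    show "I.indep_vars (\<lambda>i. borel) (\<lambda>i z. k (z i)) UNIV" by (rule indep_vars_iid_compose[OF Q]) simp
    show "(\<integral>z. k (z n) \<partial>iid Q) = 0" for n by (rule mean)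
    show "integrable (iid Q) (\<lambda>z. (k (z n))\<^sup>2)" for n
      using integral_iid_component(2)[OF Q, of "\<lambda>y. (k y)\<^sup>2" n] k(2) by simp
    show "I.variance (\<lambda>z. k (z n)) = ?r\<^sup>2" for n
      using integral_iid_component(1)[OF Q, of "\<lambda>y. (k y)\<^sup>2" n] k(4) by (simp add: mean)
    show "distr (iid Q) borel (\<lambda>z. k (z n)) = distr Q borel k" for n
      by (rule distr_iid_compose[OF Q]) simp
  qed (rule \<rho>)
  let ?S = "\<lambda>n z. (\<Sum>i<n. k (z i)) / sqrt (real n * ?r\<^sup>2)"
  have S: "?S n \<in> borel_measurable (iid Q)" for n by measurable
  have "(\<lambda>n. char (distr (iid Q) borel (?S n)) (s * ?r)) \<longlonglongrightarrow> char std_normal_distribution (s * ?r)"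
    by (rule levy_continuity1[OF real_distribution_distr[OF prob_space_iid[OF Q] S] real_dist_normal_dist w])
  then have "(\<lambda>n. Re (char (distr (iid Q) borel (?S n)) (s * ?r))) \<longlonglongrightarrow> Re (char std_normal_distribution (s * ?r))"
    by (rule tendsto_Re)
  moreover have "Re (char (distr (iid Q) borel (?S n)) (s * ?r)) = (\<integral>z. cos (s * (emp n z f - emp n z g)) \<partial>iid Q)" for n
  proof -
    have "s * ?r * ?S n z = s * (emp n z f - emp n z g)" for z
      unfolding k(5) using \<rho> by (simp add: real_sqrt_mult)
    then show ?thesis unfolding char_eq_cos[OF prob_space_iid[OF Q] S] by simp
  qed
  ultimately have "(\<lambda>n. \<integral>z. cos (s * (emp n z f - emp n z g)) \<partial>iid Q) \<longlonglongrightarrow> exp (- ((s * ?r)\<^sup>2 / 2))"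
    by (simp add: char_std_normal_distribution)
  moreover have "(\<lambda>n. \<integral>z. cos (s * (emp n z f - emp n z g)) \<partial>iid Q) \<longlonglongrightarrow> (\<integral>\<omega>. cos (s * (G \<omega> f - G \<omega> g)) \<partial>M)"
    using emp_conv_real[OF fg, of "\<lambda>x. cos (s * x)" 1 1 "-1"] by (simp add: continuous_intros)
  ultimately show ?thesis by (rule LIMSEQ_unique[symmetric])
qed

end

section \<open>Boundedness, equicontinuity and total boundedness from the tight limit\<close>

context donsker_limit
begin

interpretation Q: prob_space Q by (rule Q)
interpretation M: prob_space M by (rule M)
interpretation I: prob_space "iid Q" by (rule prob_space_iid[OF Q])

text \<open>Triples with \<open>c = 0\<close> measure the size of a path, those with
  \<open>c = 1\<close> its increments, so both moduli are treated at once.\<close>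

definition supD :: "(('z \<Rightarrow> real) \<times> ('z \<Rightarrow> real) \<times> real) set \<Rightarrow> (('z \<Rightarrow> real) \<Rightarrow> real) \<Rightarrow> real" where
  "supD D z = (SUP (f, g, c)\<in>D. \<bar>z f - c * z g\<bar>)"

context
  fixes D :: "(('z \<Rightarrow> real) \<times> ('z \<Rightarrow> real) \<times> real) set"
  assumes D: "D \<noteq> {}" "D \<subseteq> H \<times> H \<times> {0, 1}"
begin

lemma supD_bdd:
  assumes "z \<in> mspace (linf H)"
  shows "bdd_above ((\<lambda>(f, g, c). \<bar>z f - c * z g\<bar>) ` D)"
proof -
  obtain K where K: "\<And>f. f \<in> H \<Longrightarrow> \<bar>z f\<bar> \<le> K" using assms by (auto simp: linf_mspace_iff)
  show ?thesis
  proof (rule bdd_aboveI2)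
    fix p assume "p \<in> D"
    then obtain f g c where p: "p = (f, g, c)" "f \<in> H" "g \<in> H" "c = 0 \<or> c = 1" using D by (cases p) auto
    show "(case p of (f, g, c) \<Rightarrow> \<bar>z f - c * z g\<bar>) \<le> 2 * K"
      using p K[OF p(2)] K[OF p(3)] by auto
  qed
qed

text \<open>Each term changes by at most twice the distance of the paths, since \<open>c\<close> is
  0 or 1. Being Lipschitz, the supremum is Borel even over an uncountable \<open>D\<close>, so its
  events are measurable for the limit \<open>G\<close>.\<close>

lemma supD_Lipschitz:
  assumes z: "z \<in> mspace (linf H)" and w: "w \<in> mspace (linf H)"
  shows "\<bar>supD D z - supD D w\<bar> \<le> 2 * mdist (linf H) z w"
proof -
  have *: "supD D z \<le> supD D w + 2 * mdist (linf H) z w"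
    if z: "z \<in> mspace (linf H)" and w: "w \<in> mspace (linf H)" for z w
    unfolding supD_def[of _ z]
  proof (rule cSUP_least[OF D(1)])
    fix p assume p': "p \<in> D"
    then obtain f g c where p: "p = (f, g, c)" "f \<in> H" "g \<in> H" "c = 0 \<or> c = 1" using D by (cases p) auto
    have "\<bar>w f - c * w g\<bar> \<le> supD D w"
      unfolding supD_def using cSUP_upper[OF p' supD_bdd[OF w]] by (simp add: p)
    moreover have "\<bar>z f - w f\<bar> \<le> mdist (linf H) z w" "\<bar>z g - w g\<bar> \<le> mdist (linf H) z w"
      using linf_coordinate[OF z w] p by auto
    ultimately show "(case p of (f, g, c) \<Rightarrow> \<bar>z f - c * z g\<bar>) \<le> supD D w + 2 * mdist (linf H) z w"
      using p by auto
  qed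
  have "mdist (linf H) w z = mdist (linf H) z w" by (rule mdist_commute)
  then show ?thesis using *[OF z w] *[OF w z] by linarith
qed

lemma supD_less_iff:
  assumes "z \<in> mspace (linf H)"
  shows "\<epsilon> < supD D z \<longleftrightarrow> (\<exists>(f, g, c)\<in>D. \<epsilon> < \<bar>z f - c * z g\<bar>)"
  unfolding supD_def using less_cSUP_iff[OF D(1) supD_bdd[OF assms], of \<epsilon>] by (auto simp: split_beta)

lemma supD_measurable: "(\<lambda>\<omega>. supD D (G \<omega>)) \<in> borel_measurable M"
  by (rule measurable_compose[OF G_measurable continuous_map_linf_borel_measurable[OF Lipschitz_continuous_linf[OF supD_Lipschitz]]])

lemma supD_event:
  "{\<omega>\<in>space M. \<exists>(f, g, c)\<in>D. \<epsilon> < \<bar>G \<omega> f - c * G \<omega> g\<bar>} = {\<omega>\<in>space M. \<epsilon> < supD D (G \<omega>)}"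
  "{\<omega>\<in>space M. \<epsilon> < supD D (G \<omega>)} \<in> sets M"
proof -
  note supD_measurable[measurable]
  show "{\<omega>\<in>space M. \<epsilon> < supD D (G \<omega>)} \<in> sets M" by measurable
  show "{\<omega>\<in>space M. \<exists>(f, g, c)\<in>D. \<epsilon> < \<bar>G \<omega> f - c * G \<omega> g\<bar>} = {\<omega>\<in>space M. \<epsilon> < supD D (G \<omega>)}"
    by (intro Collect_cong conj_cong refl, rule supD_less_iff[OF G_space, symmetric])
qed

text \<open>A continuous ramp that is 0 up to level \<open>\<epsilon>\<close> and 1 from level
  \<open>2 * \<epsilon>\<close> on takes the place of an indicator; hence the factor 2 between the
  two levels.\<close>

lemma emp_outer:
  assumes \<epsilon>: "\<epsilon> > 0"
    and less: "measure M {\<omega>\<in>space M. \<exists>(f, g, c)\<in>D. \<epsilon> < \<bar>G \<omega> f - c * G \<omega> g\<bar>} < \<eta>"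
  shows "\<exists>N0. \<forall>N\<ge>N0. outer_le (iid Q) {z. \<exists>(f, g, c)\<in>D. 2 * \<epsilon> < \<bar>emp N z f - c * emp N z g\<bar>} \<eta>"
proof -
  define h where "h z = min 1 (max 0 (supD D z / \<epsilon> - 1))" for z
  have hB: "0 \<le> h z \<and> h z \<le> 1" for z by (simp add: h_def)
  have "continuous_map (mtopology_of (linf H)) euclideanreal (supD D)"
    by (rule Lipschitz_continuous_linf[OF supD_Lipschitz])
  from continuous_map_compose[OF this, of euclideanreal "\<lambda>x. min 1 (max 0 (x / \<epsilon> - 1))"]
  have h: "continuous_map (mtopology_of (linf H)) euclideanreal h"
    using \<epsilon> by (simp add: o_def h_def[abs_def] continuous_intros)
  have hm: "(\<lambda>\<omega>. h (G \<omega>)) \<in> borel_measurable M"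
    by (rule measurable_compose[OF G_measurable continuous_map_linf_borel_measurable[OF h]])
  have "(\<integral>\<omega>. h (G \<omega>) \<partial>M) \<le> (\<integral>\<omega>. indicator {\<omega>\<in>space M. \<epsilon> < supD D (G \<omega>)} \<omega> \<partial>M)"
  proof (rule integral_mono)
    show "integrable M (\<lambda>\<omega>. h (G \<omega>))"
      by (rule M.integrable_const_bound[of _ 1]) (use hB hm in auto)
    fix \<omega> assume "\<omega> \<in> space M"
    then show "h (G \<omega>) \<le> indicator {\<omega>\<in>space M. \<epsilon> < supD D (G \<omega>)} \<omega>"
      using \<epsilon> hB[of "G \<omega>"] by (auto simp: h_def indicator_def not_less)
  qed (use supD_event(2) in \<open>auto intro!: integrable_real_indicator simp: M.emeasure_eq_measure\<close>)
  also have "\<dots> = measure M {\<omega>\<in>space M. \<epsilon> < supD D (G \<omega>)}" using supD_event(2) by simp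
  also have "\<dots> < \<eta>" using less unfolding supD_event(1) .
  finally have lt: "(\<integral>\<omega>. h (G \<omega>) \<partial>M) < \<eta>" .
  have "(\<lambda>N. outer_expectation (iid Q) (\<lambda>z. h (\<lambda>f\<in>H. emp N z f))) \<longlonglongrightarrow> (\<integral>\<omega>. h (G \<omega>) \<partial>M)"
    by (rule emp_conv[OF h, of 1]) (use hB in auto)
  then have "\<forall>\<^sub>F N in sequentially. outer_expectation (iid Q) (\<lambda>z. h (\<lambda>f\<in>H. emp N z f)) < \<eta>"
    using lt by (rule order_tendstoD(2))
  then obtain N0 where N0: "\<And>N. N \<ge> N0 \<Longrightarrow> outer_expectation (iid Q) (\<lambda>z. h (\<lambda>f\<in>H. emp N z f)) < \<eta>"
    by (auto simp: eventually_sequentially)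
  show ?thesis
  proof (intro exI[of _ N0] allI impI)
    fix N assume "N \<ge> N0"
    from N0[OF this] show "outer_le (iid Q) {z. \<exists>(f, g, c)\<in>D. 2 * \<epsilon> < \<bar>emp N z f - c * emp N z g\<bar>} \<eta>"
    proof (rule outer_le_of_outer_expectation[OF prob_space_iid[OF Q], of _ 1, rotated])
      fix z assume z: "z \<in> space (iid Q)" and "z \<in> {z. \<exists>(f, g, c)\<in>D. 2 * \<epsilon> < \<bar>emp N z f - c * emp N z g\<bar>}"
      then obtain f g c where p: "(f, g, c) \<in> D" "2 * \<epsilon> < \<bar>emp N z f - c * emp N z g\<bar>" by auto
      then have "f \<in> H" "g \<in> H" using D by auto
      then have "\<exists>(f, g, c)\<in>D. 2 * \<epsilon> < \<bar>(\<lambda>f\<in>H. emp N z f) f - c * (\<lambda>f\<in>H. emp N z f) g\<bar>"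
        using p by (intro bexI[of _ "(f, g, c)"]) auto
      then have "2 * \<epsilon> < supD D (\<lambda>f\<in>H. emp N z f)"
        using supD_less_iff[OF emp_space[OF z]] by blast
      then show "1 \<le> h (\<lambda>f\<in>H. emp N z f)" using \<epsilon> by (simp add: h_def field_simps)
    qed (use hB in auto)
  qed
qed

text \<open>By exchangeability the bound holds for sums over every sufficiently large block of
  indices, with one \<open>N0\<close> for all blocks. The blocks will be those attached to a sign
  vector.\<close>

lemma emp_outer_sum:
  assumes \<epsilon>: "\<epsilon> > 0"
    and less: "measure M {\<omega>\<in>space M. \<exists>(f, g, c)\<in>D. \<epsilon> < \<bar>G \<omega> f - c * G \<omega> g\<bar>} < \<eta>"
  shows "\<exists>N0. \<forall>C. finite C \<and> card C \<ge> N0 \<longrightarrow> outer_le (iid Q) {z. \<exists>(f, g, c)\<in>D.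
      2 * \<epsilon> * sqrt (card C) < \<bar>(\<Sum>i\<in>C. f (z i) - integral\<^sup>L Q f) - c * (\<Sum>i\<in>C. g (z i) - integral\<^sup>L Q g)\<bar>} \<eta>"
proof -
  obtain N0 where N0: "\<And>N. N \<ge> N0 \<Longrightarrow> outer_le (iid Q) {z. \<exists>(f, g, c)\<in>D. 2 * \<epsilon> < \<bar>emp N z f - c * emp N z g\<bar>} \<eta>"
    using emp_outer[OF assms] by blast
  show ?thesis
  \<comment> \<open>The maximum with 1 excludes the empty block, where \<open>sqrt (card C)\<close>
    vanishes.\<close>
  proof (intro exI[of _ "max 1 N0"] allI impI)
    fix C :: "nat set" assume C: "finite C \<and> max 1 N0 \<le> card C"
    define t where "t f y = f y - integral\<^sup>L Q f" for f :: "'z \<Rightarrow> real" and y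
    \<comment> \<open>Written as a predicate of a functional of \<open>f\<close>, the event has the
      form in which \<open>outer_le_reindex\<close> moves it to other indices.\<close>
    define R where "R S \<longleftrightarrow> (\<exists>(f, g, c)\<in>D. 2 * \<epsilon> * sqrt (card C) < \<bar>S (t f) - c * S (t g)\<bar>)" for S :: "('z \<Rightarrow> real) \<Rightarrow> real"
    have "outer_le (iid Q) {z. R (\<lambda>f. \<Sum>i<card C. f (z i))} \<eta>"
    proof (rule outer_le_mono[OF N0[of "card C"]])
      show "{z. R (\<lambda>f. \<Sum>i<card C. f (z i))} \<inter> space (iid Q) \<subseteq> {z. \<exists>(f, g, c)\<in>D. 2 * \<epsilon> < \<bar>emp (card C) z f - c * emp (card C) z g\<bar>}"
      proof clarify
        fix z assume "R (\<lambda>f. \<Sum>i<card C. f (z i))"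
        then obtain f g c where p: "(f, g, c) \<in> D" "2 * \<epsilon> * sqrt (card C) < \<bar>(\<Sum>i<card C. t f (z i)) - c * (\<Sum>i<card C. t g (z i))\<bar>"
          by (auto simp: R_def)
        have c0: "sqrt (card C) > 0" using C by simp
        have "emp (card C) z f - c * emp (card C) z g = ((\<Sum>i<card C. t f (z i)) - c * (\<Sum>i<card C. t g (z i))) / sqrt (card C)"
          by (simp add: emp_def t_def diff_divide_distrib)
        then have "\<bar>emp (card C) z f - c * emp (card C) z g\<bar> = \<bar>(\<Sum>i<card C. t f (z i)) - c * (\<Sum>i<card C. t g (z i))\<bar> / sqrt (card C)"
          by (simp add: abs_divide)
        then have "2 * \<epsilon> < \<bar>emp (card C) z f - c * emp (card C) z g\<bar>"
          using p(2) c0 by (simp add: pos_less_divide_eq)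
        then show "\<exists>(f, g, c)\<in>D. 2 * \<epsilon> < \<bar>emp (card C) z f - c * emp (card C) z g\<bar>" using p(1) by blast
      qed
    qed (use C in auto)
    from outer_le_reindex[OF Q this] C
    show "outer_le (iid Q) {z. \<exists>(f, g, c)\<in>D.
      2 * \<epsilon> * sqrt (card C) < \<bar>(\<Sum>i\<in>C. f (z i) - integral\<^sup>L Q f) - c * (\<Sum>i\<in>C. g (z i) - integral\<^sup>L Q g)\<bar>} \<eta>"
      by (simp add: R_def t_def)
  qed
qed

end

lemma G_bounded:
  assumes \<eta>: "\<eta> > 0" and ne: "H \<noteq> {}"
  shows "\<exists>R>0. measure M {\<omega>\<in>space M. \<exists>(f, g, c)\<in>H \<times> H \<times> {0}. R < \<bar>G \<omega> f - c * G \<omega> g\<bar>} < \<eta>"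
proof -
  let ?D = "H \<times> H \<times> {0::real}"
  have D: "?D \<noteq> {}" "?D \<subseteq> H \<times> H \<times> {0, 1}" using ne by auto
  let ?A = "\<lambda>n::nat. {\<omega>\<in>space M. real n < supD ?D (G \<omega>)}"
  have "(\<lambda>n. measure M (?A n)) \<longlonglongrightarrow> measure M (\<Inter>n. ?A n)"
  proof (rule M.finite_Lim_measure_decseq)
    show "range ?A \<subseteq> sets M" using supD_event(2)[OF D] by auto
    show "decseq ?A"
      unfolding decseq_def
    proof (intro allI impI)
      fix m n :: nat assume "m \<le> n"
      then have "real m \<le> real n" by simp
      then show "?A n \<subseteq> ?A m" by fastforce
    qed
  qed
  also have "(\<Inter>n. ?A n) = {}"
  proof -
    have "\<exists>n. \<not> real n < supD ?D (G \<omega>)" for \<omega>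
      using real_arch_simple[of "supD ?D (G \<omega>)"] by (auto simp: not_less)
    then show ?thesis by blast
  qed
  finally have "(\<lambda>n. measure M (?A n)) \<longlonglongrightarrow> 0" by simp
  then have "\<forall>\<^sub>F n in sequentially. measure M (?A n) < \<eta>" using \<eta> by (rule order_tendstoD(2))
  then obtain n0 where "\<forall>n\<ge>n0. measure M (?A n) < \<eta>" by (auto simp: eventually_sequentially)
  then have "measure M (?A (Suc n0)) < \<eta>" by (simp del: of_nat_Suc)
  then show ?thesis unfolding supD_event(1)[OF D] by (intro exI[of _ "real (Suc n0)"]) auto
qed

text \<open>Compact sets are totally bounded, and closed because the space is Hausdorff, hence
  Borel. Only the finite net is used from here on.\<close>

lemma tight_net:
  assumes \<eta>: "\<eta> > 0" and \<epsilon>: "\<epsilon> > 0"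
  obtains K Z where "finite Z" "Z \<subseteq> mspace (linf H)" "K \<in> sets (linf_borel H)"
    "measure M (G -` K \<inter> space M) \<ge> 1 - \<eta>" "\<And>w. w \<in> K \<Longrightarrow> \<exists>z\<in>Z. mdist (linf H) z w < \<epsilon>"
proof -
  interpret L: Metric_space "mspace (linf H)" "mdist (linf H)" by (rule Metric_space_mspace_mdist)
  obtain K where K: "compactin (mtopology_of (linf H)) K" "measure M (G -` K \<inter> space M) \<ge> 1 - \<eta>"
    using tight \<eta> by (auto simp: tight_borel_element_def)
  have K': "compactin L.mtopology K" using K(1) by (simp add: mtopology_of_def)
  obtain Z where Z: "finite Z" "Z \<subseteq> K" "K \<subseteq> (\<Union>x\<in>Z. L.mball x \<epsilon>)"
  proof -
    have "L.mtotally_bounded K" by (rule L.compactin_imp_mtotally_bounded[OF K'])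
    then have "\<exists>Z. finite Z \<and> Z \<subseteq> K \<and> K \<subseteq> (\<Union>x\<in>Z. L.mball x \<epsilon>)"
      using \<epsilon> by (simp add: L.mtotally_bounded_def)
    then show thesis using that by (elim exE conjE)
  qed
  have KM: "K \<subseteq> mspace (linf H)" using compactin_subset_topspace[OF K'] by simp
  have "closedin L.mtopology K"
    using compactin_imp_closedin[OF L.Hausdorff_space_mtopology K'] .
  then have "openin (mtopology_of (linf H)) (mspace (linf H) - K)"
    by (simp add: closedin_def mtopology_of_def)
  then have "space (linf_borel H) - (mspace (linf H) - K) \<in> sets (linf_borel H)"
    by (intro sets.compl_sets openin_linf_borel)
  moreover have "space (linf_borel H) - (mspace (linf H) - K) = K" using KM by (auto simp: space_linf_borel)
  ultimately have "K \<in> sets (linf_borel H)" by simp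
  show thesis
  proof (rule that[OF Z(1) _ \<open>K \<in> sets (linf_borel H)\<close> K(2)])
    show "Z \<subseteq> mspace (linf H)" using Z(2) KM by blast
    fix w assume "w \<in> K"
    then obtain x where "x \<in> Z" "w \<in> L.mball x \<epsilon>" using Z(3) by blast
    then show "\<exists>z\<in>Z. mdist (linf H) z w < \<epsilon>" by (auto simp: L.in_mball)
  qed
qed

text \<open>On a tight set the process is determined up to \<open>\<epsilon>\<close> by finitely many paths, and a large
  increment of one of these paths has the probability of a ball.\<close>

lemma G_equicontinuous:
  assumes \<epsilon>: "\<epsilon> > 0" and \<eta>: "\<eta> > 0" and ne: "H \<noteq> {}"
  shows "\<exists>\<delta>>0. measure M {\<omega>\<in>space M. \<exists>(f, g, c)\<in>{(f, g, c). f \<in> H \<and> g \<in> H \<and> c = 1 \<and> rho_c Q f g < \<delta>}.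
      \<epsilon> < \<bar>G \<omega> f - c * G \<omega> g\<bar>} < \<eta>"
proof -
  interpret L: Metric_space "mspace (linf H)" "mdist (linf H)" by (rule Metric_space_mspace_mdist)
  obtain K Z where KZ: "finite Z" "Z \<subseteq> mspace (linf H)" "K \<in> sets (linf_borel H)"
    "measure M (G -` K \<inter> space M) \<ge> 1 - \<eta>/2" "\<And>w. w \<in> K \<Longrightarrow> \<exists>z\<in>Z. mdist (linf H) z w < \<epsilon>/8"
    by (rule tight_net[of "\<eta>/2" "\<epsilon>/8"]) (use \<epsilon> \<eta> in simp_all)
  define m where "m = min 1 (\<epsilon>/2)"
  have m: "m > 0" using \<epsilon> by (simp add: m_def)
  \<comment> \<open>Each ball that matters will have probability at most
    \<open>\<delta> / m\<close>; over at most \<open>card Z\<close> balls this adds up to at most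
    \<open>\<eta> / 4\<close>.\<close>
  define \<delta> where "\<delta> = m * (\<eta> / (4 * (real (card Z) + 1)))"
  have \<delta>: "\<delta> > 0" using m \<eta> by (simp add: \<delta>_def)
  define D where "D = {(f, g, c). f \<in> H \<and> g \<in> H \<and> c = (1::real) \<and> rho_c Q f g < \<delta>}"
  have D: "D \<noteq> {}" "D \<subseteq> H \<times> H \<times> {0, 1}"
  proof -
    obtain f where "f \<in> H" using ne by auto
    then have "(f, f, 1) \<in> D" using \<delta> by (simp add: D_def rho_c_def)
    then show "D \<noteq> {}" by auto
  qed (auto simp: D_def)
  let ?B = "\<lambda>z. L.mball z (\<epsilon>/8)"
  \<comment> \<open>The centres whose ball contains at least one path, of the process or not, with a
    large increment at small distance.\<close>
  define Z' where "Z' = {z\<in>Z. \<exists>w\<in>?B z. \<exists>(f, g, c)\<in>D. \<epsilon> < \<bar>w f - c * w g\<bar>}"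
  have Bsets: "G -` ?B z \<inter> space M \<in> sets M" for z
    by (rule measurable_sets[OF G_measurable openin_linf_borel]) (simp add: mtopology_of_def)
  \<comment> \<open>Every path in the ball is within \<open>\<epsilon> / 4\<close> of the exhibited
    path \<open>w\<close>, so it still has an increment above \<open>\<epsilon> / 2\<close> at the
    same pair. One fixed pair thus controls the whole ball, and Markov's inequality applies to
    it.\<close>
  have small: "measure M (G -` ?B z \<inter> space M) \<le> \<delta> / m" if z: "z \<in> Z'" for z
  proof -
    obtain w f g where w: "w \<in> ?B z" "f \<in> H" "g \<in> H" "rho_c Q f g < \<delta>" "\<epsilon> < \<bar>w f - w g\<bar>"
      using z by (auto simp: Z'_def D_def)
    note G_coordinate[OF w(2), measurable] G_coordinate[OF w(3), measurable]
    have "measure M (G -` ?B z \<inter> space M) \<le> measure M {\<omega>\<in>space M. m \<le> min 1 \<bar>G \<omega> f - G \<omega> g\<bar>}"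
    proof (rule M.finite_measure_mono)
      show "G -` ?B z \<inter> space M \<subseteq> {\<omega>\<in>space M. m \<le> min 1 \<bar>G \<omega> f - G \<omega> g\<bar>}"
      proof safe
        fix \<omega> assume om: "G \<omega> \<in> ?B z" "\<omega> \<in> space M"
        have "mdist (linf H) (G \<omega>) w < \<epsilon>/4"
        proof -
          have "mdist (linf H) (G \<omega>) w \<le> mdist (linf H) (G \<omega>) z + mdist (linf H) z w"
            using om w(1) by (intro L.triangle) auto
          moreover have "mdist (linf H) (G \<omega>) z < \<epsilon>/8" using om by (simp add: L.commute)
          moreover have "mdist (linf H) z w < \<epsilon>/8" using w(1) by simp
          ultimately show ?thesis by linarith
        qed
        moreover have "\<bar>G \<omega> f - w f\<bar> \<le> mdist (linf H) (G \<omega>) w" "\<bar>G \<omega> g - w g\<bar> \<le> mdist (linf H) (G \<omega>) w"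
          using linf_coordinate[of "G \<omega>" H w] om w by auto
        ultimately have "\<epsilon>/2 < \<bar>G \<omega> f - G \<omega> g\<bar>" using w(5) by linarith
        then show "m \<le> min 1 \<bar>G \<omega> f - G \<omega> g\<bar>" unfolding m_def by (intro min.mono) auto
      qed
      show "{\<omega>\<in>space M. m \<le> min 1 \<bar>G \<omega> f - G \<omega> g\<bar>} \<in> M.events" by measurable
    qed
    also have "\<dots> \<le> (\<integral>\<omega>. min 1 \<bar>G \<omega> f - G \<omega> g\<bar> \<partial>M) / m"
    proof (rule integral_Markov_inequality_measure[OF _ sets.empty_sets])
      show "integrable M (\<lambda>\<omega>. min 1 \<bar>G \<omega> f - G \<omega> g\<bar>)" by (rule M.integrable_const_bound[of _ 1]) auto
    qed (use m in auto)
    also have "\<dots> \<le> \<delta> / m" using G_diff_mean[OF w(2,3)] w(4) m by (intro divide_right_mono) auto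
    finally show ?thesis .
  qed
  have "{\<omega>\<in>space M. \<exists>(f, g, c)\<in>D. \<epsilon> < \<bar>G \<omega> f - c * G \<omega> g\<bar>}
      \<subseteq> (space M - (G -` K \<inter> space M)) \<union> (\<Union>z\<in>Z'. G -` ?B z \<inter> space M)"
  proof
    fix \<omega> assume om: "\<omega> \<in> {\<omega>\<in>space M. \<exists>(f, g, c)\<in>D. \<epsilon> < \<bar>G \<omega> f - c * G \<omega> g\<bar>}"
    show "\<omega> \<in> (space M - (G -` K \<inter> space M)) \<union> (\<Union>z\<in>Z'. G -` ?B z \<inter> space M)"
    proof (cases "G \<omega> \<in> K")
      case True
      then obtain z where z: "z \<in> Z" "mdist (linf H) z (G \<omega>) < \<epsilon>/8" using KZ(5) by blast
      then have "G \<omega> \<in> ?B z" using KZ(2) G_space[of \<omega>] om by (auto simp: L.in_mball)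
      moreover have "z \<in> Z'" unfolding Z'_def using z(1) calculation om by blast
      ultimately show ?thesis using om by blast
    qed (use om in auto)
  qed
  then have "measure M {\<omega>\<in>space M. \<exists>(f, g, c)\<in>D. \<epsilon> < \<bar>G \<omega> f - c * G \<omega> g\<bar>}
     \<le> measure M ((space M - (G -` K \<inter> space M)) \<union> (\<Union>z\<in>Z'. G -` ?B z \<inter> space M))"
    using Bsets measurable_sets[OF G_measurable KZ(3)] KZ(1)
    by (intro M.finite_measure_mono sets.Un sets.finite_UN) (auto simp: Z'_def)
  also have "\<dots> \<le> measure M (space M - (G -` K \<inter> space M)) + measure M (\<Union>z\<in>Z'. G -` ?B z \<inter> space M)"
    using Bsets measurable_sets[OF G_measurable KZ(3)] KZ(1)
    by (intro measure_Un_le sets.finite_UN) (auto simp: Z'_def)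
  also have "\<dots> \<le> \<eta>/2 + (\<Sum>z\<in>Z'. measure M (G -` ?B z \<inter> space M))"
  proof (rule add_mono)
    show "measure M (space M - (G -` K \<inter> space M)) \<le> \<eta>/2"
      using M.prob_compl[OF measurable_sets[OF G_measurable KZ(3)]] KZ(4) by simp
    show "measure M (\<Union>z\<in>Z'. G -` ?B z \<inter> space M) \<le> (\<Sum>z\<in>Z'. measure M (G -` ?B z \<inter> space M))"
      using Bsets KZ(1) by (intro M.finite_measure_subadditive_finite) (auto simp: Z'_def)
  qed
  also have "(\<Sum>z\<in>Z'. measure M (G -` ?B z \<inter> space M)) \<le> real (card Z') * (\<delta> / m)"
    using sum_bounded_above[OF small] by simp
  also have "\<dots> \<le> (real (card Z) + 1) * (\<delta> / m)"
  proof -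
    have "card Z' \<le> card Z" using KZ(1) by (intro card_mono) (auto simp: Z'_def)
    then show ?thesis using \<delta> m by (intro mult_right_mono) auto
  qed
  also have "\<dots> = \<eta> / 4"
  proof -
    define E where "E = real (card Z) + 1"
    have "E > 0" by (simp add: E_def)
    then show ?thesis using m unfolding \<delta>_def E_def[symmetric] by (simp add: field_simps)
  qed
  finally have "measure M {\<omega>\<in>space M. \<exists>(f, g, c)\<in>D. \<epsilon> < \<bar>G \<omega> f - c * G \<omega> g\<bar>} < \<eta>" using \<eta> by simp
  then show ?thesis using \<delta> unfolding D_def by blast
qed

text \<open>Functions are sorted by the cells of width \<open>\<epsilon>\<close> that contain their
  values under the finitely many net paths. Two functions in the same cells have an increment of at
  most \<open>3 * \<epsilon>\<close> with probability at least 3/4, which is impossible for a normal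
  variable with standard deviation at least \<open>\<delta>\<close>.\<close>

lemma rho_c_totally_bounded:
  assumes \<delta>: "\<delta> > 0"
  shows "\<exists>A. finite A \<and> A \<subseteq> H \<and> (\<forall>f\<in>H. \<exists>g\<in>A. rho_c Q f g < \<delta>)"
proof -
  define \<epsilon> where "\<epsilon> = \<delta> / 10"
  have \<epsilon>: "\<epsilon> > 0" using \<delta> by (simp add: \<epsilon>_def)
  obtain K Z where KZ: "finite Z" "Z \<subseteq> mspace (linf H)" "K \<in> sets (linf_borel H)"
    "measure M (G -` K \<inter> space M) \<ge> 1 - 1/4" "\<And>w. w \<in> K \<Longrightarrow> \<exists>z\<in>Z. mdist (linf H) z w < \<epsilon>"
    by (rule tight_net[of "1/4" \<epsilon>]) (use \<epsilon> in simp_all)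
  define cell where "cell f = (\<lambda>z\<in>Z. \<lfloor>z f / \<epsilon>\<rfloor>)" for f :: "'z \<Rightarrow> real"
  have "\<forall>z\<in>Z. \<exists>B. \<forall>f\<in>H. \<bar>z f\<bar> \<le> B" using KZ(2) linf_mspace_iff by blast
  then obtain B where B: "\<And>z f. z \<in> Z \<Longrightarrow> f \<in> H \<Longrightarrow> \<bar>z f\<bar> \<le> B z" by metis
  have "cell ` H \<subseteq> Z \<rightarrow>\<^sub>E {\<lfloor>- (Max (insert 0 (B ` Z))) / \<epsilon>\<rfloor>..\<lfloor>Max (insert 0 (B ` Z)) / \<epsilon>\<rfloor>}"
  proof (clarsimp simp: cell_def PiE_iff)
    fix f z assume fz: "f \<in> H" "z \<in> Z"
    have "B z \<le> Max (insert 0 (B ` Z))" using KZ(1) fz by (intro Max_ge) auto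
    then have "\<bar>z f\<bar> \<le> Max (insert 0 (B ` Z))" using B[OF fz(2,1)] by linarith
    then show "\<lfloor>- (Max (insert 0 (B ` Z)) / \<epsilon>)\<rfloor> \<le> \<lfloor>z f / \<epsilon>\<rfloor> \<and> \<lfloor>z f / \<epsilon>\<rfloor> \<le> \<lfloor>Max (insert 0 (B ` Z)) / \<epsilon>\<rfloor>"
      using \<epsilon> by (intro conjI floor_mono) (auto simp: field_simps abs_le_iff)
  qed
  then have fin: "finite (cell ` H)"
    by (rule finite_subset) (use KZ(1) in \<open>auto intro: finite_PiE\<close>)
  define rep where "rep v = (SOME f. f \<in> H \<and> cell f = v)" for v
  have rep: "rep (cell f) \<in> H \<and> cell (rep (cell f)) = cell f" if "f \<in> H" for f
    unfolding rep_def by (rule someI[where P="\<lambda>x. x \<in> H \<and> cell x = cell f"]) (use that in auto)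
  have "rho_c Q f g < \<delta>" if fg: "f \<in> H" "g \<in> H" and eq: "cell f = cell g" for f g
  proof (rule ccontr)
    assume "\<not> rho_c Q f g < \<delta>"
    then have r: "rho_c Q f g \<ge> \<delta>" "rho_c Q f g > 0" using \<delta> by auto
    have close: "\<bar>w f - w g\<bar> \<le> 3 * \<epsilon>" if w: "w \<in> K" for w
    proof -
      obtain z where z: "z \<in> Z" "mdist (linf H) z w < \<epsilon>" using KZ(5)[OF w] by blast
      have wm: "w \<in> mspace (linf H)" using w sets.sets_into_space[OF KZ(3)] by (auto simp: space_linf_borel)
      have zm: "z \<in> mspace (linf H)" using z KZ(2) by auto
      have "\<lfloor>z f / \<epsilon>\<rfloor> = \<lfloor>z g / \<epsilon>\<rfloor>" using fun_cong[OF eq, of z] z(1) by (simp add: cell_def)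
      then have "\<bar>z f / \<epsilon> - z g / \<epsilon>\<bar> \<le> 1" by linarith
      then have "\<bar>(z f - z g) / \<epsilon>\<bar> \<le> 1" by (simp add: diff_divide_distrib)
      then have "\<bar>z f - z g\<bar> \<le> \<epsilon>" using \<epsilon> by (simp add: abs_divide)
      moreover have "\<bar>z f - w f\<bar> \<le> mdist (linf H) z w" "\<bar>z g - w g\<bar> \<le> mdist (linf H) z w"
        using linf_coordinate[OF zm wm] fg by auto
      ultimately show ?thesis using z(2) by linarith
    qed
    \<comment> \<open>With \<open>\<epsilon> = \<delta> / 10\<close> the argument of the cosine is
      at most 3/5 on the tight set, where the cosine is at least 3/5; elsewhere it is at least -1.
      This gives the lower bound \<open>(8/5) * (3/4) - 1 = 1/5\<close>, against the upper bound
      \<open>exp (- 2) < 1/5\<close>.\<close>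
    define s where "s = 2 / \<delta>"
    note G_coordinate[OF fg(1), measurable] G_coordinate[OF fg(2), measurable]
    let ?A = "G -` K \<inter> space M"
    have A [measurable]: "?A \<in> sets M" by (rule measurable_sets[OF G_measurable KZ(3)])
    have "(\<integral>\<omega>. (8/5) * indicator ?A \<omega> - 1 \<partial>M) \<le> (\<integral>\<omega>. cos (s * (G \<omega> f - G \<omega> g)) \<partial>M)"
    proof (rule integral_mono)
      show "integrable M (\<lambda>\<omega>. (8/5) * indicator ?A \<omega> - 1 :: real)"
        by (intro Bochner_Integration.integrable_diff integrable_mult_right integrable_real_indicator) (auto simp: M.emeasure_eq_measure)
      show "integrable M (\<lambda>\<omega>. cos (s * (G \<omega> f - G \<omega> g)))"
        by (rule M.integrable_const_bound[of _ 1]) auto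
      fix \<omega> assume "\<omega> \<in> space M"
      show "(8/5) * indicator ?A \<omega> - 1 \<le> cos (s * (G \<omega> f - G \<omega> g))"
      proof (cases "\<omega> \<in> ?A")
        case True
        define x where "x = s * (G \<omega> f - G \<omega> g)"
        have "\<bar>x\<bar> \<le> s * (3 * \<epsilon>)" unfolding x_def abs_mult using close[of "G \<omega>"] True \<delta> by (intro mult_mono) (auto simp: s_def)
        also have "\<dots> = 3/5" using \<delta> by (simp add: s_def \<epsilon>_def)
        finally have "\<bar>x / 2\<bar> \<le> 3/10" by simp
        then have "\<bar>x / 2\<bar>\<^sup>2 \<le> (3/10)\<^sup>2" by (rule power_mono) simp
        then have "(x / 2)\<^sup>2 \<le> (3/10)\<^sup>2" by (simp only: power2_abs)
        moreover have "(sin (x / 2))\<^sup>2 \<le> (x / 2)\<^sup>2"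
          using power_mono[OF abs_sin_x_le_abs_x[of "x / 2"], of 2] by (simp only: power2_abs abs_ge_zero simp_thms)
        moreover have "cos x = 1 - 2 * (sin (x / 2))\<^sup>2" using cos_double_sin[of "x / 2"] by simp
        ultimately have "cos x \<ge> 3/5" by (simp add: power2_eq_square)
        then show ?thesis using True by (simp add: x_def)
      next
        case False
        have i: "indicator ?A \<omega> = (0::real)" using False by (rule indicator_simps(2))
        show ?thesis unfolding i using cos_ge_minus_one[of "s * (G \<omega> f - G \<omega> g)"] by simp
      qed
    qed
    also have "\<dots> = exp (- ((s * rho_c Q f g)\<^sup>2 / 2))" by (rule G_diff_cos[OF fg r(2)])
    also have "\<dots> \<le> exp (- 2)"
    proof -
      have "2 \<le> s * rho_c Q f g" using r(1) \<delta> by (simp add: s_def field_simps)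
      then have "2\<^sup>2 \<le> (s * rho_c Q f g)\<^sup>2" by (intro power_mono) auto
      then show ?thesis by simp
    qed
    also have "\<dots> < 1/5"
    proof -
      have "(5::real) < (1 + 2/4)^4" by (simp add: power4_eq_xxxx)
      also have "\<dots> \<le> exp 2" using exp_ge_one_plus_x_over_n_power_n[of 4 2] by simp
      finally show ?thesis by (simp add: exp_minus field_simps)
    qed
    finally have "(8/5) * measure M ?A - 1 < 1/5"
      by (subst (asm) Bochner_Integration.integral_diff) (auto simp: M.prob_space M.emeasure_eq_measure intro!: integrable_mult_right)
    then show False using KZ(4) by simp
  qed
  then have "\<forall>f\<in>H. \<exists>g\<in>rep ` cell ` H. rho_c Q f g < \<delta>" using rep by (metis imageI)
  moreover have "rep ` cell ` H \<subseteq> H" using rep by auto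
  ultimately show ?thesis using fin by blast
qed

text \<open>The indices with sign plus, or those with sign minus, may be too few for the Donsker
  limit to say anything. Adding the same block of \<open>N\<close> fresh indices to both sets leaves
  the difference of the two sums unchanged and gives each set between \<open>N\<close> and
  \<open>2 * N\<close> elements.\<close>

lemma sign_sums_small:
  assumes \<epsilon>: "\<epsilon> > 0" and \<eta>: "\<eta> > 0" and ne: "H \<noteq> {}"
  shows "\<exists>\<delta>>0. \<exists>N0. \<forall>N\<ge>N0. \<forall>s\<in>cube N. outer_le (iid Q) {z. \<exists>f\<in>H. \<exists>g\<in>H. rho_c Q f g < \<delta> \<and>
      \<epsilon> * sqrt N < \<bar>sgn_sum N s (\<lambda>i. (f (z i) - integral\<^sup>L Q f) - (g (z i) - integral\<^sup>L Q g))\<bar>} \<eta>"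
proof -
  obtain \<delta> where \<delta>: "\<delta> > 0" "measure M {\<omega>\<in>space M. \<exists>(f, g, c)\<in>{(f, g, c). f \<in> H \<and> g \<in> H \<and> c = 1 \<and> rho_c Q f g < \<delta>}.
      \<epsilon>/8 < \<bar>G \<omega> f - c * G \<omega> g\<bar>} < \<eta>/2"
    using G_equicontinuous[of "\<epsilon>/8" "\<eta>/2"] \<epsilon> \<eta> ne by auto
  define D where "D = {(f, g, c). f \<in> H \<and> g \<in> H \<and> c = (1::real) \<and> rho_c Q f g < \<delta>}"
  have D: "D \<noteq> {}" "D \<subseteq> H \<times> H \<times> {0, 1}"
  proof -
    obtain f where "f \<in> H" using ne by auto
    then have "(f, f, 1) \<in> D" using \<delta> by (simp add: D_def rho_c_def)
    then show "D \<noteq> {}" by auto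
  qed (auto simp: D_def)
  define \<Delta> where "\<Delta> C z f g = (\<Sum>i\<in>C. (f (z i) - integral\<^sup>L Q f) - (g (z i) - integral\<^sup>L Q g))" for C :: "nat set" and z and f g :: "'z \<Rightarrow> real"
  obtain N0 where N0: "\<And>C. finite C \<Longrightarrow> card C \<ge> N0 \<Longrightarrow> outer_le (iid Q) {z. \<exists>(f, g, c)\<in>D.
      2 * (\<epsilon>/8) * sqrt (card C) < \<bar>(\<Sum>i\<in>C. f (z i) - integral\<^sup>L Q f) - c * (\<Sum>i\<in>C. g (z i) - integral\<^sup>L Q g)\<bar>} (\<eta>/2)"
    using emp_outer_sum[OF D _ \<delta>(2)[folded D_def]] \<epsilon> by auto
  have N0': "outer_le (iid Q) {z. \<exists>f\<in>H. \<exists>g\<in>H. rho_c Q f g < \<delta> \<and> \<epsilon>/4 * sqrt (card C) < \<bar>\<Delta> C z f g\<bar>} (\<eta>/2)"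
    if "finite C" "card C \<ge> N0" for C
    by (rule outer_le_mono[OF N0[OF that]]) (force simp: D_def \<Delta>_def sum_subtractf)+
  show ?thesis
  proof (intro exI[of _ \<delta>] exI[of _ N0] conjI allI impI ballI \<delta>(1))
    fix N s assume N: "N0 \<le> N" and s: "s \<in> cube N"
    define B where "B = {N..<2*N}"
    define C where "C = {i\<in>{..<N}. s i = 1} \<union> B"
    define C' where "C' = {i\<in>{..<N}. s i = 0} \<union> B"
    have card: "N0 \<le> card X \<and> card X \<le> 2 * N \<and> finite X" if "X = C \<or> X = C'" for X
    proof -
      have "B \<subseteq> X" "X \<subseteq> {..<2*N}" using that by (auto simp: C_def C'_def B_def)
      then have "card B \<le> card X" "card X \<le> card {..<2*N}" "finite X"
        by (auto intro: card_mono finite_subset simp del: card_lessThan)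
      then show ?thesis using N by (simp add: B_def)
    qed
    have split: "sgn_sum N s (\<lambda>i. (f (z i) - integral\<^sup>L Q f) - (g (z i) - integral\<^sup>L Q g)) = \<Delta> C z f g - \<Delta> C' z f g" for z f g
    proof -
      define h where "h i = (f (z i) - integral\<^sup>L Q f) - (g (z i) - integral\<^sup>L Q g)" for i
      have C: "sum h C = sum h {i\<in>{..<N}. s i = 1} + sum h B"
        unfolding C_def by (rule sum.union_disjoint) (auto simp: B_def)
      have C': "sum h C' = sum h {i\<in>{..<N}. s i = 0} + sum h B"
        unfolding C'_def by (rule sum.union_disjoint) (auto simp: B_def)
      have "sgn_sum N s h = (\<Sum>i<N. (if s i = 1 then h i else 0) - (if s i = 0 then h i else 0))"
        unfolding sgn_sum_def by (rule sum.cong) (use cube_values[OF s] in force)+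
      also have "\<dots> = sum h {i\<in>{..<N}. s i = 1} - sum h {i\<in>{..<N}. s i = 0}"
        by (simp add: sum_subtractf sum.inter_filter[symmetric])
      finally show ?thesis unfolding \<Delta>_def h_def[symmetric] using C C' by simp
    qed
    have "outer_le (iid Q) ({z. \<exists>f\<in>H. \<exists>g\<in>H. rho_c Q f g < \<delta> \<and> \<epsilon>/4 * sqrt (card C) < \<bar>\<Delta> C z f g\<bar>}
       \<union> {z. \<exists>f\<in>H. \<exists>g\<in>H. rho_c Q f g < \<delta> \<and> \<epsilon>/4 * sqrt (card C') < \<bar>\<Delta> C' z f g\<bar>}) (\<eta>/2 + \<eta>/2)"
      by (rule outer_le_Un[OF prob_space_iid[OF Q] N0' N0']) (use card in auto)
    then show "outer_le (iid Q) {z. \<exists>f\<in>H. \<exists>g\<in>H. rho_c Q f g < \<delta> \<and>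
      \<epsilon> * sqrt N < \<bar>sgn_sum N s (\<lambda>i. (f (z i) - integral\<^sup>L Q f) - (g (z i) - integral\<^sup>L Q g))\<bar>} \<eta>"
    proof (rule outer_le_mono)
      \<comment> \<open>Each of the two blocks may use half of the threshold
        \<open>\<epsilon> * sqrt N\<close>; \<open>card X \<le> 4 * N\<close> is a convenient
        weakening with a rational square root factor.\<close>
      have sq: "\<epsilon>/4 * sqrt (card X) \<le> \<epsilon>/2 * sqrt N" if "X = C \<or> X = C'" for X
      proof -
        have "sqrt (card X) \<le> sqrt (4 * real N)" using card[OF that] by (intro real_sqrt_le_mono) linarith
        also have "\<dots> = 2 * sqrt N" by (simp add: real_sqrt_mult)
        finally show ?thesis using \<epsilon> by (simp add: field_simps)
      qed
      show "{z. \<exists>f\<in>H. \<exists>g\<in>H. rho_c Q f g < \<delta> \<and>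
         \<epsilon> * sqrt N < \<bar>sgn_sum N s (\<lambda>i. (f (z i) - integral\<^sup>L Q f) - (g (z i) - integral\<^sup>L Q g))\<bar>} \<inter> space (iid Q)
        \<subseteq> {z. \<exists>f\<in>H. \<exists>g\<in>H. rho_c Q f g < \<delta> \<and> \<epsilon>/4 * sqrt (card C) < \<bar>\<Delta> C z f g\<bar>}
         \<union> {z. \<exists>f\<in>H. \<exists>g\<in>H. rho_c Q f g < \<delta> \<and> \<epsilon>/4 * sqrt (card C') < \<bar>\<Delta> C' z f g\<bar>}"
      proof clarify
        fix z f g assume fg: "f \<in> H" "g \<in> H" "rho_c Q f g < \<delta>"
          and big: "\<epsilon> * sqrt N < \<bar>sgn_sum N s (\<lambda>i. (f (z i) - integral\<^sup>L Q f) - (g (z i) - integral\<^sup>L Q g))\<bar>"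
          and no: "\<not> (\<exists>f\<in>H. \<exists>g\<in>H. rho_c Q f g < \<delta> \<and> \<epsilon>/4 * sqrt (card C') < \<bar>\<Delta> C' z f g\<bar>)"
        have "\<bar>\<Delta> C' z f g\<bar> \<le> \<epsilon>/4 * sqrt (card C')" using no fg by (meson not_less)
        then have "\<epsilon>/4 * sqrt (card C) < \<bar>\<Delta> C z f g\<bar>"
          using big sq[of C, OF disjI1[OF refl]] sq[of C', OF disjI2[OF refl]] unfolding split by linarith
        then show "\<exists>f\<in>H. \<exists>g\<in>H. rho_c Q f g < \<delta> \<and> \<epsilon>/4 * sqrt (card C) < \<bar>\<Delta> C z f g\<bar>" using fg by blast
      qed
    qed simp
  qed
qed

lemma sums_bounded:
  assumes \<eta>: "\<eta> > 0" and ne: "H \<noteq> {}"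
  shows "\<exists>R>0. \<exists>N0. \<forall>N\<ge>N0. outer_le (iid Q) {z. \<exists>f\<in>H. R * sqrt N < \<bar>\<Sum>i<N. f (z i) - integral\<^sup>L Q f\<bar>} \<eta>"
proof -
  let ?D = "H \<times> H \<times> {0::real}"
  have D: "?D \<noteq> {}" "?D \<subseteq> H \<times> H \<times> {0, 1}" using ne by auto
  obtain R where R: "R > 0" "measure M {\<omega>\<in>space M. \<exists>(f, g, c)\<in>?D. R < \<bar>G \<omega> f - c * G \<omega> g\<bar>} < \<eta>"
    using G_bounded[OF \<eta> ne] by blast
  obtain N0 where N0: "\<And>C. finite C \<Longrightarrow> card C \<ge> N0 \<Longrightarrow> outer_le (iid Q) {z. \<exists>(f, g, c)\<in>?D.
      2 * R * sqrt (card C) < \<bar>(\<Sum>i\<in>C. f (z i) - integral\<^sup>L Q f) - c * (\<Sum>i\<in>C. g (z i) - integral\<^sup>L Q g)\<bar>} \<eta>"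
    using emp_outer_sum[OF D R] by auto
  show ?thesis
  proof (intro exI[of _ "2 * R"] exI[of _ N0] conjI allI impI)
    fix N assume "N0 \<le> N"
    then show "outer_le (iid Q) {z. \<exists>f\<in>H. 2 * R * sqrt N < \<bar>\<Sum>i<N. f (z i) - integral\<^sup>L Q f\<bar>} \<eta>"
      by (intro outer_le_mono[OF N0[of "{..<N}"]]) auto
  qed (use R in simp)
qed

end

subsection \<open>Gaussian sequences with a given covariance\<close>

definition psd_kernel :: "(nat \<Rightarrow> nat \<Rightarrow> real) \<Rightarrow> bool" where
  "psd_kernel K \<longleftrightarrow> (\<forall>i j. K i j = K j i) \<and>
     (\<forall>A a. finite A \<longrightarrow> 0 \<le> (\<Sum>i\<in>A. \<Sum>j\<in>A. a i * a j * K i j))"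

text \<open>Successive Schur complements: the covariance that remains after the first
  \<open>m\<close> variables are regressed out. If the pivot is 0, the division gives 0 and the
  kernel is left unchanged.\<close>

fun schur :: "(nat \<Rightarrow> nat \<Rightarrow> real) \<Rightarrow> nat \<Rightarrow> nat \<Rightarrow> nat \<Rightarrow> real" where
  "schur K 0 = K"
| "schur K (Suc m) = (\<lambda>i j. schur K m i j - schur K m i m * schur K m m j / schur K m m m)"

lemma psd_kernelD: "psd_kernel K \<Longrightarrow> finite A \<Longrightarrow> 0 \<le> (\<Sum>i\<in>A. \<Sum>j\<in>A. a i * a j * K i j)"
  unfolding psd_kernel_def by blast

lemma psd_kernel_sym: "psd_kernel K \<Longrightarrow> K i j = K j i"
  unfolding psd_kernel_def by blast

lemma psd_kernel_diag: "psd_kernel K \<Longrightarrow> 0 \<le> K i i"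
  using psd_kernelD[of K "{i}" "\<lambda>_. 1"] by simp

text \<open>With a zero diagonal entry the quadratic form is affine in the coefficient
  \<open>t\<close>, so a nonzero entry in the row would make it negative. This is why a zero pivot
  can be skipped.\<close>

lemma psd_kernel_row:
  assumes K: "psd_kernel K" and 0: "K m m = 0"
  shows "K i m = 0"
proof (cases "i = m")
  case False
  have q: "0 \<le> K i i + 2 * t * K i m" for t
  proof -
    have "0 \<le> (\<Sum>k\<in>{i,m}. \<Sum>j\<in>{i,m}. (if k = m then t else 1) * (if j = m then t else 1) * K k j)"
      by (rule psd_kernelD[OF K]) simp
    also have "\<dots> = K i i + 2 * t * K i m"
      using False 0 psd_kernel_sym[OF K, of m i] by simp
    finally show ?thesis .
  qed
  show ?thesis
  proof (rule ccontr)
    assume ne: "K i m \<noteq> 0"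
    then have "2 * (- (K i i + 1) / (2 * K i m)) * K i m = - (K i i + 1)" by (simp add: field_simps)
    then show False using q[of "- (K i i + 1) / (2 * K i m)"] by simp
  qed
qed (simp add: 0)

text \<open>Completing the square: the quadratic form of the Schur complement is the minimum of the
  old form over the coefficient of variable \<open>m\<close>.\<close>

lemma psd_kernel_schur: "psd_kernel K \<Longrightarrow> psd_kernel (schur K m)"
proof (induction m)
  case (Suc m)
  define S where "S = schur K m"
  have S: "psd_kernel S" using Suc by (simp add: S_def)
  then have sym: "S i j = S j i" for i j by (rule psd_kernel_sym)
  have "0 \<le> (\<Sum>i\<in>A. \<Sum>j\<in>A. a i * a j * (S i j - S i m * S m j / S m m))" if A: "finite A" for A a
  proof (cases "S m m = 0")
    case True
    then show ?thesis using psd_kernelD[OF S A, of a] by simp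
  next
    case False
    then have pos: "S m m > 0" using psd_kernel_diag[OF S, of m] by simp
    define L where "L = (\<Sum>i\<in>A. a i * S i m)"
    \<comment> \<open>The minimizing change of the coefficient at \<open>m\<close>.\<close>
    define t where "t = - L / S m m"
    \<comment> \<open>The change is added to the coefficient at \<open>m\<close>, which need not be
      0 because \<open>m\<close> may belong to \<open>A\<close>.\<close>
    define b where "b i = (if i \<in> A then a i else 0) + (if i = m then t else 0)" for i
    let ?B = "insert m A"
    have fB: "finite ?B" using A by simp
    have s1: "(\<Sum>i\<in>?B. (if i \<in> A then a i else 0) * u i) = (\<Sum>i\<in>A. a i * u i)" for u
      using A by (intro sum.mono_neutral_cong_right) auto
    have s2: "(\<Sum>i\<in>?B. (if i = m then t else 0) * u i) = t * u m" for u
      using A by (subst sum.remove[of _ m]) (auto intro!: sum.neutral)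
    have s: "(\<Sum>i\<in>?B. b i * u i) = (\<Sum>i\<in>A. a i * u i) + t * u m" for u
      unfolding b_def distrib_right sum.distrib s1 s2 ..
    have "0 \<le> (\<Sum>i\<in>?B. \<Sum>j\<in>?B. b i * b j * S i j)"
      by (rule psd_kernelD[OF S fB])
    also have "\<dots> = (\<Sum>i\<in>?B. b i * (\<Sum>j\<in>?B. b j * S i j))"
      by (simp only: sum_distrib_left mult.assoc)
    also have "\<dots> = (\<Sum>i\<in>?B. b i * ((\<Sum>j\<in>A. a j * S i j) + t * S i m))"
      unfolding s ..
    also have "\<dots> = (\<Sum>i\<in>A. a i * ((\<Sum>j\<in>A. a j * S i j) + t * S i m)) + t * ((\<Sum>j\<in>A. a j * S m j) + t * S m m)"
      unfolding s ..
    also have "(\<Sum>j\<in>A. a j * S m j) = L" unfolding L_def by (simp add: sym)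
    also have "(\<Sum>i\<in>A. a i * ((\<Sum>j\<in>A. a j * S i j) + t * S i m)) = (\<Sum>i\<in>A. \<Sum>j\<in>A. a i * a j * S i j) + t * L"
      unfolding L_def by (simp add: distrib_left sum.distrib sum_distrib_left mult.assoc mult.left_commute)
    also have "(\<Sum>i\<in>A. \<Sum>j\<in>A. a i * a j * S i j) + t * L + t * (L + t * S m m) =
        (\<Sum>i\<in>A. \<Sum>j\<in>A. a i * a j * S i j) - L * L / S m m"
      using pos by (simp add: t_def field_simps)
    also have "L * L / S m m = (\<Sum>i\<in>A. \<Sum>j\<in>A. a i * a j * (S i m * S m j / S m m))"
    proof -
      have "L * L / S m m = (\<Sum>i\<in>A. \<Sum>j\<in>A. (a i * S i m) * (a j * S j m)) / S m m"
        unfolding L_def sum_product ..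
      also have "\<dots> = (\<Sum>i\<in>A. \<Sum>j\<in>A. a i * a j * (S i m * S m j / S m m))"
        unfolding sum_divide_distrib
      proof (intro sum.cong refl)
        fix i j
        have "S m j = S j m" by (rule sym)
        then show "a i * S i m * (a j * S j m) / S m m = a i * a j * (S i m * S m j / S m m)" by simp
      qed
      finally show ?thesis .
    qed
    finally show ?thesis by (simp add: right_diff_distrib sum_subtractf)
  qed
  moreover have "S i j - S i m * S m j / S m m = S j i - S j m * S m i / S m m" for i j
    using sym[of i j] sym[of i m] sym[of j m] by simp
  ultimately show ?case unfolding psd_kernel_def schur.simps S_def[symmetric] by blast
qed simp

lemma schur_zero:
  assumes K: "psd_kernel K" and j: "j < m"
  shows "schur K m i j = 0"
  using j
proof (induction m arbitrary: i)
  case (Suc m)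
  note S = psd_kernel_schur[OF K, of m]
  show ?case
  proof (cases "j = m")
    case True
    then show ?thesis using psd_kernel_row[OF S, of m i] by (cases "schur K m m m = 0") auto
  next
    case False
    then show ?thesis using Suc by simp
  qed
qed simp

text \<open>The Cholesky factor for semidefinite kernels: a zero pivot yields a zero column, again
  because division by 0 gives 0.\<close>

definition chol :: "(nat \<Rightarrow> nat \<Rightarrow> real) \<Rightarrow> nat \<Rightarrow> nat \<Rightarrow> real" where
  "chol K i m = schur K m i m / sqrt (schur K m m m)"

text \<open>The products of column entries are the differences of consecutive Schur complements, so
  the sum telescopes; row \<open>i\<close> of the complement is exhausted after \<open>n > i\<close>
  steps.\<close>

lemma chol_factorization:
  assumes K: "psd_kernel K" and i: "i < n"
  shows "(\<Sum>m<n. chol K i m * chol K j m) = K i j"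
proof -
  have "chol K i m * chol K j m = schur K m i j - schur K (Suc m) i j" for m
  proof -
    note S = psd_kernel_schur[OF K, of m]
    have "chol K i m * chol K j m = schur K m i m * schur K m j m / schur K m m m"
      using psd_kernel_diag[OF S, of m] by (simp add: chol_def)
    also have "schur K m j m = schur K m m j" by (rule psd_kernel_sym[OF S])
    finally show ?thesis by simp
  qed
  then have "(\<Sum>m<n. chol K i m * chol K j m) = (\<Sum>m<n. schur K m i j - schur K (Suc m) i j)" by simp
  also have "\<dots> = schur K 0 i j - schur K n i j" by (rule sum_lessThan_telescope')
  also have "schur K n i j = schur K n j i" by (rule psd_kernel_sym[OF psd_kernel_schur[OF K]])
  also have "\<dots> = 0" by (rule schur_zero[OF K i])
  finally show ?thesis by simp
qed

lemma chol_zero: "psd_kernel K \<Longrightarrow> i < m \<Longrightarrow> chol K i m = 0"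
proof -
  assume K: "psd_kernel K" and "i < m"
  then have "schur K m m i = 0" by (intro schur_zero[OF K])
  then have "schur K m i m = 0" using psd_kernel_sym[OF psd_kernel_schur[OF K, of m], of i m] by simp
  then show ?thesis by (simp add: chol_def)
qed

lemma cos_normal_of_char:
  assumes M: "prob_space M" and X [measurable]: "X \<in> borel_measurable M" and v: "v \<ge> 0"
    and ch: "\<And>t. char (distr M borel X) t = complex_of_real (exp (- (t\<^sup>2 * v / 2)))"
  shows "cos_normal M X v"
  unfolding cos_normal_def
proof (intro conjI allI X v)
  interpret prob_space M by (rule M)
  fix t b
  have eq: "complex_of_real (\<integral>\<omega>. cos (t * X \<omega>) \<partial>M) + \<i> * complex_of_real (\<integral>\<omega>. cos (t * X \<omega> + - (pi/2)) \<partial>M)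
      = complex_of_real (exp (- (t\<^sup>2 * v / 2)))"
    using ch[of t] char_eq_cos[OF M X, of t] by simp
  have C: "(\<integral>\<omega>. cos (t * X \<omega>) \<partial>M) = exp (- (t\<^sup>2 * v / 2))" using arg_cong[OF eq, of Re] by simp
  have S: "(\<integral>\<omega>. sin (t * X \<omega>) \<partial>M) = 0" using arg_cong[OF eq, of Im] by (simp add: cos_diff)
  have "(\<integral>\<omega>. cos (t * X \<omega> + b) \<partial>M) = (\<integral>\<omega>. cos (t * X \<omega>) * cos b - sin (t * X \<omega>) * sin b \<partial>M)"
    by (simp add: cos_add)
  also have "\<dots> = (\<integral>\<omega>. cos (t * X \<omega>) \<partial>M) * cos b - (\<integral>\<omega>. sin (t * X \<omega>) \<partial>M) * sin b"
    by (subst Bochner_Integration.integral_diff) (auto intro!: integrable_mult_left integrable_const_bound[of _ 1])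
  finally show "(\<integral>\<omega>. cos (t * X \<omega> + b) \<partial>M) = exp (- (t\<^sup>2 * v / 2)) * cos b" using C S by simp
qed

abbreviation normals :: "(nat \<Rightarrow> real) measure" where
  "normals \<equiv> iid std_normal_distribution"

lemma prob_std_normal: "prob_space std_normal_distribution"
  by (rule prob_space_normal_density) simp

lemma cos_normal_normals:
  "cos_normal normals (\<lambda>\<omega>. \<Sum>m<n. b m * \<omega> m) (\<Sum>m<n. (b m)\<^sup>2)"
proof (rule cos_normal_of_char)
  note N = prob_std_normal
  interpret I: prob_space normals by (rule prob_space_iid[OF N])
  show "prob_space normals" by (rule prob_space_iid[OF N])
  show "(\<lambda>\<omega>. \<Sum>m<n. b m * \<omega> m) \<in> borel_measurable normals"
  proof -
    have "I.indep_vars (\<lambda>_. borel) (\<lambda>m \<omega>. \<omega> m) UNIV"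
      using indep_vars_iid_compose[OF N, of "\<lambda>x. x"] by simp
    then have [measurable]: "(\<lambda>\<omega>. \<omega> m) \<in> borel_measurable normals" for m
      unfolding I.indep_vars_def2 by auto
    show ?thesis by measurable
  qed
  show "0 \<le> (\<Sum>m<n. (b m)\<^sup>2)" by (intro sum_nonneg) auto
  fix t
  have ind: "I.indep_vars (\<lambda>_. borel) (\<lambda>m \<omega>. b m * \<omega> m) {..<n}"
  proof -
    have "I.indep_vars (\<lambda>_. borel) (\<lambda>m \<omega>. \<omega> m) UNIV"
      using indep_vars_iid_compose[OF N, of "\<lambda>x. x"] by simp
    then have "I.indep_vars (\<lambda>_. borel) (\<lambda>m \<omega>. (\<lambda>x. b m * x) (\<omega> m)) UNIV"
      by (rule I.indep_vars_compose2) auto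
    then show ?thesis by (rule I.indep_vars_subset) auto
  qed
  have "char (distr normals borel (\<lambda>\<omega>. \<Sum>m<n. b m * \<omega> m)) t = (\<Prod>m<n. char (distr normals borel (\<lambda>\<omega>. b m * \<omega> m)) t)"
    by (rule I.char_distr_sum[OF ind])
  also have "\<dots> = (\<Prod>m<n. complex_of_real (exp (- (t * b m)\<^sup>2 / 2)))"
  proof (rule prod.cong[OF refl])
    fix m
    have "distr normals borel (\<lambda>\<omega>. b m * \<omega> m) = distr std_normal_distribution borel (\<lambda>x. b m * x)"
      by (rule distr_iid_compose[OF N, of "\<lambda>x. b m * x"]) simp
    then have "char (distr normals borel (\<lambda>\<omega>. b m * \<omega> m)) t = char std_normal_distribution (t * b m)"
      by (simp add: char_def integral_distr mult.assoc)
    then show "char (distr normals borel (\<lambda>\<omega>. b m * \<omega> m)) t = complex_of_real (exp (- (t * b m)\<^sup>2 / 2))"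
      by (simp add: char_std_normal_distribution)
  qed
  also have "\<dots> = complex_of_real (exp (\<Sum>m<n. - (t * b m)\<^sup>2 / 2))"
    by (simp add: exp_sum)
  also have "(\<Sum>m<n. - (t * b m)\<^sup>2 / 2) = - (t\<^sup>2 * (\<Sum>m<n. (b m)\<^sup>2) / 2)"
    by (simp add: sum_divide_distrib sum_negf sum_distrib_left power_mult_distrib)
  finally show "char (distr normals borel (\<lambda>\<omega>. \<Sum>m<n. b m * \<omega> m)) t = complex_of_real (exp (- (t\<^sup>2 * (\<Sum>m<n. (b m)\<^sup>2) / 2)))" .
qed

text \<open>The factor is lower triangular, so every coordinate is a finite combination of the same
  independent normals, and all coordinates live on one probability space.\<close>

lemma gaussian_sequence:
  assumes K: "psd_kernel K"
  defines "X \<equiv> \<lambda>j (\<omega>::nat \<Rightarrow> real). \<Sum>m<Suc j. chol K j m * \<omega> m"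
  shows "cos_normal normals (\<lambda>\<omega>. \<Sum>j<k. a j * X j \<omega>) (\<Sum>i<k. \<Sum>j<k. a i * a j * K i j)"
proof -
  define b where "b m = (\<Sum>j<k. a j * chol K j m)" for m
  have X: "X j \<omega> = (\<Sum>m<k. chol K j m * \<omega> m)" if "j < k" for j \<omega>
    unfolding X_def using that chol_zero[OF K]
    by (intro sum.mono_neutral_left) auto
  have "(\<lambda>\<omega>. \<Sum>j<k. a j * X j \<omega>) = (\<lambda>\<omega>. \<Sum>m<k. b m * \<omega> m)"
  proof
    fix \<omega> :: "nat \<Rightarrow> real"
    have "(\<Sum>j<k. a j * X j \<omega>) = (\<Sum>j<k. \<Sum>m<k. a j * chol K j m * \<omega> m)"
      by (intro sum.cong) (auto simp: X sum_distrib_left mult.assoc)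
    also have "\<dots> = (\<Sum>m<k. \<Sum>j<k. a j * chol K j m * \<omega> m)" by (rule sum.swap)
    also have "\<dots> = (\<Sum>m<k. b m * \<omega> m)" by (simp add: b_def sum_distrib_right)
    finally show "(\<Sum>j<k. a j * X j \<omega>) = (\<Sum>m<k. b m * \<omega> m)" .
  qed
  moreover have "(\<Sum>m<k. (b m)\<^sup>2) = (\<Sum>i<k. \<Sum>j<k. a i * a j * K i j)"
  proof -
    have "(\<Sum>m<k. (b m)\<^sup>2) = (\<Sum>m<k. \<Sum>i<k. \<Sum>j<k. a i * a j * (chol K i m * chol K j m))"
      by (simp add: b_def power2_eq_square sum_product mult_ac)
    also have "\<dots> = (\<Sum>i<k. \<Sum>j<k. \<Sum>m<k. a i * a j * (chol K i m * chol K j m))"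
      by (subst sum.swap) (intro sum.cong refl sum.swap)
    also have "\<dots> = (\<Sum>i<k. \<Sum>j<k. a i * a j * K i j)"
      unfolding sum_distrib_left[symmetric] by (intro sum.cong refl) (simp add: chol_factorization[OF K])
    finally show ?thesis .
  qed
  ultimately show ?thesis using cos_normal_normals[where n=k and b=b] by simp
qed

subsection \<open>Extension to a totally bounded index set\<close>

lemma floor_divide_eq_imp_close:
  assumes "\<lfloor>a / q\<rfloor> = \<lfloor>b / q\<rfloor>" "q > (0::real)"
  shows "\<bar>a - b\<bar> \<le> q"
proof -
  have "\<bar>a / q - b / q\<bar> \<le> 1" using assms(1) by linarith
  then have "\<bar>(a - b) / q\<bar> \<le> 1" by (simp add: diff_divide_distrib)
  then show ?thesis using assms(2) by (simp add: abs_divide)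
qed

definition rate :: "nat \<Rightarrow> real" where
  "rate m = 1 / real (Suc m)"

lemma rate_pos [simp]: "rate m > 0"
  by (simp add: rate_def)

lemma eventually_rate_less: "\<delta> > 0 \<Longrightarrow> \<exists>m0. \<forall>m\<ge>m0. rate m < \<delta>"
proof -
  assume "\<delta> > 0"
  then obtain q :: nat where q: "1 / real (Suc q) < \<delta>" using nat_approx_posE by blast
  have "rate m < \<delta>" if "m \<ge> q" for m
  proof -
    have "1 / real (Suc m) \<le> 1 / real (Suc q)" using that by (intro divide_left_mono) auto
    then show ?thesis unfolding rate_def using q by linarith
  qed
  then show ?thesis by blast
qed

lemma rate_approx: "\<delta> > 0 \<Longrightarrow> \<exists>q. rate q < \<delta>"
  using eventually_rate_less by blast

text \<open>The union of finite nets is enumerated as one sequence. The bound \<open>J m\<close>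
  records that level \<open>m\<close> uses finitely many terms, so approximations at a level are
  finite-dimensional.\<close>

lemma net_sequence:
  fixes F :: "'a set" and \<rho> :: "'a \<Rightarrow> 'a \<Rightarrow> real"
  assumes ne: "F \<noteq> {}" and tb: "\<And>\<delta>. \<delta> > 0 \<Longrightarrow> \<exists>A. finite A \<and> A \<subseteq> F \<and> (\<forall>f\<in>F. \<exists>g\<in>A. \<rho> f g < \<delta>)"
  obtains t :: "nat \<Rightarrow> 'a" and idx :: "nat \<Rightarrow> 'a \<Rightarrow> nat" and J :: "nat \<Rightarrow> nat" where
    "\<And>j. t j \<in> F" "\<And>m f. f \<in> F \<Longrightarrow> idx m f < J m \<and> \<rho> f (t (idx m f)) < rate m"
proof -
  have "\<forall>m. \<exists>A. finite A \<and> A \<subseteq> F \<and> (\<forall>f\<in>F. \<exists>g\<in>A. \<rho> f g < rate m)"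
    by (intro allI tb) simp
  then obtain A where A: "\<And>m. finite (A m)" "\<And>m. A m \<subseteq> F" "\<And>m f. f \<in> F \<Longrightarrow> \<exists>g\<in>A m. \<rho> f g < rate m"
    by metis
  let ?T = "\<Union>m. A m"
  have cT: "countable ?T" using A(1) by (auto intro: countable_finite)
  have neT: "?T \<noteq> {}" using ne A(3) by blast
  define t where "t = from_nat_into ?T"
  have tT: "t j \<in> ?T" for j unfolding t_def by (rule from_nat_into[OF neT])
  have surj: "\<exists>j. t j = g" if "g \<in> ?T" for g
    unfolding t_def using from_nat_into_surj[OF cT that] by blast
  define ix where "ix g = (SOME j. t j = g)" for g
  have ix: "t (ix g) = g" if "g \<in> ?T" for g unfolding ix_def by (rule someI_ex[OF surj[OF that]])
  define J where "J m = Suc (Max (insert 0 (ix ` A m)))" for m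
  have "\<forall>m f. \<exists>g. f \<in> F \<longrightarrow> g \<in> A m \<and> \<rho> f g < rate m" using A(3) by blast
  then obtain nn where nn: "\<And>m f. f \<in> F \<Longrightarrow> nn m f \<in> A m \<and> \<rho> f (nn m f) < rate m" by metis
  show thesis
  proof (rule that[of t "\<lambda>m f. ix (nn m f)" J])
    show "t j \<in> F" for j using tT[of j] A(2) by blast
    fix m f assume f: "f \<in> F"
    have "ix (nn m f) \<le> Max (insert 0 (ix ` A m))" using nn[OF f, of m] A(1) by (intro Max_ge) auto
    moreover have "t (ix (nn m f)) = nn m f" using nn[OF f, of m] by (intro ix) blast
    ultimately show "ix (nn m f) < J m \<and> \<rho> f (t (ix (nn m f))) < rate m"
      using nn[OF f, of m] by (simp add: J_def)
  qed
qed

text \<open>The triangle inequality is asked for up to a factor 2 only, as for the square root of a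
  sum of squared increments. Equicontinuity concerns finitely many coordinates at a time, where the
  events are measurable, but \<open>\<delta>\<close> is uniform in their number.\<close>

locale path_extension = prob_space M for M :: "'w measure" +
  fixes F :: "'a set" and \<rho> :: "'a \<Rightarrow> 'a \<Rightarrow> real" and t :: "nat \<Rightarrow> 'a" and idx :: "nat \<Rightarrow> 'a \<Rightarrow> nat"
    and J :: "nat \<Rightarrow> nat" and X :: "nat \<Rightarrow> 'w \<Rightarrow> real"
  assumes F_ne: "F \<noteq> {}"
    and rho_nonneg: "\<And>f g. f \<in> F \<Longrightarrow> g \<in> F \<Longrightarrow> 0 \<le> \<rho> f g"
    and rho_sym: "\<And>f g. f \<in> F \<Longrightarrow> g \<in> F \<Longrightarrow> \<rho> f g = \<rho> g f"
    and rho_tri: "\<And>f g h. f \<in> F \<Longrightarrow> g \<in> F \<Longrightarrow> h \<in> F \<Longrightarrow> \<rho> f h \<le> 2 * (\<rho> f g + \<rho> g h)"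
    and tF: "\<And>j. t j \<in> F"
    and idx: "\<And>m f. f \<in> F \<Longrightarrow> idx m f < J m" "\<And>m f. f \<in> F \<Longrightarrow> \<rho> f (t (idx m f)) < rate m"
    and X [measurable]: "\<And>j. X j \<in> borel_measurable M"
    and equi: "\<And>\<epsilon> \<eta>. \<epsilon> > 0 \<Longrightarrow> \<eta> > 0 \<Longrightarrow> \<exists>\<delta>>0. \<forall>n. prob {\<omega>\<in>space M. \<exists>j<n. \<exists>k<n. \<rho> (t j) (t k) < \<delta> \<and> \<epsilon> < \<bar>X j \<omega> - X k \<omega>\<bar>} \<le> \<eta>"
begin

definition osc :: "real \<Rightarrow> real \<Rightarrow> 'w set" where
  "osc \<delta> \<epsilon> = {\<omega>\<in>space M. \<exists>j k. \<rho> (t j) (t k) < \<delta> \<and> \<epsilon> < \<bar>X j \<omega> - X k \<omega>\<bar>}"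

lemma osc_sets [measurable]: "osc \<delta> \<epsilon> \<in> sets M"
  unfolding osc_def by measurable

lemma osc_mono: "\<delta> \<le> \<delta>' \<Longrightarrow> \<epsilon>' \<le> \<epsilon> \<Longrightarrow> osc \<delta> \<epsilon> \<subseteq> osc \<delta>' \<epsilon>'"
  unfolding osc_def by (auto, meson order.strict_trans2 le_less_trans)

lemma osc_small:
  assumes "\<epsilon> > 0" "\<eta> > 0"
  shows "\<exists>\<delta>>0. prob (osc \<delta> \<epsilon>) \<le> \<eta>"
proof -
  obtain \<delta> where \<delta>: "\<delta> > 0" "\<And>n. prob {\<omega>\<in>space M. \<exists>j<n. \<exists>k<n. \<rho> (t j) (t k) < \<delta> \<and> \<epsilon> < \<bar>X j \<omega> - X k \<omega>\<bar>} \<le> \<eta>"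
    using equi[OF assms] by blast
  let ?A = "\<lambda>n::nat. {\<omega>\<in>space M. \<exists>j<n. \<exists>k<n. \<rho> (t j) (t k) < \<delta> \<and> \<epsilon> < \<bar>X j \<omega> - X k \<omega>\<bar>}"
  have "(\<lambda>n. prob (?A n)) \<longlonglongrightarrow> prob (\<Union>n. ?A n)"
  proof (rule finite_Lim_measure_incseq)
    show "range ?A \<subseteq> sets M" by auto
    show "incseq ?A" unfolding incseq_def
    proof (intro allI impI)
      fix m n :: nat assume "m \<le> n"
      then have "j < n" if "j < m" for j using that by simp
      then show "?A m \<subseteq> ?A n" by blast
    qed
  qed
  moreover have "(\<Union>n. ?A n) = osc \<delta> \<epsilon>"
  proof -
    have "\<omega> \<in> (\<Union>n. ?A n)" if w: "\<omega> \<in> osc \<delta> \<epsilon>" for \<omega>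
    proof -
      obtain j k where "\<rho> (t j) (t k) < \<delta>" "\<epsilon> < \<bar>X j \<omega> - X k \<omega>\<bar>" "\<omega> \<in> space M" using w unfolding osc_def by blast
      moreover have "j < Suc (max j k)" "k < Suc (max j k)" by simp_all
      ultimately have "\<omega> \<in> ?A (Suc (max j k))" by blast
      then show ?thesis by blast
    qed
    then have "osc \<delta> \<epsilon> \<subseteq> (\<Union>n. ?A n)" by blast
    moreover have "(\<Union>n. ?A n) \<subseteq> osc \<delta> \<epsilon>" unfolding osc_def by blast
    ultimately show ?thesis by blast
  qed
  ultimately have "(\<lambda>n. prob (?A n)) \<longlonglongrightarrow> prob (osc \<delta> \<epsilon>)" by simp
  then have "prob (osc \<delta> \<epsilon>) \<le> \<eta>" by (rule LIMSEQ_le_const2) (use \<delta>(2) in blast)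
  then show ?thesis using \<delta>(1) by blast
qed

text \<open>Uniform continuity along the dense sequence, quantified over countably many levels so
  that the set is measurable.\<close>

definition good :: "'w set" where
  "good = {\<omega>\<in>space M. \<forall>p::nat. \<exists>q::nat. \<omega> \<notin> osc (rate q) (rate p)}"

lemma good_sets [measurable]: "good \<in> sets M"
  unfolding good_def by measurable

lemma AE_good: "AE \<omega> in M. \<omega> \<in> good"
proof -
  have "AE \<omega> in M. \<exists>q::nat. \<omega> \<notin> osc (rate q) (rate p)" for p :: nat
  proof -
    let ?B = "{\<omega>\<in>space M. \<forall>q::nat. \<omega> \<in> osc (rate q) (rate p)}"
    have "prob ?B \<le> \<eta>" if \<eta>: "\<eta> > 0" for \<eta>
    proof -
      obtain \<delta> where \<delta>: "\<delta> > 0" "prob (osc \<delta> (rate p)) \<le> \<eta>" using osc_small[OF _ \<eta>, of "rate p"] by (auto simp del: of_nat_Suc)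
      obtain q :: nat where q: "rate q < \<delta>" using rate_approx[OF \<delta>(1)] by blast
      have "osc (rate q) (rate p) \<subseteq> osc \<delta> (rate p)"
        by (rule osc_mono) (use q in simp_all)
      then have "?B \<subseteq> osc \<delta> (rate p)" by blast
      then have "prob ?B \<le> prob (osc \<delta> (rate p))" by (intro finite_measure_mono) auto
      then show ?thesis using \<delta>(2) by linarith
    qed
    then have "prob ?B \<le> 0" by (rule field_le_epsilon[of _ 0, simplified])
    then have "prob ?B = 0" using measure_nonneg[of M ?B] by linarith
    moreover have "?B \<in> sets M" by measurable
    ultimately have "?B \<in> null_sets M" by (simp add: null_sets_def emeasure_eq_measure)
    then show ?thesis by (rule AE_I') auto
  qed
  then have "AE \<omega> in M. \<forall>p::nat. \<exists>q::nat. \<omega> \<notin> osc (rate q) (rate p)"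
    by (simp add: AE_all_countable)
  then show ?thesis using AE_space by eventually_elim (simp add: good_def)
qed

lemma good_osc:
  assumes "\<omega> \<in> good" "\<epsilon> > 0"
  shows "\<exists>\<delta>>0. \<omega> \<notin> osc \<delta> \<epsilon>"
proof -
  obtain p :: nat where p: "rate p < \<epsilon>" using rate_approx[OF assms(2)] by blast
  obtain q :: nat where "\<omega> \<notin> osc (rate q) (rate p)" using assms(1) unfolding good_def by blast
  then have "\<omega> \<notin> osc (rate q) \<epsilon>" using osc_mono[of "rate q" "rate q" "rate p" \<epsilon>] p by auto
  then show ?thesis by (intro exI[of _ "rate q"]) auto
qed

lemma not_osc: "\<omega> \<in> space M \<Longrightarrow> \<omega> \<notin> osc \<delta> \<epsilon> \<Longrightarrow> \<rho> (t j) (t k) < \<delta> \<Longrightarrow> \<bar>X j \<omega> - X k \<omega>\<bar> \<le> \<epsilon>"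
  by (force simp: osc_def)

lemma good_space: "\<omega> \<in> good \<Longrightarrow> \<omega> \<in> space M"
  by (simp add: good_def)

text \<open>Extension by uniform continuity from the dense sequence. The zero path off the good set
  keeps every path bounded and uniformly continuous.\<close>

definition G :: "'w \<Rightarrow> 'a \<Rightarrow> real" where
  "G \<omega> = (if \<omega> \<in> good then (\<lambda>f\<in>F. lim (\<lambda>m. X (idx m f) \<omega>)) else (\<lambda>f\<in>F. 0))"

text \<open>Two uses of the quasi-triangle inequality add up to \<open>7 * \<delta> / 12\<close> at
  most: \<open>2 * (\<delta> / 24)\<close> from the first approximation and
  \<open>4 * (\<delta> / 12 + \<delta> / 24)\<close> from the rest.\<close>

lemma rho_idx:
  assumes f: "f \<in> F" and g: "g \<in> F" and "\<rho> f g < \<delta> / 12" "rate m < \<delta> / 24" "rate n < \<delta> / 24"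
  shows "\<rho> (t (idx m f)) (t (idx n g)) < \<delta>"
proof -
  have "\<rho> (t (idx m f)) (t (idx n g)) \<le> 2 * (\<rho> (t (idx m f)) f + \<rho> f (t (idx n g)))"
    by (rule rho_tri) (use f tF in auto)
  moreover have "\<rho> f (t (idx n g)) \<le> 2 * (\<rho> f g + \<rho> g (t (idx n g)))"
    by (rule rho_tri) (use f g tF in auto)
  moreover have "\<rho> (t (idx m f)) f = \<rho> f (t (idx m f))" by (rule rho_sym) (use f tF in auto)
  ultimately show ?thesis using idx(2)[OF f, of m] idx(2)[OF g, of n] assms rate_pos[of m] unfolding distrib_left by linarith
qed

text \<open>Reflexivity is not among the assumptions; it follows by going from \<open>f\<close> to
  an approximating point and back.\<close>

lemma rho_self_small: 
  assumes f: "f \<in> F" and \<delta>: "\<delta> > 0"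
  shows "\<rho> f f < \<delta>"
proof -
  obtain q :: nat where q: "rate q < \<delta> / 4" using rate_approx[of "\<delta>/4"] \<delta> by auto
  have "\<rho> f f \<le> 2 * (\<rho> f (t (idx q f)) + \<rho> (t (idx q f)) f)" by (rule rho_tri) (use f tF in auto)
  then show ?thesis using rho_sym[OF f tF, of "idx q f"] idx(2)[OF f, of q] q by simp
qed

lemma G_limit:
  assumes w: "\<omega> \<in> good" and f: "f \<in> F"
  shows "(\<lambda>m. X (idx m f) \<omega>) \<longlonglongrightarrow> G \<omega> f"
proof -
  have "Cauchy (\<lambda>m. X (idx m f) \<omega>)"
  proof (rule metric_CauchyI)
    fix e :: real assume e: "e > 0"
    obtain \<delta> where \<delta>: "\<delta> > 0" "\<omega> \<notin> osc \<delta> (e/2)" using good_osc[OF w, of "e/2"] e by auto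
    obtain m0 where m0: "\<And>m. m \<ge> m0 \<Longrightarrow> rate m < \<delta> / 24" using eventually_rate_less[of "\<delta> / 24"] \<delta> by auto
    have "dist (X (idx m f) \<omega>) (X (idx n f) \<omega>) < e" if "m \<ge> m0" "n \<ge> m0" for m n
    proof -
      have "\<rho> (t (idx m f)) (t (idx n f)) < \<delta>"
        by (rule rho_idx[OF f f rho_self_small[OF f]]) (use \<delta> m0 that in auto)
      from not_osc[OF good_space[OF w] \<delta>(2) this] show ?thesis using e by (simp add: dist_real_def)
    qed
    then show "\<exists>M. \<forall>m\<ge>M. \<forall>n\<ge>M. dist (X (idx m f) \<omega>) (X (idx n f) \<omega>) < e" by blast
  qed
  then have "convergent (\<lambda>m. X (idx m f) \<omega>)" by (simp add: Cauchy_convergent_iff)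
  then show ?thesis using w f by (simp add: G_def convergent_LIMSEQ_iff)
qed

text \<open>Both bounds are limits of increments along the sequence. The second keeps an
  approximating index in place of \<open>f\<close>, which is what compares \<open>G\<close> with its
  step approximations.\<close>

lemma G_increment:
  assumes w: "\<omega> \<in> good" and no: "\<omega> \<notin> osc \<delta> \<epsilon>" and f: "f \<in> F" and g: "g \<in> F" and "\<rho> f g < \<delta> / 12"
  shows "\<bar>G \<omega> f - G \<omega> g\<bar> \<le> \<epsilon>"
    and "rate m < \<delta> / 24 \<Longrightarrow> \<bar>X (idx m f) \<omega> - G \<omega> g\<bar> \<le> \<epsilon>"
proof -
  have \<delta>: "\<exists>m0. \<forall>m\<ge>m0. rate m < \<delta> / 24" if "rate m < \<delta> / 24" for m
    using eventually_rate_less[of "\<delta> / 24"] that by (smt (verit) rate_pos)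
  have *: "\<bar>X (idx m f) \<omega> - G \<omega> g\<bar> \<le> \<epsilon>" if m: "rate m < \<delta> / 24" for m
  proof (rule LIMSEQ_le_const2)
    show "(\<lambda>n. \<bar>X (idx m f) \<omega> - X (idx n g) \<omega>\<bar>) \<longlonglongrightarrow> \<bar>X (idx m f) \<omega> - G \<omega> g\<bar>"
      by (intro tendsto_intros G_limit[OF w g])
    obtain m0 where m0: "\<And>m. m \<ge> m0 \<Longrightarrow> rate m < \<delta> / 24" using \<delta>[OF m] by auto
    show "\<exists>N. \<forall>n\<ge>N. \<bar>X (idx m f) \<omega> - X (idx n g) \<omega>\<bar> \<le> \<epsilon>"
      using not_osc[OF good_space[OF w] no rho_idx[OF f g assms(5) m m0]] by blast
  qed
  show "rate m < \<delta> / 24 \<Longrightarrow> \<bar>X (idx m f) \<omega> - G \<omega> g\<bar> \<le> \<epsilon>" by (rule *)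
  show "\<bar>G \<omega> f - G \<omega> g\<bar> \<le> \<epsilon>"
  proof (cases "\<delta> > 0")
    case True
    show ?thesis
    proof (rule LIMSEQ_le_const2)
      show "(\<lambda>m. \<bar>X (idx m f) \<omega> - G \<omega> g\<bar>) \<longlonglongrightarrow> \<bar>G \<omega> f - G \<omega> g\<bar>"
        by (intro tendsto_intros G_limit[OF w f])
      obtain m0 where m0: "\<And>m. m \<ge> m0 \<Longrightarrow> rate m < \<delta> / 24" using eventually_rate_less[of "\<delta> / 24"] True by auto
      show "\<exists>N. \<forall>n\<ge>N. \<bar>X (idx n f) \<omega> - G \<omega> g\<bar> \<le> \<epsilon>" using * m0 by blast
    qed
  next
    case False
    have "0 \<le> \<rho> f g" by (rule rho_nonneg[OF f g])
    then show ?thesis using assms(5) False by linarith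
  qed
qed

lemma G_uc: "uniformly_continuous_wrt \<rho> F (G \<omega>)"
  unfolding uniformly_continuous_wrt_def
proof (intro allI impI)
  fix \<epsilon> :: real assume \<epsilon>: "\<epsilon> > 0"
  show "\<exists>\<delta>>0. \<forall>f\<in>F. \<forall>g\<in>F. \<rho> f g < \<delta> \<longrightarrow> \<bar>G \<omega> f - G \<omega> g\<bar> < \<epsilon>"
  proof (cases "\<omega> \<in> good")
    case True
    obtain \<delta> where \<delta>: "\<delta> > 0" "\<omega> \<notin> osc \<delta> (\<epsilon>/2)" using good_osc[OF True, of "\<epsilon>/2"] \<epsilon> by auto
    show ?thesis
    proof (intro exI[of _ "\<delta> / 12"] conjI ballI impI)
      fix f g assume "f \<in> F" "g \<in> F" "\<rho> f g < \<delta> / 12"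
      from G_increment(1)[OF True \<delta>(2) this] show "\<bar>G \<omega> f - G \<omega> g\<bar> < \<epsilon>" using \<epsilon> by linarith
    qed (use \<delta> in simp)
  next
    case False
    then show ?thesis using \<epsilon> by (intro exI[of _ 1]) (auto simp: G_def)
  qed
qed

text \<open>Finite-dimensional approximation of a path: for functions in \<open>F\<close> only the
  coordinates below \<open>J m\<close> are read.\<close>

definition step :: "nat \<Rightarrow> (nat \<Rightarrow> real) \<Rightarrow> 'a \<Rightarrow> real" where
  "step m x = (\<lambda>f\<in>F. x (idx m f))"

lemma step_space: "step m x \<in> mspace (linf F)"
  unfolding step_def
proof (rule linf_restrict)
  fix f assume "f \<in> F"
  then show "\<bar>x (idx m f)\<bar> \<le> (\<Sum>j<J m. \<bar>x j\<bar>)"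
    using idx(1) by (intro member_le_sum[of "idx m f" _ "\<lambda>j. \<bar>x j\<bar>"]) auto
qed

lemma step_close:
  assumes w: "\<omega> \<in> good" and no: "\<omega> \<notin> osc \<delta> \<epsilon>" and m: "rate m < \<delta> / 24" and f: "f \<in> F"
  shows "\<bar>step m (\<lambda>j. X j \<omega>) f - G \<omega> f\<bar> \<le> \<epsilon>"
proof -
  have "\<rho> f f < \<delta> / 12"
  proof (rule rho_self_small[OF f])
    have "0 < rate m" by simp
    then show "0 < \<delta> / 12" using m by linarith
  qed
  from G_increment(2)[OF w no f f this m] show ?thesis using f by (simp add: step_def)
qed

lemma G_space: "G \<omega> \<in> mspace (linf F)"
proof (cases "\<omega> \<in> good")
  case True
  obtain \<delta> where \<delta>: "\<delta> > 0" "\<omega> \<notin> osc \<delta> 1" using good_osc[OF True, of 1] by auto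
  obtain m where m: "rate m < \<delta> / 24" using eventually_rate_less[of "\<delta> / 24"] \<delta> by auto
  obtain K where K: "\<And>f. f \<in> F \<Longrightarrow> \<bar>step m (\<lambda>j. X j \<omega>) f\<bar> \<le> K" using step_space[of m] linf_mspace_iff by metis
  have "\<bar>G \<omega> f\<bar> \<le> K + 1" if "f \<in> F" for f
    using step_close[OF True \<delta>(2) m that] K[OF that] by linarith
  moreover have "G \<omega> \<in> extensional F" by (simp add: G_def)
  ultimately show ?thesis by (auto simp: linf_mspace_iff)
next
  case False
  then show ?thesis by (auto simp: G_def linf_mspace_iff)
qed

text \<open>Finitely many coordinates control the supremum distance of two step paths, so
  \<open>step m\<close> is continuous from the product topology, whose Borel sets the coordinates
  generate.\<close>

lemma open_step_preimage:
  assumes U: "openin (mtopology_of (linf F)) U"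
  shows "open {x. step m x \<in> U}"
proof -
  interpret L: Metric_space "mspace (linf F)" "mdist (linf F)" by (rule Metric_space_mspace_mdist)
  show ?thesis
proof (subst open_subopen, intro ballI)
  fix x assume "x \<in> {x. step m x \<in> U}"
  then obtain r where r: "r > 0" "L.mball (step m x) r \<subseteq> U"
    using U by (auto simp: mtopology_of_def L.openin_mtopology)
  let ?T = "\<Inter>j\<in>{..<J m}. {y. \<bar>y j - x j\<bar> < r/2}"
  have "open {y. \<bar>y j - x j\<bar> < r/2}" for j :: nat
    by (intro open_Collect_less continuous_intros continuous_on_product_coordinates)
  then have "open ?T" by (intro open_INT) auto
  moreover have "x \<in> ?T" using r by simp
  moreover have "?T \<subseteq> {x. step m x \<in> U}"
  proof
    fix y assume y: "y \<in> ?T"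
    have "\<forall>f\<in>F. \<bar>step m x f - step m y f\<bar> \<le> r/2"
    proof
      fix f assume f: "f \<in> F"
      then have "\<bar>y (idx m f) - x (idx m f)\<bar> < r/2" using y idx(1) by auto
      then show "\<bar>step m x f - step m y f\<bar> \<le> r/2" using f by (simp add: step_def abs_minus_commute)
    qed
    then have "mdist (linf F) (step m x) (step m y) \<le> r/2"
      by (subst linf_mdist_le[OF step_space step_space F_ne])
    then have "step m y \<in> L.mball (step m x) r" using r step_space by (simp add: L.in_mball)
    then show "y \<in> {x. step m x \<in> U}" using r by auto
  qed
  ultimately show "\<exists>T. open T \<and> x \<in> T \<and> T \<subseteq> {x. step m x \<in> U}" by blast
qed
qed

lemma X_seq_measurable: "(\<lambda>\<omega> j. X j \<omega>) \<in> borel_measurable M"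
  by (rule measurable_coordinatewise_then_product) simp

lemma step_preimage_sets:
  assumes "openin (mtopology_of (linf F)) U"
  shows "{\<omega>\<in>space M. step m (\<lambda>j. X j \<omega>) \<in> U} \<in> sets M"
proof -
  have "{x. step m x \<in> U} \<in> sets borel" using open_step_preimage[OF assms] by simp
  from measurable_sets[OF X_seq_measurable this] show ?thesis by (simp add: vimage_def Int_def conj_commute)
qed

text \<open>The space of bounded functions is not separable in general, so measurability of the
  coordinates is not enough. On good points \<open>G\<close> is a uniform limit of the step paths,
  and membership in an open set is decided by them.\<close>

lemma G_measurable: "G \<in> M \<rightarrow>\<^sub>M linf_borel F"
  unfolding linf_borel_def
proof (rule measurable_measure_of)
  interpret L: Metric_space "mspace (linf F)" "mdist (linf F)" by (rule Metric_space_mspace_mdist)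
  show "{U. openin (mtopology_of (linf F)) U} \<subseteq> Pow (mspace (linf F))"
    by (auto simp: topspace_linf dest!: openin_subset)
  show "G \<in> space M \<rightarrow> mspace (linf F)" using G_space by auto
  fix U assume "U \<in> {U. openin (mtopology_of (linf F)) U}"
  then have U: "openin (mtopology_of (linf F)) U" by simp
  \<comment> \<open>The points that can be moved by \<open>rate k\<close> without leaving
    \<open>U\<close>, up to an open kernel. A limit lies in \<open>U\<close> if and only if the
    approximations eventually lie in a common \<open>V k\<close>.\<close>
  define V where "V k = \<Union>{W. openin (mtopology_of (linf F)) W \<and> (\<forall>w\<in>W. L.mball w (rate k) \<subseteq> U)}" for k :: nat
  have V: "openin (mtopology_of (linf F)) (V k)" for k unfolding V_def by (rule openin_Union) auto
  have eq: "G \<omega> \<in> U \<longleftrightarrow> (\<exists>k m0. \<forall>m\<ge>m0. step m (\<lambda>j. X j \<omega>) \<in> V k)" if w: "\<omega> \<in> good" for \<omega>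
  proof
    assume "G \<omega> \<in> U"
    then obtain r where r: "r > 0" "L.mball (G \<omega>) r \<subseteq> U"
      using U by (auto simp: mtopology_of_def L.openin_mtopology)
    obtain k :: nat where k: "rate k < r/2" using rate_approx[of "r/2"] r by auto
    have sub: "L.mball (G \<omega>) (r/2) \<subseteq> V k"
    proof -
      have "L.mball w (rate k) \<subseteq> U" if "w \<in> L.mball (G \<omega>) (r/2)" for w
      proof
        fix v assume v: "v \<in> L.mball w (rate k)"
        have "mdist (linf F) (G \<omega>) v \<le> mdist (linf F) (G \<omega>) w + mdist (linf F) w v"
          using that v by (intro L.triangle) auto
        also have "\<dots> < r" using that v k by auto
        finally show "v \<in> U" using r(2) v that by auto
      qed
      moreover have "openin (mtopology_of (linf F)) (L.mball (G \<omega>) (r/2))" by (simp add: mtopology_of_def)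
      ultimately show ?thesis unfolding V_def by blast
    qed
    obtain \<delta> where \<delta>: "\<delta> > 0" "\<omega> \<notin> osc \<delta> (r/4)" using good_osc[OF w, of "r/4"] r by auto
    obtain m0 where m0: "\<And>m. m \<ge> m0 \<Longrightarrow> rate m < \<delta> / 24" using eventually_rate_less[of "\<delta> / 24"] \<delta> by auto
    have "step m (\<lambda>j. X j \<omega>) \<in> V k" if "m \<ge> m0" for m
    proof -
      have "mdist (linf F) (G \<omega>) (step m (\<lambda>j. X j \<omega>)) \<le> r/4"
        unfolding linf_mdist_le[OF G_space step_space F_ne]
        using step_close[OF w \<delta>(2) m0[OF that]] by (simp add: abs_minus_commute)
      then have "step m (\<lambda>j. X j \<omega>) \<in> L.mball (G \<omega>) (r/2)" using r step_space G_space by (simp add: L.in_mball)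
      then show ?thesis using sub by blast
    qed
    then show "\<exists>k m0. \<forall>m\<ge>m0. step m (\<lambda>j. X j \<omega>) \<in> V k" by blast
  next
    assume "\<exists>k m0. \<forall>m\<ge>m0. step m (\<lambda>j. X j \<omega>) \<in> V k"
    then obtain k m0 where km: "\<And>m. m \<ge> m0 \<Longrightarrow> step m (\<lambda>j. X j \<omega>) \<in> V k" by blast
    define e where "e = rate k"
    have e: "e > 0" by (simp add: e_def)
    obtain \<delta> where \<delta>: "\<delta> > 0" "\<omega> \<notin> osc \<delta> (e/2)" using good_osc[OF w, of "e/2"] e by auto
    obtain m1 where m1: "\<And>m. m \<ge> m1 \<Longrightarrow> rate m < \<delta> / 24" using eventually_rate_less[of "\<delta> / 24"] \<delta> by auto
    let ?m = "max m0 m1"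
    have "mdist (linf F) (step ?m (\<lambda>j. X j \<omega>)) (G \<omega>) \<le> e/2"
      unfolding linf_mdist_le[OF step_space G_space F_ne]
      using step_close[OF w \<delta>(2) m1[of ?m]] by simp
    then have "G \<omega> \<in> L.mball (step ?m (\<lambda>j. X j \<omega>)) (rate k)"
      using e step_space G_space unfolding e_def[symmetric] by (simp add: L.in_mball)
    moreover have "L.mball (step ?m (\<lambda>j. X j \<omega>)) (rate k) \<subseteq> U" using km[of ?m] unfolding V_def by auto
    ultimately show "G \<omega> \<in> U" by blast
  qed
  note step_preimage_sets[OF V, measurable]
  have A: "{\<omega>\<in>space M. \<omega> \<in> good \<and> (\<exists>k m0. \<forall>m\<ge>m0. \<omega> \<in> {\<omega>\<in>space M. step m (\<lambda>j. X j \<omega>) \<in> V k})} \<in> sets M"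
    by measurable
  have B: "{\<omega>\<in>space M. \<omega> \<notin> good \<and> (\<lambda>f\<in>F. 0) \<in> U} \<in> sets M" by measurable
  have "G -` U \<inter> space M = {\<omega>\<in>space M. \<omega> \<in> good \<and> (\<exists>k m0. \<forall>m\<ge>m0. \<omega> \<in> {\<omega>\<in>space M. step m (\<lambda>j. X j \<omega>) \<in> V k})} \<union> {\<omega>\<in>space M. \<omega> \<notin> good \<and> (\<lambda>f\<in>F. 0) \<in> U}"
    (is "_ = ?A \<union> ?B")
  proof (intro set_eqI)
    fix \<omega>
    show "\<omega> \<in> G -` U \<inter> space M \<longleftrightarrow> \<omega> \<in> ?A \<union> ?B"
    proof (cases "\<omega> \<in> good")
      case True
      then show ?thesis using eq[OF True] good_space[OF True] by simp
    next
      case False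
      then show ?thesis by (auto simp: G_def)
    qed
  qed
  then show "G -` U \<inter> space M \<in> sets M" using sets.Un[OF A B] by (simp only:)
qed

lemma tail_small:
  assumes "\<eta> > 0"
  shows "\<exists>R. prob {\<omega>\<in>space M. \<exists>j<n. R < \<bar>X j \<omega>\<bar>} \<le> \<eta>"
proof -
  let ?A = "\<lambda>r::nat. {\<omega>\<in>space M. \<exists>j<n. real r < \<bar>X j \<omega>\<bar>}"
  have "(\<lambda>r. prob (?A r)) \<longlonglongrightarrow> prob (\<Inter>r. ?A r)"
  proof (rule finite_Lim_measure_decseq)
    show "range ?A \<subseteq> sets M" by auto
    show "decseq ?A" unfolding decseq_def
    proof (intro allI impI)
      fix r r' :: nat assume "r \<le> r'"
      then have "real r < y" if "real r' < y" for y using that by linarith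
      then show "?A r' \<subseteq> ?A r" by blast
    qed
  qed
  moreover have "(\<Inter>r. ?A r) = {}"
  proof -
    have False if "\<omega> \<in> (\<Inter>r. ?A r)" for \<omega>
    proof -
      obtain r :: nat where r: "(\<Sum>j<n. \<bar>X j \<omega>\<bar>) \<le> real r" using real_arch_simple by blast
      obtain j where j: "j < n" "real r < \<bar>X j \<omega>\<bar>" using \<open>\<omega> \<in> (\<Inter>r. ?A r)\<close> by blast
      have "\<bar>X j \<omega>\<bar> \<le> (\<Sum>j<n. \<bar>X j \<omega>\<bar>)" using j by (intro member_le_sum) auto
      then show False using r j by linarith
    qed
    then show ?thesis by blast
  qed
  ultimately have "(\<lambda>r. prob (?A r)) \<longlonglongrightarrow> 0" by simp
  then have "\<forall>\<^sub>F r in sequentially. prob (?A r) < \<eta>" using assms by (rule order_tendstoD(2))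
  then obtain r where "prob (?A r) < \<eta>" by (auto simp: eventually_sequentially)
  then show ?thesis by (intro exI[of _ "real r"]) simp
qed

text \<open>An Ascoli-type set: for each level \<open>p\<close> the path is within
  \<open>rate p\<close> of a step path with bounded values. Such a set is totally bounded, and its
  closure is compact because the space is complete.\<close>

lemma G_tight: "tight_borel_element M F G"
  unfolding tight_borel_element_def
proof (intro conjI allI impI G_measurable)
  interpret L: Metric_space "mspace (linf F)" "mdist (linf F)" by (rule Metric_space_mspace_mdist)
  have complete: "L.mcomplete"
    using Met_TC.mcomplete_funspace[of F] complete_UNIV
    by (simp add: linf_def mcomplete_of_def euclidean_metric_def)
  fix \<epsilon> :: real assume \<epsilon>: "\<epsilon> > 0"
  \<comment> \<open>Spent twice at each level, once for oscillation and once for size; the total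
    over all levels is \<open>\<epsilon>\<close>.\<close>
  define \<eta> where "\<eta> p = \<epsilon> / 2 * (1/2) ^ (Suc p)" for p :: nat
  have \<eta>: "\<eta> p > 0" for p using \<epsilon> by (simp add: \<eta>_def)
  have "\<forall>p. \<exists>\<delta>>0. prob (osc \<delta> (rate p)) \<le> \<eta> p" using osc_small \<eta> by simp
  then obtain \<delta> where \<delta>: "\<And>p. \<delta> p > 0" "\<And>p. prob (osc (\<delta> p) (rate p)) \<le> \<eta> p" by metis
  have "\<forall>p. \<exists>m. rate m < \<delta> p / 24" using eventually_rate_less \<delta>(1) by (meson order_refl zero_less_divide_iff zero_less_numeral)
  then obtain m where m: "\<And>p. rate (m p) < \<delta> p / 24" by metis
  have "\<forall>p. \<exists>R. prob {\<omega>\<in>space M. \<exists>j<J (m p). R < \<bar>X j \<omega>\<bar>} \<le> \<eta> p" using tail_small \<eta> by blast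
  from choice[OF this] obtain R where "\<forall>p. prob {\<omega>\<in>space M. \<exists>j<J (m p). R p < \<bar>X j \<omega>\<bar>} \<le> \<eta> p" by blast
  then have R: "\<And>p. prob {\<omega>\<in>space M. \<exists>j<J (m p). R p < \<bar>X j \<omega>\<bar>} \<le> \<eta> p" by blast
  \<comment> \<open>The vector \<open>x\<close> is existentially quantified, so \<open>K\<close> is
    a set of functions defined without reference to sample points.\<close>
  define K where "K = {z\<in>mspace (linf F). \<forall>p. \<exists>x. (\<forall>j<J (m p). \<bar>x j\<bar> \<le> R p) \<and> (\<forall>f\<in>F. \<bar>z f - x (idx (m p) f)\<bar> \<le> rate p)}"
  have KM: "K \<subseteq> mspace (linf F)" by (auto simp: K_def)
  have tb: "L.mtotally_bounded K"
    unfolding L.mtotally_bounded_def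
  proof (intro allI impI)
    fix e :: real assume e: "e > 0"
    obtain p :: nat where p: "rate p < e / 4" using rate_approx[of "e/4"] e by auto
    have "\<forall>z\<in>K. \<exists>x. (\<forall>j<J (m p). \<bar>x j\<bar> \<le> R p) \<and> (\<forall>f\<in>F. \<bar>z f - x (idx (m p) f)\<bar> \<le> rate p)"
      by (simp add: K_def)
    from bchoice[OF this] obtain x where x': "\<forall>z\<in>K. (\<forall>j<J (m p). \<bar>x z j\<bar> \<le> R p) \<and> (\<forall>f\<in>F. \<bar>z f - x z (idx (m p) f)\<bar> \<le> rate p)"
      by (elim exE)
    note x = bspec[OF x']
    \<comment> \<open>Equal cells put two approximating vectors within \<open>e / 4\<close> of each
      other; with the two approximation errors the distance is at most
      \<open>3 * (e / 4)\<close>.\<close>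
    define cell where "cell z = (\<lambda>j\<in>{..<J (m p)}. \<lfloor>x z j / (e/4)\<rfloor>)" for z
    have "cell ` K \<subseteq> {..<J (m p)} \<rightarrow>\<^sub>E {\<lfloor>- R p / (e/4)\<rfloor>..\<lfloor>R p / (e/4)\<rfloor>}"
    proof (rule image_subsetI)
      fix z assume z: "z \<in> K"
      have "\<lfloor>- R p / (e/4)\<rfloor> \<le> \<lfloor>x z j / (e/4)\<rfloor> \<and> \<lfloor>x z j / (e/4)\<rfloor> \<le> \<lfloor>R p / (e/4)\<rfloor>" if "j < J (m p)" for j
      proof -
        have "- R p \<le> x z j" "x z j \<le> R p" using x[OF z] that by (auto simp: abs_le_iff minus_le_iff)
        then show ?thesis using e by (intro conjI floor_mono divide_right_mono) auto
      qed
      then show "cell z \<in> {..<J (m p)} \<rightarrow>\<^sub>E {\<lfloor>- R p / (e/4)\<rfloor>..\<lfloor>R p / (e/4)\<rfloor>}"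
        by (auto simp: cell_def)
    qed
    then have fin: "finite (cell ` K)" by (rule finite_subset) (auto intro: finite_PiE)
    define rep where "rep v = (SOME z. z \<in> K \<and> cell z = v)" for v
    have rep: "rep (cell z) \<in> K \<and> cell (rep (cell z)) = cell z" if "z \<in> K" for z
      unfolding rep_def by (rule someI[where P="\<lambda>x. x \<in> K \<and> cell x = cell z"]) (use that in auto)
    have close: "mdist (linf F) w z < e" if z: "z \<in> K" and w: "w \<in> K" and eq: "cell w = cell z" for z w
    proof -
      have "mdist (linf F) w z \<le> 3 * (e / 4)"
        unfolding linf_mdist_le[OF subsetD[OF KM w] subsetD[OF KM z] F_ne]
      proof
        fix f assume f: "f \<in> F"
        let ?j = "idx (m p) f"
        have "\<lfloor>x w ?j / (e/4)\<rfloor> = \<lfloor>x z ?j / (e/4)\<rfloor>" using fun_cong[OF eq, of ?j] idx(1)[OF f] by (simp add: cell_def)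
        then have "\<bar>x w ?j - x z ?j\<bar> \<le> e/4" using e by (intro floor_divide_eq_imp_close) auto
        moreover have "\<bar>z f - x z ?j\<bar> \<le> rate p" "\<bar>w f - x w ?j\<bar> \<le> rate p"
          using x[OF z] x[OF w] f by auto
        ultimately show "\<bar>w f - z f\<bar> \<le> 3 * (e / 4)" using p by linarith
      qed
      then show ?thesis using e by linarith
    qed
    show "\<exists>Z. finite Z \<and> Z \<subseteq> K \<and> K \<subseteq> (\<Union>x\<in>Z. L.mball x e)"
    proof (intro exI[of _ "rep ` cell ` K"] conjI)
      show "finite (rep ` cell ` K)" using fin by simp
      show "rep ` cell ` K \<subseteq> K" using rep by auto
      show "K \<subseteq> (\<Union>x\<in>rep ` cell ` K. L.mball x e)"
      proof
        fix z assume z: "z \<in> K"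
        have "z \<in> L.mball (rep (cell z)) e"
          using close[OF z] rep[OF z] KM z by (auto simp: L.in_mball)
        then show "z \<in> (\<Union>x\<in>rep ` cell ` K. L.mball x e)" using z by blast
      qed
    qed
  qed
  define Kc where "Kc = L.mtopology closure_of K"
  have comp: "compactin L.mtopology Kc"
    using L.mtotally_bounded_eq_compact_closure_of[OF complete, of K] tb by (simp add: Kc_def)
  have "closedin L.mtopology Kc" by (simp add: Kc_def)
  then have "openin (mtopology_of (linf F)) (mspace (linf F) - Kc)"
    by (simp add: closedin_def mtopology_of_def)
  then have "G -` (mspace (linf F) - Kc) \<inter> space M \<in> sets M"
    by (intro measurable_sets[OF G_measurable] openin_linf_borel)
  then have "space M - (G -` (mspace (linf F) - Kc) \<inter> space M) \<in> sets M" by (rule sets.compl_sets)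
  moreover have "space M - (G -` (mspace (linf F) - Kc) \<inter> space M) = G -` Kc \<inter> space M" using G_space by auto
  ultimately have Kc_sets: "G -` Kc \<inter> space M \<in> sets M" by simp
  define T where "T p = {\<omega>\<in>space M. \<exists>j<J (m p). R p < \<bar>X j \<omega>\<bar>}" for p
  have T [measurable]: "T p \<in> sets M" for p unfolding T_def by measurable
  define Bad where "Bad p = osc (\<delta> p) (rate p) \<union> T p" for p
  have Bad [measurable]: "Bad p \<in> sets M" for p unfolding Bad_def by measurable
  have badp: "prob (Bad p) \<le> \<epsilon> * (1/2) ^ Suc p" for p
  proof -
    have "prob (Bad p) \<le> prob (osc (\<delta> p) (rate p)) + prob (T p)"
      unfolding Bad_def by (rule measure_Un_le) auto
    also have "\<dots> \<le> \<eta> p + \<eta> p" using \<delta>(2) R by (intro add_mono) (auto simp: T_def)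
    finally show ?thesis by (simp add: \<eta>_def)
  qed
  have sums: "(\<lambda>p. \<epsilon> * (1/2) ^ Suc p) sums (\<epsilon> * 1)"
    by (rule sums_mult[OF power_half_series])
  have smb: "summable (\<lambda>p. prob (Bad p))"
  proof (rule summable_comparison_test'[OF sums_summable[OF sums], of 0])
    show "norm (prob (Bad p)) \<le> \<epsilon> * (1/2) ^ Suc p" for p
      using badp[of p] by (simp only: real_norm_def abs_of_nonneg measure_nonneg)
  qed
  have "prob (\<Union>p. Bad p) \<le> (\<Sum>p. prob (Bad p))"
    by (rule finite_measure_subadditive_countably) (use smb in auto)
  also have "\<dots> \<le> (\<Sum>p. \<epsilon> * (1/2) ^ Suc p)"
    by (intro suminf_le badp sums_summable[OF sums] smb)
  also have "\<dots> = \<epsilon>" using sums_unique[OF sums] by simp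
  finally have badU: "prob (\<Union>p. Bad p) \<le> \<epsilon>" .
  have "1 - \<epsilon> \<le> prob (space M - (\<Union>p. Bad p))"
    using badU by (subst prob_compl) auto
  also have "\<dots> = prob ((space M - (\<Union>p. Bad p)) \<inter> good)"
    by (rule finite_measure_eq_AE) (use AE_good in auto)
  also have "\<dots> \<le> prob (G -` Kc \<inter> space M)"
  proof (rule finite_measure_mono[OF _ Kc_sets])
    show "(space M - (\<Union>p. Bad p)) \<inter> good \<subseteq> G -` Kc \<inter> space M"
    proof
      fix \<omega> assume w: "\<omega> \<in> (space M - (\<Union>p. Bad p)) \<inter> good"
      then have g: "\<omega> \<in> good" and s: "\<omega> \<in> space M" by auto
      have "\<exists>x. (\<forall>j<J (m p). \<bar>x j\<bar> \<le> R p) \<and> (\<forall>f\<in>F. \<bar>G \<omega> f - x (idx (m p) f)\<bar> \<le> rate p)" for p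
      proof (intro exI[of _ "\<lambda>j. X j \<omega>"] conjI allI impI ballI)
        have nb: "\<omega> \<notin> osc (\<delta> p) (rate p)" "\<omega> \<notin> T p" using w by (auto simp: Bad_def)
        show "\<bar>X j \<omega>\<bar> \<le> R p" if "j < J (m p)" for j
        proof (rule ccontr)
          assume "\<not> \<bar>X j \<omega>\<bar> \<le> R p"
          then have "\<omega> \<in> T p" unfolding T_def using that s by (auto simp: not_le)
          then show False using nb(2) by simp
        qed
        fix f assume f: "f \<in> F"
        show "\<bar>G \<omega> f - X (idx (m p) f) \<omega>\<bar> \<le> rate p"
          using step_close[OF g nb(1) m f] f by (simp add: step_def abs_minus_commute)
      qed
      then have "G \<omega> \<in> K" using G_space by (simp add: K_def)
      then have "G \<omega> \<in> Kc" unfolding Kc_def using closure_of_subset[of K L.mtopology] KM by auto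
      then show "\<omega> \<in> G -` Kc \<inter> space M" using s by simp
    qed
  qed
  finally show "\<exists>K. compactin (mtopology_of (linf F)) K \<and> 1 - \<epsilon> \<le> prob (G -` K \<inter> space M)"
    using comp by (intro exI[of _ Kc]) (simp add: mtopology_of_def)
qed

end

subsection \<open>The survey model\<close>

text \<open>Combines the covers with \<open>sign_majorant\<close>: on \<open>Gd\<close> the sign
  vectors whose covers contain the population have mass below 1/36. The majorant bounds all
  increments at small distance and is measurable, which their supremum need not be.\<close>

lemma (in donsker_limit) good_majorant:
  assumes \<epsilon>: "\<epsilon> > 0" and \<eta>: "\<eta> > 0" and ne: "H \<noteq> {}"
  shows "\<exists>\<delta>>0. \<exists>N0. \<forall>N\<ge>N0. \<exists>Gd\<in>sets (iid Q). \<exists>W. measure (iid Q) (space (iid Q) - Gd) \<le> \<eta> \<and>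
    (\<forall>s. (\<lambda>z. W z s) \<in> borel_measurable (iid Q)) \<and>
    (\<forall>z\<in>Gd. (\<forall>s. 0 \<le> W z s) \<and> cube_mean N (W z) \<le> \<epsilon> * sqrt N \<and>
      (\<forall>f\<in>H. \<forall>g\<in>H. rho_c Q f g < \<delta> \<longrightarrow> (\<forall>s\<in>cube N.
        \<bar>sgn_sum N s (\<lambda>i. (f (z i) - integral\<^sup>L Q f) - (g (z i) - integral\<^sup>L Q g))\<bar> \<le> W z s)))"
proof -
  interpret I: prob_space "iid Q" by (rule prob_space_iid[OF Q])
  define t where "t f g z = (\<lambda>i::nat. (f (z i) - integral\<^sup>L Q f) - (g (z i) - integral\<^sup>L Q g))" for f g :: "'z \<Rightarrow> real" and z
  obtain \<delta> N0 where \<delta>: "\<delta> > 0" and N0: "\<And>N s. N \<ge> N0 \<Longrightarrow> s \<in> cube N \<Longrightarrow> outer_le (iid Q)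
      {z. \<exists>f\<in>H. \<exists>g\<in>H. rho_c Q f g < \<delta> \<and> \<epsilon>/2 * sqrt N < \<bar>sgn_sum N s (t f g z)\<bar>} (\<eta>/36)"
    using sign_sums_small[of "\<epsilon>/2" "\<eta>/36"] \<epsilon> \<eta> ne unfolding t_def by auto
  show ?thesis
  proof (intro exI[of _ \<delta>] exI[of _ N0] conjI allI impI \<delta>)
    fix N assume N: "N0 \<le> N"
    let ?Bad = "\<lambda>s. {z. \<exists>f\<in>H. \<exists>g\<in>H. rho_c Q f g < \<delta> \<and> \<epsilon>/2 * sqrt N < \<bar>sgn_sum N s (t f g z)\<bar>}"
    have "\<forall>s\<in>cube N. \<exists>A. A \<in> sets (iid Q) \<and> {z. \<exists>f\<in>H. \<exists>g\<in>H. rho_c Q f g < \<delta> \<and> \<epsilon>/2 * sqrt N < \<bar>sgn_sum N s (t f g z)\<bar>} \<inter> space (iid Q) \<subseteq> A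
        \<and> measure (iid Q) A \<le> \<eta>/36"
    proof
      fix s assume "s \<in> cube N"
      from N0[OF N this] obtain A where "A \<in> sets (iid Q)" "?Bad s \<inter> space (iid Q) \<subseteq> A" "measure (iid Q) A \<le> \<eta>/36"
        unfolding outer_le_def by (elim bexE conjE)
      then show "\<exists>A. A \<in> sets (iid Q) \<and> ?Bad s \<inter> space (iid Q) \<subseteq> A \<and> measure (iid Q) A \<le> \<eta>/36"
        by (intro exI[of _ A] conjI)
    qed
    from bchoice[OF this] obtain A where A: "\<And>s. s \<in> cube N \<Longrightarrow> A s \<in> sets (iid Q)"
      "\<And>s. s \<in> cube N \<Longrightarrow> {z. \<exists>f\<in>H. \<exists>g\<in>H. rho_c Q f g < \<delta> \<and> \<epsilon>/2 * sqrt N < \<bar>sgn_sum N s (t f g z)\<bar>} \<inter> space (iid Q) \<subseteq> A s"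
      "\<And>s. s \<in> cube N \<Longrightarrow> measure (iid Q) (A s) \<le> \<eta>/36" by blast
    define B where "B z = {s\<in>cube N. z \<in> A s}" for z
    define \<mu> where "\<mu> z = cube_mean N (\<lambda>s. indicator (A s) z)" for z
    have ind: "(\<lambda>z. indicator (A s) z :: real) \<in> borel_measurable (iid Q)" if "s \<in> cube N" for s
      using A(1)[OF that] by simp
    have \<mu>m [measurable]: "\<mu> \<in> borel_measurable (iid Q)"
      unfolding \<mu>_def bexp_def by (intro borel_measurable_sum borel_measurable_scaleR borel_measurable_const ind)
    have \<mu>i: "integrable (iid Q) \<mu>" and \<mu>b: "integral\<^sup>L (iid Q) \<mu> \<le> \<eta>/36"
    proof -
      have ii: "integrable (iid Q) (\<lambda>z. design_prob N (\<lambda>_. 1/2) s *\<^sub>R indicator (A s) z :: real)" if "s \<in> cube N" for s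
        using A(1)[OF that] by (intro integrable_scaleR_right integrable_real_indicator) (auto simp: I.emeasure_eq_measure)
      show "integrable (iid Q) \<mu>" unfolding \<mu>_def bexp_def by (intro Bochner_Integration.integrable_sum ii)
      have "integral\<^sup>L (iid Q) \<mu> = (\<Sum>s\<in>cube N. \<integral>z. design_prob N (\<lambda>_. 1/2) s *\<^sub>R indicator (A s) z \<partial>iid Q)"
        unfolding \<mu>_def bexp_def by (rule Bochner_Integration.integral_sum) (rule ii)
      also have "\<dots> = cube_mean N (\<lambda>s. measure (iid Q) (A s))"
        unfolding bexp_def using A(1) by (intro sum.cong) auto
      also have "\<dots> \<le> cube_mean N (\<lambda>s. \<eta>/36)" by (intro bexp_mono A(3)) auto
      finally show "integral\<^sup>L (iid Q) \<mu> \<le> \<eta>/36" by (simp add: bexp_const)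
    qed
    \<comment> \<open>The mean of \<open>\<mu>\<close> is at most \<open>\<eta> / 36\<close>, so
      Markov's inequality at level 1/36 costs exactly \<open>\<eta>\<close>.\<close>
    define Gd where "Gd = {z\<in>space (iid Q). \<mu> z < 1/36}"
    have Gd: "Gd \<in> sets (iid Q)" unfolding Gd_def by measurable
    have "measure (iid Q) {z\<in>space (iid Q). \<mu> z \<ge> 1/36} \<le> integral\<^sup>L (iid Q) \<mu> / (1/36)"
      by (rule integral_Markov_inequality_measure[OF \<mu>i sets.empty_sets])
         (auto simp: \<mu>_def intro!: bexp_nonneg)
    also have "\<dots> \<le> \<eta>" using \<mu>b by simp
    also have "{z\<in>space (iid Q). \<mu> z \<ge> 1/36} = space (iid Q) - Gd" by (auto simp: Gd_def)
    finally have small: "measure (iid Q) (space (iid Q) - Gd) \<le> \<eta>" .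
    \<comment> \<open>For each set of sign vectors a majorant is chosen without looking at the
      population; composed with \<open>B\<close> it is one of finitely many on measurable
      pieces.\<close>
    have "\<forall>C. \<exists>W. cube_mean N (\<lambda>s. if s \<in> C then 1 else 0) \<le> 1/36 \<longrightarrow> (\<forall>s. 0 \<le> W s) \<and> cube_mean N W \<le> 2 * (\<epsilon>/2 * sqrt N) \<and>
        (\<forall>h. (\<forall>s\<in>cube N - C. \<bar>sgn_sum N s h\<bar> \<le> \<epsilon>/2 * sqrt N) \<longrightarrow> (\<forall>s\<in>cube N. \<bar>sgn_sum N s h\<bar> \<le> W s))"
    proof
      fix C
      have "0 \<le> \<epsilon>/2 * sqrt N" using \<epsilon> by simp
      from sign_majorant[OF this, of N C]
      show "\<exists>W. cube_mean N (\<lambda>s. if s \<in> C then 1 else 0) \<le> 1/36 \<longrightarrow> (\<forall>s. 0 \<le> W s) \<and> cube_mean N W \<le> 2 * (\<epsilon>/2 * sqrt N) \<and>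
        (\<forall>h. (\<forall>s\<in>cube N - C. \<bar>sgn_sum N s h\<bar> \<le> \<epsilon>/2 * sqrt N) \<longrightarrow> (\<forall>s\<in>cube N. \<bar>sgn_sum N s h\<bar> \<le> W s))"
        by blast
    qed
    from choice[OF this] obtain W where W: "\<And>C. cube_mean N (\<lambda>s. if s \<in> C then 1 else 0) \<le> 1/36 \<Longrightarrow> (\<forall>s. 0 \<le> W C s) \<and> cube_mean N (W C) \<le> 2 * (\<epsilon>/2 * sqrt N) \<and>
        (\<forall>h. (\<forall>s\<in>cube N - C. \<bar>sgn_sum N s h\<bar> \<le> \<epsilon>/2 * sqrt N) \<longrightarrow> (\<forall>s\<in>cube N. \<bar>sgn_sum N s h\<bar> \<le> W C s))"
      by blast
    have Wm: "(\<lambda>z. W (B z) s) \<in> borel_measurable (iid Q)" for s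
    proof -
      have Bset: "{z\<in>space (iid Q). B z = C} \<in> sets (iid Q)" if C: "C \<subseteq> cube N" for C
      proof -
        have "{z\<in>space (iid Q). \<forall>s\<in>cube N. s \<in> C \<longleftrightarrow> z \<in> A s} \<in> sets (iid Q)"
        proof (rule sets.sets_Collect_finite_All)
          fix s assume s: "s \<in> cube N"
          have "{z\<in>space (iid Q). s \<in> C \<longleftrightarrow> z \<in> A s} = (if s \<in> C then A s else space (iid Q) - A s)"
            using sets.sets_into_space[OF A(1)[OF s]] by auto
          then show "{z\<in>space (iid Q). s \<in> C \<longleftrightarrow> z \<in> A s} \<in> sets (iid Q)"
            using A(1)[OF s] by (simp add: sets.compl_sets)
        qed simp
        also have "{z\<in>space (iid Q). \<forall>s\<in>cube N. s \<in> C \<longleftrightarrow> z \<in> A s} = {z\<in>space (iid Q). B z = C}"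
          using C by (auto simp: B_def)
        finally show ?thesis .
      qed
      have "(\<lambda>z. \<Sum>C\<in>Pow (cube N). indicator {z\<in>space (iid Q). B z = C} z * W C s) \<in> borel_measurable (iid Q)"
        using Bset by (intro borel_measurable_sum borel_measurable_times borel_measurable_const borel_measurable_indicator) auto
      moreover have "(\<Sum>C\<in>Pow (cube N). indicator {z\<in>space (iid Q). B z = C} z * W C s) = W (B z) s" if "z \<in> space (iid Q)" for z
      proof -
        have "(\<Sum>C\<in>Pow (cube N). indicator {z\<in>space (iid Q). B z = C} z * W C s) = (\<Sum>C\<in>Pow (cube N). if C = B z then W C s else 0)"
          using that by (intro sum.cong) auto
        also have "\<dots> = W (B z) s" by (subst sum.delta) (auto simp: B_def)
        finally show ?thesis .
      qed
      ultimately show ?thesis by (subst measurable_cong[where g="\<lambda>z. \<Sum>C\<in>Pow (cube N). indicator {z\<in>space (iid Q). B z = C} z * W C s"]) auto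
    qed
    show "\<exists>Gd\<in>sets (iid Q). \<exists>W. measure (iid Q) (space (iid Q) - Gd) \<le> \<eta> \<and>
      (\<forall>s. (\<lambda>z. W z s) \<in> borel_measurable (iid Q)) \<and>
      (\<forall>z\<in>Gd. (\<forall>s. 0 \<le> W z s) \<and> cube_mean N (W z) \<le> \<epsilon> * sqrt N \<and>
      (\<forall>f\<in>H. \<forall>g\<in>H. rho_c Q f g < \<delta> \<longrightarrow> (\<forall>s\<in>cube N.
        \<bar>sgn_sum N s (\<lambda>i. (f (z i) - integral\<^sup>L Q f) - (g (z i) - integral\<^sup>L Q g))\<bar> \<le> W z s)))"
    proof (intro bexI[OF _ Gd] exI[of _ "\<lambda>z. W (B z)"] conjI small allI Wm)
      show "\<forall>z\<in>Gd. (\<forall>s. 0 \<le> W (B z) s) \<and> cube_mean N (W (B z)) \<le> \<epsilon> * sqrt N \<and>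
        (\<forall>f\<in>H. \<forall>g\<in>H. rho_c Q f g < \<delta> \<longrightarrow> (\<forall>s\<in>cube N.
        \<bar>sgn_sum N s (\<lambda>i. (f (z i) - integral\<^sup>L Q f) - (g (z i) - integral\<^sup>L Q g))\<bar> \<le> W (B z) s))"
      proof
        fix z assume z: "z \<in> Gd"
        have "cube_mean N (\<lambda>s. if s \<in> B z then 1 else 0) = \<mu> z"
          unfolding \<mu>_def by (rule bexp_cong) (auto simp: B_def)
        then have w: "cube_mean N (\<lambda>s. if s \<in> B z then 1 else 0) \<le> 1/36" using z by (simp add: Gd_def)
        have "\<forall>s\<in>cube N - B z. \<bar>sgn_sum N s (t f g z)\<bar> \<le> \<epsilon>/2 * sqrt N" if "f \<in> H" "g \<in> H" "rho_c Q f g < \<delta>" for f g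
        proof
          fix s assume s: "s \<in> cube N - B z"
          show "\<bar>sgn_sum N s (t f g z)\<bar> \<le> \<epsilon>/2 * sqrt N"
          proof (rule ccontr)
            assume "\<not> \<bar>sgn_sum N s (t f g z)\<bar> \<le> \<epsilon>/2 * sqrt N"
            then have "z \<in> {z. \<exists>f\<in>H. \<exists>g\<in>H. rho_c Q f g < \<delta> \<and> \<epsilon>/2 * sqrt N < \<bar>sgn_sum N s (t f g z)\<bar>} \<inter> space (iid Q)"
              using that z unfolding Gd_def not_le by blast
            then have "z \<in> A s" using A(2)[of s] s by blast
            then show False using s by (simp add: B_def)
          qed
        qed
        then have "\<forall>f\<in>H. \<forall>g\<in>H. rho_c Q f g < \<delta> \<longrightarrow> (\<forall>s\<in>cube N. \<bar>sgn_sum N s (t f g z)\<bar> \<le> W (B z) s)"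
          using W[OF w] by blast
        then show "(\<forall>s. 0 \<le> W (B z) s) \<and> cube_mean N (W (B z)) \<le> \<epsilon> * sqrt N \<and>
          (\<forall>f\<in>H. \<forall>g\<in>H. rho_c Q f g < \<delta> \<longrightarrow> (\<forall>s\<in>cube N.
            \<bar>sgn_sum N s (\<lambda>i. (f (z i) - integral\<^sup>L Q f) - (g (z i) - integral\<^sup>L Q g))\<bar> \<le> W (B z) s))"
          using W[OF w] unfolding t_def by simp
      qed
    qed
  qed
qed

text \<open>A weight \<open>real (s i) / p i - 1\<close> has mean 0 and variance
  \<open>1 / p i - 1\<close>, and different weights are uncorrelated.\<close>

lemma bexp_HT_product:
  assumes p: "\<And>i. i < N \<Longrightarrow> 0 < p i"
  shows "bexp N p (\<lambda>s. (\<Sum>i<N. (real (s i) / p i - 1) * a i) * (\<Sum>i<N. (real (s i) / p i - 1) * b i))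
    = (\<Sum>i<N. (1 / p i - 1) * (a i * b i))"
proof -
  have c: "bexp N p (\<lambda>s. (real (s i) / p i - 1) * (real (s j) / p j - 1)) = (if i = j then 1 / p i - 1 else 0)"
    if ij: "i < N" "j < N" for i j
  proof (cases "i = j")
    case True
    define q where "q = p i"
    have "bexp N p (\<lambda>s. (real (s i) / q - 1) * (real (s i) / q - 1))
        = q *\<^sub>R ((real 1 / q - 1) * (real 1 / q - 1)) + (1 - q) *\<^sub>R ((real 0 / q - 1) * (real 0 / q - 1))"
      unfolding q_def by (rule bexp_coordinate[OF ij(1), where \<phi>="\<lambda>v. (real v / p i - 1) * (real v / p i - 1)"])
    also have "\<dots> = 1 / q - 1" using p[OF ij(1)] by (simp add: q_def field_simps)
    finally show ?thesis using True by (simp add: q_def)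
  next
    case False
    define \<phi> where "\<phi> k v = (if k = i \<or> k = j then real v / p k - 1 else 1)" for k v
    have "(\<Prod>k<N. \<phi> k (s k)) = (real (s i) / p i - 1) * (real (s j) / p j - 1)" for s
    proof -
      have "(\<Prod>k<N. \<phi> k (s k)) = (\<Prod>k\<in>{i,j}. \<phi> k (s k))"
        using ij by (intro prod.mono_neutral_right) (auto simp: \<phi>_def)
      then show ?thesis using False by (simp add: \<phi>_def)
    qed
    then have "bexp N p (\<lambda>s. (real (s i) / p i - 1) * (real (s j) / p j - 1)) = bexp N p (\<lambda>s. \<Prod>k<N. \<phi> k (s k))" by simp
    also have "\<dots> = (\<Prod>k<N. p k *\<^sub>R \<phi> k 1 + (1 - p k) *\<^sub>R \<phi> k 0)" by (rule bexp_prod)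
    also have "\<dots> = 0"
    proof (rule prod_zero)
      show "\<exists>k\<in>{..<N}. p k *\<^sub>R \<phi> k 1 + (1 - p k) *\<^sub>R \<phi> k 0 = 0"
        using ij p[OF ij(1)] by (intro bexI[of _ i]) (auto simp: \<phi>_def field_simps)
    qed simp
    finally show ?thesis using False by simp
  qed
  have "bexp N p (\<lambda>s. (\<Sum>i<N. (real (s i) / p i - 1) * a i) * (\<Sum>i<N. (real (s i) / p i - 1) * b i))
      = (\<Sum>i<N. \<Sum>j<N. bexp N p (\<lambda>s. (a i * b j) * ((real (s i) / p i - 1) * (real (s j) / p j - 1))))"
    unfolding sum_product bexp_sum[symmetric] by (intro bexp_cong sum.cong) (auto simp: mult_ac)
  also have "\<dots> = (\<Sum>i<N. \<Sum>j<N. (a i * b j) * (if i = j then 1 / p i - 1 else 0))"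
    unfolding bexp_cmult by (intro sum.cong refl) (simp add: c)
  also have "\<dots> = (\<Sum>i<N. (1 / p i - 1) * (a i * b i))"
    by (intro sum.cong refl) (simp add: if_distrib cong: if_cong)
  finally show ?thesis .
qed

locale poisson_survey =
  fixes Pyx :: "('y::{banach, second_countable_topology} \<times> 'x::{banach, second_countable_topology}) measure"
    and Pd :: "'d measure" and D :: "'d \<Rightarrow> real" and Pe :: "'e measure"
    and en :: "nat \<Rightarrow> nat \<Rightarrow> nat \<Rightarrow> nat" and \<pi> :: "nat \<Rightarrow> nat \<Rightarrow> (nat \<Rightarrow> 'x) \<Rightarrow> real"
  assumes Pyx: "prob_space Pyx" and sets_Pyx: "sets Pyx = sets borel"
    and Pd: "prob_space Pd" and D: "uniform01_rv Pd D" and Pe: "prob_space Pe"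
    and en': "\<And>N. bij_betw (en N) {..<2 ^ N} ({..<N} \<rightarrow>\<^sub>E {0, 1})"
    and design: "measurable_poisson_design \<pi>"
begin

definition Py :: "'y measure" where
  "Py = distr Pyx borel fst"

abbreviation "Z \<equiv> iid Pyx"
abbreviation "P \<equiv> full_space Pyx Pd Pe"
abbreviation "p \<equiv> incl_prob \<pi>"
abbreviation "S \<equiv> inclusion_indicators D en \<pi>"

lemma en: "bij_betw (en N) {..<2 ^ N} (cube N)"
  using en'[of N] by (simp add: cube_def)

lemma prob_Z: "prob_space Z" by (rule prob_space_iid[OF Pyx])

sublocale Z: prob_space Z by (rule prob_Z)

lemma prob_E: "prob_space (iid Pe)" by (rule prob_space_iid[OF Pe])

lemma P_eq: "P = Z \<Otimes>\<^sub>M (Pd \<Otimes>\<^sub>M iid Pe)"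
  by (simp add: full_space_def)

lemma prob_P: "prob_space P"
proof -
  interpret D: prob_space Pd by (rule Pd)
  interpret E: prob_space "iid Pe" by (rule prob_E)
  interpret DE: pair_prob_space Pd "iid Pe" ..
  interpret P: pair_prob_space Z "Pd \<Otimes>\<^sub>M iid Pe" ..
  show ?thesis unfolding P_eq by unfold_locales
qed

sublocale P: prob_space P by (rule prob_P)

lemma fst_measurable_P [measurable]: "fst \<in> P \<rightarrow>\<^sub>M Z"
  unfolding P_eq by measurable

lemma distr_P_fst: "distr P Z fst = Z"
proof -
  interpret D: prob_space Pd by (rule Pd)
  interpret E: prob_space "iid Pe" by (rule prob_E)
  interpret DE: pair_prob_space Pd "iid Pe" ..
  show ?thesis unfolding P_eq by (rule DE.distr_pair_fst)
qed

lemma fst_Pyx [measurable]: "fst \<in> Pyx \<rightarrow>\<^sub>M borel" and snd_Pyx [measurable]: "snd \<in> Pyx \<rightarrow>\<^sub>M borel"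
proof -
  have e: "sets Pyx = sets ((borel :: 'y measure) \<Otimes>\<^sub>M (borel :: 'x measure))" unfolding borel_prod by (rule sets_Pyx)
  have e2: "Pyx \<rightarrow>\<^sub>M borel = (borel \<Otimes>\<^sub>M borel) \<rightarrow>\<^sub>M (borel :: 'y measure)" "Pyx \<rightarrow>\<^sub>M borel = (borel \<Otimes>\<^sub>M borel) \<rightarrow>\<^sub>M (borel :: 'x measure)"
    using e by (auto intro: measurable_cong_sets)
  show "fst \<in> Pyx \<rightarrow>\<^sub>M borel" "snd \<in> Pyx \<rightarrow>\<^sub>M borel" unfolding e2 by measurable
qed

lemma prob_Py: "prob_space Py"
  unfolding Py_def by (rule prob_space.prob_space_distr[OF Pyx fst_Pyx])

lemma sets_Py [simp]: "sets Py = sets borel" "space Py = UNIV"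
  by (simp_all add: Py_def)

lemma Y_measurable [measurable]: "(\<lambda>z. Y_of z i) \<in> Z \<rightarrow>\<^sub>M borel"
  unfolding Y_of_def by measurable

lemma distr_Y: "distr Z (iid Py) Y_of = iid Py"
proof -
  have ind: "Z.indep_vars (\<lambda>_. borel) (\<lambda>i z. fst (z i)) UNIV"
    using Z.indep_vars_compose[OF indep_vars_iid[OF Pyx], of "\<lambda>_. fst" "\<lambda>_. borel"] by (simp add: o_def)
  have "distr Z (Pi\<^sub>M UNIV (\<lambda>_::nat. borel)) (\<lambda>z. \<lambda>i\<in>UNIV. fst (z i)) = Pi\<^sub>M UNIV (\<lambda>i. distr Z borel (\<lambda>z. fst (z i)))"
    using ind by (subst (asm) Z.indep_vars_iff_distr_eq_PiM) auto
  also have "(\<lambda>i::nat. distr Z borel (\<lambda>z. fst (z i))) = (\<lambda>_. Py)"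
  proof
    fix i :: nat
    have "distr Z borel (\<lambda>z. fst (z i)) = distr (distr Z Pyx (\<lambda>z. z i)) borel fst"
      by (subst distr_distr) (auto simp: o_def)
    then show "distr Z borel (\<lambda>z. fst (z i)) = Py" by (simp add: distr_iid_component[OF Pyx] Py_def)
  qed
  finally have "distr Z (Pi\<^sub>M UNIV (\<lambda>_::nat. borel)) Y_of = iid Py"
    by (simp add: restrict_UNIV Y_of_def[abs_def])
  moreover have "sets (Pi\<^sub>M UNIV (\<lambda>_::nat. borel :: 'y measure)) = sets (iid Py)"
    by (intro sets_PiM_cong) auto
  ultimately show ?thesis by (metis distr_cong)
qed

lemma Y_of_measurable: "Y_of \<in> Z \<rightarrow>\<^sub>M iid Py"
proof -
  have "Z \<rightarrow>\<^sub>M Py = Z \<rightarrow>\<^sub>M borel" by (intro measurable_cong_sets) auto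
  then show ?thesis
    by (intro measurable_PiM_single') (use Y_measurable in \<open>auto simp: PiE_iff\<close>)
qed

lemma outer_le_Y:
  assumes "outer_le (iid Py) A \<eta>"
  shows "outer_le Z {z. Y_of z \<in> A} \<eta>" "outer_le P {\<omega>. Y_of (fst \<omega>) \<in> A} \<eta>"
proof -
  show Z: "outer_le Z {z. Y_of z \<in> A} \<eta>"
    using outer_le_distr[OF assms Y_of_measurable distr_Y] by (simp add: vimage_def)
  show "outer_le P {\<omega>. Y_of (fst \<omega>) \<in> A} \<eta>"
    using outer_le_distr[OF Z fst_measurable_P distr_P_fst] by (simp add: vimage_def)
qed

lemma measure_P_fst:
  assumes "A \<in> sets Z"
  shows "measure P {\<omega>\<in>space P. fst \<omega> \<in> A} = measure Z A"
proof -
  have "measure Z A = measure (distr P Z fst) A" by (simp add: distr_P_fst)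
  also have "\<dots> = measure P (fst -` A \<inter> space P)" by (rule measure_distr[OF fst_measurable_P assms])
  also have "fst -` A \<inter> space P = {\<omega>\<in>space P. fst \<omega> \<in> A}" by auto
  finally show ?thesis by simp
qed

lemma converges_in_probability_fst:
  "converges_in_probability P (\<lambda>N (z, d, e). T N z) c \<longleftrightarrow> converges_in_probability Z T c"
proof -
  have eq: "(\<lambda>(z, d, e). T N z) = (\<lambda>\<omega>. T N (fst \<omega>))" for N by auto
  have meas: "(\<lambda>\<omega>. T N (fst \<omega>)) \<in> borel_measurable P \<longleftrightarrow> T N \<in> borel_measurable Z" for N
  proof
    assume m: "(\<lambda>\<omega>. T N (fst \<omega>)) \<in> borel_measurable P"
    interpret D: prob_space Pd by (rule Pd)
    interpret E: prob_space "iid Pe" by (rule prob_E)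
    interpret DE: pair_prob_space Pd "iid Pe" ..
    \<comment> \<open>The section through a fixed point of the other factors gives measurability
      back on the population space.\<close>
    obtain w where w: "w \<in> space (Pd \<Otimes>\<^sub>M iid Pe)" using DE.not_empty by blast
    have "(\<lambda>z. T N (fst (z, w))) \<in> borel_measurable Z"
      by (rule measurable_compose[OF _ m]) (use w in \<open>simp add: P_eq\<close>)
    then show "T N \<in> borel_measurable Z" by simp
  qed (rule measurable_compose[OF fst_measurable_P])
  have m: "measure P {\<omega>\<in>space P. \<epsilon> < \<bar>T N (fst \<omega>) - c\<bar>} = measure Z {z\<in>space Z. \<epsilon> < \<bar>T N z - c\<bar>}"
    if [measurable]: "T N \<in> borel_measurable Z" for N \<epsilon>
  proof -
    have "{\<omega>\<in>space P. \<epsilon> < \<bar>T N (fst \<omega>) - c\<bar>} = {\<omega>\<in>space P. fst \<omega> \<in> {z\<in>space Z. \<epsilon> < \<bar>T N z - c\<bar>}}"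
      using measurable_space[OF fst_measurable_P] by auto
    then show ?thesis by (simp only:) (rule measure_P_fst, measurable)
  qed
  show ?thesis unfolding converges_in_probability_def eq meas using m by auto
qed

lemma X_vec_space: "X_vec N z \<in> {..<N} \<rightarrow>\<^sub>E UNIV"
  by (simp add: X_vec_def)

lemma p_bounds: "i < N \<Longrightarrow> 0 < p N z i \<and> p N z i \<le> 1"
  using design X_vec_space[of N z] unfolding measurable_poisson_design_def incl_prob_def by blast

lemma p_bounds': "i < N \<Longrightarrow> 0 \<le> p N z i \<and> p N z i \<le> 1"
  using p_bounds[of i N z] by simp

lemma design_prob_measurable: "s \<in> cube N \<Longrightarrow> (\<lambda>z. design_prob N (p N z) s) \<in> borel_measurable Z"
proof -
  assume s: "s \<in> cube N"
  have X: "X_vec N \<in> Z \<rightarrow>\<^sub>M Pi\<^sub>M {..<N} (\<lambda>_. borel)"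
    unfolding X_vec_def[abs_def] by (rule measurable_restrict) measurable
  have m: "(\<lambda>x. design_prob N (\<lambda>i. \<pi> N i x) s) \<in> borel_measurable (Pi\<^sub>M {..<N} (\<lambda>_. borel))"
    using design s unfolding measurable_poisson_design_def cube_def by blast
  have eq: "p N = (\<lambda>z i. \<pi> N i (X_vec N z))"
    by (intro ext) (simp add: incl_prob_def)
  show ?thesis unfolding eq by (rule measurable_compose[OF X m])
qed

text \<open>Measurability is assumed for the probabilities of whole samples; an inclusion
  probability is recovered as the mean of its indicator.\<close>

lemma p_measurable: "i < N \<Longrightarrow> (\<lambda>z. p N z i) \<in> borel_measurable Z"
proof -
  assume i: "i < N"
  have eq: "(\<lambda>z. p N z i) = (\<lambda>z. \<Sum>s\<in>cube N. design_prob N (p N z) s * real (s i))"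
    by (rule ext) (use bexp_coordinate[OF i, where \<phi>=real] in \<open>simp add: bexp_def\<close>)
  show ?thesis by (subst eq) (intro borel_measurable_sum borel_measurable_times design_prob_measurable borel_measurable_const)
qed

lemma
  fixes u :: "(nat \<Rightarrow> 'y \<times> 'x) \<Rightarrow> (nat \<Rightarrow> nat) \<Rightarrow> real"
  assumes u: "\<And>s. (\<lambda>z. u z s) \<in> borel_measurable Z" and B: "\<And>z s. z \<in> space Z \<Longrightarrow> \<bar>u z s\<bar> \<le> B"
  shows P_measurable: "(\<lambda>(z, d, e). u z (S N z d)) \<in> borel_measurable P"
    and P_integral: "(\<integral>\<omega>. (case \<omega> of (z, d, e) \<Rightarrow> u z (S N z d)) \<partial>P) = (\<integral>z. bexp N (p N z) (u z) \<partial>Z)"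
  using integral_full_space[where p="p N" and u=u and B=B and N=N and en="en N" and M=Z and Pd=Pd and D=D and Pe'="iid Pe",
      OF Pd D prob_Z prob_E design_prob_measurable en p_bounds' u B]
  unfolding P_eq inclusion_indicators_def by simp_all

text \<open>The bounded case is applied to \<open>arctan\<close>, and \<open>tan\<close> undoes
  it.\<close>

lemma S_measurable:
  assumes u: "\<And>s. (\<lambda>z. u z s :: real) \<in> borel_measurable Z"
  shows "(\<lambda>(z, d, e). u z (S N z d)) \<in> borel_measurable P"
proof -
  have b: "\<bar>arctan y\<bar> \<le> 2" for y
    using arctan_lbound[of y] arctan_ubound[of y] pi_less_4 by linarith
  have "(\<lambda>(z, d, e). arctan (u z (S N z d))) \<in> borel_measurable P"
    by (rule P_measurable[where u="\<lambda>z s. arctan (u z s)" and B=2])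
       (use u in \<open>auto intro!: b measurable_compose[OF _ borel_measurable_continuous_onI[OF continuous_on_arctan[OF continuous_on_id]]]\<close>)
  then have "(\<lambda>\<omega>. arctan (u (fst \<omega>) (S N (fst \<omega>) (fst (snd \<omega>))))) \<in> borel_measurable P" by (simp add: split_beta')
  then have "(\<lambda>\<omega>. tan (arctan (u (fst \<omega>) (S N (fst \<omega>) (fst (snd \<omega>)))))) \<in> borel_measurable P"
    unfolding tan_def by measurable
  then show ?thesis by (simp add: tan_arctan split_beta')
qed

lemma
  assumes m: "\<And>s. {z\<in>space Z. Q z s} \<in> sets Z"
  shows P_event: "{\<omega>\<in>space P. Q (fst \<omega>) (S N (fst \<omega>) (fst (snd \<omega>)))} \<in> sets P"
    and P_prob: "measure P {\<omega>\<in>space P. Q (fst \<omega>) (S N (fst \<omega>) (fst (snd \<omega>)))}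
      = (\<integral>z. bexp N (p N z) (\<lambda>s. if Q z s then 1 else 0) \<partial>Z)"
proof -
  let ?u = "\<lambda>z s. if Q z s then 1 else 0 :: real"
  have u: "(\<lambda>z. ?u z s) \<in> borel_measurable Z" for s
    by (intro measurable_If) (use m in auto)
  have B: "\<bar>?u z s\<bar> \<le> 1" for z s by simp
  note mm = P_measurable[OF u B, where N=N]
  let ?A = "{\<omega>\<in>space P. Q (fst \<omega>) (S N (fst \<omega>) (fst (snd \<omega>)))}"
  have "?A = (\<lambda>(z, d, e). ?u z (S N z d)) -` {1} \<inter> space P" by (auto split: if_splits)
  also have "\<dots> \<in> sets P" by (rule measurable_sets[OF mm]) simp
  finally show A: "?A \<in> sets P" .
  have "measure P ?A = (\<integral>\<omega>. indicator ?A \<omega> \<partial>P)" using A by simp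
  also have "\<dots> = (\<integral>\<omega>. (case \<omega> of (z, d, e) \<Rightarrow> ?u z (S N z d)) \<partial>P)"
    by (rule Bochner_Integration.integral_cong) (auto simp: indicator_def)
  also have "\<dots> = (\<integral>z. bexp N (p N z) (\<lambda>s. if Q z s then 1 else 0) \<partial>Z)" by (rule P_integral[OF u B])
  finally show "measure P ?A = (\<integral>z. bexp N (p N z) (\<lambda>s. if Q z s then 1 else 0) \<partial>Z)" .
qed

end

subsection \<open>Characteristic functions under the design\<close>

text \<open>The product of \<open>1 - w + w^2/2\<close> and \<open>1 + w + w^2/2\<close> is
  \<open>1 + w^4/4\<close>, hence at least 1, and the second factor is below
  \<open>exp w\<close>.\<close>

lemma exp_minus_le_quadratic:
  assumes "0 \<le> (w::real)"
  shows "exp (- w) \<le> 1 - w + w\<^sup>2 / 2"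
proof -
  have 1: "1 + w + w\<^sup>2 / 2 \<le> exp w" by (rule exp_lower_Taylor_quadratic[OF assms])
  have pos: "0 < 1 + w + w\<^sup>2 / 2" using assms by (simp add: add_pos_nonneg)
  have "exp (- w) = 1 / exp w" unfolding exp_minus inverse_eq_divide ..
  also have "\<dots> \<le> 1 / (1 + w + w\<^sup>2 / 2)" using 1 pos by (simp add: frac_le)
  also have "\<dots> \<le> 1 - w + w\<^sup>2 / 2"
  proof -
    define u where "u = w\<^sup>2 / 2"
    have "w * w = 2 * u" by (simp add: u_def power2_eq_square)
    moreover have "(1 - w + u) * (1 + w + u) = 1 + 2 * u + u * u - w * w" by (simp add: ring_distribs)
    ultimately have "(1 - w + u) * (1 + w + u) = 1 + u * u" by simp
    then have "1 \<le> (1 - w + w\<^sup>2 / 2) * (1 + w + w\<^sup>2 / 2)" by (simp add: u_def)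
    then show ?thesis using pos by (simp add: pos_divide_le_eq)
  qed
  finally show ?thesis .
qed

text \<open>One design weight times \<open>x\<close> takes the values \<open>(1 / q - 1) * x\<close>
  and \<open>- x\<close>, with mean 0 and variance \<open>(1 / q - 1) * x^2\<close>. The error is
  proportional to this variance, so errors of many factors add up to a multiple of the total design
  variance.\<close>

lemma two_point_char_approx:
  fixes x q c \<tau> :: real
  assumes q: "0 < q" "q \<le> 1" "1 / q \<le> c" and x: "\<bar>x\<bar> \<le> \<tau>"
  shows "cmod (q *\<^sub>R iexp ((1 / q - 1) * x) + (1 - q) *\<^sub>R iexp (- x) - of_real (exp (- ((1 / q - 1) * x\<^sup>2 / 2))))
    \<le> c * (\<tau> + \<tau>\<^sup>2) * ((1 / q - 1) * x\<^sup>2)"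
proof -
  define a where "a = 1 / q - 1"
  define v where "v = a * x\<^sup>2"
  have c1: "1 \<le> 1 / q" using q by simp
  have a: "0 \<le> a" "a \<le> c" "1 \<le> c" unfolding a_def using q(3) c1 by linarith+
  have qa: "q * a = 1 - q" using q by (simp add: a_def right_diff_distrib)
  have \<tau>: "0 \<le> \<tau>" using x by simp
  have v: "0 \<le> v" using a by (simp add: v_def)
  \<comment> \<open>The variance of the weight with values \<open>a\<close> and -1.\<close>
  have qa2: "q * a\<^sup>2 + (1 - q) = a"
  proof -
    have "q * a\<^sup>2 + q * a = a * (q * a + q)" by (simp add: algebra_simps power2_eq_square)
    then show ?thesis unfolding qa by simp
  qed
  have ie: "cmod (iexp y - (1 + \<i> * y - of_real (y\<^sup>2 / 2))) \<le> \<bar>y\<bar> ^ 3 / 6" for y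
    using iexp_approx1[of y 2] by (simp add: numeral_eq_Suc power2_eq_square algebra_simps)
  have e1: "cmod (q *\<^sub>R (iexp (a * x) - (1 + \<i> * (a * x) - of_real ((a * x)\<^sup>2 / 2)))) \<le> q * (\<bar>a * x\<bar> ^ 3 / 6)"
    unfolding norm_scaleR using mult_left_mono[OF ie[of "a * x"], of q] q by (simp only: abs_of_nonneg less_imp_le)
  have e2: "cmod ((1 - q) *\<^sub>R (iexp (- x) - (1 + \<i> * (- x) - of_real ((- x)\<^sup>2 / 2)))) \<le> (1 - q) * (\<bar>- x\<bar> ^ 3 / 6)"
    unfolding norm_scaleR using mult_left_mono[OF ie[of "- x"], of "1 - q"] q by (simp only: abs_of_nonneg diff_ge_0_iff_ge)
  \<comment> \<open>The second-order Taylor polynomials average to \<open>1 - v / 2\<close>: the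
    linear terms cancel and the quadratic ones give the variance. What remains is the third absolute
    moment and the Taylor error of \<open>exp (- (v / 2))\<close>.\<close>
  have main: "q *\<^sub>R (1 + \<i> * (a * x) - of_real ((a * x)\<^sup>2 / 2)) + (1 - q) *\<^sub>R (1 + \<i> * (- x) - of_real ((- x)\<^sup>2 / 2)) = of_real (1 - v / 2)"
  proof -
    have "q * (a * x) + (1 - q) * (- x) = 0" unfolding qa[symmetric] by simp
    moreover have "q * (1 - (a * x)\<^sup>2 / 2) + (1 - q) * (1 - x\<^sup>2 / 2) = 1 - v / 2"
    proof -
      have "q * (1 - (a * x)\<^sup>2 / 2) + (1 - q) * (1 - x\<^sup>2 / 2) = 1 - (q * a\<^sup>2 + (1 - q)) * x\<^sup>2 / 2"
        by (simp add: field_simps power_mult_distrib)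
      then show ?thesis unfolding qa2 v_def .
    qed
    ultimately show ?thesis by (simp add: complex_eq_iff)
  qed
  have "q * (\<bar>a * x\<bar> ^ 3 / 6) + (1 - q) * (\<bar>- x\<bar> ^ 3 / 6) \<le> c * \<tau> * v / 6"
  proof -
    have "q * (\<bar>a * x\<bar> ^ 3) \<le> q * ((c * \<bar>x\<bar>) * (a\<^sup>2 * x\<^sup>2))"
    proof -
      have "\<bar>a * x\<bar> ^ 3 = (a * \<bar>x\<bar>) * (a\<^sup>2 * x\<^sup>2)"
        using a by (simp add: power3_eq_cube power2_eq_square abs_mult mult_ac)
      also have "\<dots> \<le> (c * \<bar>x\<bar>) * (a\<^sup>2 * x\<^sup>2)" by (intro mult_right_mono a) auto
      finally show ?thesis using q by (intro mult_left_mono) auto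
    qed
    moreover have "(1 - q) * (\<bar>- x\<bar> ^ 3) \<le> (1 - q) * ((c * \<bar>x\<bar>) * x\<^sup>2)"
    proof -
      have "\<bar>- x\<bar> ^ 3 = (1 * \<bar>x\<bar>) * x\<^sup>2" by (simp add: power3_eq_cube power2_eq_square)
      also have "\<dots> \<le> (c * \<bar>x\<bar>) * x\<^sup>2" by (intro mult_right_mono a) auto
      finally show ?thesis using q by (intro mult_left_mono) auto
    qed
    moreover have "q * ((c * \<bar>x\<bar>) * (a\<^sup>2 * x\<^sup>2)) + (1 - q) * ((c * \<bar>x\<bar>) * x\<^sup>2) = (c * \<bar>x\<bar>) * v"
    proof -
      have "q * ((c * \<bar>x\<bar>) * (a\<^sup>2 * x\<^sup>2)) + (1 - q) * ((c * \<bar>x\<bar>) * x\<^sup>2) = (c * \<bar>x\<bar>) * ((q * a\<^sup>2 + (1 - q)) * x\<^sup>2)"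
        by (simp add: algebra_simps)
      then show ?thesis unfolding qa2 v_def .
    qed
    moreover have "(c * \<bar>x\<bar>) * v \<le> (c * \<tau>) * v" using a x v by (intro mult_right_mono mult_left_mono) auto
    ultimately show ?thesis by linarith
  qed
  note third_order = this
  have split: "q *\<^sub>R A + (1 - q) *\<^sub>R A' - W = q *\<^sub>R (A - B) + (1 - q) *\<^sub>R (A' - B')"
    if "q *\<^sub>R B + (1 - q) *\<^sub>R B' = W" for A B A' B' W :: complex
    unfolding that[symmetric] by (simp add: scaleR_diff_right)
  have "cmod (q *\<^sub>R iexp (a * x) + (1 - q) *\<^sub>R iexp (- x) - of_real (1 - v / 2)) \<le> c * \<tau> * v / 6"
    unfolding split[OF main] by (rule norm_triangle_le[OF order_trans[OF add_mono[OF e1 e2] third_order]])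
  moreover have "cmod (of_real (1 - v / 2) - of_real (exp (- (v / 2)))) \<le> c * \<tau>\<^sup>2 * v / 8"
  proof -
    have "\<bar>(1 - v / 2) - exp (- (v / 2))\<bar> \<le> (v / 2)\<^sup>2 / 2"
      using exp_ge_add_one_self[of "- (v/2)"] exp_minus_le_quadratic[of "v / 2"] v by simp
    also have "\<dots> = v * v / 8" by (simp add: power2_eq_square)
    also have "\<dots> \<le> (c * \<tau>\<^sup>2) * v / 8"
    proof -
      have "a * x\<^sup>2 \<le> c * \<tau>\<^sup>2" using a x by (intro mult_mono) (auto simp: abs_le_square_iff[symmetric])
      then show ?thesis using v by (intro divide_right_mono mult_right_mono) (auto simp: v_def)
    qed
    finally show ?thesis by (simp only: of_real_diff[symmetric] norm_of_real)
  qed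
  ultimately have "cmod (q *\<^sub>R iexp (a * x) + (1 - q) *\<^sub>R iexp (- x) - of_real (exp (- (v / 2)))) \<le> c * \<tau> * v / 6 + c * \<tau>\<^sup>2 * v / 8"
    by (rule norm_diff_triangle_le)
  also have "\<dots> \<le> c * (\<tau> + \<tau>\<^sup>2) * v"
  proof -
    have "0 \<le> c * \<tau> * v" "0 \<le> c * \<tau>\<^sup>2 * v" using a \<tau> v by auto
    then show ?thesis unfolding distrib_left distrib_right by linarith
  qed
  finally show ?thesis unfolding a_def v_def .
qed

text \<open>Both characteristic functions are products of factors of modulus at most 1, so the
  distance of the products is at most the sum of the distances of the factors. The phase is carried
  along as a factor \<open>iexp b\<close>.\<close>

lemma bexp_cos_approx:
  fixes x :: "nat \<Rightarrow> real"
  assumes p: "\<And>i. i < N \<Longrightarrow> L \<le> p i \<and> p i \<le> 1" and L: "L > 0" and x: "\<And>i. i < N \<Longrightarrow> \<bar>x i\<bar> \<le> \<tau>"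
  shows "\<bar>bexp N p (\<lambda>s. cos ((\<Sum>i<N. (real (s i) / p i - 1) * x i) + b)) - exp (- ((\<Sum>i<N. (1 / p i - 1) * (x i)\<^sup>2) / 2)) * cos b\<bar>
    \<le> 1 / L * (\<tau> + \<tau>\<^sup>2) * (\<Sum>i<N. (1 / p i - 1) * (x i)\<^sup>2)"
proof -
  define \<phi> where "\<phi> i = p i *\<^sub>R iexp ((1 / p i - 1) * x i) + (1 - p i) *\<^sub>R iexp (- x i)" for i
  define e :: "nat \<Rightarrow> complex" where "e i = of_real (exp (- ((1 / p i - 1) * (x i)\<^sup>2 / 2)))" for i :: nat
  let ?q = "\<Sum>i<N. (1 / p i - 1) * (x i)\<^sup>2"
  have p': "0 < p i" "p i \<le> 1" "1 / p i \<le> 1 / L" if "i < N" for i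
    using p[OF that] L by (auto intro: divide_left_mono)
  have "bexp N p (\<lambda>s. \<Prod>i<N. iexp ((real (s i) / p i - 1) * x i)) = (\<Prod>i<N. \<phi> i)"
    using bexp_prod[of N p "\<lambda>i v. iexp ((real v / p i - 1) * x i)"] by (simp add: \<phi>_def)
  then have prod: "bexp N p (\<lambda>s. iexp (\<Sum>i<N. (real (s i) / p i - 1) * x i)) = (\<Prod>i<N. \<phi> i)"
    by (simp add: exp_sum sum_distrib_left)
  have e_prod: "(\<Prod>i<N. e i) = of_real (exp (- (?q / 2)))"
    unfolding e_def of_real_prod[symmetric] exp_sum[OF finite_lessThan, symmetric] sum_negf sum_divide_distrib ..
  have cos_Re: "cos (t + b) = Re (iexp t * iexp b)" for t
    by (simp add: cis_conv_exp[symmetric] cis_mult)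
  have "bexp N p (\<lambda>s. cos ((\<Sum>i<N. (real (s i) / p i - 1) * x i) + b))
      = bexp N p (\<lambda>s. Re (iexp (\<Sum>i<N. (real (s i) / p i - 1) * x i) * iexp b))"
    by (intro bexp_cong refl) (rule cos_Re)
  also have "\<dots> = Re (bexp N p (\<lambda>s. iexp (\<Sum>i<N. (real (s i) / p i - 1) * x i)) * iexp b)"
    unfolding bexp_def by (simp add: sum_distrib_right)
  finally have 1: "bexp N p (\<lambda>s. cos ((\<Sum>i<N. (real (s i) / p i - 1) * x i) + b)) = Re ((\<Prod>i<N. \<phi> i) * iexp b)"
    unfolding prod .
  have 2: "exp (- (?q / 2)) * cos b = Re ((\<Prod>i<N. e i) * iexp b)"
    unfolding e_prod by (simp add: cis_conv_exp[symmetric])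
  have "\<bar>Re ((\<Prod>i<N. \<phi> i) * iexp b) - Re ((\<Prod>i<N. e i) * iexp b)\<bar> \<le> cmod (((\<Prod>i<N. \<phi> i) - (\<Prod>i<N. e i)) * iexp b)"
    using abs_Re_le_cmod[of "((\<Prod>i<N. \<phi> i) - (\<Prod>i<N. e i)) * iexp b"] by (simp add: algebra_simps)
  also have "\<dots> = cmod ((\<Prod>i<N. \<phi> i) - (\<Prod>i<N. e i))" by (simp add: norm_mult)
  also have "\<dots> \<le> (\<Sum>i<N. cmod (\<phi> i - e i))"
  proof (rule norm_prod_diff)
    fix i assume "i \<in> {..<N}"
    then have i: "i < N" by simp
    show "cmod (\<phi> i) \<le> 1"
    proof -
      have "cmod (\<phi> i) \<le> cmod (p i *\<^sub>R iexp ((1 / p i - 1) * x i)) + cmod ((1 - p i) *\<^sub>R iexp (- x i))"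
        unfolding \<phi>_def by (rule norm_triangle_ineq)
      also have "\<dots> = \<bar>p i\<bar> + \<bar>1 - p i\<bar>" unfolding norm_scaleR norm_exp_i_times by simp
      finally show ?thesis using p'[OF i] by simp
    qed
    have "0 \<le> 1 / p i - 1" using p'[OF i] by simp
    then show "cmod (e i) \<le> 1" unfolding e_def norm_of_real by simp
  qed
  also have "\<dots> \<le> (\<Sum>i<N. 1 / L * (\<tau> + \<tau>\<^sup>2) * ((1 / p i - 1) * (x i)\<^sup>2))"
    unfolding \<phi>_def e_def using p' x by (intro sum_mono two_point_char_approx) auto
  also have "\<dots> = 1 / L * (\<tau> + \<tau>\<^sup>2) * ?q" by (simp add: sum_distrib_left)
  finally show ?thesis unfolding 1 2 .
qed

section \<open>Design covariances and the linearization of the Hajek process\<close>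

definition dcov :: "nat \<Rightarrow> (nat \<Rightarrow> real) \<Rightarrow> (nat \<Rightarrow> 'y) \<Rightarrow> ('y \<Rightarrow> real) \<Rightarrow> ('y \<Rightarrow> real) \<Rightarrow> real" where
  "dcov N p y u v = 1 / real N * (\<Sum>i<N. (1 / p i - 1) * (u (y i) * v (y i)))"

lemma bexp_HT_process:
  assumes "\<And>i. i < N \<Longrightarrow> 0 < p i"
  shows "bexp N p (\<lambda>s. HT_process N p s y u * HT_process N p s y v) = dcov N p y u v"
proof -
  have "bexp N p (\<lambda>s. HT_process N p s y u * HT_process N p s y v) =
     bexp N p (\<lambda>s. (1 / real N) * ((\<Sum>i<N. (real (s i) / p i - 1) * u (y i)) * (\<Sum>i<N. (real (s i) / p i - 1) * v (y i))))"
    unfolding HT_process_def by (intro bexp_cong refl) (simp add: field_simps)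
  then show ?thesis unfolding bexp_cmult dcov_def by (simp only: bexp_HT_product[OF assms])
qed

lemma dcov_le:
  assumes p: "\<And>i. i < N \<Longrightarrow> L \<le> p i \<and> p i \<le> 1" and L: "L > 0"
  shows "dcov N p y u u \<le> 1 / L * emp_mean N y (\<lambda>z. (u z)\<^sup>2)"
proof -
  have "(\<Sum>i<N. (1 / p i - 1) * (u (y i) * u (y i))) \<le> (\<Sum>i<N. 1 / L * (u (y i))\<^sup>2)"
  proof (rule sum_mono)
    fix i assume "i \<in> {..<N}"
    then have "1 / p i \<le> 1 / L" using p[of i] L by (auto intro: divide_left_mono)
    then have "1 / p i - 1 \<le> 1 / L" by linarith
    then show "(1 / p i - 1) * (u (y i) * u (y i)) \<le> 1 / L * (u (y i))\<^sup>2"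
      unfolding power2_eq_square by (intro mult_right_mono) auto
  qed
  then have "1 / real N * (\<Sum>i<N. (1 / p i - 1) * (u (y i) * u (y i))) \<le> 1 / real N * (1 / L * (\<Sum>i<N. (u (y i))\<^sup>2))"
    unfolding sum_distrib_left[symmetric] by (intro mult_left_mono) auto
  then show ?thesis by (simp add: dcov_def emp_mean_def mult.commute)
qed

lemma dcov_nonneg:
  assumes "\<And>i. i < N \<Longrightarrow> 0 < p i \<and> p i \<le> 1"
  shows "0 \<le> dcov N p y u u"
  unfolding dcov_def using assms by (intro mult_nonneg_nonneg[of _ "sum _ _"] sum_nonneg mult_nonneg_nonneg[OF _ zero_le_square]) auto

lemma N_hat_eq: "N > 0 \<Longrightarrow> N_hat N p s = real N + sqrt (real N) * HT_process N p s y (\<lambda>_. 1)"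
  by (simp add: N_hat_def HT_process_def sum_subtractf)

text \<open>An exact identity for the ratio estimator. The numerator is the Horvitz-Thompson process
  of \<open>u\<close> minus its empirical mean, and the denominator is
  \<open>N_hat / N\<close>.\<close>

lemma hajek_eq:
  assumes N: "N > 0" and ne: "N_hat N p s \<noteq> 0"
  shows "hajek_process N p s y u = (HT_process N p s y u - HT_process N p s y (\<lambda>_. 1) * emp_mean N y u)
    / (1 + HT_process N p s y (\<lambda>_. 1) / sqrt (real N))"
proof -
  define R where "R = HT_process N p s y (\<lambda>_. 1)"
  define T where "T = HT_process N p s y u"
  define m where "m = emp_mean N y u"
  define r where "r = sqrt (real N)"
  have r: "r > 0" "real N = r * r" using N by (auto simp: r_def)
  have Nh: "N_hat N p s = r * (r + R)" unfolding N_hat_eq[OF N, of p s y] R_def[symmetric] r_def[symmetric]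
    unfolding r(2) by (simp add: distrib_left)
  have "(\<Sum>i<N. real (s i) / p i * u (y i)) = (\<Sum>i<N. (real (s i) / p i - 1) * u (y i)) + (\<Sum>i<N. u (y i))"
    by (simp add: sum.distrib[symmetric] algebra_simps)
  also have "\<dots> = r * T + r * r * m"
  proof -
    have "r * T = (\<Sum>i<N. (real (s i) / p i - 1) * u (y i))"
      unfolding T_def HT_process_def r_def[symmetric] using r(1) by simp
    moreover have "r * r * m = (\<Sum>i<N. u (y i))"
      unfolding r(2)[symmetric] m_def emp_mean_def using N by simp
    ultimately show ?thesis by simp
  qed
  finally have s: "(\<Sum>i<N. real (s i) / p i * u (y i)) = r * T + r * r * m" .
  have rR: "r + R \<noteq> 0" using ne unfolding Nh by auto
  have "hajek_process N p s y u = r * (1 / (r * (r + R)) * (r * T + r * r * m) - m)"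
    unfolding hajek_process_def s m_def[symmetric] r_def[symmetric] using ne by (simp add: Nh)
  also have "\<dots> = (T - R * m) / (1 + R / r)"
  proof -
    define w where "w = r + R"
    have w: "w \<noteq> 0" using rR by (simp add: w_def)
    have "1 + R / r = w / r" using r(1) by (simp add: w_def add_divide_distrib)
    moreover have "1 / (r * w) * (r * T + r * r * m) = (T + r * m) / w"
      using r(1) w by (simp add: field_simps)
    moreover have "(T + r * m) / w - m = (T - R * m) / w"
      using w by (simp add: field_simps) (simp add: w_def algebra_simps)
    ultimately show ?thesis unfolding w_def[symmetric] using r(1) w by simp
  qed
  finally show ?thesis unfolding R_def T_def m_def r_def .
qed

lemma cos_diff_le: "\<bar>cos a - cos b\<bar> \<le> \<bar>a - b\<bar>" for a b :: real
proof -
  have "\<bar>sin x\<bar> \<le> \<bar>x\<bar>" for x :: real by (rule abs_sin_x_le_abs_x)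
  from this[of "(b - a)/2"] have "\<bar>sin ((a + b) / 2)\<bar> * \<bar>sin ((b - a) / 2)\<bar> \<le> 1 * \<bar>(b - a) / 2\<bar>"
    by (intro mult_mono) auto
  then show ?thesis by (simp add: cos_diff_cos abs_mult)
qed

text \<open>Useful for functions with small empirical mean. Where the denominator is at least 1/2,
  all products are split into squares of \<open>R\<close> and \<open>T\<close>, whose design means
  are bounded by \<open>1 / L\<close> times empirical second moments.\<close>

lemma bexp_hajek_HT:
  assumes p: "\<And>i. i < N \<Longrightarrow> L \<le> p i \<and> p i \<le> 1" and L: "L > 0" and N: "N > 0"
  shows "bexp N p (\<lambda>s. \<bar>cos (hajek_process N p s y u + b) - cos (HT_process N p s y u + b)\<bar>)
    \<le> 8 / L * (1 / real N) + (1 + 1 / L) * \<bar>emp_mean N y u\<bar> + 1 / L * (1 + emp_mean N y (\<lambda>z. (u z)\<^sup>2)) / sqrt (real N)"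
proof -
  define R where "R s = HT_process N p s y (\<lambda>_. 1)" for s
  define T where "T s = HT_process N p s y u" for s
  define m where "m = emp_mean N y u"
  define r where "r = sqrt (real N)"
  have r: "r > 0" using N by (simp add: r_def)
  have p0: "\<And>i. i < N \<Longrightarrow> 0 < p i" "\<And>i. i < N \<Longrightarrow> 0 \<le> p i \<and> p i \<le> 1" using p L by (auto intro: less_le_trans less_imp_le order_trans)
  have pt: "\<bar>cos (hajek_process N p s y u + b) - cos (T s + b)\<bar> \<le> 8 * (1 / real N) * (R s * R s) + \<bar>m\<bar> * (R s * R s) + \<bar>m\<bar> + 1 / r * (T s * T s) + 1 / r * (R s * R s)" for s
  proof (cases "\<bar>R s / r\<bar> \<le> 1 / 2")
    case True
    have N_hat: "N_hat N p s = r * r * (1 + R s / r)"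
      using N_hat_eq[OF N, of p s y] r by (simp add: R_def r_def field_simps)
    have d: "1 / 2 \<le> 1 + R s / r" using True by linarith
    have d0: "0 < 1 + R s / r" by (rule less_le_trans[OF _ d]) simp
    have ne: "N_hat N p s \<noteq> 0" unfolding N_hat using r d0 by simp
    define h where "h = hajek_process N p s y u"
    have h: "h = (T s - R s * m) / (1 + R s / r)"
      unfolding h_def hajek_eq[OF N ne] R_def T_def m_def r_def ..
    have "h * (1 + R s / r) = T s - R s * m" unfolding h using d0 by simp
    then have "(h - T s) * (1 + R s / r) = - (R s * m) - T s * (R s / r)"
      unfolding left_diff_distrib by (simp add: distrib_left)
    then have "\<bar>h - T s\<bar> * (1 + R s / r) = \<bar>- (R s * m) - T s * (R s / r)\<bar>" using d0 by (metis abs_mult abs_of_pos)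
    also have "\<dots> \<le> \<bar>R s\<bar> * \<bar>m\<bar> + \<bar>T s\<bar> * \<bar>R s\<bar> / r"
      using abs_triangle_ineq4[of "- (R s * m)" "T s * (R s / r)"] r by (simp add: abs_mult)
    finally have "\<bar>h - T s\<bar> * (1/2) \<le> \<bar>R s\<bar> * \<bar>m\<bar> + \<bar>T s\<bar> * \<bar>R s\<bar> / r"
      by (rule order_trans[OF mult_left_mono[OF d abs_ge_zero]])
    then have "\<bar>h - T s\<bar> \<le> \<bar>m\<bar> * (2 * \<bar>R s\<bar>) + (2 * \<bar>T s\<bar> * \<bar>R s\<bar>) / r" by (simp add: algebra_simps)
    also have "\<dots> \<le> \<bar>m\<bar> * (R s * R s + 1) + (T s * T s + R s * R s) / r"
    proof (intro add_mono mult_left_mono divide_right_mono)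
      show "2 * \<bar>R s\<bar> \<le> R s * R s + 1" using zero_le_square[of "\<bar>R s\<bar> - 1"] by (simp add: algebra_simps)
      show "2 * \<bar>T s\<bar> * \<bar>R s\<bar> \<le> T s * T s + R s * R s" using zero_le_square[of "\<bar>T s\<bar> - \<bar>R s\<bar>"] by (simp add: algebra_simps)
    qed (use r in auto)
    finally have "\<bar>h - T s\<bar> \<le> \<bar>m\<bar> * (R s * R s) + \<bar>m\<bar> + 1 / r * (T s * T s) + 1 / r * (R s * R s)"
      by (simp add: distrib_left add_divide_distrib)
    moreover have "\<bar>cos (h + b) - cos (T s + b)\<bar> \<le> \<bar>h - T s\<bar>" using cos_diff_le[of "h + b" "T s + b"] by simp
    moreover have "0 \<le> 8 * (1 / real N) * (R s * R s)" by simp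
    ultimately show ?thesis unfolding h_def by linarith
  next
    case False
    \<comment> \<open>Chebyshev's argument pointwise: where the denominator may be small, the square
      of \<open>R s / r\<close> exceeds 1/4, so 8 times this square dominates the trivial bound
      2.\<close>
    then have "(1/2)\<^sup>2 \<le> (R s / r)\<^sup>2" by (subst abs_le_square_iff[symmetric]) auto
    also have "(R s / r)\<^sup>2 = (1 / real N) * (R s * R s)" using N by (simp add: r_def power_divide power2_eq_square)
    finally have "2 \<le> 8 * (1 / real N) * (R s * R s)" by (simp add: power2_eq_square)
    moreover have "\<bar>cos (hajek_process N p s y u + b) - cos (T s + b)\<bar> \<le> 2"
      using cos_le_one[of "hajek_process N p s y u + b"] cos_ge_minus_one[of "hajek_process N p s y u + b"]
        cos_le_one[of "T s + b"] cos_ge_minus_one[of "T s + b"] by linarith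
    moreover have "0 \<le> \<bar>m\<bar> * (R s * R s)" "0 \<le> 1 / r * (T s * T s)" "0 \<le> 1 / r * (R s * R s)" using r by auto
    ultimately show ?thesis by linarith
  qed
  have RR: "bexp N p (\<lambda>s. R s * R s) \<le> 1 / L" 
    unfolding R_def by (subst bexp_HT_process) (use p0(1) dcov_le[where N=N and p=p and y=y and u="\<lambda>_. 1", OF p L] N in \<open>simp_all add: emp_mean_def\<close>)
  have TT: "bexp N p (\<lambda>s. T s * T s) \<le> 1 / L * emp_mean N y (\<lambda>z. (u z)\<^sup>2)"
    unfolding T_def by (subst bexp_HT_process) (use p0(1) dcov_le[where N=N and p=p and y=y and u=u, OF p L] in simp_all)
  have "bexp N p (\<lambda>s. \<bar>cos (hajek_process N p s y u + b) - cos (T s + b)\<bar>)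
      \<le> bexp N p (\<lambda>s. 8 * (1 / real N) * (R s * R s) + \<bar>m\<bar> * (R s * R s) + \<bar>m\<bar> + 1 / r * (T s * T s) + 1 / r * (R s * R s))"
    by (intro bexp_mono p0 pt)
  also have "\<dots> = 8 * (1 / real N) * bexp N p (\<lambda>s. R s * R s) + \<bar>m\<bar> * bexp N p (\<lambda>s. R s * R s) + \<bar>m\<bar> + 1 / r * bexp N p (\<lambda>s. T s * T s) + 1 / r * bexp N p (\<lambda>s. R s * R s)"
    unfolding bexp_add bexp_cmult bexp_const ..
  also have "\<dots> \<le> 8 * (1 / real N) * (1 / L) + \<bar>m\<bar> * (1 / L) + \<bar>m\<bar> + 1 / r * (1 / L * emp_mean N y (\<lambda>z. (u z)\<^sup>2)) + 1 / r * (1 / L)"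
    by (intro add_mono mult_left_mono RR TT order_refl) (use r in auto)
  also have "\<dots> = 8 / L * (1 / real N) + (1 + 1 / L) * \<bar>m\<bar> + 1 / L * (1 + emp_mean N y (\<lambda>z. (u z)\<^sup>2)) / r"
    by (simp add: algebra_simps add_divide_distrib)
  finally show ?thesis unfolding T_def m_def r_def .
qed

text \<open>If \<open>K < c\<close>, then off two events of vanishing probability \<open>U N\<close>
  is at least the midpoint \<open>m\<close> of \<open>K\<close> and \<open>c\<close>; by Markov's
  inequality this has probability at most \<open>K / m < 1\<close>.\<close>

lemma converges_in_probability_le:
  assumes M: "prob_space M" and T: "converges_in_probability M T c"
    and A: "\<And>N. A N \<in> sets M" "(\<lambda>N. measure M (A N)) \<longlonglongrightarrow> 1"
    and U: "\<forall>\<^sub>F N in sequentially. integrable M (U N) \<and> integral\<^sup>L M (U N) \<le> K" "\<And>N \<omega>. \<omega> \<in> space M \<Longrightarrow> 0 \<le> U N \<omega>"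
    and TU: "\<And>N \<omega>. \<omega> \<in> A N \<Longrightarrow> T N \<omega> \<le> U N \<omega>"
  shows "c \<le> K"
proof (rule ccontr)
  assume "\<not> c \<le> K"
  then have less: "K < c" by simp
  interpret prob_space M by fact
  obtain N0 where N0: "integral\<^sup>L M (U N0) \<le> K"
    using U(1) by (auto simp: eventually_sequentially)
  have "0 \<le> integral\<^sup>L M (U N0)" using U(2) by (intro integral_nonneg_AE) auto
  then have K: "0 \<le> K" using N0 by simp
  define m where "m = (K + c) / 2"
  define \<epsilon> where "\<epsilon> = (c - K) / 2"
  have m: "0 < m" "K < m" and \<epsilon>: "0 < \<epsilon>" "c - \<epsilon> = m" using K less by (auto simp: m_def \<epsilon>_def field_simps)
  have [measurable]: "T N \<in> borel_measurable M" for N using T by (simp add: converges_in_probability_def)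
  define B where "B N = {\<omega>\<in>space M. \<epsilon> < \<bar>T N \<omega> - c\<bar>}" for N
  have B: "(\<lambda>N. measure M (B N)) \<longlonglongrightarrow> 0" using T \<epsilon>(1) by (simp add: converges_in_probability_def B_def)
  have [measurable]: "B N \<in> sets M" for N unfolding B_def by measurable
  have "1 \<le> 0 + (1 - 1) + K / m"
  proof (rule tendsto_lowerbound)
    show "((\<lambda>N. measure M (B N) + (1 - measure M (A N)) + K / m) \<longlongrightarrow> 0 + (1 - 1) + K / m) sequentially"
      by (intro tendsto_intros B A)
    show "\<forall>\<^sub>F N in sequentially. 1 \<le> measure M (B N) + (1 - measure M (A N)) + K / m"
      using U(1)
    proof eventually_elim
      case (elim N)
      then have [measurable]: "U N \<in> borel_measurable M" by auto
      have C [measurable]: "{\<omega>\<in>space M. U N \<omega> \<ge> m} \<in> sets M" by measurable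
      have "measure M {\<omega>\<in>space M. U N \<omega> \<ge> m} \<le> integral\<^sup>L M (U N) / m"
        by (rule integral_Markov_inequality_measure[OF _ sets.empty_sets]) (use elim U(2) m in auto)
      also have "\<dots> \<le> K / m" using elim m by (simp add: divide_right_mono)
      finally have c: "measure M {\<omega>\<in>space M. U N \<omega> \<ge> m} \<le> K / m" .
      have "space M \<subseteq> (B N \<union> (space M - A N)) \<union> {\<omega>\<in>space M. U N \<omega> \<ge> m}"
      proof
        fix \<omega> assume \<omega>: "\<omega> \<in> space M"
        show "\<omega> \<in> (B N \<union> (space M - A N)) \<union> {\<omega>\<in>space M. U N \<omega> \<ge> m}"
          using \<omega> TU[of \<omega> N] \<epsilon> by (auto simp: B_def not_less)
      qed
      then have "measure M (space M) \<le> measure M ((B N \<union> (space M - A N)) \<union> {\<omega>\<in>space M. U N \<omega> \<ge> m})"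
        using A(1)[of N] C by (intro finite_measure_mono) auto
      also have "\<dots> \<le> measure M (B N \<union> (space M - A N)) + measure M {\<omega>\<in>space M. U N \<omega> \<ge> m}"
        using A(1)[of N] C by (intro measure_Un_le) auto
      also have "\<dots> \<le> (measure M (B N) + measure M (space M - A N)) + K / m"
        using A(1)[of N] c by (intro add_mono measure_Un_le) auto
      finally show ?case using A(1)[of N] by (simp add: prob_space prob_compl)
    qed
  qed simp
  then show False using m by simp
qed

lemma converges_in_probability_nonneg:
  assumes M: "prob_space M" and T: "converges_in_probability M T c" and n: "\<And>N \<omega>. \<omega> \<in> space M \<Longrightarrow> 0 \<le> T N \<omega>"
  shows "0 \<le> c"
proof -
  have "- 1 * c \<le> 0"
    by (rule converges_in_probability_le[OF M converges_in_probability_mult[OF M converges_in_probability_const T], of "\<lambda>_. space M" "\<lambda>_ _. 0"])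
       (use n prob_space.prob_space[OF M] in auto)
  then show ?thesis by simp
qed

lemma converges_in_probability_unique:
  assumes M: "prob_space M" and T: "converges_in_probability M T c" "converges_in_probability M T d"
  shows "c = d"
proof (rule antisym)
  have *: "c \<le> d" if "converges_in_probability M T c" "converges_in_probability M T d" for c d
  proof -
    have "0 \<le> d + - 1 * c"
      by (rule converges_in_probability_nonneg[OF M converges_in_probability_add[OF M that(2) converges_in_probability_mult[OF M converges_in_probability_const that(1)]]]) simp
    then show ?thesis by simp
  qed
  show "c \<le> d" "d \<le> c" using T by (auto intro: *)
qed

lemma dcov_sym: "dcov N p y u v = dcov N p y v u"
  by (simp add: dcov_def mult.commute)

text \<open>The shifts are arbitrary numbers, so the same expansion serves for centring at the mean
  and at the empirical mean.\<close>

lemma dcov_shift: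
  "dcov N p y (\<lambda>x. u x - a) (\<lambda>x. v x - b) =
    dcov N p y u v + - a * dcov N p y (\<lambda>_. 1) v + - b * dcov N p y (\<lambda>_. 1) u + a * b * dcov N p y (\<lambda>_. 1) (\<lambda>_. 1)"
proof -
  have "(\<Sum>i<N. (1 / p i - 1) * ((u (y i) - a) * (v (y i) - b))) = (\<Sum>i<N. (1 / p i - 1) * (u (y i) * v (y i)))
    + - a * (\<Sum>i<N. (1 / p i - 1) * (1 * v (y i))) + - b * (\<Sum>i<N. (1 / p i - 1) * (1 * u (y i))) + a * b * (\<Sum>i<N. (1 / p i - 1) * (1 * 1))"
    unfolding sum_distrib_left sum.distrib[symmetric] by (intro sum.cong refl) (simp add: ring_distribs)
  then show ?thesis unfolding dcov_def by (simp add: ring_distribs add_divide_distrib diff_divide_distrib)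
qed

lemma dcov_sum:
  "dcov N p y (\<lambda>x. \<Sum>i\<in>A. a i * u i x) (\<lambda>x. \<Sum>i\<in>A. a i * u i x) = (\<Sum>i\<in>A. \<Sum>j\<in>A. (a i * a j) * dcov N p y (u i) (u j))"
proof -
  have "dcov N p y (\<lambda>x. \<Sum>i\<in>A. a i * u i x) (\<lambda>x. \<Sum>i\<in>A. a i * u i x)
     = (\<Sum>k<N. \<Sum>i\<in>A. \<Sum>j\<in>A. (a i * a j) * (1 / real N * ((1 / p k - 1) * (u i (y k) * u j (y k)))))"
    unfolding dcov_def sum_distrib_left[of "1 / real N"]
    by (intro sum.cong refl) (simp add: sum_product sum_distrib_left sum_divide_distrib mult_ac)
  also have "\<dots> = (\<Sum>i\<in>A. \<Sum>j\<in>A. \<Sum>k<N. (a i * a j) * (1 / real N * ((1 / p k - 1) * (u i (y k) * u j (y k)))))"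
    by (subst sum.swap) (intro sum.cong refl sum.swap)
  also have "\<dots> = (\<Sum>i\<in>A. \<Sum>j\<in>A. (a i * a j) * dcov N p y (u i) (u j))"
    unfolding dcov_def sum_distrib_left[symmetric] ..
  finally show ?thesis .
qed

section \<open>Measurability and moments in the survey model\<close>

context poisson_survey
begin

lemma lower_bound_sets: "{z\<in>space Z. \<forall>i<N. c \<le> p N z i} \<in> sets Z"
proof -
  have "{z\<in>space Z. \<forall>i\<in>{..<N}. c \<le> p N z i} \<in> sets Z"
  proof (rule sets.sets_Collect_finite_All)
    fix i assume "i \<in> {..<N}"
    then have [measurable]: "(\<lambda>z. p N z i) \<in> borel_measurable Z" using p_measurable by simp
    show "{z\<in>space Z. c \<le> p N z i} \<in> sets Z" by measurable
  qed simp
  then show ?thesis by (simp only: Ball_def lessThan_iff)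
qed

lemma bexp_measurable:
  assumes "\<And>s. (\<lambda>z. g z s :: real) \<in> borel_measurable Z"
  shows "(\<lambda>z. bexp N (p N z) (g z)) \<in> borel_measurable Z"
  unfolding bexp_def using assms design_prob_measurable by (intro borel_measurable_sum borel_measurable_scaleR) auto

lemma u_Y_measurable: "u \<in> borel_measurable borel \<Longrightarrow> (\<lambda>z. u (Y_of z i)) \<in> borel_measurable Z"
  by (rule measurable_compose[OF Y_measurable])

lemma emp_mean_measurable: "u \<in> borel_measurable borel \<Longrightarrow> (\<lambda>z. emp_mean N (Y_of z) u) \<in> borel_measurable Z"
  unfolding emp_mean_def by (intro borel_measurable_times borel_measurable_const borel_measurable_sum u_Y_measurable)

lemma dcov_measurable:
  assumes "u \<in> borel_measurable borel" "v \<in> borel_measurable borel"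
  shows "(\<lambda>z. dcov N (p N z) (Y_of z) u v) \<in> borel_measurable Z"
  unfolding dcov_def using assms
  by (intro borel_measurable_times borel_measurable_const borel_measurable_sum u_Y_measurable borel_measurable_diff borel_measurable_divide p_measurable) auto

lemma HT_measurable: "u \<in> borel_measurable borel \<Longrightarrow> (\<lambda>z. HT_process N (p N z) s (Y_of z) u) \<in> borel_measurable Z"
  unfolding HT_process_def
  by (intro borel_measurable_times borel_measurable_const borel_measurable_sum u_Y_measurable borel_measurable_diff borel_measurable_divide p_measurable) auto

lemma hajek_measurable: "u \<in> borel_measurable borel \<Longrightarrow> (\<lambda>z. hajek_process N (p N z) s (Y_of z) u) \<in> borel_measurable Z"
proof -
  assume u: "u \<in> borel_measurable borel"
  have [measurable]: "(\<lambda>z. N_hat N (p N z) s) \<in> borel_measurable Z"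
    unfolding N_hat_def by (intro borel_measurable_sum borel_measurable_divide borel_measurable_const p_measurable) auto
  have [measurable]: "(\<lambda>z. \<Sum>i<N. real (s i) / p N z i * u (Y_of z i)) \<in> borel_measurable Z"
    by (intro borel_measurable_sum borel_measurable_divide borel_measurable_times borel_measurable_const p_measurable u_Y_measurable u) auto
  note emp_mean_measurable[OF u, measurable]
  show ?thesis unfolding hajek_process_def by measurable
qed

lemma integrable_Py:
  fixes u :: "'y \<Rightarrow> real"
  assumes "u \<in> borel_measurable borel"
  shows "integrable Pyx (\<lambda>w. u (fst w)) \<longleftrightarrow> integrable Py u" "(\<integral>w. u (fst w) \<partial>Pyx) = integral\<^sup>L Py u"
  unfolding Py_def using assms integrable_distr_eq[OF fst_Pyx, of u] integral_distr[OF fst_Pyx, of u] by auto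

lemma
  fixes u :: "'y \<Rightarrow> real"
  assumes u: "u \<in> borel_measurable borel" and i: "integrable Py u"
  shows integrable_emp_mean: "integrable Z (\<lambda>z. emp_mean N (Y_of z) u)"
    and integral_emp_mean: "N > 0 \<Longrightarrow> (\<integral>z. emp_mean N (Y_of z) u \<partial>Z) = integral\<^sup>L Py u"
proof -
  have m: "(\<lambda>w. u (fst w)) \<in> borel_measurable Pyx" using u by measurable
  have k: "integrable Z (\<lambda>z. u (Y_of z k))" "(\<integral>z. u (Y_of z k) \<partial>Z) = integral\<^sup>L Py u" for k
    using integral_iid_component[OF Pyx m, of k] integrable_Py[OF u] i by (simp_all add: Y_of_def)
  then show "integrable Z (\<lambda>z. emp_mean N (Y_of z) u)" unfolding emp_mean_def by simp
  show "(\<integral>z. emp_mean N (Y_of z) u \<partial>Z) = integral\<^sup>L Py u" if "N > 0"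
    unfolding emp_mean_def using k that by simp
qed

lemma
  fixes u :: "'y \<Rightarrow> real"
  assumes u: "u \<in> borel_measurable borel" and i: "integrable Py u" "integrable Py (\<lambda>y. (u y)\<^sup>2)" "integral\<^sup>L Py u = 0"
  shows integrable_emp_mean_square: "integrable Z (\<lambda>z. (emp_mean N (Y_of z) u)\<^sup>2)"
    and integral_emp_mean_square: "N > 0 \<Longrightarrow> (\<integral>z. (emp_mean N (Y_of z) u)\<^sup>2 \<partial>Z) = (1 / real N) * (\<integral>y. (u y)\<^sup>2 \<partial>Py)"
proof -
  have u2: "(\<lambda>y. (u y)\<^sup>2) \<in> borel_measurable borel" using u by measurable
  have i': "integrable Pyx (\<lambda>w. u (fst w))" "integrable Pyx (\<lambda>w. (u (fst w))\<^sup>2)" "(\<integral>w. u (fst w) \<partial>Pyx) = 0"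
    using integrable_Py[OF u] integrable_Py[OF u2] i by simp_all
  note sq = sum_iid_square[OF Pyx i' finite_lessThan[of N]]
  have eq: "(emp_mean N (Y_of z) u)\<^sup>2 = (1 / (real N)\<^sup>2) * (\<Sum>k<N. u (fst (z k)))\<^sup>2" for z
    by (simp add: emp_mean_def Y_of_def power_mult_distrib power_divide)
  show "integrable Z (\<lambda>z. (emp_mean N (Y_of z) u)\<^sup>2)" unfolding eq using sq(1) by simp
  show "(\<integral>z. (emp_mean N (Y_of z) u)\<^sup>2 \<partial>Z) = (1 / real N) * (\<integral>y. (u y)\<^sup>2 \<partial>Py)" if "N > 0"
    unfolding eq using sq(2) that integrable_Py(2)[OF u2] by (simp add: power2_eq_square)
qed

lemma emp_mean_converges:
  fixes u :: "'y \<Rightarrow> real"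
  assumes u: "u \<in> borel_measurable borel" and i: "integrable Py u" "integrable Py (\<lambda>y. (u y)\<^sup>2)" "integral\<^sup>L Py u = 0"
  shows "converges_in_probability Z (\<lambda>N z. emp_mean N (Y_of z) u) 0"
  unfolding converges_in_probability_def
proof (intro conjI allI impI emp_mean_measurable u)
  fix \<epsilon> :: real assume \<epsilon>: "\<epsilon> > 0"
  note emp_mean_measurable[OF u, measurable]
  let ?\<sigma> = "\<integral>y. (u y)\<^sup>2 \<partial>Py"
  show "(\<lambda>N. measure Z {z \<in> space Z. \<epsilon> < \<bar>emp_mean N (Y_of z) u - 0\<bar>}) \<longlonglongrightarrow> 0"
  proof (rule tendsto_sandwich[OF always_eventually _ tendsto_const])
    show "(\<lambda>N. (1 / real N) * ?\<sigma> / \<epsilon>\<^sup>2) \<longlonglongrightarrow> 0"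
      using lim_1_over_n by (intro tendsto_divide_zero tendsto_mult_left_zero) auto
    show "\<forall>\<^sub>F N in sequentially. measure Z {z \<in> space Z. \<epsilon> < \<bar>emp_mean N (Y_of z) u - 0\<bar>} \<le> (1 / real N) * ?\<sigma> / \<epsilon>\<^sup>2"
      using eventually_gt_at_top[of 0]
    proof eventually_elim
      case (elim N)
      have "measure Z {z \<in> space Z. \<epsilon> < \<bar>emp_mean N (Y_of z) u - 0\<bar>} \<le> measure Z {z \<in> space Z. (emp_mean N (Y_of z) u)\<^sup>2 \<ge> \<epsilon>\<^sup>2}"
        using \<epsilon> by (intro Z.finite_measure_mono) (auto simp: abs_le_square_iff[symmetric])
      also have "\<dots> \<le> (\<integral>z. (emp_mean N (Y_of z) u)\<^sup>2 \<partial>Z) / \<epsilon>\<^sup>2"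
        using \<epsilon> integrable_emp_mean_square[OF u i] by (intro integral_Markov_inequality_measure[OF _ sets.empty_sets]) auto
      finally show ?case unfolding integral_emp_mean_square[OF u i elim] .
    qed
  qed simp
qed

text \<open>Covers both processes: the centred one is the Horvitz-Thompson process of a function
  \<open>w u\<close> that may depend on the population.\<close>

lemma design_cov_eq:
  assumes G: "\<And>s u. G N (p N z) s (Y_of z) u = HT_process N (p N z) s (Y_of z) (w u)"
  shows "design_cov G Pd D en \<pi> f g N z = dcov N (p N z) (Y_of z) (w f) (w g)"
  unfolding design_cov_def G inclusion_indicators_def
  by (subst integral_poisson_sample[OF Pd D en p_bounds', where \<phi>="\<lambda>s. HT_process N (p N z) s (Y_of z) (w f) * HT_process N (p N z) s (Y_of z) (w g)"])
     (auto intro!: bexp_HT_process p_bounds simp: p_bounds)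

lemma design_cov_HT: "design_cov HT_process Pd D en \<pi> f g N z = dcov N (p N z) (Y_of z) f g"
  by (rule design_cov_eq) simp

lemma design_cov_centred: "design_cov centred_HT_process Pd D en \<pi> f g N z =
    dcov N (p N z) (Y_of z) (\<lambda>y. f y - emp_mean N (Y_of z) f) (\<lambda>y. g y - emp_mean N (Y_of z) g)"
  by (rule design_cov_eq) (simp add: centred_HT_process_def HT_process_def)

text \<open>The Lindeberg condition: the union bound gives \<open>real N\<close> times one tail
  probability, which is at most \<open>1 / \<tau>\<^sup>2\<close> times a truncated second moment,
  and that tends to 0 by dominated convergence.\<close>

lemma max_negligible:
  fixes u :: "'y \<Rightarrow> real"
  assumes u: "u \<in> borel_measurable borel" and i: "integrable Py (\<lambda>y. (u y)\<^sup>2)" and \<tau>: "\<tau> > 0"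
  shows "(\<lambda>N. measure Z {z\<in>space Z. \<exists>i<N. \<tau> * sqrt (real N) < \<bar>u (Y_of z i)\<bar>}) \<longlonglongrightarrow> 0"
proof (rule tendsto_sandwich[OF always_eventually _ tendsto_const])
  interpret Y: prob_space Py by (rule prob_Py)
  note u[measurable]
  let ?A = "\<lambda>N. {y. \<tau> * sqrt (real N) < \<bar>u y\<bar>}"
  have A: "?A N \<in> sets borel" for N by measurable
  have "u \<in> borel_measurable Py" using u by (simp add: measurable_cong_sets[OF sets_Py(1) refl])
  then have im: "(\<lambda>y. indicator (?A N) y * (u y)\<^sup>2) \<in> borel_measurable Py" for N
    using A by (intro borel_measurable_times borel_measurable_power borel_measurable_indicator) auto
  have "(\<lambda>N. \<integral>y. indicator (?A N) y * (u y)\<^sup>2 \<partial>Py) \<longlonglongrightarrow> (\<integral>y. 0 \<partial>Py)"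
  proof (rule integral_dominated_convergence[where w="\<lambda>y. (u y)\<^sup>2"])
    show "AE y in Py. (\<lambda>N. indicator (?A N) y * (u y)\<^sup>2) \<longlonglongrightarrow> 0"
    proof (rule AE_I2, rule tendsto_eventually)
      fix y
      have "filterlim (\<lambda>N. \<tau> * sqrt (real N)) at_top sequentially"
        using \<tau> by (intro filterlim_tendsto_pos_mult_at_top[OF tendsto_const] filterlim_compose[OF sqrt_at_top] filterlim_real_sequentially)
      then have "\<forall>\<^sub>F N in sequentially. \<bar>u y\<bar> < \<tau> * sqrt (real N)" by (simp add: filterlim_at_top_dense)
      then show "\<forall>\<^sub>F N in sequentially. indicator (?A N) y * (u y)\<^sup>2 = 0"
        by eventually_elim auto
    qed
  qed (use i im in \<open>auto simp: indicator_def\<close>)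
  then have lim: "(\<lambda>N. (1 / \<tau>\<^sup>2) * (\<integral>y. indicator (?A N) y * (u y)\<^sup>2 \<partial>Py)) \<longlonglongrightarrow> 0"
    by (intro tendsto_mult_right_zero) simp
  show "(\<lambda>N. (1 / \<tau>\<^sup>2) * (\<integral>y. indicator (?A N) y * (u y)\<^sup>2 \<partial>Py)) \<longlonglongrightarrow> 0" by (rule lim)
  show "\<forall>\<^sub>F N in sequentially. measure Z {z\<in>space Z. \<exists>i<N. \<tau> * sqrt (real N) < \<bar>u (Y_of z i)\<bar>}
      \<le> (1 / \<tau>\<^sup>2) * (\<integral>y. indicator (?A N) y * (u y)\<^sup>2 \<partial>Py)"
  proof (rule always_eventually, rule allI)
    fix N
    note Y_measurable[measurable]
    have one: "measure Z {z\<in>space Z. \<tau> * sqrt (real N) < \<bar>u (Y_of z k)\<bar>} = measure Py (?A N)" for k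
    proof -
      have m: "(\<lambda>w. indicator (?A N) (fst w) :: real) \<in> borel_measurable Pyx" using A by measurable
      have "measure Z {z\<in>space Z. \<tau> * sqrt (real N) < \<bar>u (Y_of z k)\<bar>} = (\<integral>z. indicator (?A N) (fst (z k)) \<partial>Z)"
        by (subst Bochner_Integration.integral_cong[where g="indicator {z\<in>space Z. \<tau> * sqrt (real N) < \<bar>u (Y_of z k)\<bar>}"])
           (auto simp: indicator_def Y_of_def)
      also have "\<dots> = (\<integral>w. indicator (?A N) (fst w) \<partial>Pyx)" by (rule integral_iid_component(1)[OF Pyx m])
      also have "\<dots> = (\<integral>y. indicator (?A N) y \<partial>Py)" by (rule integrable_Py(2)) (use A in measurable)
      also have "\<dots> = measure Py (?A N)" using A by simp
      finally show ?thesis .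
    qed
    have "measure Z {z\<in>space Z. \<exists>i<N. \<tau> * sqrt (real N) < \<bar>u (Y_of z i)\<bar>} = measure Z (\<Union>i\<in>{..<N}. {z\<in>space Z. \<tau> * sqrt (real N) < \<bar>u (Y_of z i)\<bar>})"
      by (rule arg_cong[where f="measure Z"]) auto
    also have "\<dots> \<le> (\<Sum>i<N. measure Z {z\<in>space Z. \<tau> * sqrt (real N) < \<bar>u (Y_of z i)\<bar>})"
      by (rule measure_UNION_le) auto
    also have "\<dots> = (\<integral>y. real N * indicator (?A N) y \<partial>Py)" unfolding one using A by simp
    also have "\<dots> \<le> (\<integral>y. (1 / \<tau>\<^sup>2) * (indicator (?A N) y * (u y)\<^sup>2) \<partial>Py)"
    proof (rule integral_mono)
      show "integrable Py (\<lambda>y. real N * indicator (?A N) y)"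
        using A by (intro integrable_mult_right integrable_real_indicator) (auto simp: Y.emeasure_eq_measure)
      show "integrable Py (\<lambda>y. (1 / \<tau>\<^sup>2) * (indicator (?A N) y * (u y)\<^sup>2))"
        by (intro integrable_mult_right Bochner_Integration.integrable_bound[OF i im]) (auto simp: indicator_def)
      fix y
      show "real N * indicator (?A N) y \<le> (1 / \<tau>\<^sup>2) * (indicator (?A N) y * (u y)\<^sup>2)"
      proof (cases "y \<in> ?A N")
        case True
        then have "(\<tau> * sqrt (real N))\<^sup>2 \<le> (u y)\<^sup>2" using \<tau> by (intro abs_le_square_iff[THEN iffD1]) auto
        then have "real N * \<tau>\<^sup>2 \<le> (u y)\<^sup>2" by (simp add: power_mult_distrib mult.commute)
        then show ?thesis using True \<tau> by (simp add: pos_le_divide_eq)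
      qed simp
    qed
    also have "\<dots> = (1 / \<tau>\<^sup>2) * (\<integral>y. indicator (?A N) y * (u y)\<^sup>2 \<partial>Py)" by simp
    finally show "measure Z {z\<in>space Z. \<exists>i<N. \<tau> * sqrt (real N) < \<bar>u (Y_of z i)\<bar>} \<le> \<dots>" .
  qed
qed simp

end

lemma converges_in_probability_eventually:
  assumes T: "converges_in_probability M T c" and U: "\<And>N. U N \<in> borel_measurable M"
    and eq: "\<forall>\<^sub>F N in sequentially. \<forall>\<omega>\<in>space M. U N \<omega> = T N \<omega>"
  shows "converges_in_probability M U c"
  unfolding converges_in_probability_def
proof (intro conjI allI impI U)
  fix \<epsilon> :: real assume "\<epsilon> > 0"
  then have "(\<lambda>N. measure M {\<omega>\<in>space M. \<epsilon> < \<bar>T N \<omega> - c\<bar>}) \<longlonglongrightarrow> 0" using T by (simp add: converges_in_probability_def)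
  moreover have "\<forall>\<^sub>F N in sequentially. measure M {\<omega>\<in>space M. \<epsilon> < \<bar>T N \<omega> - c\<bar>} = measure M {\<omega>\<in>space M. \<epsilon> < \<bar>U N \<omega> - c\<bar>}"
    using eq by eventually_elim (intro arg_cong[where f="measure M"], auto)
  ultimately show "(\<lambda>N. measure M {\<omega>\<in>space M. \<epsilon> < \<bar>U N \<omega> - c\<bar>}) \<longlonglongrightarrow> 0" by (rule Lim_transform_eventually)
qed

lemma integrable_square_sum:
  fixes u :: "'i \<Rightarrow> 'z \<Rightarrow> real"
  assumes "\<And>i. i \<in> I \<Longrightarrow> u i \<in> borel_measurable M" "\<And>i. i \<in> I \<Longrightarrow> integrable M (\<lambda>y. (u i y)\<^sup>2)"
  shows "integrable M (\<lambda>y. (\<Sum>i\<in>I. u i y)\<^sup>2)"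
  using assms
proof (induction I rule: infinite_finite_induct)
  case (insert i I)
  let ?s = "\<lambda>y. \<Sum>j\<in>I. u j y"
  have [measurable]: "u i \<in> borel_measurable M" "?s \<in> borel_measurable M" using insert.prems(1) by auto
  have "integrable M (\<lambda>y. 2 * (u i y)\<^sup>2 + 2 * (?s y)\<^sup>2)"
    using insert.IH insert.prems by simp
  then have "integrable M (\<lambda>y. (u i y + ?s y)\<^sup>2)"
  proof (rule Bochner_Integration.integrable_bound)
    show "AE y in M. norm ((u i y + ?s y)\<^sup>2) \<le> norm (2 * (u i y)\<^sup>2 + 2 * (?s y)\<^sup>2)"
    proof (rule AE_I2)
      fix y
      have "(u i y + ?s y)\<^sup>2 \<le> 2 * (u i y)\<^sup>2 + 2 * (?s y)\<^sup>2"
        using zero_le_power2[of "u i y - ?s y"] by (simp add: power2_eq_square algebra_simps)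
      then show "norm ((u i y + ?s y)\<^sup>2) \<le> norm (2 * (u i y)\<^sup>2 + 2 * (?s y)\<^sup>2)" by simp
    qed
  qed measurable
  then show ?case using insert.hyps by simp
qed auto

section \<open>Centred functions and the limit covariance\<close>

locale poisson_limit = poisson_survey Pyx Pd D Pe en \<pi>
  for Pyx :: "('y::{banach, second_countable_topology} \<times> 'x::{banach, second_countable_topology}) measure"
    and Pd :: "'d measure" and D :: "'d \<Rightarrow> real" and Pe :: "'e measure"
    and en :: "nat \<Rightarrow> nat \<Rightarrow> nat \<Rightarrow> nat" and \<pi> :: "nat \<Rightarrow> nat \<Rightarrow> (nat \<Rightarrow> 'x) \<Rightarrow> real" +
  fixes F :: "('y \<Rightarrow> real) set" and M0 :: "'m measure" and G0 :: "'m \<Rightarrow> ('y \<Rightarrow> real) \<Rightarrow> real"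
    and f0 :: "'y \<Rightarrow> real" and C :: real and \<Sigma> :: "('y \<Rightarrow> real) \<Rightarrow> ('y \<Rightarrow> real) \<Rightarrow> real" and L :: real
  assumes don: "donsker_limit Py F M0 G0" and F_meas: "F \<subseteq> borel_measurable borel"
    and f0: "f0 \<in> F" "C \<noteq> 0" "AE y in Py. f0 y = C"
    and cov: "\<And>f g. f \<in> F \<Longrightarrow> g \<in> F \<Longrightarrow> converges_in_probability Z (\<lambda>N z. dcov N (p N z) (Y_of z) f g) (\<Sigma> f g)"
    and L: "L > 0" and L_prob: "(\<lambda>N. measure Z {z\<in>space Z. \<forall>i<N. L \<le> p N z i}) \<longlonglongrightarrow> 1"
begin

sublocale dl: donsker_limit Py F M0 G0 by (rule don)

abbreviation \<mu> :: "('y \<Rightarrow> real) \<Rightarrow> real" where "\<mu> f \<equiv> integral\<^sup>L Py f"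

definition cen :: "('y \<Rightarrow> real) \<Rightarrow> 'y \<Rightarrow> real" where "cen f y = f y - \<mu> f"

definition A :: "nat \<Rightarrow> (nat \<Rightarrow> 'y \<times> 'x) set" where "A N = {z\<in>space Z. \<forall>i<N. L \<le> p N z i}"

lemma A_sets [measurable]: "A N \<in> sets Z"
  unfolding A_def by (rule lower_bound_sets)

lemma A_prob: "(\<lambda>N. measure Z (A N)) \<longlonglongrightarrow> 1"
  using L_prob by (simp add: A_def)

lemma A_p: "z \<in> A N \<Longrightarrow> i < N \<Longrightarrow> L \<le> p N z i \<and> p N z i \<le> 1"
  using p_bounds by (auto simp: A_def)

lemma f_meas: "f \<in> F \<Longrightarrow> f \<in> borel_measurable borel"
  using F_meas by auto

lemma cen_meas: "f \<in> F \<Longrightarrow> cen f \<in> borel_measurable borel"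
  unfolding cen_def[abs_def] by (rule borel_measurable_diff[OF f_meas borel_measurable_const])

lemma meas_Py: "u \<in> borel_measurable borel \<Longrightarrow> u \<in> borel_measurable Py"
  unfolding measurable_cong_sets[OF sets_Py(1) refl] .

lemma cen_int: "f \<in> F \<Longrightarrow> integrable Py (cen f)" and cen_sq: "f \<in> F \<Longrightarrow> integrable Py (\<lambda>y. (cen f y)\<^sup>2)"
  and cen_mean: "f \<in> F \<Longrightarrow> integral\<^sup>L Py (cen f) = 0"
proof -
  interpret Y: prob_space Py by (rule prob_Py)
  assume f: "f \<in> F"
  show "integrable Py (cen f)" "integral\<^sup>L Py (cen f) = 0"
    unfolding cen_def[abs_def] using dl.H_int[OF f] Y.prob_space by simp_all
  show "integrable Py (\<lambda>y. (cen f y)\<^sup>2)" unfolding cen_def by (rule dl.donsker_square_integrable[OF f])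
qed

lemma AE_f0: "AE z in Z. \<forall>i. f0 (Y_of z i) = C"
proof (subst AE_all_countable, rule allI)
  fix i
  have "AE w in Pyx. f0 (fst w) = C" using AE_distrD[OF fst_Pyx f0(3)[unfolded Py_def]] .
  then have "AE w in distr Z Pyx (\<lambda>z. z i). f0 (fst w) = C" by (simp only: distr_iid_component[OF Pyx])
  from AE_distrD[OF _ this] show "AE z in Z. f0 (Y_of z i) = C" unfolding Y_of_def by simp
qed

text \<open>The constant function 1 need not belong to the class; almost surely \<open>f0\<close>
  acts as \<open>C\<close> times it at all observations.\<close>

lemma cov_one:
  assumes g: "g \<in> F"
  shows "converges_in_probability Z (\<lambda>N z. dcov N (p N z) (Y_of z) (\<lambda>_. 1) g) (1 / C * \<Sigma> f0 g)"
proof (rule converges_in_probability_cong[OF converges_in_probability_mult[OF prob_Z converges_in_probability_const cov[OF f0(1) g]]])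
  fix N
  show "(\<lambda>z. dcov N (p N z) (Y_of z) (\<lambda>_. 1) g) \<in> borel_measurable Z" by (intro dcov_measurable borel_measurable_const f_meas g)
  show "AE z in Z. dcov N (p N z) (Y_of z) (\<lambda>_. 1) g = 1 / C * dcov N (p N z) (Y_of z) f0 g"
    using AE_f0
  proof eventually_elim
    case (elim z)
    have "(\<Sum>i<N. (1 / p N z i - 1) * (f0 (Y_of z i) * g (Y_of z i))) = C * (\<Sum>i<N. (1 / p N z i - 1) * (1 * g (Y_of z i)))"
      unfolding sum_distrib_left using elim by (intro sum.cong refl) simp
    then show ?case using f0(2) by (simp add: dcov_def)
  qed
qed

lemma cov_one_one: "converges_in_probability Z (\<lambda>N z. dcov N (p N z) (Y_of z) (\<lambda>_. 1) (\<lambda>_. 1)) (1 / C * (1 / C * \<Sigma> f0 f0))"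
proof (rule converges_in_probability_cong[OF converges_in_probability_mult[OF prob_Z converges_in_probability_const cov_one[OF f0(1)]]])
  fix N
  show "(\<lambda>z. dcov N (p N z) (Y_of z) (\<lambda>_. 1) (\<lambda>_. 1)) \<in> borel_measurable Z" by (intro dcov_measurable) auto
  show "AE z in Z. dcov N (p N z) (Y_of z) (\<lambda>_. 1) (\<lambda>_. 1) = 1 / C * dcov N (p N z) (Y_of z) (\<lambda>_. 1) f0"
    using AE_f0
  proof eventually_elim
    case (elim z)
    have "(\<Sum>i<N. (1 / p N z i - 1) * (1 * f0 (Y_of z i))) = C * (\<Sum>i<N. (1 / p N z i - 1) * (1 * 1))"
      unfolding sum_distrib_left using elim by (intro sum.cong refl) simp
    then show ?case using f0(2) by (simp add: dcov_def)
  qed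
qed

text \<open>The limit of the right-hand side of \<open>dcov_shift\<close> when the shifts tend to
  the means.\<close>

definition Sig :: "('y \<Rightarrow> real) \<Rightarrow> ('y \<Rightarrow> real) \<Rightarrow> real" where
  "Sig f g = \<Sigma> f g + - \<mu> f * (1 / C * \<Sigma> f0 g) + - \<mu> g * (1 / C * \<Sigma> f0 f) + \<mu> f * \<mu> g * (1 / C * (1 / C * \<Sigma> f0 f0))"

text \<open>Any consistent centring has the same limit. This identifies the limit of the empirically
  centred design covariance with the covariance of the Gaussian limit, which is computed with the
  true means.\<close>

lemma cov_shift:
  assumes f: "f \<in> F" and g: "g \<in> F" and a: "converges_in_probability Z a (\<mu> f)" and b: "converges_in_probability Z b (\<mu> g)"
  shows "converges_in_probability Z (\<lambda>N z. dcov N (p N z) (Y_of z) (\<lambda>y. f y - a N z) (\<lambda>y. g y - b N z)) (Sig f g)"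
proof -
  have neg: "converges_in_probability Z (\<lambda>N z. - T N z) (- c)" if "converges_in_probability Z T c" for T c
    using converges_in_probability_mult[OF prob_Z converges_in_probability_const[of Z "- 1"] that] by simp
  show ?thesis unfolding dcov_shift Sig_def
    by (intro converges_in_probability_add[OF prob_Z] converges_in_probability_mult[OF prob_Z] cov cov_one cov_one_one neg f g a b)
qed

lemma cov_cen: "f \<in> F \<Longrightarrow> g \<in> F \<Longrightarrow> converges_in_probability Z (\<lambda>N z. dcov N (p N z) (Y_of z) (cen f) (cen g)) (Sig f g)"
  unfolding cen_def[abs_def] 
  by (rule cov_shift[where a="\<lambda>_ _. \<mu> f" and b="\<lambda>_ _. \<mu> g", OF _ _ converges_in_probability_const converges_in_probability_const])

lemma emp_mean_mean:
  assumes f: "f \<in> F"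
  shows "converges_in_probability Z (\<lambda>N z. emp_mean N (Y_of z) f) (\<mu> f)"
proof (rule converges_in_probability_eventually)
  have "converges_in_probability Z (\<lambda>N z. emp_mean N (Y_of z) (cen f) + \<mu> f) (0 + \<mu> f)"
    by (intro converges_in_probability_add[OF prob_Z] converges_in_probability_const emp_mean_converges cen_meas cen_int cen_sq cen_mean f)
  then show "converges_in_probability Z (\<lambda>N z. emp_mean N (Y_of z) (cen f) + \<mu> f) (\<mu> f)" by simp
  show "(\<lambda>z. emp_mean N (Y_of z) f) \<in> borel_measurable Z" for N by (intro emp_mean_measurable f_meas f)
  show "\<forall>\<^sub>F N in sequentially. \<forall>z\<in>space Z. emp_mean N (Y_of z) f = emp_mean N (Y_of z) (cen f) + \<mu> f"
    using eventually_gt_at_top[of 0]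
    by eventually_elim (auto simp: emp_mean_def cen_def sum_subtractf field_simps)
qed

lemma centred_design_cov:
  assumes "f \<in> F" "g \<in> F"
  shows "converges_in_probability P (\<lambda>N (z, d, e). design_cov centred_HT_process Pd D en \<pi> f g N z) (Sig f g)"
  unfolding converges_in_probability_fst design_cov_centred
  by (rule cov_shift[where a="\<lambda>N z. emp_mean N (Y_of z) f" and b="\<lambda>N z. emp_mean N (Y_of z) g", OF assms emp_mean_mean[OF assms(1)] emp_mean_mean[OF assms(2)]])

definition lin :: "'i set \<Rightarrow> ('i \<Rightarrow> real) \<Rightarrow> ('i \<Rightarrow> 'y \<Rightarrow> real) \<Rightarrow> 'y \<Rightarrow> real" where
  "lin I a t y = (\<Sum>i\<in>I. a i * cen (t i) y)"

lemma
  assumes t: "\<And>i. i \<in> I \<Longrightarrow> t i \<in> F"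
  shows lin_meas: "lin I a t \<in> borel_measurable borel" and lin_int: "integrable Py (lin I a t)"
    and lin_sq: "integrable Py (\<lambda>y. (lin I a t y)\<^sup>2)" and lin_mean: "integral\<^sup>L Py (lin I a t) = 0"
    and lin_cov: "converges_in_probability Z (\<lambda>N z. dcov N (p N z) (Y_of z) (lin I a t) (lin I a t)) (\<Sum>i\<in>I. \<Sum>j\<in>I. a i * a j * Sig (t i) (t j))"
proof -
  show "lin I a t \<in> borel_measurable borel"
    unfolding lin_def[abs_def] by (intro borel_measurable_sum borel_measurable_times borel_measurable_const cen_meas t)
  show "integrable Py (lin I a t)"
    unfolding lin_def[abs_def] by (intro Bochner_Integration.integrable_sum integrable_mult_right cen_int t)
  show "integral\<^sup>L Py (lin I a t) = 0"
    unfolding lin_def[abs_def] using cen_int cen_mean t by (subst Bochner_Integration.integral_sum) auto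
  show "integrable Py (\<lambda>y. (lin I a t y)\<^sup>2)"
    unfolding lin_def by (rule integrable_square_sum)
      (auto simp: power_mult_distrib intro!: integrable_mult_right cen_sq t borel_measurable_times meas_Py cen_meas)
  show "converges_in_probability Z (\<lambda>N z. dcov N (p N z) (Y_of z) (lin I a t) (lin I a t)) (\<Sum>i\<in>I. \<Sum>j\<in>I. a i * a j * Sig (t i) (t j))"
    unfolding lin_def[abs_def] dcov_sum
    by (intro converges_in_probability_sum[OF prob_Z] converges_in_probability_mult[OF prob_Z converges_in_probability_const] cov_cen t)
qed

text \<open>A limit in probability of design variances, which are nonnegative; this makes the
  Cholesky construction applicable.\<close>

lemma Sig_nonneg:
  assumes t: "\<And>i. i \<in> I \<Longrightarrow> t i \<in> F"
  shows "0 \<le> (\<Sum>i\<in>I. \<Sum>j\<in>I. a i * a j * Sig (t i) (t j))"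
proof (rule converges_in_probability_nonneg[OF prob_Z lin_cov[OF t]])
  show "0 \<le> dcov N (p N z) (Y_of z) (lin I a t) (lin I a t)" for N z
    by (rule dcov_nonneg) (rule p_bounds)
qed

lemma Sig_sym:
  assumes "f \<in> F" "g \<in> F"
  shows "Sig f g = Sig g f"
proof (rule converges_in_probability_unique[OF prob_Z cov_cen[OF assms]])
  have "(\<lambda>N z. dcov N (p N z) (Y_of z) (cen f) (cen g)) = (\<lambda>N z. dcov N (p N z) (Y_of z) (cen g) (cen f))"
    by (intro ext) (rule dcov_sym)
  then show "converges_in_probability Z (\<lambda>N z. dcov N (p N z) (Y_of z) (cen f) (cen g)) (Sig g f)"
    using cov_cen[OF assms(2,1)] by (simp only:)
qed

lemma Sig_psd:
  assumes t: "\<And>i. t i \<in> F"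
  shows "psd_kernel (\<lambda>i j. Sig (t i) (t j))"
  unfolding psd_kernel_def
proof (intro conjI allI impI)
  show "Sig (t i) (t j) = Sig (t j) (t i)" for i j by (rule Sig_sym[OF t t])
  show "0 \<le> (\<Sum>i\<in>I. \<Sum>j\<in>I. a i * a j * Sig (t i) (t j))" for I a by (rule Sig_nonneg[OF t])
qed

end

section \<open>Characteristic function of the Hajek process\<close>

context poisson_limit
begin

text \<open>Given the population, the cosine moment is close to
  \<open>exp (- q N z / 2) * cos b\<close>, except when an inclusion probability falls below
  \<open>L\<close>, an observation is too large for the Lindeberg condition, or \<open>q N z\<close>
  is far from \<open>v\<close>.\<close>

lemma hajek_char:
  assumes u: "u \<in> borel_measurable borel" "integrable Py u" "integrable Py (\<lambda>y. (u y)\<^sup>2)" "integral\<^sup>L Py u = 0"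
    and v: "converges_in_probability Z (\<lambda>N z. dcov N (p N z) (Y_of z) u u) v"
  shows "(\<lambda>N. \<integral>z. bexp N (p N z) (\<lambda>s. cos (hajek_process N (p N z) s (Y_of z) u + b)) \<partial>Z) \<longlonglongrightarrow> exp (- v / 2) * cos b"
proof -
  define q where "q N z = dcov N (p N z) (Y_of z) u u" for N z
  define h where "h N z = bexp N (p N z) (\<lambda>s. cos (hajek_process N (p N z) s (Y_of z) u + b))" for N z
  define T where "T N z = bexp N (p N z) (\<lambda>s. cos (HT_process N (p N z) s (Y_of z) u + b))" for N z
  have q0: "0 \<le> q N z" for N z unfolding q_def by (intro dcov_nonneg p_bounds)
  have v0: "0 \<le> v" by (rule converges_in_probability_nonneg[OF prob_Z v]) (use q0 q_def in auto)
  have qm [measurable]: "q N \<in> borel_measurable Z" for N unfolding q_def by (intro dcov_measurable u)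
  have cosm: "(\<lambda>z. cos (X z + b)) \<in> borel_measurable Z" if "X \<in> borel_measurable Z" for X using that by measurable
  have hm [measurable]: "h N \<in> borel_measurable Z" for N
    unfolding h_def by (intro bexp_measurable cosm hajek_measurable u)
  have abs1: "\<bar>bexp N (p N z) (\<lambda>s. cos (X s))\<bar> \<le> 1" for N and z :: "nat \<Rightarrow> 'y \<times> 'x" and X :: "_ \<Rightarrow> real"
  proof -
    have "\<bar>bexp N (p N z) (\<lambda>s. cos (X s))\<bar> \<le> bexp N (p N z) (\<lambda>s. \<bar>cos (X s)\<bar>)" by (intro bexp_abs p_bounds')
    also have "\<dots> \<le> bexp N (p N z) (\<lambda>_. 1)" by (intro bexp_mono p_bounds') auto
    finally show ?thesis by (simp add: bexp_const)
  qed
  have eb: "\<bar>exp (- q N z / 2) * cos b\<bar> \<le> 1" for N z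
    using q0[of N z] by (simp add: abs_mult mult_le_one)
  \<comment> \<open>Bounded convergence in probability; \<open>q N z\<close> is nonnegative, so the
    exponential stays below 1.\<close>
  have J: "(\<lambda>N. \<integral>z. exp (- q N z / 2) * cos b \<partial>Z) \<longlonglongrightarrow> exp (- v / 2) * cos b"
    using converges_in_probability_integral[OF prob_Z v[folded q_def], of "\<lambda>x. exp (- x / 2) * cos b" 1] eb
    by (auto intro!: continuous_intros)
  define m2 where "m2 N z = (emp_mean N (Y_of z) u)\<^sup>2" for N and z :: "nat \<Rightarrow> 'y \<times> 'x"
  define s2 where "s2 N z = emp_mean N (Y_of z) (\<lambda>y. (u y)\<^sup>2)" for N and z :: "nat \<Rightarrow> 'y \<times> 'x"
  define \<sigma> where "\<sigma> = (\<integral>y. (u y)\<^sup>2 \<partial>Py)"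
  \<comment> \<open>The bound of \<open>bexp_hajek_HT\<close>, with the absolute empirical mean
    replaced by \<open>sqrt N\<close> times its square plus \<open>1 / sqrt N\<close>. In this form
    its integral is computed from second moments.\<close>
  define e where "e N z = 8 / L * (1 / real N) + (1 + 1 / L) * (sqrt (real N) * m2 N z + 1 / sqrt (real N)) + 1 / L * ((1 + s2 N z) / sqrt (real N))" for N z
  have u2m: "(\<lambda>y. (u y)\<^sup>2) \<in> borel_measurable borel" using u(1) by measurable
  have m2i: "integrable Z (m2 N)" and s2i: "integrable Z (s2 N)" for N
    unfolding m2_def s2_def by (intro integrable_emp_mean_square u integrable_emp_mean u2m)+
  have ei: "integrable Z (e N)" for N unfolding e_def using m2i s2i by (intro Bochner_Integration.integrable_add integrable_mult_right integrable_divide) auto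
  have e0: "0 \<le> e N z" for N z
  proof -
    have "0 \<le> s2 N z" unfolding s2_def emp_mean_def by (intro mult_nonneg_nonneg sum_nonneg) auto
    then show ?thesis unfolding e_def m2_def using L by (intro add_nonneg_nonneg mult_nonneg_nonneg divide_nonneg_nonneg) auto
  qed
  have e_lim: "(\<lambda>N. integral\<^sup>L Z (e N)) \<longlonglongrightarrow> 0"
  proof (rule Lim_transform_eventually)
    have s0: "(\<lambda>N. 1 / sqrt (real N)) \<longlonglongrightarrow> 0"
      by (intro tendsto_divide_0[OF tendsto_const] filterlim_at_top_imp_at_infinity filterlim_compose[OF sqrt_at_top] filterlim_real_sequentially)
    have "(\<lambda>N. 8 / L * (1 / real N) + (1 + 1 / L) * (\<sigma> * (1 / sqrt (real N)) + 1 / sqrt (real N)) + 1 / L * ((1 + \<sigma>) * (1 / sqrt (real N))))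
      \<longlonglongrightarrow> 8 / L * 0 + (1 + 1 / L) * (\<sigma> * 0 + 0) + 1 / L * ((1 + \<sigma>) * 0)"
      by (intro tendsto_intros s0 lim_1_over_n)
    then show "(\<lambda>N. 8 / L * (1 / real N) + (1 + 1 / L) * (\<sigma> * (1 / sqrt (real N)) + 1 / sqrt (real N)) + 1 / L * ((1 + \<sigma>) * (1 / sqrt (real N)))) \<longlonglongrightarrow> 0" by simp
    show "\<forall>\<^sub>F N in sequentially. 8 / L * (1 / real N) + (1 + 1 / L) * (\<sigma> * (1 / sqrt (real N)) + 1 / sqrt (real N)) + 1 / L * ((1 + \<sigma>) * (1 / sqrt (real N))) = integral\<^sup>L Z (e N)"
      using eventually_gt_at_top[of 0]
    proof eventually_elim
      case (elim N)
      have m: "integral\<^sup>L Z (m2 N) = 1 / real N * \<sigma>" "integral\<^sup>L Z (s2 N) = \<sigma>"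
        unfolding m2_def s2_def \<sigma>_def using integral_emp_mean_square[OF u elim] integral_emp_mean[OF u2m u(3) elim] by simp_all
      have r: "sqrt (real N) * (1 / real N * \<sigma>) = \<sigma> * (1 / sqrt (real N))"
      proof -
        define w where "w = sqrt (real N)"
        have w: "real N = w * w" "w > 0" using elim by (auto simp: w_def)
        show ?thesis unfolding w_def[symmetric] unfolding w(1) using w(2) by simp
      qed
      have "integral\<^sup>L Z (e N) = 8 / L * (1 / real N) + (1 + 1 / L) * (sqrt (real N) * integral\<^sup>L Z (m2 N) + 1 / sqrt (real N)) + 1 / L * ((1 + integral\<^sup>L Z (s2 N)) / sqrt (real N))"
        unfolding e_def using m2i s2i by (simp add: Z.prob_space)
      then show ?case unfolding m r by simp
    qed
  qed
  have "(\<lambda>N. integral\<^sup>L Z (h N) - (\<integral>z. exp (- q N z / 2) * cos b \<partial>Z)) \<longlonglongrightarrow> 0"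
  proof (rule LIMSEQ_I)
    fix r :: real assume r: "r > 0"
    \<comment> \<open>Off \<open>B2\<close> the design variance is at most \<open>v + 1\<close>;
      this choice then brings the error of \<open>bexp_cos_approx\<close> below
      \<open>r / 4\<close>.\<close>
    define \<tau> where "\<tau> = min 1 (r * L / (8 * (v + 1)))"
    have \<tau>: "0 < \<tau>" "\<tau> \<le> 1" "\<tau> \<le> r * L / (8 * (v + 1))" using r L v0 by (auto simp: \<tau>_def)
    have \<kappa>: "1 / L * (\<tau> + \<tau>\<^sup>2) * (v + 1) \<le> r / 4"
    proof -
      have "\<tau> * \<tau> \<le> \<tau> * 1" using \<tau> by (intro mult_left_mono) auto
      then have "1 / L * (\<tau> + \<tau>\<^sup>2) * (v + 1) \<le> 1 / L * (2 * \<tau>) * (v + 1)"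
        using L v0 by (intro mult_right_mono mult_left_mono) (auto simp: power2_eq_square)
      also have "\<dots> = 2 * (v + 1) / L * \<tau>" by simp
      also have "\<dots> \<le> 2 * (v + 1) / L * (r * L / (8 * (v + 1)))" using L v0 \<tau> by (intro mult_left_mono) auto
      also have "\<dots> = r / 4"
      proof -
        have "2 * k / L * (r * L / (8 * k)) = r / 4" if "k > 0" for k :: real using that L by (simp add: field_simps)
        from this[of "v + 1"] show ?thesis using v0 by simp
      qed
      finally show ?thesis .
    qed
    define B1 where "B1 N = {z\<in>space Z. \<exists>i<N. \<tau> * sqrt (real N) < \<bar>u (Y_of z i)\<bar>}" for N
    define B2 where "B2 N = {z\<in>space Z. 1 < \<bar>q N z - v\<bar>}" for N
    have B1 [measurable]: "B1 N \<in> sets Z" for N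
    proof -
      note u_Y_measurable[OF u(1), measurable]
      have "{z\<in>space Z. \<exists>i\<in>{..<N}. \<tau> * sqrt (real N) < \<bar>u (Y_of z i)\<bar>} \<in> sets Z"
        by (rule sets.sets_Collect_finite_Ex) measurable
      then show ?thesis unfolding B1_def by (simp only: Bex_def lessThan_iff)
    qed
    have B2 [measurable]: "B2 N \<in> sets Z" for N unfolding B2_def by measurable
    \<comment> \<open>On each of the three exceptional events both quantities compared have modulus
      at most 1, hence the factor 2.\<close>
    define bad where "bad N = 2 * (measure Z (space Z - A N) + measure Z (B1 N) + measure Z (B2 N)) + integral\<^sup>L Z (e N)" for N
    have "bad \<longlonglongrightarrow> 2 * ((1 - 1) + 0 + 0) + 0"
      unfolding bad_def Z.prob_compl[OF A_sets]
      by (intro tendsto_intros A_prob e_lim)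
         (use max_negligible[OF u(1) u(3) \<tau>(1)] v in \<open>auto simp: B1_def B2_def q_def converges_in_probability_def\<close>)
    then have "\<forall>\<^sub>F N in sequentially. bad N < r / 2" by (rule order_tendstoD(2)) (use r in simp)
    then have ev: "\<forall>\<^sub>F N in sequentially. bad N < r / 2 \<and> N > 0" using eventually_gt_at_top[of 0] by (rule eventually_conj)
    have pt: "\<bar>h N z - exp (- q N z / 2) * cos b\<bar>
      \<le> r / 4 + e N z + 2 * (indicator (space Z - A N) z + indicator (B1 N) z + indicator (B2 N) z)"
      if z: "z \<in> space Z" and N: "N > 0" for N z
    proof (cases "z \<in> A N \<and> z \<notin> B1 N \<and> z \<notin> B2 N")
      case False
      then have "1 \<le> indicator (space Z - A N) z + indicator (B1 N) z + (indicator (B2 N) z :: real)"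
        using z by (auto simp: indicator_def)
      moreover have "\<bar>h N z\<bar> \<le> 1" unfolding h_def by (rule abs1)
      ultimately show ?thesis using eb[of N z] e0[of N z] r by argo
    next
      case True
      then have pL: "i < N \<Longrightarrow> L \<le> p N z i \<and> p N z i \<le> 1" for i using A_p by blast
      define x where "x i = u (Y_of z i) / sqrt (real N)" for i
      have xb: "\<bar>x i\<bar> \<le> \<tau>" if "i < N" for i
      proof -
        have "\<not> \<tau> * sqrt (real N) < \<bar>u (Y_of z i)\<bar>" using True that z unfolding B1_def by blast
        then show ?thesis using N by (simp add: x_def pos_divide_le_eq)
      qed
      have HT: "HT_process N (p N z) s (Y_of z) u = (\<Sum>i<N. (real (s i) / p N z i - 1) * x i)" for s
        unfolding HT_process_def x_def sum_distrib_left by (intro sum.cong refl) simp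
      have qx: "(\<Sum>i<N. (1 / p N z i - 1) * (x i)\<^sup>2) = q N z"
        unfolding q_def dcov_def x_def sum_distrib_left by (intro sum.cong refl) (simp add: power_divide power2_eq_square)
      have "\<bar>T N z - exp (- (q N z / 2)) * cos b\<bar> \<le> 1 / L * (\<tau> + \<tau>\<^sup>2) * q N z"
        using bexp_cos_approx[where N=N and p="p N z" and L=L and x=x and \<tau>=\<tau> and b=b, OF pL L xb]
        unfolding T_def HT qx by simp
      also have "\<dots> \<le> 1 / L * (\<tau> + \<tau>\<^sup>2) * (v + 1)"
        using True z L \<tau>(1) by (intro mult_left_mono) (auto simp: B2_def not_less)
      also note \<kappa>
      finally have 1: "\<bar>T N z - exp (- q N z / 2) * cos b\<bar> \<le> r / 4" by simp
      have "\<bar>h N z - T N z\<bar> \<le> bexp N (p N z) (\<lambda>s. \<bar>cos (hajek_process N (p N z) s (Y_of z) u + b) - cos (HT_process N (p N z) s (Y_of z) u + b)\<bar>)"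
        unfolding h_def T_def bexp_diff[symmetric] by (intro bexp_abs p_bounds')
      also have "\<dots> \<le> 8 / L * (1 / real N) + (1 + 1 / L) * \<bar>emp_mean N (Y_of z) u\<bar> + 1 / L * (1 + s2 N z) / sqrt (real N)"
        unfolding s2_def by (rule bexp_hajek_HT[OF pL L N])
      also have "\<dots> \<le> e N z"
      proof -
        define w where "w = sqrt (real N)"
        have w: "w > 0" using N by (simp add: w_def)
        have "\<bar>emp_mean N (Y_of z) u\<bar> \<le> w * m2 N z + 1 / w"
        proof -
          define y where "y = \<bar>emp_mean N (Y_of z) u\<bar>"
          have y: "0 \<le> y" "m2 N z = y * y" by (auto simp: y_def m2_def power2_eq_square)
          show ?thesis unfolding y_def[symmetric] y(2)
          proof (cases "y \<le> 1 / w")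
            case False
            then have "1 * y \<le> (w * y) * y" using w y by (intro mult_right_mono) (auto simp: field_simps)
            then have "y \<le> w * (y * y)" by (simp only: mult.assoc mult_1)
            moreover have "0 \<le> 1 / w" using w by simp
            ultimately show "y \<le> w * (y * y) + 1 / w" by linarith
          next
            case True
            moreover have "0 \<le> w * (y * y)" using w y by simp
            ultimately show "y \<le> w * (y * y) + 1 / w" by linarith
          qed
        qed
        then have "(1 + 1 / L) * \<bar>emp_mean N (Y_of z) u\<bar> \<le> (1 + 1 / L) * (w * m2 N z + 1 / w)"
          using L by (intro mult_left_mono) auto
        then show ?thesis unfolding e_def w_def by simp
      qed
      finally have 2: "\<bar>h N z - T N z\<bar> \<le> e N z" .
      have "\<bar>h N z - exp (- q N z / 2) * cos b\<bar> \<le> r / 4 + e N z" using 1 2 by linarith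
      then show ?thesis by (rule add_increasing2[rotated]) simp
    qed
    show "\<exists>N0. \<forall>N\<ge>N0. norm (integral\<^sup>L Z (h N) - (\<integral>z. exp (- q N z / 2) * cos b \<partial>Z) - 0) < r"
      unfolding eventually_sequentially[symmetric] using ev
    proof eventually_elim
      case (elim N)
      have hi: "integrable Z (h N)" "integrable Z (\<lambda>z. exp (- q N z / 2) * cos b)"
        by (rule Z.integrable_const_bound[where B=1]; use eb in \<open>auto simp: h_def intro!: abs1 AE_I2\<close>)+
      have ii: "integrable Z (\<lambda>z. r / 4 + e N z + 2 * (indicator (space Z - A N) z + indicator (B1 N) z + indicator (B2 N) z))"
        using ei by (intro Bochner_Integration.integrable_add integrable_mult_right integrable_real_indicator) (auto simp: Z.emeasure_eq_measure)
      have "\<bar>integral\<^sup>L Z (h N) - (\<integral>z. exp (- q N z / 2) * cos b \<partial>Z)\<bar> = \<bar>\<integral>z. h N z - exp (- q N z / 2) * cos b \<partial>Z\<bar>"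
        using hi by simp
      also have "\<dots> \<le> (\<integral>z. \<bar>h N z - exp (- q N z / 2) * cos b\<bar> \<partial>Z)" by (rule integral_abs_bound)
      also have "\<dots> \<le> (\<integral>z. r / 4 + e N z + 2 * (indicator (space Z - A N) z + indicator (B1 N) z + indicator (B2 N) z) \<partial>Z)"
        using hi elim by (intro integral_mono ii pt integrable_abs Bochner_Integration.integrable_diff) auto
      also have "\<dots> = r / 4 + bad N"
        unfolding bad_def using ei by (simp add: Z.prob_space Z.emeasure_eq_measure)
      finally show ?case using elim r by simp
    qed
  qed
  from tendsto_add[OF this J] show ?thesis unfolding h_def by simp
qed

end

section \<open>Linearity, finite-dimensional limits and equicontinuity of the Hajek process\<close>

lemma hajek_sum:
  assumes "finite I"
  shows "hajek_process N p s y (\<lambda>x. \<Sum>i\<in>I. a i * u i x) = (\<Sum>i\<in>I. a i * hajek_process N p s y (u i))"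
proof (cases "N_hat N p s = 0")
  case False
  have swap: "(\<Sum>i<N. w i * (\<Sum>j\<in>I. a j * u j (y i))) = (\<Sum>j\<in>I. a j * (\<Sum>i<N. w i * u j (y i)))" for w :: "nat \<Rightarrow> real"
    unfolding sum_distrib_left by (subst sum.swap) (simp add: mult_ac)
  have 1: "(\<Sum>i<N. real (s i) / p i * (\<Sum>j\<in>I. a j * u j (y i))) = (\<Sum>j\<in>I. a j * (\<Sum>i<N. real (s i) / p i * u j (y i)))"
    by (rule swap)
  have 2: "(\<Sum>i<N. \<Sum>j\<in>I. a j * u j (y i)) = (\<Sum>j\<in>I. a j * (\<Sum>i<N. u j (y i)))"
    using swap[of "\<lambda>_. 1"] by simp
  have lin: "\<alpha> * (\<beta> * (\<Sum>j\<in>I. a j * v j) - \<gamma> * (\<Sum>j\<in>I. a j * w j)) = (\<Sum>j\<in>I. a j * (\<alpha> * (\<beta> * v j - \<gamma> * w j)))"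
    for \<alpha> \<beta> \<gamma> :: real and v w
    unfolding sum_distrib_left sum_subtractf[symmetric] by (intro sum.cong refl) (simp add: algebra_simps)
  show ?thesis unfolding hajek_process_def emp_mean_def 1 2 lin using False by simp
qed (simp add: hajek_process_def)

text \<open>The Hajek weights are normalized to total one, so constants drop out and functions may
  be centred freely. For \<open>N_hat N p s = 0\<close> both sides are 0 by the convention.\<close>

lemma hajek_shift:
  assumes N: "N > 0"
  shows "hajek_process N p s y (\<lambda>x. u x - c) = hajek_process N p s y u"
proof (cases "N_hat N p s = 0")
  case False
  have 1: "(\<Sum>i<N. real (s i) / p i * (u (y i) - c)) = (\<Sum>i<N. real (s i) / p i * u (y i)) - N_hat N p s * c"
    unfolding N_hat_def sum_distrib_right sum_subtractf[symmetric] by (intro sum.cong refl) (simp only: right_diff_distrib)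
  have 2: "emp_mean N y (\<lambda>x. u x - c) = emp_mean N y u - c"
    using N by (simp add: emp_mean_def sum_subtractf right_diff_distrib)
  show ?thesis unfolding hajek_process_def 1 2 using False by (simp add: right_diff_distrib)
qed (simp add: hajek_process_def)

text \<open>The difference is a linear combination indexed by \<open>bool\<close>, to which
  \<open>hajek_sum\<close> applies.\<close>

lemma hajek_diff:
  assumes N: "N > 0"
  shows "hajek_process N p s y f - hajek_process N p s y g = hajek_process N p s y (\<lambda>x. (f x - a) - (g x - b))"
proof -
  have "hajek_process N p s y (\<lambda>x. (f x - a) - (g x - b)) = hajek_process N p s y (\<lambda>x. \<Sum>i\<in>UNIV. (if i then 1 else - 1) * (if i then f x - a else g x - b))"
    by (rule arg_cong[where f="hajek_process N p s y"]) (simp add: UNIV_bool fun_eq_iff)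
  also have "\<dots> = (\<Sum>i\<in>UNIV. (if i then 1 else - 1) * hajek_process N p s y (\<lambda>x. if i then f x - a else g x - b))"
    by (rule hajek_sum) simp
  also have "\<dots> = hajek_process N p s y f - hajek_process N p s y g"
    using hajek_shift[OF N, of p s y f a] hajek_shift[OF N, of p s y g b] by (simp add: UNIV_bool)
  finally show ?thesis by simp
qed

context poisson_limit
begin

definition hj :: "nat \<Rightarrow> (nat \<Rightarrow> 'y \<times> 'x) \<times> 'd \<times> (nat \<Rightarrow> 'e) \<Rightarrow> ('y \<Rightarrow> real) \<Rightarrow> real" where
  "hj N \<omega> f = hajek_process N (p N (fst \<omega>)) (S N (fst \<omega>) (fst (snd \<omega>))) (Y_of (fst \<omega>)) f"

lemma hj_measurable:
  assumes "f \<in> F"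
  shows "(\<lambda>\<omega>. hj N \<omega> f) \<in> borel_measurable P"
  using S_measurable[where u="\<lambda>z s. hajek_process N (p N z) s (Y_of z) f" and N=N, OF hajek_measurable[OF f_meas[OF assms]]]
  by (simp add: hj_def split_beta')

text \<open>The family \<open>t\<close> over an index set serves both for initial segments of a
  dense sequence and, as the identity, for finite subsets of the class.\<close>

lemma hj_fidi:
  assumes I: "finite I" and t: "\<And>i. i \<in> I \<Longrightarrow> t i \<in> F"
  shows "(\<lambda>N. \<integral>\<omega>. cos ((\<Sum>i\<in>I. a i * hj N \<omega> (t i)) + b) \<partial>P)
    \<longlonglongrightarrow> exp (- (\<Sum>i\<in>I. \<Sum>j\<in>I. a i * a j * Sig (t i) (t j)) / 2) * cos b"
proof (rule Lim_transform_eventually[OF hajek_char[OF lin_meas[OF t] lin_int[OF t] lin_sq[OF t] lin_mean[OF t] lin_cov[OF t]]])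
  show "\<forall>\<^sub>F N in sequentially. (\<integral>z. bexp N (p N z) (\<lambda>s. cos (hajek_process N (p N z) s (Y_of z) (lin I a t) + b)) \<partial>Z)
     = (\<integral>\<omega>. cos ((\<Sum>i\<in>I. a i * hj N \<omega> (t i)) + b) \<partial>P)"
    using eventually_gt_at_top[of 0]
  proof eventually_elim
    case (elim N)
    have h: "hajek_process N (p N z) s (Y_of z) (lin I a t) = (\<Sum>i\<in>I. a i * hajek_process N (p N z) s (Y_of z) (t i))" for z s
      unfolding lin_def[abs_def] hajek_sum[OF I] cen_def[abs_def] hajek_shift[OF elim] ..
    have m: "(\<lambda>z. cos (hajek_process N (p N z) s (Y_of z) (lin I a t) + b)) \<in> borel_measurable Z" for s
    proof -
      have "(\<lambda>z. hajek_process N (p N z) s (Y_of z) (lin I a t)) \<in> borel_measurable Z"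
        by (rule hajek_measurable[OF lin_meas[OF t]])
      then show ?thesis by measurable
    qed
    have "(\<integral>\<omega>. (case \<omega> of (z, d, e) \<Rightarrow> cos (hajek_process N (p N z) (S N z d) (Y_of z) (lin I a t) + b)) \<partial>P)
      = (\<integral>z. bexp N (p N z) (\<lambda>s. cos (hajek_process N (p N z) s (Y_of z) (lin I a t) + b)) \<partial>Z)"
      by (rule P_integral[where u="\<lambda>z s. cos (hajek_process N (p N z) s (Y_of z) (lin I a t) + b)" and B=1, OF m]) auto
    then show ?case unfolding h hj_def by (simp add: split_beta')
  qed
qed

lemma F_ne: "F \<noteq> {}"
  using f0(1) by auto

text \<open>Chebyshev's inequality under the design for the relative error of the estimated
  population size.\<close>

lemma HT_tail:
  assumes z: "z \<in> A N" and \<kappa>: "\<kappa> > 0" and N: "N > 0"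
  shows "bexp N (p N z) (\<lambda>s. if \<kappa> * sqrt (real N) < \<bar>HT_process N (p N z) s (Y_of z) (\<lambda>_. 1)\<bar> then 1 else 0) \<le> 1 / (L * \<kappa>\<^sup>2) * (1 / real N)"
proof -
  define R where "R s = HT_process N (p N z) s (Y_of z) (\<lambda>_. 1)" for s
  define w where "w = \<kappa>\<^sup>2 * real N"
  have w: "w > 0" using \<kappa> N by (simp add: w_def)
  have "bexp N (p N z) (\<lambda>s. if \<kappa> * sqrt (real N) < \<bar>R s\<bar> then 1 else 0) \<le> bexp N (p N z) (\<lambda>s. 1 / w * (R s * R s))"
  proof (rule bexp_mono[OF p_bounds'])
    fix s
    show "(if \<kappa> * sqrt (real N) < \<bar>R s\<bar> then 1 else 0) \<le> 1 / w * (R s * R s)"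
    proof (cases "\<kappa> * sqrt (real N) < \<bar>R s\<bar>")
      case True
      then have "(\<kappa> * sqrt (real N))\<^sup>2 \<le> \<bar>R s\<bar>\<^sup>2" using \<kappa> by (intro power_mono) auto
      moreover have "(\<kappa> * sqrt (real N))\<^sup>2 = w" by (simp add: w_def power_mult_distrib)
      moreover have "\<bar>R s\<bar>\<^sup>2 = R s * R s" by (simp add: power2_eq_square)
      ultimately have "w \<le> R s * R s" by simp
      then show ?thesis using True w by simp
    qed (use w in simp)
  qed
  also have "\<dots> = 1 / w * dcov N (p N z) (Y_of z) (\<lambda>_. 1) (\<lambda>_. 1)"
    unfolding bexp_cmult R_def by (subst bexp_HT_process) (use p_bounds in auto)
  also have "\<dots> \<le> 1 / w * (1 / L * emp_mean N (Y_of z) (\<lambda>_. 1\<^sup>2))"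
    using w by (intro mult_left_mono dcov_le[OF A_p[OF z] L]) auto
  also have "\<dots> = 1 / (L * \<kappa>\<^sup>2) * (1 / real N)" using N by (simp add: emp_mean_def w_def)
  finally show ?thesis unfolding R_def .
qed

text \<open>By \<open>hajek_eq\<close> an increment is small if the Horvitz-Thompson process of the
  centred difference \<open>h\<close> is small, the empirical mean of \<open>h\<close> is of order
  \<open>1 / sqrt N\<close>, and the denominator is at least 1/2. These are controlled by the
  majorant, by \<open>dl.sums_bounded\<close> and by \<open>HT_tail\<close>.\<close>

lemma hajek_equicontinuous:
  assumes \<epsilon>: "\<epsilon> > 0" and \<eta>: "\<eta> > 0"
  shows "\<exists>\<delta>>0. \<exists>N0. \<forall>N\<ge>N0. outer_le P {\<omega>. \<exists>f\<in>F. \<exists>g\<in>F. rho_c Py f g < \<delta> \<and> \<epsilon> < \<bar>hj N \<omega> f - hj N \<omega> g\<bar>} \<eta>"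
proof -
  \<comment> \<open>Five failures are paid for: the majorant and the denominator, both inside
    \<open>B\<close>, the event \<open>A N\<close>, the set \<open>Gd\<close>, and large sums over
    the class.\<close>
  define \<theta> where "\<theta> = \<eta> / 5"
  \<comment> \<open>The mean of the majorant is \<open>1 / L\<close> times its mean over the cube;
    with this choice Markov's inequality at level \<open>\<epsilon> / 4 * sqrt N\<close> costs
    \<open>\<theta>\<close>.\<close>
  define \<epsilon>' where "\<epsilon>' = \<theta> * L * (\<epsilon> / 4)"
  have \<theta>: "\<theta> > 0" and \<epsilon>': "\<epsilon>' > 0" using \<epsilon> \<eta> L by (auto simp: \<theta>_def \<epsilon>'_def)
  obtain \<delta> N1 where \<delta>: "\<delta> > 0" and N1: "\<And>N. N \<ge> N1 \<Longrightarrow> \<exists>Gd\<in>sets (iid Py). \<exists>W. measure (iid Py) (space (iid Py) - Gd) \<le> \<theta> \<and>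
    (\<forall>s. (\<lambda>z. W z s) \<in> borel_measurable (iid Py)) \<and>
    (\<forall>z\<in>Gd. (\<forall>s. 0 \<le> W z s) \<and> cube_mean N (W z) \<le> \<epsilon>' * sqrt N \<and>
      (\<forall>f\<in>F. \<forall>g\<in>F. rho_c Py f g < \<delta> \<longrightarrow> (\<forall>s\<in>cube N.
        \<bar>sgn_sum N s (\<lambda>i. (f (z i) - \<mu> f) - (g (z i) - \<mu> g))\<bar> \<le> W z s)))"
    using dl.good_majorant[OF \<epsilon>' \<theta> F_ne] by (elim exE conjE) blast
  obtain R0 N2 where R0: "R0 > 0" and N2: "\<And>N. N \<ge> N2 \<Longrightarrow> outer_le (iid Py) {z. \<exists>f\<in>F. R0 * sqrt N < \<bar>\<Sum>i<N. f (z i) - \<mu> f\<bar>} \<theta>"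
    using dl.sums_bounded[OF \<theta> F_ne] by (elim exE conjE) blast
  \<comment> \<open>The bound 1/2 keeps the denominator away from 0; the other keeps the product of
    \<open>R'\<close> with the empirical mean, at most \<open>2 * R0 / sqrt N\<close>, below
    \<open>\<epsilon> / 4\<close>.\<close>
  define \<kappa> where "\<kappa> = min (1 / 2) (\<epsilon> / (8 * R0))"
  have \<kappa>: "\<kappa> > 0" "\<kappa> \<le> 1 / 2" "\<kappa> * (2 * R0) \<le> \<epsilon> / 4"
  proof -
    show "\<kappa> > 0" "\<kappa> \<le> 1 / 2" using \<epsilon> R0 by (auto simp: \<kappa>_def)
    have "\<kappa> * (2 * R0) \<le> \<epsilon> / (8 * R0) * (2 * R0)" using R0 by (intro mult_right_mono) (auto simp: \<kappa>_def)
    then show "\<kappa> * (2 * R0) \<le> \<epsilon> / 4" using R0 by simp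
  qed
  have "\<forall>\<^sub>F N in sequentially. 1 / (L * \<kappa>\<^sup>2) * (1 / real N) < \<theta>"
    by (rule order_tendstoD(2)[OF tendsto_mult_right_zero[OF lim_1_over_n]]) (rule \<theta>)
  moreover have "\<forall>\<^sub>F N in sequentially. 1 - \<theta> < measure Z (A N)"
    by (rule order_tendstoD(1)[OF A_prob]) (use \<theta> in simp)
  ultimately have "\<forall>\<^sub>F N in sequentially. 1 / (L * \<kappa>\<^sup>2) * (1 / real N) < \<theta> \<and> 1 - \<theta> < measure Z (A N) \<and> N > 0 \<and> N \<ge> N1 \<and> N \<ge> N2"
    using eventually_gt_at_top[of 0] eventually_ge_at_top[of N1] eventually_ge_at_top[of N2] by eventually_elim auto
  then obtain N0 where N0: "\<And>N. N \<ge> N0 \<Longrightarrow> 1 / (L * \<kappa>\<^sup>2) * (1 / real N) < \<theta> \<and> 1 - \<theta> < measure Z (A N) \<and> N > 0 \<and> N \<ge> N1 \<and> N \<ge> N2"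
    unfolding eventually_sequentially by (elim exE) blast
  show ?thesis
  proof (intro exI[of _ \<delta>] exI[of _ N0] conjI \<delta> allI impI)
    fix N assume "N \<ge> N0"
    note N = N0[OF this]
    then have Npos: "N > 0" and r: "sqrt (real N) > 0" by auto
    obtain Gd W where Gd: "Gd \<in> sets (iid Py)" "measure (iid Py) (space (iid Py) - Gd) \<le> \<theta>"
      and Wm: "\<And>s. (\<lambda>z. W z s) \<in> borel_measurable (iid Py)"
      and W: "\<And>z. z \<in> Gd \<Longrightarrow> (\<forall>s. 0 \<le> W z s) \<and> cube_mean N (W z) \<le> \<epsilon>' * sqrt N \<and>
      (\<forall>f\<in>F. \<forall>g\<in>F. rho_c Py f g < \<delta> \<longrightarrow> (\<forall>s\<in>cube N.
        \<bar>sgn_sum N s (\<lambda>i. (f (z i) - \<mu> f) - (g (z i) - \<mu> g))\<bar> \<le> W z s))"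
      using N1[of N] N by blast
    define maj where "maj z s = mult_majorant N (1 / L) (p N z) (W (Y_of z)) s" for z s
    \<comment> \<open>Samples outside the cube occur only on the null event \<open>D > 1\<close>.
      Putting them into \<open>B\<close> makes \<open>s \<in> cube N\<close> available later, and
      they do not contribute to \<open>bexp\<close>.\<close>
    define B where "B z s \<longleftrightarrow> s \<notin> cube N \<or> (z \<in> A N \<and> Y_of z \<in> Gd \<and>
      (\<epsilon> / 4 * sqrt N < maj z s \<or> \<kappa> * sqrt N < \<bar>HT_process N (p N z) s (Y_of z) (\<lambda>_. 1)\<bar>))" for z s
    have majm: "(\<lambda>z. maj z s) \<in> borel_measurable Z" for s
    proof -
      have Wz: "(\<lambda>z. W (Y_of z) e) \<in> borel_measurable Z" for e by (rule measurable_compose[OF Y_of_measurable Wm])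
      have pm: "(\<lambda>z. (1 + (real (s i) / p N z i - 1) / (1 / L)) / 2) \<in> borel_measurable Z" if "i < N" for i
        by (intro borel_measurable_divide borel_measurable_add borel_measurable_diff borel_measurable_const p_measurable that)
      show ?thesis unfolding maj_def mult_majorant_def bexp_def design_prob_def
        by (intro borel_measurable_times borel_measurable_const borel_measurable_sum borel_measurable_scaleR Wz
            borel_measurable_prod borel_measurable_power borel_measurable_diff pm) auto
    qed
    have YG: "{z\<in>space Z. Y_of z \<in> Gd} \<in> sets Z"
      using measurable_sets[OF Y_of_measurable Gd(1)] by (simp add: vimage_def Int_def conj_commute)
    have Bm: "{z\<in>space Z. B z s} \<in> sets Z" for s
    proof -
      note majm[measurable] HT_measurable[OF borel_measurable_const, measurable] YG[measurable]
      show ?thesis unfolding B_def by measurable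
    qed
    have "measure P {\<omega>\<in>space P. B (fst \<omega>) (S N (fst \<omega>) (fst (snd \<omega>)))} = (\<integral>z. bexp N (p N z) (\<lambda>s. if B z s then 1 else 0) \<partial>Z)"
      by (rule P_prob[OF Bm])
    also have "\<dots> \<le> (\<integral>z. 2 * \<theta> \<partial>Z)"
    proof (rule integral_mono)
      have im: "(\<lambda>z. bexp N (p N z) (\<lambda>s. if B z s then 1 else 0 :: real)) \<in> borel_measurable Z"
        by (rule bexp_measurable, rule measurable_If) (use Bm in auto)
      have ib: "bexp N (p N z) (\<lambda>s. if B z s then 1 else 0) \<le> 2 * \<theta>" for z
      proof (cases "z \<in> A N \<and> Y_of z \<in> Gd")
        case False
        have "bexp N (p N z) (\<lambda>s. if B z s then 1 else 0) = bexp N (p N z) (\<lambda>_. 0 :: real)"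
          by (rule bexp_cong) (use False in \<open>auto simp: B_def\<close>)
        then show ?thesis using \<theta> by (simp add: bexp_const)
      next
        case True
        define w where "w = \<epsilon> / 4 * sqrt N"
        have w: "w > 0" using \<epsilon> r by (simp add: w_def)
        let ?R = "\<lambda>s. if \<kappa> * sqrt N < \<bar>HT_process N (p N z) s (Y_of z) (\<lambda>_. 1)\<bar> then 1 else 0 :: real"
        have maj0: "0 \<le> maj z s" if "s \<in> cube N" for s
          using mult_majorant[where N=N and L=L and p="p N z" and s=s and h="\<lambda>_. 0" and W="W (Y_of z)", OF A_p L that] True W[of "Y_of z"]
          by (simp add: maj_def sgn_sum_def)
        have "bexp N (p N z) (\<lambda>s. if B z s then 1 else 0) \<le> bexp N (p N z) (\<lambda>s. 1 / w * maj z s + ?R s)"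
        proof (rule bexp_mono[OF p_bounds'])
          fix s assume s: "s \<in> cube N"
          have m: "0 \<le> 1 / w * maj z s" using w maj0[OF s] by simp
          show "(if B z s then 1 else 0) \<le> 1 / w * maj z s + ?R s"
          proof (cases "w < maj z s")
            case True
            then have "1 \<le> 1 / w * maj z s" using w by simp
            then show ?thesis by auto
          next
            case False
            then show ?thesis using s m by (auto simp: B_def w_def)
          qed
        qed
        also have "\<dots> = 1 / w * bexp N (p N z) (maj z) + bexp N (p N z) ?R" unfolding bexp_add bexp_cmult ..
        also have "bexp N (p N z) (maj z) = 1 / L * cube_mean N (W (Y_of z))"
          unfolding maj_def[abs_def] by (rule bexp_mult_majorant) (use p_bounds in auto)
        also have "1 / w * (1 / L * cube_mean N (W (Y_of z))) \<le> 1 / w * (1 / L * (\<epsilon>' * sqrt N))"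
          using W[of "Y_of z"] True w L by (intro mult_left_mono) auto
        also have "1 / w * (1 / L * (\<epsilon>' * sqrt N)) = \<theta>"
          unfolding w_def \<epsilon>'_def using \<epsilon> L r by simp
        also have "bexp N (p N z) ?R \<le> 1 / (L * \<kappa>\<^sup>2) * (1 / real N)"
          by (rule HT_tail[OF _ \<kappa>(1) Npos]) (use True in simp)
        finally show ?thesis using N by simp
      qed
      have i0: "0 \<le> bexp N (p N z) (\<lambda>s. if B z s then 1 else 0 :: real)" for z by (rule bexp_nonneg[OF p_bounds']) auto
      show "integrable Z (\<lambda>z. bexp N (p N z) (\<lambda>s. if B z s then 1 else 0 :: real))"
        by (rule Z.integrable_const_bound[OF _ im, where B="2 * \<theta>"]) (use ib i0 in auto)
      show "integrable Z (\<lambda>_. 2 * \<theta>)" by simp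
      show "bexp N (p N z) (\<lambda>s. if B z s then 1 else 0) \<le> 2 * \<theta>" for z by (rule ib)
    qed
    also have "(\<integral>z. 2 * \<theta> \<partial>Z) = 2 * \<theta>" by (simp add: Z.prob_space)
    finally have E1: "outer_le P {\<omega>. B (fst \<omega>) (S N (fst \<omega>) (fst (snd \<omega>)))} (2 * \<theta>)"
      using P_event[OF Bm] by (intro outer_le_sets) auto
    have E2: "outer_le P {\<omega>. fst \<omega> \<in> space Z - A N} \<theta>"
    proof -
      have "outer_le Z (space Z - A N) \<theta>"
        unfolding outer_le_def using N by (intro bexI[of _ "space Z - A N"]) (auto simp: Z.prob_compl)
      from outer_le_distr[OF this fst_measurable_P distr_P_fst] show ?thesis by (simp add: vimage_def)
    qed
    have E3: "outer_le P {\<omega>. Y_of (fst \<omega>) \<in> space (iid Py) - Gd} \<theta>"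
      by (rule outer_le_Y(2)) (use Gd in \<open>auto simp: outer_le_def\<close>)
    have E4: "outer_le P {\<omega>. Y_of (fst \<omega>) \<in> {z. \<exists>f\<in>F. R0 * sqrt N < \<bar>\<Sum>i<N. f (z i) - \<mu> f\<bar>}} \<theta>"
      by (rule outer_le_Y(2)[OF N2]) (use N in simp)
    note U = outer_le_Un[OF prob_P outer_le_Un[OF prob_P outer_le_Un[OF prob_P E1 E2] E3] E4]
    show "outer_le P {\<omega>. \<exists>f\<in>F. \<exists>g\<in>F. rho_c Py f g < \<delta> \<and> \<epsilon> < \<bar>hj N \<omega> f - hj N \<omega> g\<bar>} \<eta>"
    proof (rule outer_le_mono[OF U])
      show "2 * \<theta> + \<theta> + \<theta> + \<theta> \<le> \<eta>" by (simp add: \<theta>_def)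
      show "{\<omega>. \<exists>f\<in>F. \<exists>g\<in>F. rho_c Py f g < \<delta> \<and> \<epsilon> < \<bar>hj N \<omega> f - hj N \<omega> g\<bar>} \<inter> space P
        \<subseteq> {\<omega>. B (fst \<omega>) (S N (fst \<omega>) (fst (snd \<omega>)))} \<union> {\<omega>. fst \<omega> \<in> space Z - A N} \<union>
          {\<omega>. Y_of (fst \<omega>) \<in> space (iid Py) - Gd} \<union> {\<omega>. Y_of (fst \<omega>) \<in> {z. \<exists>f\<in>F. R0 * sqrt N < \<bar>\<Sum>i<N. f (z i) - \<mu> f\<bar>}}"
        (is "_ \<subseteq> ?U")
      proof (rule subsetI, rule ccontr)
        fix \<omega> assume \<omega>: "\<omega> \<in> {\<omega>. \<exists>f\<in>F. \<exists>g\<in>F. rho_c Py f g < \<delta> \<and> \<epsilon> < \<bar>hj N \<omega> f - hj N \<omega> g\<bar>} \<inter> space P" and nU: "\<omega> \<notin> ?U"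
        define z where "z = fst \<omega>"
        define s where "s = S N (fst \<omega>) (fst (snd \<omega>))"
        have zZ: "z \<in> space Z" using \<omega> measurable_space[OF fst_measurable_P] by (simp add: z_def)
        have yY: "Y_of z \<in> space (iid Py)" by (rule measurable_space[OF Y_of_measurable zZ])
        have nB: "\<not> B z s" and zA: "z \<in> A N" and yG: "Y_of z \<in> Gd"
          and sm: "\<And>f. f \<in> F \<Longrightarrow> \<bar>\<Sum>i<N. f (Y_of z i) - \<mu> f\<bar> \<le> R0 * sqrt N"
          using nU zZ yY by (auto simp: z_def s_def not_less)
        then have s: "s \<in> cube N" and mj: "maj z s \<le> \<epsilon> / 4 * sqrt N" and R: "\<bar>HT_process N (p N z) s (Y_of z) (\<lambda>_. 1)\<bar> \<le> \<kappa> * sqrt N"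
          by (auto simp: B_def not_less)
        obtain f g where fg: "f \<in> F" "g \<in> F" "rho_c Py f g < \<delta>" "\<epsilon> < \<bar>hj N \<omega> f - hj N \<omega> g\<bar>" using \<omega> by blast
        define h where "h x = (f x - \<mu> f) - (g x - \<mu> g)" for x
        define R' where "R' = HT_process N (p N z) s (Y_of z) (\<lambda>_. 1)"
        define T where "T = HT_process N (p N z) s (Y_of z) h"
        define m where "m = emp_mean N (Y_of z) h"
        define q where "q = sqrt (real N)"
        have q: "q > 0" "real N = q * q" using Npos by (auto simp: q_def)
        have d: "hj N \<omega> f - hj N \<omega> g = hajek_process N (p N z) s (Y_of z) h"
          unfolding hj_def z_def s_def h_def[abs_def] by (rule hajek_diff[OF Npos])
        show False
        proof (cases "N_hat N (p N z) s = 0")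
          case True
          then show False using fg(4) d \<epsilon> by (simp add: hajek_process_def)
        next
          case False
          have e: "hj N \<omega> f - hj N \<omega> g = (T - R' * m) / (1 + R' / q)"
            unfolding d hajek_eq[OF Npos False] T_def R'_def m_def q_def ..
          have "\<bar>sgn_sum N e (\<lambda>i. h (Y_of z i))\<bar> \<le> W (Y_of z) e" if "e \<in> cube N" for e
            using W[OF yG] fg that by (simp add: h_def)
          from mult_majorant[where N=N and L=L and p="p N z" and s=s and h="\<lambda>i. h (Y_of z i)" and W="W (Y_of z)", OF A_p[OF zA] L s this]
          have "\<bar>\<Sum>i<N. (real (s i) / p N z i - 1) * h (Y_of z i)\<bar> \<le> \<epsilon> / 4 * q" using mj by (simp add: maj_def q_def)
          then have Tb: "\<bar>T\<bar> \<le> \<epsilon> / 4" using q(1) by (simp add: T_def HT_process_def q_def[symmetric] abs_mult pos_divide_le_eq)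
          have "(\<Sum>i<N. h (Y_of z i)) = (\<Sum>i<N. f (Y_of z i) - \<mu> f) - (\<Sum>i<N. g (Y_of z i) - \<mu> g)"
            unfolding h_def sum_subtractf ..
          then have sb: "\<bar>\<Sum>i<N. h (Y_of z i)\<bar> \<le> 2 * R0 * q" using sm[OF fg(1)] sm[OF fg(2)] by (simp add: q_def)
          have "\<bar>m\<bar> = \<bar>\<Sum>i<N. h (Y_of z i)\<bar> / (q * q)" unfolding m_def emp_mean_def q(2) by (simp add: abs_mult)
          also have "\<dots> \<le> 2 * R0 * q / (q * q)" using sb q by (intro divide_right_mono) auto
          finally have mb: "\<bar>m\<bar> \<le> 2 * R0 / q" using q by simp
          have Rb: "\<bar>R'\<bar> \<le> \<kappa> * q" using R by (simp add: R'_def q_def)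
          have "\<bar>R' * m\<bar> \<le> (\<kappa> * q) * (2 * R0 / q)" unfolding abs_mult using Rb mb \<kappa>(1) q by (intro mult_mono) auto
          also have "\<dots> = \<kappa> * (2 * R0)" using q by simp
          finally have Rm: "\<bar>R' * m\<bar> \<le> \<epsilon> / 4" using \<kappa>(3) by linarith
          have "\<bar>R' / q\<bar> \<le> \<kappa>" using Rb q by (simp add: pos_divide_le_eq)
          then have den: "1 / 2 \<le> 1 + R' / q" using \<kappa>(2) by linarith
          have num: "\<bar>T - R' * m\<bar> \<le> \<epsilon> / 2" using Tb Rm by linarith
          have "\<bar>(T - R' * m) / (1 + R' / q)\<bar> = \<bar>T - R' * m\<bar> / (1 + R' / q)" using den by (simp only: abs_divide)
          also have "\<dots> \<le> (\<epsilon> / 2) / (1 / 2)" using num den \<epsilon> by (intro frac_le) auto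
          finally show False using fg(4) unfolding e by simp
        qed
      qed
    qed
  qed
qed

end

subsection \<open>Weak convergence of processes\<close>

lemma outer_expectation_mono:
  assumes M: "prob_space M" and T: "\<And>\<omega>. \<omega> \<in> space M \<Longrightarrow> \<bar>T \<omega>\<bar> \<le> B" and T': "\<And>\<omega>. \<omega> \<in> space M \<Longrightarrow> \<bar>T' \<omega>\<bar> \<le> B"
    and le: "\<And>\<omega>. \<omega> \<in> space M \<Longrightarrow> T \<omega> \<le> T' \<omega>"
  shows "outer_expectation M T \<le> outer_expectation M T'"
proof (rule outer_expectation_ge[OF M T'])
  fix U assume U: "integrable M U" "\<And>\<omega>. \<omega> \<in> space M \<Longrightarrow> T' \<omega> \<le> U \<omega>"
  show "outer_expectation M T \<le> integral\<^sup>L M U"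
    by (rule outer_expectation_le[OF M T U(1)]) (use le U(2) order_trans in blast)+
qed

text \<open>A bounded continuous function is the increasing limit of its infimal convolutions with
  \<open>n\<close> times the distance, which are Lipschitz.\<close>

lemma Lipschitz_minorants:
  fixes m :: "'a metric" and h :: "'a \<Rightarrow> real"
  assumes h: "continuous_map (mtopology_of m) euclideanreal h" and B: "\<And>z. z \<in> mspace m \<Longrightarrow> \<bar>h z\<bar> \<le> B"
  obtains k :: "nat \<Rightarrow> 'a \<Rightarrow> real" where "\<And>n z. z \<in> mspace m \<Longrightarrow> \<bar>k n z\<bar> \<le> B" "\<And>n z. z \<in> mspace m \<Longrightarrow> k n z \<le> h z"
    "\<And>n z w. z \<in> mspace m \<Longrightarrow> w \<in> mspace m \<Longrightarrow> \<bar>k n z - k n w\<bar> \<le> real n * mdist m z w"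
    "\<And>z. z \<in> mspace m \<Longrightarrow> (\<lambda>n. k n z) \<longlonglongrightarrow> h z"
proof -
  interpret m: Metric_space "mspace m" "mdist m" by (rule Metric_space_mspace_mdist)
  define k where "k n z = (INF w\<in>mspace m. h w + real n * mdist m z w)" for n :: nat and z
  have ge: "- B \<le> h w + real n * mdist m z w" if "w \<in> mspace m" for n w z
    using B[OF that] by (smt (verit) m.nonneg mult_nonneg_nonneg of_nat_0_le_iff)
  have bdd: "bdd_below ((\<lambda>w. h w + real n * mdist m z w) ` mspace m)" for n z
    using ge by (intro bdd_belowI2[of _ "- B"]) auto
  have le: "k n z \<le> h w + real n * mdist m z w" if "w \<in> mspace m" for n z w
    unfolding k_def by (rule cINF_lower[OF bdd that])
  have gr: "c \<le> k n z" if "z \<in> mspace m" "\<And>w. w \<in> mspace m \<Longrightarrow> c \<le> h w + real n * mdist m z w" for c n z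
    unfolding k_def by (rule cINF_greatest) (use that in auto)
  have kh: "k n z \<le> h z" if "z \<in> mspace m" for n z using le[OF that, of n z] that by simp
  have kB: "\<bar>k n z\<bar> \<le> B" if "z \<in> mspace m" for n z
    using kh[OF that, of n] B[OF that] gr[OF that, of "- B" n] ge by (simp add: abs_le_iff)
  have kL: "k n z - k n w \<le> real n * mdist m z w" if z: "z \<in> mspace m" and w: "w \<in> mspace m" for n z w
  proof -
    have "k n z - real n * mdist m z w \<le> k n w"
    proof (rule gr[OF w])
      fix v assume v: "v \<in> mspace m"
      have "real n * mdist m z v \<le> real n * (mdist m z w + mdist m w v)"
        by (intro mult_left_mono m.triangle z w v) simp
      then show "k n z - real n * mdist m z w \<le> h v + real n * mdist m w v"
        using le[OF v, of n z] unfolding distrib_left by linarith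
    qed
    then show ?thesis by simp
  qed
  have lim: "(\<lambda>n. k n z) \<longlonglongrightarrow> h z" if z: "z \<in> mspace m" for z
  proof (rule order_tendstoI)
    fix a assume a: "a < h z"
    define b where "b = (a + h z) / 2"
    have b: "a < b" "b < h z" using a by (auto simp: b_def)
    have "openin (mtopology_of m) {w\<in>topspace (mtopology_of m). h w \<in> {b<..}}"
      using h openin_continuous_map_preimage[OF h, of "{b<..}"] by simp
    then have "openin m.mtopology {w\<in>mspace m. h w \<in> {b<..}}" by (simp add: mtopology_of_def)
    then obtain r where r: "r > 0" "m.mball z r \<subseteq> {w\<in>mspace m. h w \<in> {b<..}}"
      unfolding m.openin_mtopology using z b by auto
    \<comment> \<open>Beyond distance \<open>r\<close> the penalty then exceeds
      \<open>2 * B\<close>, the largest possible drop of \<open>h\<close>, so only the ball matters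
      for the infimum.\<close>
    obtain n0 :: nat where n0: "2 * B / r < real n0" using reals_Archimedean2 by blast
    show "\<forall>\<^sub>F n in sequentially. a < k n z"
      using eventually_ge_at_top[of n0]
    proof eventually_elim
      case (elim n)
      have "b \<le> k n z"
      proof (rule gr[OF z])
        fix w assume w: "w \<in> mspace m"
        show "b \<le> h w + real n * mdist m z w"
        proof (cases "mdist m z w < r")
          case True
          then have "w \<in> m.mball z r" using z w by simp
          then have "b < h w" using r(2) by auto
          moreover have "0 \<le> real n * mdist m z w" by simp
          ultimately show ?thesis by linarith
        next
          case False
          have "2 * B < real n0 * r" using n0 r(1) by (simp add: pos_divide_less_eq)
          also have "\<dots> \<le> real n * mdist m z w" using elim False r by (intro mult_mono) auto
          finally show ?thesis using B[OF w] B[OF z] b by linarith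
        qed
      qed
      then show ?case using b by simp
    qed
  next
    fix a assume "h z < a"
    then show "\<forall>\<^sub>F n in sequentially. k n z < a" using kh[OF z] by (intro always_eventually allI) (rule le_less_trans)
  qed
  show ?thesis
  proof (rule that[of k, OF kB kh _ lim])
    fix n z w assume "z \<in> mspace m" "w \<in> mspace m"
    then show "\<bar>k n z - k n w\<bar> \<le> real n * mdist m z w" using kL[of z w n] kL[of w z n] m.commute[of z w] by (simp add: abs_le_iff)
  qed
qed

locale weak_limit =
  fixes P :: "'o measure" and Hs :: "nat \<Rightarrow> 'o \<Rightarrow> 'a \<Rightarrow> real" and F :: "'a set" and \<rho> :: "'a \<Rightarrow> 'a \<Rightarrow> real"
    and t :: "nat \<Rightarrow> 'a" and M :: "'w measure" and X :: "nat \<Rightarrow> 'w \<Rightarrow> real"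
  assumes P: "prob_space P" and M: "prob_space M" and t_in: "\<And>j. t j \<in> F"
    and Hs_measurable: "\<And>N f. f \<in> F \<Longrightarrow> (\<lambda>\<omega>. Hs N \<omega> f) \<in> borel_measurable P"
    and X_measurable: "\<And>j. X j \<in> borel_measurable M"
    and conv: "\<And>k a b. (\<lambda>N. \<integral>\<omega>. cos ((\<Sum>j<k. a j * Hs N \<omega> (t j)) + b) \<partial>P) \<longlonglongrightarrow> (\<integral>\<omega>. cos ((\<Sum>j<k. a j * X j \<omega>) + b) \<partial>M)"
    and equiP: "\<And>\<epsilon> \<eta>. \<epsilon> > 0 \<Longrightarrow> \<eta> > 0 \<Longrightarrow> \<exists>\<delta>>0. \<exists>N0. \<forall>N\<ge>N0.
      outer_le P {\<omega>. \<exists>f\<in>F. \<exists>g\<in>F. \<rho> f g < \<delta> \<and> \<epsilon> < \<bar>Hs N \<omega> f - Hs N \<omega> g\<bar>} \<eta>"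
begin

interpretation P: prob_space P by (rule P)
interpretation M: prob_space M by (rule M)

lemma
  fixes H :: "(nat \<Rightarrow> real) \<Rightarrow> real"
  assumes H: "continuous_on UNIV H"
  shows Hs_seq: "(\<lambda>\<omega>. H (\<lambda>j. Hs N \<omega> (t j))) \<in> borel_measurable P" and X_seq: "(\<lambda>\<omega>. H (\<lambda>j. X j \<omega>)) \<in> borel_measurable M"
  by (rule measurable_compose[OF _ borel_measurable_continuous_onI[OF H]], rule measurable_coordinatewise_then_product,
      rule Hs_measurable X_measurable, rule t_in)
    (rule measurable_compose[OF _ borel_measurable_continuous_onI[OF H]], rule measurable_coordinatewise_then_product, rule X_measurable)

lemma seq_limit:
  fixes H :: "(nat \<Rightarrow> real) \<Rightarrow> real"
  assumes H: "continuous_on UNIV H" and fin: "\<And>x. H x = H (\<lambda>j. if j < k then x j else 0)" and B: "\<And>x. \<bar>H x\<bar> \<le> B"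
  shows "(\<lambda>N. \<integral>\<omega>. H (\<lambda>j. Hs N \<omega> (t j)) \<partial>P) \<longlonglongrightarrow> (\<integral>\<omega>. H (\<lambda>j. X j \<omega>) \<partial>M)"
  by (rule cramer_wold[where X="\<lambda>N \<omega> j. Hs N \<omega> (t j)" and Z="\<lambda>\<omega> j. X j \<omega>", OF P M Hs_measurable[OF t_in] X_measurable conv H fin B Hs_seq[OF H] X_seq[OF H]])

text \<open>For finitely many coordinates the event has a continuous bounded substitute, whose mean
  passes to the limit. The outer bound for the processes holds for all pairs in \<open>F\<close> at
  once, so \<open>\<delta>\<close> does not depend on \<open>n\<close>.\<close>

lemma equi_limit:
  assumes \<epsilon>: "\<epsilon> > 0" and \<eta>: "\<eta> > 0"
  shows "\<exists>\<delta>>0. \<forall>n. measure M {\<omega>\<in>space M. \<exists>j<n. \<exists>k<n. \<rho> (t j) (t k) < \<delta> \<and> \<epsilon> < \<bar>X j \<omega> - X k \<omega>\<bar>} \<le> \<eta>"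
proof -
  have "\<epsilon> / 2 > 0" using \<epsilon> by simp
  from equiP[OF this \<eta>] obtain \<delta> N0 where \<delta>: "\<delta> > 0"
    and N0: "\<And>N. N \<ge> N0 \<Longrightarrow> outer_le P {\<omega>. \<exists>f\<in>F. \<exists>g\<in>F. \<rho> f g < \<delta> \<and> \<epsilon> / 2 < \<bar>Hs N \<omega> f - Hs N \<omega> g\<bar>} \<eta>" by blast
  show ?thesis
  proof (intro exI[of _ \<delta>] conjI \<delta> allI)
    fix n
    define ramp where "ramp y = min 1 (max 0 (2 * y / \<epsilon> - 1))" for y :: real
    define S where "S = {jk. fst jk < n \<and> snd jk < n \<and> \<rho> (t (fst jk)) (t (snd jk)) < \<delta>}"
    have S: "finite S" by (rule finite_subset[of _ "{..<n} \<times> {..<n}"]) (auto simp: S_def)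
    \<comment> \<open>A continuous version of the indicator that some pair in \<open>S\<close>
      oscillates: it vanishes if all increments are at most \<open>\<epsilon> / 2\<close> and equals
      1 if one of them exceeds \<open>\<epsilon>\<close>.\<close>
    define H where "H x = 1 - (\<Prod>jk\<in>S. 1 - ramp \<bar>x (fst jk) - x (snd jk)\<bar>)" for x :: "nat \<Rightarrow> real"
    have ramp: "0 \<le> ramp y" "ramp y \<le> 1" for y by (auto simp: ramp_def)
    have H01: "0 \<le> H x" "H x \<le> 1" for x
      unfolding H_def using ramp by (auto intro!: prod_le_1 prod_nonneg)
    have Hc: "continuous_on UNIV H"
      unfolding H_def ramp_def by (intro continuous_intros continuous_on_product_coordinates) (use \<epsilon> in auto)
    have Hfin: "H x = H (\<lambda>j. if j < n then x j else 0)" for x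
      unfolding H_def by (intro arg_cong2[where f="(-)"] refl prod.cong) (auto simp: S_def)
    have H0: "H x = 0" if "\<And>jk. jk \<in> S \<Longrightarrow> \<bar>x (fst jk) - x (snd jk)\<bar> \<le> \<epsilon> / 2" for x
    proof -
      have "ramp \<bar>x (fst jk) - x (snd jk)\<bar> = 0" if jk: "jk \<in> S" for jk
      proof -
        have "2 * \<bar>x (fst jk) - x (snd jk)\<bar> / \<epsilon> \<le> 1" using \<open>jk \<in> S \<Longrightarrow> _\<close>[OF jk] \<epsilon> by (simp add: pos_divide_le_eq)
        then show ?thesis by (simp add: ramp_def)
      qed
      then show ?thesis by (simp add: H_def)
    qed
    have H1: "H x = 1" if "jk \<in> S" "\<epsilon> < \<bar>x (fst jk) - x (snd jk)\<bar>" for x jk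
    proof -
      have "2 \<le> 2 * \<bar>x (fst jk) - x (snd jk)\<bar> / \<epsilon>" using that(2) \<epsilon> by (simp add: pos_le_divide_eq)
      then have "1 - ramp \<bar>x (fst jk) - x (snd jk)\<bar> = 0" by (simp add: ramp_def)
      then show ?thesis unfolding H_def using S that(1) by (simp add: prod_zero_iff) blast
    qed
    have Hi: "integrable M (\<lambda>\<omega>. H (\<lambda>j. X j \<omega>))" "integrable P (\<lambda>\<omega>. H (\<lambda>j. Hs N \<omega> (t j)))" for N
      using H01 by (auto intro!: M.integrable_const_bound[where B=1] P.integrable_const_bound[where B=1] Hs_seq X_seq Hc)
    have "(\<integral>\<omega>. H (\<lambda>j. X j \<omega>) \<partial>M) \<le> \<eta>"
    proof (rule LIMSEQ_le_const2[OF seq_limit[OF Hc Hfin]])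
      show "\<bar>H x\<bar> \<le> 1" for x using H01[of x] by simp
      have "(\<integral>\<omega>. H (\<lambda>j. Hs N \<omega> (t j)) \<partial>P) \<le> \<eta>" if N: "N \<ge> N0" for N
      proof -
        obtain A where A: "A \<in> sets P" "{\<omega>. \<exists>f\<in>F. \<exists>g\<in>F. \<rho> f g < \<delta> \<and> \<epsilon> / 2 < \<bar>Hs N \<omega> f - Hs N \<omega> g\<bar>} \<inter> space P \<subseteq> A" "measure P A \<le> \<eta>"
          using N0[OF N] unfolding outer_le_def by blast
        have "(\<integral>\<omega>. H (\<lambda>j. Hs N \<omega> (t j)) \<partial>P) \<le> (\<integral>\<omega>. indicator A \<omega> \<partial>P)"
        proof (rule integral_mono[OF Hi(2)])
          show "integrable P (indicator A :: _ \<Rightarrow> real)" using A by (simp add: P.emeasure_eq_measure)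
          fix \<omega> assume \<omega>: "\<omega> \<in> space P"
          show "H (\<lambda>j. Hs N \<omega> (t j)) \<le> indicator A \<omega>"
          proof (cases "\<omega> \<in> A")
            case False
            have "H (\<lambda>j. Hs N \<omega> (t j)) = 0"
            proof (rule H0, rule ccontr)
              fix jk assume "jk \<in> S" "\<not> \<bar>Hs N \<omega> (t (fst jk)) - Hs N \<omega> (t (snd jk))\<bar> \<le> \<epsilon> / 2"
              then have "\<omega> \<in> {\<omega>. \<exists>f\<in>F. \<exists>g\<in>F. \<rho> f g < \<delta> \<and> \<epsilon> / 2 < \<bar>Hs N \<omega> f - Hs N \<omega> g\<bar>} \<inter> space P"
                using \<omega> t_in by (auto simp: S_def not_le)
              then show False using A(2) False by blast
            qed
            then show ?thesis using False by simp
          qed (use H01 in simp)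
        qed
        also have "\<dots> = measure P A" using A by simp
        finally show ?thesis using A(3) by simp
      qed
      then show "\<exists>N. \<forall>n\<ge>N. (\<integral>\<omega>. H (\<lambda>j. Hs n \<omega> (t j)) \<partial>P) \<le> \<eta>" by blast
    qed
    moreover have "measure M {\<omega>\<in>space M. \<exists>j<n. \<exists>k<n. \<rho> (t j) (t k) < \<delta> \<and> \<epsilon> < \<bar>X j \<omega> - X k \<omega>\<bar>} \<le> (\<integral>\<omega>. H (\<lambda>j. X j \<omega>) \<partial>M)"
    proof -
      note X_measurable[measurable]
      let ?E = "{\<omega>\<in>space M. \<exists>j<n. \<exists>k<n. \<rho> (t j) (t k) < \<delta> \<and> \<epsilon> < \<bar>X j \<omega> - X k \<omega>\<bar>}"
      have E: "?E \<in> sets M" by measurable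
      have "measure M ?E = (\<integral>\<omega>. indicator ?E \<omega> \<partial>M)" using E by simp
      also have "\<dots> \<le> (\<integral>\<omega>. H (\<lambda>j. X j \<omega>) \<partial>M)"
      proof (rule integral_mono[OF _ Hi(1)])
        show "integrable M (indicator ?E :: _ \<Rightarrow> real)" using E by (simp add: M.emeasure_eq_measure)
        fix \<omega>
        show "indicator ?E \<omega> \<le> H (\<lambda>j. X j \<omega>)"
        proof (cases "\<omega> \<in> ?E")
          case True
          then obtain j k where "(j, k) \<in> S" "\<epsilon> < \<bar>X j \<omega> - X k \<omega>\<bar>" by (auto simp: S_def)
          then show ?thesis using H1[of "(j, k)" "\<lambda>j. X j \<omega>"] True by simp
        qed (use H01 in simp)
      qed
      finally show ?thesis .
    qed
    ultimately show "measure M {\<omega>\<in>space M. \<exists>j<n. \<exists>k<n. \<rho> (t j) (t k) < \<delta> \<and> \<epsilon> < \<bar>X j \<omega> - X k \<omega>\<bar>} \<le> \<eta>" by linarith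
  qed
qed

end

locale weak_path = weak_limit P Hs F \<rho> t M X + path_extension M F \<rho> t idx J X
  for P :: "'o measure" and Hs :: "nat \<Rightarrow> 'o \<Rightarrow> 'a \<Rightarrow> real" and F \<rho> t and M :: "'w measure" and X idx J +
  assumes Hs_space: "\<And>N \<omega>. \<omega> \<in> space P \<Longrightarrow> Hs N \<omega> \<in> mspace (linf F)"
begin

interpretation P: prob_space P by (rule P)

text \<open>Both \<open>Hs N\<close> and \<open>G\<close> are uniformly close to their step
  approximations outside small sets, and for step approximations \<open>h\<close> is a continuous
  function of finitely many coordinates, covered by \<open>seq_limit\<close>.\<close>

lemma weak_Lipschitz:
  fixes h :: "('a \<Rightarrow> real) \<Rightarrow> real"
  assumes Lip: "\<And>z w. z \<in> mspace (linf F) \<Longrightarrow> w \<in> mspace (linf F) \<Longrightarrow> \<bar>h z - h w\<bar> \<le> K * mdist (linf F) z w"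
    and B: "\<And>z. z \<in> mspace (linf F) \<Longrightarrow> \<bar>h z\<bar> \<le> B"
  shows "(\<lambda>N. outer_expectation P (\<lambda>\<omega>. h (Hs N \<omega>))) \<longlonglongrightarrow> (\<integral>\<omega>. h (G \<omega>) \<partial>M)"
proof (rule LIMSEQ_I)
  fix r :: real assume r: "r > 0"
  interpret L: Metric_space "mspace (linf F)" "mdist (linf F)" by (rule Metric_space_mspace_mdist)
  have B0: "0 \<le> B" using B[OF step_space[of 0 "\<lambda>_. 0"]] by linarith
  \<comment> \<open>Distance \<open>\<epsilon>\<close> changes \<open>h\<close> by at most
    \<open>r / 8\<close>, and an exceptional set of probability \<open>\<eta>\<close> costs
    \<open>r / 8\<close> more; the two approximations and the finite-dimensional limit take
    \<open>r / 4\<close> each.\<close>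
  define \<epsilon> where "\<epsilon> = r / (8 * (\<bar>K\<bar> + 1))"
  define \<eta> where "\<eta> = r / (16 * (B + 1))"
  have \<epsilon>: "\<epsilon> > 0" and \<eta>: "\<eta> > 0" using r B0 by (auto simp: \<epsilon>_def \<eta>_def)
  have K\<epsilon>: "\<bar>K\<bar> * \<epsilon> \<le> r / 8"
  proof -
    have "k * (r / (8 * k)) = r / 8" if "k > 0" for k :: real using that by simp
    from this[of "\<bar>K\<bar> + 1"] have "(\<bar>K\<bar> + 1) * \<epsilon> = r / 8" unfolding \<epsilon>_def by argo
    then show ?thesis using \<epsilon> by (simp add: distrib_right)
  qed
  have B\<eta>: "2 * B * \<eta> \<le> r / 8"
  proof -
    have "2 * k * (r / (16 * k)) = r / 8" if "k > 0" for k :: real using that by simp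
    from this[of "B + 1"] B0 have "2 * (B + 1) * \<eta> = r / 8" unfolding \<eta>_def by simp
    moreover have "2 * (B + 1) * \<eta> = 2 * B * \<eta> + 2 * \<eta>" by (simp add: distrib_right distrib_left)
    ultimately show ?thesis using \<eta> by linarith
  qed
  obtain \<delta>1 where \<delta>1: "\<delta>1 > 0" "prob (osc \<delta>1 \<epsilon>) \<le> \<eta>" using osc_small[OF \<epsilon> \<eta>] by blast
  obtain \<delta>2 N0 where \<delta>2: "\<delta>2 > 0" and N0: "\<And>N. N \<ge> N0 \<Longrightarrow> outer_le P {\<omega>. \<exists>f\<in>F. \<exists>g\<in>F. \<rho> f g < \<delta>2 \<and> \<epsilon> < \<bar>Hs N \<omega> f - Hs N \<omega> g\<bar>} \<eta>"
    using equiP[OF \<epsilon> \<eta>] by blast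
  \<comment> \<open>One level serves both sides: \<open>\<delta>1 / 24\<close> is the margin of
    \<open>step_close\<close> for the limit, \<open>\<delta>2\<close> that of \<open>equiP\<close>
    for the processes.\<close>
  obtain m where m: "rate m < min (\<delta>1 / 24) \<delta>2" using rate_approx[of "min (\<delta>1 / 24) \<delta>2"] \<delta>1 \<delta>2 by auto
  define V where "V x = h (step m x)" for x
  have close: "\<bar>h z - h w\<bar> \<le> r / 8" if zw: "z \<in> mspace (linf F)" "w \<in> mspace (linf F)" and c: "\<And>f. f \<in> F \<Longrightarrow> \<bar>z f - w f\<bar> \<le> \<epsilon>" for z w
  proof -
    have "\<bar>h z - h w\<bar> \<le> K * mdist (linf F) z w" by (rule Lip[OF zw])
    also have "\<dots> \<le> \<bar>K\<bar> * mdist (linf F) z w" by (intro mult_right_mono) auto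
    also have "\<dots> \<le> \<bar>K\<bar> * \<epsilon>" using c linf_mdist_le[OF zw F_ne, of \<epsilon>] by (intro mult_left_mono) auto
    finally show ?thesis using K\<epsilon> by simp
  qed
  have far: "\<bar>h z - h w\<bar> \<le> 2 * B" if zw: "z \<in> mspace (linf F)" "w \<in> mspace (linf F)" for z w
    using B[OF zw(1)] B[OF zw(2)] by linarith
  have hc: "continuous_map (mtopology_of (linf F)) euclideanreal h" by (rule Lipschitz_continuous_linf[OF Lip])
  have Vc: "continuous_on UNIV V"
    unfolding continuous_on_open_vimage[OF open_UNIV]
  proof (intro allI impI)
    fix S :: "real set" assume "open S"
    then have "openin (mtopology_of (linf F)) {z\<in>topspace (mtopology_of (linf F)). h z \<in> S}"
      by (intro openin_continuous_map_preimage[OF hc]) simp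
    from open_step_preimage[OF this, of m] show "open (V -` S \<inter> UNIV)"
      using step_space by (simp add: V_def vimage_def topspace_linf)
  qed
  have Vfin: "V x = V (\<lambda>j. if j < J m then x j else 0)" for x
    unfolding V_def step_def using idx(1) by (intro arg_cong[where f=h] restrict_ext) simp
  have VB: "\<bar>V x\<bar> \<le> B" for x unfolding V_def by (rule B[OF step_space])
  let ?a = "\<lambda>N. \<integral>\<omega>. V (\<lambda>j. Hs N \<omega> (t j)) \<partial>P"
  let ?b = "\<integral>\<omega>. V (\<lambda>j. X j \<omega>) \<partial>M"
  have Vi: "integrable M (\<lambda>\<omega>. V (\<lambda>j. X j \<omega>))" "integrable P (\<lambda>\<omega>. V (\<lambda>j. Hs N \<omega> (t j)))" for N
    using VB by (auto intro!: integrable_const_bound[where B=B] P.integrable_const_bound[where B=B] Hs_seq X_seq Vc)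
  have hGi: "integrable M (\<lambda>\<omega>. h (G \<omega>))"
    by (rule integrable_const_bound[where B=B])
       (use B[OF G_space] in \<open>auto intro!: measurable_compose[OF G_measurable continuous_map_linf_borel_measurable[OF hc]]\<close>)
  have 1: "\<bar>?b - (\<integral>\<omega>. h (G \<omega>) \<partial>M)\<bar> \<le> r / 4"
  proof -
    have "\<bar>?b - (\<integral>\<omega>. h (G \<omega>) \<partial>M)\<bar> = \<bar>\<integral>\<omega>. V (\<lambda>j. X j \<omega>) - h (G \<omega>) \<partial>M\<bar>" using Vi hGi by simp
    also have "\<dots> \<le> (\<integral>\<omega>. \<bar>V (\<lambda>j. X j \<omega>) - h (G \<omega>)\<bar> \<partial>M)" by (rule integral_abs_bound)
    also have "\<dots> \<le> (\<integral>\<omega>. r / 8 + 2 * B * indicator (osc \<delta>1 \<epsilon>) \<omega> \<partial>M)"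
    proof (rule integral_mono_AE)
      show "AE \<omega> in M. \<bar>V (\<lambda>j. X j \<omega>) - h (G \<omega>)\<bar> \<le> r / 8 + 2 * B * indicator (osc \<delta>1 \<epsilon>) \<omega>"
        using AE_good
      proof eventually_elim
        case (elim \<omega>)
        show ?case
        proof (cases "\<omega> \<in> osc \<delta>1 \<epsilon>")
          case False
          have "\<bar>V (\<lambda>j. X j \<omega>) - h (G \<omega>)\<bar> \<le> r / 8"
            unfolding V_def by (rule close[OF step_space G_space step_close[OF elim False]]) (use m in auto)
          then show ?thesis using False by simp
        next
          case True
          then show ?thesis using far[OF step_space[of m "\<lambda>j. X j \<omega>"] G_space[of \<omega>]] r by (simp add: V_def)
        qed
      qed
    qed (use Vi hGi in \<open>auto simp: emeasure_eq_measure\<close>)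
    also have "\<dots> = r / 8 + 2 * B * prob (osc \<delta>1 \<epsilon>)" by (simp add: prob_space emeasure_eq_measure)
    also have "\<dots> \<le> r / 8 + 2 * B * \<eta>" using \<delta>1(2) B0 by (intro add_left_mono mult_left_mono) auto
    finally show ?thesis using B\<eta> by simp
  qed
  have 2: "\<bar>outer_expectation P (\<lambda>\<omega>. h (Hs N \<omega>)) - ?a N\<bar> \<le> r / 4" if N: "N \<ge> N0" for N
  proof -
    obtain A where A: "A \<in> sets P" "{\<omega>. \<exists>f\<in>F. \<exists>g\<in>F. \<rho> f g < \<delta>2 \<and> \<epsilon> < \<bar>Hs N \<omega> f - Hs N \<omega> g\<bar>} \<inter> space P \<subseteq> A" "measure P A \<le> \<eta>"
      using N0[OF N] unfolding outer_le_def by blast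
    let ?e = "\<lambda>\<omega>. r / 8 + 2 * B * indicator A \<omega>"
    have ei: "integrable P ?e" using A by (simp add: P.emeasure_eq_measure)
    have ee: "integral\<^sup>L P ?e \<le> r / 4"
    proof -
      have "integral\<^sup>L P ?e = r / 8 + 2 * B * measure P A" using A by (simp add: P.prob_space P.emeasure_eq_measure)
      also have "\<dots> \<le> r / 8 + 2 * B * \<eta>" using A(3) B0 by (intro add_left_mono mult_left_mono) auto
      finally show ?thesis using B\<eta> by simp
    qed
    have pt: "\<bar>h (Hs N \<omega>) - V (\<lambda>j. Hs N \<omega> (t j))\<bar> \<le> ?e \<omega>" if \<omega>: "\<omega> \<in> space P" for \<omega>
    proof (cases "\<omega> \<in> A")
      case False
      have "\<bar>Hs N \<omega> f - step m (\<lambda>j. Hs N \<omega> (t j)) f\<bar> \<le> \<epsilon>" if f: "f \<in> F" for f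
      proof (rule ccontr)
        assume "\<not> \<bar>Hs N \<omega> f - step m (\<lambda>j. Hs N \<omega> (t j)) f\<bar> \<le> \<epsilon>"
        then have "\<epsilon> < \<bar>Hs N \<omega> f - Hs N \<omega> (t (idx m f))\<bar>" using f by (simp add: step_def not_le)
        moreover have "\<rho> f (t (idx m f)) < \<delta>2" using idx(2)[OF f, of m] m by simp
        ultimately have "\<omega> \<in> {\<omega>. \<exists>f\<in>F. \<exists>g\<in>F. \<rho> f g < \<delta>2 \<and> \<epsilon> < \<bar>Hs N \<omega> f - Hs N \<omega> g\<bar>} \<inter> space P" using f \<omega> t_in by blast
        then show False using A(2) False by blast
      qed
      then have "\<bar>h (Hs N \<omega>) - V (\<lambda>j. Hs N \<omega> (t j))\<bar> \<le> r / 8"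
        unfolding V_def by (intro close Hs_space[OF \<omega>] step_space)
      then show ?thesis using False by simp
    next
      case True
      then show ?thesis using far[OF Hs_space[OF \<omega>, of N] step_space[of m "\<lambda>j. Hs N \<omega> (t j)"]] r by (simp add: V_def)
    qed
    have gen: "\<bar>x - v\<bar> \<le> e \<Longrightarrow> x \<le> u \<Longrightarrow> v - e \<le> u" for x v e u :: real by linarith
    have hb: "\<bar>h (Hs N \<omega>)\<bar> \<le> B" if "\<omega> \<in> space P" for \<omega> by (rule B[OF Hs_space[OF that]])
    have "outer_expectation P (\<lambda>\<omega>. h (Hs N \<omega>)) \<le> (\<integral>\<omega>. V (\<lambda>j. Hs N \<omega> (t j)) + ?e \<omega> \<partial>P)"
    proof (rule outer_expectation_le[OF P hb Bochner_Integration.integrable_add[OF Vi(2) ei]])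
      fix \<omega> assume "\<omega> \<in> space P"
      from abs_le_D1[OF pt[OF this]] show "h (Hs N \<omega>) \<le> V (\<lambda>j. Hs N \<omega> (t j)) + ?e \<omega>" by (simp only: diff_le_eq add.commute)
    qed
    also have "\<dots> = ?a N + integral\<^sup>L P ?e" by (rule Bochner_Integration.integral_add[OF Vi(2) ei])
    finally have u: "outer_expectation P (\<lambda>\<omega>. h (Hs N \<omega>)) \<le> ?a N + r / 4" using ee by linarith
    have "?a N - integral\<^sup>L P ?e \<le> outer_expectation P (\<lambda>\<omega>. h (Hs N \<omega>))"
    proof (rule outer_expectation_ge[OF P hb])
      fix U assume U: "integrable P U" "\<And>\<omega>. \<omega> \<in> space P \<Longrightarrow> h (Hs N \<omega>) \<le> U \<omega>"
      have "?a N - integral\<^sup>L P ?e = (\<integral>\<omega>. V (\<lambda>j. Hs N \<omega> (t j)) - ?e \<omega> \<partial>P)"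
        by (rule Bochner_Integration.integral_diff[OF Vi(2) ei, symmetric])
      also have "\<dots> \<le> integral\<^sup>L P U"
      proof (rule integral_mono[OF Bochner_Integration.integrable_diff[OF Vi(2) ei] U(1)])
        fix \<omega> assume \<omega>: "\<omega> \<in> space P"
        show "V (\<lambda>j. Hs N \<omega> (t j)) - ?e \<omega> \<le> U \<omega>" 
          using gen[OF pt[OF \<omega>] U(2)[OF \<omega>]] .
      qed
      finally show "?a N - integral\<^sup>L P ?e \<le> integral\<^sup>L P U" .
    qed
    then show ?thesis using u ee by linarith
  qed
  have "\<forall>\<^sub>F N in sequentially. \<bar>?a N - ?b\<bar> < r / 4"
    using tendstoD[OF seq_limit[OF Vc Vfin VB], of "r / 4"] r by (simp add: dist_real_def)
  then have "\<forall>\<^sub>F N in sequentially. norm (outer_expectation P (\<lambda>\<omega>. h (Hs N \<omega>)) - (\<integral>\<omega>. h (G \<omega>) \<partial>M)) < r"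
    using eventually_ge_at_top[of N0]
  proof eventually_elim
    case (elim N)
    then show ?case unfolding real_norm_def using 1 2[OF elim(2)] r by linarith
  qed
  then show "\<exists>N0. \<forall>N\<ge>N0. norm (outer_expectation P (\<lambda>\<omega>. h (Hs N \<omega>)) - (\<integral>\<omega>. h (G \<omega>) \<partial>M)) < r"
    by (simp only: eventually_sequentially)
qed

text \<open>A lower bound comes from Lipschitz minorants of \<open>h\<close>, an upper bound from
  those of \<open>- h\<close>; their integrals under the limit converge by dominated
  convergence.\<close>

lemma weak: "weakly_converges P F Hs M G"
  unfolding weakly_converges_def
proof (intro conjI allI impI ballI Hs_space)
  fix h assume h: "continuous_map (mtopology_of (linf F)) euclideanreal h \<and> bounded (h ` mspace (linf F))"
  then have hc: "continuous_map (mtopology_of (linf F)) euclideanreal h" by simp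
  obtain B where B: "\<And>z. z \<in> mspace (linf F) \<Longrightarrow> \<bar>h z\<bar> \<le> B" using h by (auto simp: bounded_iff)
  have hB: "\<bar>h (Hs N \<omega>)\<bar> \<le> B" if "\<omega> \<in> space P" for N \<omega> by (rule B[OF Hs_space[OF that]])
  \<comment> \<open>Outer expectation is not odd, so the sign \<open>s\<close> stands outside it.
    For \<open>s = - 1\<close> the functions \<open>- k n\<close> are Lipschitz majorants of
    \<open>h\<close>, and monotonicity is applied to them.\<close>
  have lower: "\<forall>\<^sub>F N in sequentially. a < s * outer_expectation P (\<lambda>\<omega>. h (Hs N \<omega>))"
    if a: "a < (\<integral>\<omega>. s * h (G \<omega>) \<partial>M)" and s: "s = 1 \<or> s = - 1" for a s
  proof -
    have shc: "continuous_map (mtopology_of (linf F)) euclideanreal (\<lambda>z. s * h z)" by (intro continuous_map_real_mult_left hc)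
    have shB: "\<bar>s * h z\<bar> \<le> B" if "z \<in> mspace (linf F)" for z using B[OF that] s by auto
    obtain k where kB: "\<And>n z. z \<in> mspace (linf F) \<Longrightarrow> \<bar>k n z\<bar> \<le> B" and kh: "\<And>n z. z \<in> mspace (linf F) \<Longrightarrow> k n z \<le> s * h z"
      and kL: "\<And>n z w. z \<in> mspace (linf F) \<Longrightarrow> w \<in> mspace (linf F) \<Longrightarrow> \<bar>k n z - k n w\<bar> \<le> real n * mdist (linf F) z w"
      and kl: "\<And>z. z \<in> mspace (linf F) \<Longrightarrow> (\<lambda>n. k n z) \<longlonglongrightarrow> s * h z"
      using Lipschitz_minorants[of "linf F" "\<lambda>z. s * h z" B, OF shc shB] by blast
    have "(\<lambda>n. \<integral>\<omega>. k n (G \<omega>) \<partial>M) \<longlonglongrightarrow> (\<integral>\<omega>. s * h (G \<omega>) \<partial>M)"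
    proof (rule integral_dominated_convergence[where w="\<lambda>_. B"])
      show "(\<lambda>\<omega>. s * h (G \<omega>)) \<in> borel_measurable M"
        by (rule measurable_compose[OF G_measurable continuous_map_linf_borel_measurable[OF shc]])
      show "(\<lambda>\<omega>. k n (G \<omega>)) \<in> borel_measurable M" for n
        by (rule measurable_compose[OF G_measurable continuous_map_linf_borel_measurable[OF Lipschitz_continuous_linf[OF kL]]])
    qed (use kl[OF G_space] kB[OF G_space] in auto)
    from order_tendstoD(1)[OF this a] obtain n where n: "a < (\<integral>\<omega>. k n (G \<omega>) \<partial>M)"
      by (auto simp: eventually_sequentially)
    show ?thesis
    proof (cases "s = 1")
      case True
      have "(\<lambda>N. outer_expectation P (\<lambda>\<omega>. k n (Hs N \<omega>))) \<longlonglongrightarrow> (\<integral>\<omega>. k n (G \<omega>) \<partial>M)"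
        by (rule weak_Lipschitz[where h="k n" and K="real n" and B=B]) (rule kL, assumption, assumption, rule kB, assumption)
      from order_tendstoD(1)[OF this n] show ?thesis
      proof eventually_elim
        case (elim N)
        have "outer_expectation P (\<lambda>\<omega>. k n (Hs N \<omega>)) \<le> outer_expectation P (\<lambda>\<omega>. h (Hs N \<omega>))"
          by (rule outer_expectation_mono[where B=B, OF P kB[OF Hs_space] hB]) (use kh[OF Hs_space] True in auto)
        then show ?case using elim True by simp
      qed
    next
      case False
      then have s: "s = - 1" using s by simp
      have "(\<lambda>N. outer_expectation P (\<lambda>\<omega>. - k n (Hs N \<omega>))) \<longlonglongrightarrow> (\<integral>\<omega>. - k n (G \<omega>) \<partial>M)"
      proof (rule weak_Lipschitz[where h="\<lambda>z. - k n z" and K="real n" and B=B])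
        fix z w assume "z \<in> mspace (linf F)" "w \<in> mspace (linf F)"
        from kL[OF this, of n] show "\<bar>- k n z - - k n w\<bar> \<le> real n * mdist (linf F) z w" by linarith
      next
        fix z assume "z \<in> mspace (linf F)"
        from kB[OF this, of n] show "\<bar>- k n z\<bar> \<le> B" by simp
      qed
      moreover have "(\<integral>\<omega>. - k n (G \<omega>) \<partial>M) < - a" using n by simp
      ultimately have "\<forall>\<^sub>F N in sequentially. outer_expectation P (\<lambda>\<omega>. - k n (Hs N \<omega>)) < - a" by (rule order_tendstoD(2))
      then show ?thesis
      proof eventually_elim
        case (elim N)
        have "outer_expectation P (\<lambda>\<omega>. h (Hs N \<omega>)) \<le> outer_expectation P (\<lambda>\<omega>. - k n (Hs N \<omega>))"
        proof (rule outer_expectation_mono[where B=B, OF P hB])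
          fix \<omega> assume "\<omega> \<in> space P"
          note z = Hs_space[OF this, of N]
          show "\<bar>- k n (Hs N \<omega>)\<bar> \<le> B" using kB[OF z] by simp
          show "h (Hs N \<omega>) \<le> - k n (Hs N \<omega>)" using kh[OF z, of n] s by simp
        qed
        then show ?case using elim s by simp
      qed
    qed
  qed
  show "(\<lambda>N. outer_expectation P (\<lambda>\<omega>. h (Hs N \<omega>))) \<longlonglongrightarrow> (\<integral>\<omega>. h (G \<omega>) \<partial>M)"
  proof (rule order_tendstoI)
    fix a assume "a < (\<integral>\<omega>. h (G \<omega>) \<partial>M)"
    then show "\<forall>\<^sub>F N in sequentially. a < outer_expectation P (\<lambda>\<omega>. h (Hs N \<omega>))" using lower[of a 1] by simp
  next
    fix a assume "(\<integral>\<omega>. h (G \<omega>) \<partial>M) < a"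
    then have "\<forall>\<^sub>F N in sequentially. - a < - 1 * outer_expectation P (\<lambda>\<omega>. h (Hs N \<omega>))" by (intro lower) auto
    then show "\<forall>\<^sub>F N in sequentially. outer_expectation P (\<lambda>\<omega>. h (Hs N \<omega>)) < a" by simp
  qed
qed

end

subsection \<open>The limit of the Hajek process\<close>

context path_extension
begin

text \<open>The limit is moved to its image law, with the identity as random element, because the
  points of the final probability space are functions on the class.\<close>

definition law :: "('a \<Rightarrow> real) measure" where
  "law = distr M (linf_borel F) G"

lemma prob_law: "prob_space law"
  unfolding law_def by (rule prob_space_distr[OF G_measurable])

lemma law_ident: "(\<lambda>z. z) \<in> law \<rightarrow>\<^sub>M linf_borel F"
  unfolding law_def by simp

lemma integral_law:
  fixes h :: "('a \<Rightarrow> real) \<Rightarrow> real"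
  assumes "h \<in> borel_measurable (linf_borel F)"
  shows "integral\<^sup>L law h = (\<integral>\<omega>. h (G \<omega>) \<partial>M)"
  unfolding law_def using integral_distr[OF G_measurable assms] by simp

lemma law_tight: "tight_borel_element law F (\<lambda>z. z)"
  unfolding tight_borel_element_def
proof (intro conjI allI impI law_ident)
  interpret L: Metric_space "mspace (linf F)" "mdist (linf F)" by (rule Metric_space_mspace_mdist)
  fix \<epsilon> :: real assume "\<epsilon> > 0"
  then obtain K where K: "compactin (mtopology_of (linf F)) K" "1 - \<epsilon> \<le> measure M (G -` K \<inter> space M)"
    using G_tight unfolding tight_borel_element_def by blast
  have "Hausdorff_space (mtopology_of (linf F))" unfolding mtopology_of_def by (rule L.Hausdorff_space_mtopology)
  then have "closedin (mtopology_of (linf F)) K" by (rule compactin_imp_closedin[OF _ K(1)])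
  then have c: "K \<subseteq> mspace (linf F)" "openin (mtopology_of (linf F)) (mspace (linf F) - K)"
    unfolding closedin_def topspace_linf by auto
  have "space (linf_borel F) - (mspace (linf F) - K) \<in> sets (linf_borel F)"
    by (rule sets.compl_sets[OF openin_linf_borel[OF c(2)]])
  also have "space (linf_borel F) - (mspace (linf F) - K) = K" using c(1) by (auto simp: space_linf_borel)
  finally have Ks: "K \<in> sets (linf_borel F)" .
  have "(\<lambda>z. z) -` K \<inter> space law = K" using c(1) by (auto simp: law_def space_linf_borel)
  then have "measure law ((\<lambda>z. z) -` K \<inter> space law) = measure M (G -` K \<inter> space M)"
    unfolding law_def using measure_distr[OF G_measurable Ks] by simp
  then show "\<exists>K. compactin (mtopology_of (linf F)) K \<and> 1 - \<epsilon> \<le> measure law ((\<lambda>z. z) -` K \<inter> space law)"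
    using K by auto
qed

lemma law_weak: "weakly_converges P F Hs M G \<Longrightarrow> weakly_converges P F Hs law (\<lambda>z. z)"
  unfolding weakly_converges_def using integral_law[OF continuous_map_linf_borel_measurable] by simp

text \<open>A function that is not uniformly continuous stays so under perturbations smaller than a
  third of its oscillation. The exceptional set is thus open, hence measurable, and the property
  passes to the law.\<close>

lemma law_uc: "AE z in law. uniformly_continuous_wrt \<rho> F z"
proof -
  interpret L: Metric_space "mspace (linf F)" "mdist (linf F)" by (rule Metric_space_mspace_mdist)
  let ?U = "{z\<in>mspace (linf F). \<not> uniformly_continuous_wrt \<rho> F z}"
  have "openin L.mtopology ?U"
    unfolding L.openin_mtopology
  proof (intro conjI allI impI)
    fix z assume z: "z \<in> ?U"
    then obtain \<epsilon> where \<epsilon>: "\<epsilon> > 0" "\<And>\<delta>. \<delta> > 0 \<Longrightarrow> \<exists>f\<in>F. \<exists>g\<in>F. \<rho> f g < \<delta> \<and> \<not> \<bar>z f - z g\<bar> < \<epsilon>"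
      unfolding uniformly_continuous_wrt_def by blast
    have "L.mball z (\<epsilon> / 3) \<subseteq> ?U"
    proof
      fix w assume "w \<in> L.mball z (\<epsilon> / 3)"
      then have w: "w \<in> mspace (linf F)" and d: "mdist (linf F) z w < \<epsilon> / 3" by auto
      have "\<not> uniformly_continuous_wrt \<rho> F w"
      proof
        assume "uniformly_continuous_wrt \<rho> F w"
        note uc = this[unfolded uniformly_continuous_wrt_def, rule_format]
        have "\<epsilon> / 3 > 0" using \<epsilon>(1) by simp
        from uc[OF this] obtain \<delta> where \<delta>: "\<delta> > 0" "\<And>f g. f \<in> F \<Longrightarrow> g \<in> F \<Longrightarrow> \<rho> f g < \<delta> \<Longrightarrow> \<bar>w f - w g\<bar> < \<epsilon> / 3"
          by (elim exE conjE) blast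
        obtain f g where fg: "f \<in> F" "g \<in> F" "\<rho> f g < \<delta>" "\<not> \<bar>z f - z g\<bar> < \<epsilon>"
          using \<epsilon>(2)[OF \<delta>(1)] by (elim bexE conjE)
        have "\<bar>z f - w f\<bar> < \<epsilon> / 3" "\<bar>z g - w g\<bar> < \<epsilon> / 3"
          using linf_coordinate[of z F w f] linf_coordinate[of z F w g] z w fg(1,2) d by simp_all
        then show False using \<delta>(2)[OF fg(1-3)] fg(4) by linarith
      qed
      then show "w \<in> ?U" using w by simp
    qed
    then show "\<exists>r>0. L.mball z r \<subseteq> ?U" using \<epsilon>(1) by (intro exI[of _ "\<epsilon> / 3"]) simp
  qed auto
  then have U: "?U \<in> sets (linf_borel F)" by (intro openin_linf_borel) (simp add: mtopology_of_def)
  have "space (linf_borel F) - ?U \<in> sets (linf_borel F)" by (rule sets.compl_sets[OF U])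
  also have "space (linf_borel F) - ?U = {z\<in>space (linf_borel F). uniformly_continuous_wrt \<rho> F z}" by (auto simp: space_linf_borel)
  finally show ?thesis unfolding law_def using G_uc by (subst AE_distr_iff[OF G_measurable]) auto
qed

text \<open>Scaling the coefficients by \<open>t\<close> turns the assumption into the
  characteristic function of each linear combination, so \<open>cos_normal_imp\<close> applies to
  it.\<close>

lemma law_gaussian:
  assumes char: "\<And>A a b. finite A \<Longrightarrow> A \<subseteq> F \<Longrightarrow> (\<integral>\<omega>. cos ((\<Sum>f\<in>A. a f * G \<omega> f) + b) \<partial>M) = exp (- (\<Sum>f\<in>A. \<Sum>g\<in>A. a f * a g * C f g) / 2) * cos b"
    and psd: "\<And>A a. finite A \<Longrightarrow> A \<subseteq> F \<Longrightarrow> 0 \<le> (\<Sum>f\<in>A. \<Sum>g\<in>A. a f * a g * C f g)"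
    and sym: "\<And>f g. f \<in> F \<Longrightarrow> g \<in> F \<Longrightarrow> C f g = C g f"
  shows "zero_mean_gaussian_process law F (\<lambda>z. z) C"
proof -
  have cm: "(\<lambda>z. z f) \<in> borel_measurable (linf_borel F)" if "f \<in> F" for f
    by (rule continuous_map_linf_borel_measurable[OF continuous_linf_coordinate[OF that]])
  have cn: "cos_normal law (\<lambda>z. \<Sum>f\<in>A. a f * z f) (\<Sum>f\<in>A. \<Sum>g\<in>A. a f * a g * C f g)" if A: "finite A" "A \<subseteq> F" for A a
    unfolding cos_normal_def
  proof (intro conjI allI psd[OF A])
    have m [measurable]: "(\<lambda>z. \<Sum>f\<in>A. a f * z f) \<in> borel_measurable (linf_borel F)"
      by (intro borel_measurable_sum borel_measurable_times borel_measurable_const cm) (use A in auto)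
    then show "(\<lambda>z. \<Sum>f\<in>A. a f * z f) \<in> borel_measurable law" by (simp add: law_def)
    fix t b
    have "(\<integral>z. cos (t * (\<Sum>f\<in>A. a f * z f) + b) \<partial>law) = (\<integral>\<omega>. cos (t * (\<Sum>f\<in>A. a f * G \<omega> f) + b) \<partial>M)"
      by (rule integral_law) measurable
    also have "\<dots> = (\<integral>\<omega>. cos ((\<Sum>f\<in>A. (t * a f) * G \<omega> f) + b) \<partial>M)" by (simp add: sum_distrib_left mult.assoc)
    also have "\<dots> = exp (- (\<Sum>f\<in>A. \<Sum>g\<in>A. (t * a f) * (t * a g) * C f g) / 2) * cos b" by (rule char[OF A])
    also have "(\<Sum>f\<in>A. \<Sum>g\<in>A. (t * a f) * (t * a g) * C f g) = t\<^sup>2 * (\<Sum>f\<in>A. \<Sum>g\<in>A. a f * a g * C f g)"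
      unfolding sum_distrib_left by (intro sum.cong refl) (simp add: power2_eq_square)
    finally show "(\<integral>z. cos (t * (\<Sum>f\<in>A. a f * z f) + b) \<partial>law) = exp (- (t\<^sup>2 * (\<Sum>f\<in>A. \<Sum>g\<in>A. a f * a g * C f g) / 2)) * cos b" by simp
  qed
  note imp = cos_normal_imp[OF prob_law cn]
  have one: "integrable law (\<lambda>z. (z f)\<^sup>2)" "(\<integral>z. z f \<partial>law) = 0" "(\<integral>z. (z f)\<^sup>2 \<partial>law) = C f f" if "f \<in> F" for f
    using imp(2-4)[of "{f}" "\<lambda>_. 1"] that by simp_all
  show ?thesis
    unfolding zero_mean_gaussian_process_def gaussian_process_def
  proof (intro conjI allI ballI impI)
    show "normal_rv law (\<lambda>z. \<Sum>f\<in>A. a f * z f)" if "finite A \<and> A \<subseteq> F" for A a by (rule imp(1)) (use that in auto)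
    show "(\<integral>z. z f \<partial>law) = 0" if "f \<in> F" for f by (rule one(2)[OF that])
    fix f g assume f: "f \<in> F" and g: "g \<in> F"
    show "(\<integral>z. z f * z g \<partial>law) = C f g"
    proof (cases "f = g")
      case True
      then show ?thesis using one(3)[OF f] by (simp add: power2_eq_square)
    next
      \<comment> \<open>Polarization: the covariance is obtained from the variance of the sum. The
        two functions must differ for \<open>{f, g}\<close> to index this sum.\<close>
      case False
      have two: "integrable law (\<lambda>z. (z f + z g)\<^sup>2)" "(\<integral>z. (z f + z g)\<^sup>2 \<partial>law) = C f f + C f g + (C g f + C g g)"
        using imp(2,4)[of "{f, g}" "\<lambda>_. 1"] f g False by simp_all
      have "(\<integral>z. z f * z g \<partial>law) = (\<integral>z. 1 / 2 * ((z f + z g)\<^sup>2 - (z f)\<^sup>2 - (z g)\<^sup>2) \<partial>law)"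
        by (intro Bochner_Integration.integral_cong refl) (simp add: power2_eq_square algebra_simps)
      also have "\<dots> = 1 / 2 * ((C f f + C f g + (C g f + C g g)) - C f f - C g g)"
        using two one[OF f] one[OF g] by simp
      also have "\<dots> = C f g" using sym[OF f g] by simp
      finally show ?thesis .
    qed
  qed
qed

end

text \<open>The bound depends on \<open>u\<close> only through the pointwise envelope
  \<open>b\<close>, so it is uniform over a class with this envelope.\<close>

lemma hajek_bounded:
  assumes "\<And>i. i < N \<Longrightarrow> \<bar>u (y i)\<bar> \<le> b i"
  shows "\<bar>hajek_process N p s y u\<bar> \<le> sqrt (real N) * (\<bar>1 / N_hat N p s\<bar> * (\<Sum>i<N. \<bar>real (s i) / p i\<bar> * b i) + 1 / real N * (\<Sum>i<N. b i))"
proof -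
  have b: "0 \<le> b i" if "i < N" for i using assms[OF that] by linarith
  have 1: "\<bar>\<Sum>i<N. real (s i) / p i * u (y i)\<bar> \<le> (\<Sum>i<N. \<bar>real (s i) / p i\<bar> * b i)"
    by (rule order_trans[OF sum_abs], rule sum_mono, subst abs_mult, rule mult_left_mono[OF assms abs_ge_zero]) simp
  have 2: "\<bar>\<Sum>i<N. u (y i)\<bar> \<le> (\<Sum>i<N. b i)"
    by (rule order_trans[OF sum_abs], rule sum_mono, rule assms) simp
  have rhs: "0 \<le> \<bar>1 / N_hat N p s\<bar> * (\<Sum>i<N. \<bar>real (s i) / p i\<bar> * b i) + 1 / real N * (\<Sum>i<N. b i)"
    using b by (intro add_nonneg_nonneg mult_nonneg_nonneg sum_nonneg) auto
  show ?thesis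
  proof (cases "N_hat N p s = 0")
    case True
    then have "hajek_process N p s y u = 0" by (simp add: hajek_process_def)
    then show ?thesis by (simp only: abs_zero) (rule mult_nonneg_nonneg[OF _ rhs], simp)
  next
    case False
    define x where "x = 1 / N_hat N p s * (\<Sum>i<N. real (s i) / p i * u (y i)) - emp_mean N y u"
    have "\<bar>x\<bar>
      \<le> \<bar>1 / N_hat N p s\<bar> * \<bar>\<Sum>i<N. real (s i) / p i * u (y i)\<bar> + 1 / real N * \<bar>\<Sum>i<N. u (y i)\<bar>"
      unfolding x_def emp_mean_def by (rule order_trans[OF abs_triangle_ineq4]) (simp add: abs_mult)
    also have "\<dots> \<le> \<bar>1 / N_hat N p s\<bar> * (\<Sum>i<N. \<bar>real (s i) / p i\<bar> * b i) + 1 / real N * (\<Sum>i<N. b i)"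
      by (intro add_mono mult_left_mono 1 2) auto
    finally have "sqrt (real N) * \<bar>x\<bar> \<le> sqrt (real N) * (\<bar>1 / N_hat N p s\<bar> * (\<Sum>i<N. \<bar>real (s i) / p i\<bar> * b i) + 1 / real N * (\<Sum>i<N. b i))"
      by (rule mult_left_mono) simp
    moreover have "hajek_process N p s y u = sqrt (real N) * x" unfolding hajek_process_def x_def using False by (rule if_not_P)
    moreover have "\<bar>sqrt (real N) * x\<bar> = sqrt (real N) * \<bar>x\<bar>" by (simp add: abs_mult)
    ultimately show ?thesis by (simp only:)
  qed
qed

context poisson_limit
begin

lemma cen_diff_sq: "f \<in> F \<Longrightarrow> g \<in> F \<Longrightarrow> integrable Py (\<lambda>y. (cen f y - cen g y)\<^sup>2)"
proof -
  assume "f \<in> F" "g \<in> F"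
  note fg = meas_Py[OF cen_meas[OF this(1)]] meas_Py[OF cen_meas[OF this(2)]] cen_sq[OF this(1)] cen_sq[OF this(2)]
  have "integrable Py (\<lambda>y. (\<Sum>b\<in>UNIV. if b then cen f y else - cen g y)\<^sup>2)"
  proof (rule integrable_square_sum)
    fix b :: bool
    show "(\<lambda>y. if b then cen f y else - cen g y) \<in> borel_measurable Py" using fg by (cases b) simp_all
    show "integrable Py (\<lambda>y. (if b then cen f y else - cen g y)\<^sup>2)" using fg by (cases b) simp_all
  qed
  then show ?thesis by (simp add: UNIV_bool)
qed

lemma rho_c_cen: "rho_c Py f g = sqrt (\<integral>y. (cen f y - cen g y)\<^sup>2 \<partial>Py)"
  by (simp add: rho_c_def cen_def)

text \<open>The pointwise inequality for the square of a sum gives a factor \<open>sqrt 2\<close>,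
  which is absorbed into 2; this is the form that \<open>path_extension\<close> asks for.\<close>

lemma rho_c_quasi_triangle:
  assumes "f \<in> F" "g \<in> F" "h \<in> F"
  shows "rho_c Py f h \<le> 2 * (rho_c Py f g + rho_c Py g h)"
proof -
  define x where "x = (\<integral>y. (cen f y - cen g y)\<^sup>2 \<partial>Py)"
  define y where "y = (\<integral>y. (cen g y - cen h y)\<^sup>2 \<partial>Py)"
  have xy: "0 \<le> x" "0 \<le> y" unfolding x_def y_def by (rule integral_nonneg_AE, simp)+
  have "(\<integral>y. (cen f y - cen h y)\<^sup>2 \<partial>Py) \<le> (\<integral>y. 2 * (cen f y - cen g y)\<^sup>2 + 2 * (cen g y - cen h y)\<^sup>2 \<partial>Py)"
  proof (rule integral_mono)
    fix y
    have "(a + b)\<^sup>2 \<le> 2 * a\<^sup>2 + 2 * b\<^sup>2" for a b :: real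
      using zero_le_power2[of "a - b"] by (simp add: power2_eq_square algebra_simps)
    from this[of "cen f y - cen g y" "cen g y - cen h y"]
    show "(cen f y - cen h y)\<^sup>2 \<le> 2 * (cen f y - cen g y)\<^sup>2 + 2 * (cen g y - cen h y)\<^sup>2" by simp
  qed (use cen_diff_sq assms in auto)
  also have "\<dots> = 2 * x + 2 * y" unfolding x_def y_def using cen_diff_sq assms by simp
  also have "\<dots> \<le> (2 * (sqrt x + sqrt y))\<^sup>2"
  proof -
    have "(2 * (sqrt x + sqrt y))\<^sup>2 = 4 * x + 4 * y + 8 * (sqrt x * sqrt y)"
    proof -
      have "(2 * (a + b))\<^sup>2 = 4 * (a * a) + 4 * (b * b) + 8 * (a * b)" for a b :: real
        by (simp add: power2_eq_square algebra_simps)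
      from this[of "sqrt x" "sqrt y"] show ?thesis using xy by simp
    qed
    moreover have "0 \<le> sqrt x * sqrt y" using xy by simp
    ultimately show ?thesis using xy by linarith
  qed
  finally show ?thesis unfolding rho_c_cen x_def[symmetric] y_def[symmetric] using xy by (intro real_le_lsqrt) auto
qed

lemma hajek_element_hj: "f \<in> F \<Longrightarrow> hajek_element F D en \<pi> N \<omega> f = hj N \<omega> f"
  by (simp add: hajek_element_def hj_def split_beta')

text \<open>The envelope exists for centred functions only, and centring leaves the process
  unchanged for \<open>N > 0\<close>. For \<open>N = 0\<close> the process vanishes.\<close>

lemma hajek_element_space:
  fixes \<omega> :: "(nat \<Rightarrow> 'y \<times> 'x) \<times> 'd \<times> (nat \<Rightarrow> 'e)"
  assumes bdd: "\<And>y. bdd_above ((\<lambda>f. \<bar>f y - \<mu> f\<bar>) ` F)"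
  shows "hajek_element F D en \<pi> N \<omega> \<in> mspace (linf F)"
proof -
  have "\<forall>y. \<exists>b. \<forall>f\<in>F. \<bar>cen f y\<bar> \<le> b" using bdd unfolding bdd_above_def cen_def by auto
  from choice[OF this] obtain b where b: "\<And>y f. f \<in> F \<Longrightarrow> \<bar>cen f y\<bar> \<le> b y" by blast
  have "\<exists>K. \<forall>f\<in>F. \<bar>hj N \<omega> f\<bar> \<le> K"
  proof (cases "N = 0")
    case True
    then show ?thesis by (intro exI[of _ 0]) (simp add: hj_def hajek_process_def)
  next
    case False
    then have eq: "hj N \<omega> f = hajek_process N (p N (fst \<omega>)) (S N (fst \<omega>) (fst (snd \<omega>))) (Y_of (fst \<omega>)) (cen f)" for f
      unfolding hj_def cen_def[abs_def] by (subst hajek_shift) auto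
    show ?thesis
      by (intro exI ballI, subst eq, rule hajek_bounded[where b="\<lambda>i. b (Y_of (fst \<omega>) i)"], erule b)
  qed
  then obtain K where K: "\<And>f. f \<in> F \<Longrightarrow> \<bar>hj N \<omega> f\<bar> \<le> K" by blast
  have "hajek_element F D en \<pi> N \<omega> = (\<lambda>f\<in>F. hj N \<omega> f)"
    by (simp add: hajek_element_def hj_def split_beta')
  then show ?thesis using linf_restrict[of F "hj N \<omega>" K, OF K] by simp
qed

text \<open>A Gaussian sequence with covariance \<open>Sig\<close> is placed on a
  \<open>rho_c\<close>-dense sequence of functions; it inherits the equicontinuity of the Hajek
  processes and is extended to the whole class.\<close>

lemma hajek_limit:
  assumes bdd: "\<And>y. bdd_above ((\<lambda>f. \<bar>f y - \<mu> f\<bar>) ` F)"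
  shows "\<exists>(M :: (('y \<Rightarrow> real) \<Rightarrow> real) measure) G. prob_space M \<and> zero_mean_gaussian_process M F G Sig \<and>
    tight_borel_element M F G \<and> weakly_converges P F (hajek_element F D en \<pi>) M G \<and>
    (AE \<omega> in M. uniformly_continuous_wrt (rho_c Py) F (G \<omega>))"
proof -
  have "\<exists>(t :: nat \<Rightarrow> 'y \<Rightarrow> real) idx J. (\<forall>j. t j \<in> F) \<and> (\<forall>m. \<forall>f\<in>F. idx m f < (J m :: nat) \<and> rho_c Py f (t (idx m f)) < rate m)"
  proof (rule net_sequence[of F "rho_c Py"])
    show "F \<noteq> {}" by (rule F_ne)
    show "\<exists>A. finite A \<and> A \<subseteq> F \<and> (\<forall>f\<in>F. \<exists>g\<in>A. rho_c Py f g < \<delta>)" if "\<delta> > 0" for \<delta>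
      by (rule dl.rho_c_totally_bounded[OF that])
    fix t :: "nat \<Rightarrow> 'y \<Rightarrow> real" and idx :: "nat \<Rightarrow> ('y \<Rightarrow> real) \<Rightarrow> nat" and J :: "nat \<Rightarrow> nat"
    assume "\<And>j. t j \<in> F" "\<And>m f. f \<in> F \<Longrightarrow> idx m f < J m \<and> rho_c Py f (t (idx m f)) < rate m"
    then show "\<exists>(t :: nat \<Rightarrow> 'y \<Rightarrow> real) idx J. (\<forall>j. t j \<in> F) \<and> (\<forall>m. \<forall>f\<in>F. idx m f < (J m :: nat) \<and> rho_c Py f (t (idx m f)) < rate m)"
      by (intro exI[of _ t] exI[of _ idx] exI[of _ J] conjI allI ballI) simp_all
  qed
  then obtain t :: "nat \<Rightarrow> 'y \<Rightarrow> real" and idx and J :: "nat \<Rightarrow> nat" where t: "\<And>j. t j \<in> F"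
    and idx: "\<And>m f. f \<in> F \<Longrightarrow> idx m f < J m \<and> rho_c Py f (t (idx m f)) < rate m"
    by (elim exE conjE) blast
  define X where "X j \<omega> = (\<Sum>m<Suc j. chol (\<lambda>i j. Sig (t i) (t j)) j m * \<omega> m)" for j and \<omega> :: "nat \<Rightarrow> real"
  have gs: "cos_normal normals (\<lambda>\<omega>. \<Sum>j<k. a j * X j \<omega>) (\<Sum>i<k. \<Sum>j<k. a i * a j * Sig (t i) (t j))" for k a
    unfolding X_def by (rule gaussian_sequence[OF Sig_psd[OF t]])
  have Xm: "X j \<in> borel_measurable normals" for j
  proof -
    have "(\<lambda>\<omega>. \<Sum>i<Suc j. (if i = j then 1 else 0) * X i \<omega>) \<in> borel_measurable normals"
      using gs[of "\<lambda>i. if i = j then 1 else 0" "Suc j"] unfolding cos_normal_def by (rule conjunct1)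
    moreover have "(\<Sum>i<Suc j. (if i = j then 1 else 0) * X i \<omega>) = X j \<omega>" for \<omega>
      using sum.delta[of "{..<Suc j}" j "\<lambda>i. X i \<omega>"] by (simp add: if_distrib[of "\<lambda>c. c * _"] cong: if_cong)
    ultimately show ?thesis by simp
  qed
  have nrm: "prob_space normals" by (rule prob_space_iid[OF prob_std_normal])
  let ?H = "hajek_element F D en \<pi>"
  \<comment> \<open>This precedes the path extension because \<open>weak_limit.equi_limit\<close>
    supplies the equicontinuity of \<open>X\<close> that the extension requires.\<close>
  have wl: "weak_limit P ?H F (rho_c Py) t normals X"
  proof (rule weak_limit.intro[OF prob_P nrm t])
    show "(\<lambda>\<omega>. ?H N \<omega> f) \<in> borel_measurable P" if "f \<in> F" for N f
      using hj_measurable[OF that] by (simp add: hajek_element_hj[OF that])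
    show "X j \<in> borel_measurable normals" for j by (rule Xm)
    fix k a b
    have "(\<integral>\<omega>. cos ((\<Sum>j<k. a j * X j \<omega>) + b) \<partial>normals) = exp (- (\<Sum>i<k. \<Sum>j<k. a i * a j * Sig (t i) (t j)) / 2) * cos b"
    proof -
      have "(\<integral>\<omega>. cos (1 * (\<Sum>j<k. a j * X j \<omega>) + b) \<partial>normals) = exp (- (1\<^sup>2 * (\<Sum>i<k. \<Sum>j<k. a i * a j * Sig (t i) (t j)) / 2)) * cos b"
        using gs[of a k] unfolding cos_normal_def by blast
      then show ?thesis by simp
    qed
    then show "(\<lambda>N. \<integral>\<omega>. cos ((\<Sum>j<k. a j * ?H N \<omega> (t j)) + b) \<partial>P) \<longlonglongrightarrow> (\<integral>\<omega>. cos ((\<Sum>j<k. a j * X j \<omega>) + b) \<partial>normals)"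
      using hj_fidi[of "{..<k}" t a b, OF finite_lessThan t] by (simp add: hajek_element_hj[OF t])
  next
    fix \<epsilon> \<eta> :: real assume "\<epsilon> > 0" "\<eta> > 0"
    from hajek_equicontinuous[OF this]
    show "\<exists>\<delta>>0. \<exists>N0. \<forall>N\<ge>N0. outer_le P {\<omega>. \<exists>f\<in>F. \<exists>g\<in>F. rho_c Py f g < \<delta> \<and> \<epsilon> < \<bar>?H N \<omega> f - ?H N \<omega> g\<bar>} \<eta>"
      by (simp add: hajek_element_hj cong: bex_cong)
  qed
  have pe: "path_extension normals F (rho_c Py) t idx J X"
  proof (rule path_extension.intro[OF nrm], unfold_locales)
    show "F \<noteq> {}" by (rule F_ne)
    show "0 \<le> rho_c Py f g" for f g unfolding rho_c_def by (simp add: integral_nonneg_AE)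
    show "rho_c Py f g = rho_c Py g f" for f g unfolding rho_c_def by (simp add: power2_commute)
    show "rho_c Py f h \<le> 2 * (rho_c Py f g + rho_c Py g h)" if "f \<in> F" "g \<in> F" "h \<in> F" for f g h
      by (rule rho_c_quasi_triangle[OF that])
    show "\<exists>\<delta>>0. \<forall>n. measure normals {\<omega>\<in>space normals. \<exists>j<n. \<exists>k<n. rho_c Py (t j) (t k) < \<delta> \<and> \<epsilon> < \<bar>X j \<omega> - X k \<omega>\<bar>} \<le> \<eta>"
      if "\<epsilon> > 0" "\<eta> > 0" for \<epsilon> \<eta> by (rule weak_limit.equi_limit[OF wl that])
  qed (use t idx Xm in auto)
  interpret E: path_extension normals F "rho_c Py" t idx J X by (rule pe)
  have sp: "?H N \<omega> \<in> mspace (linf F)" for N and \<omega> :: "(nat \<Rightarrow> 'y \<times> 'x) \<times> 'd \<times> (nat \<Rightarrow> 'e)" by (rule hajek_element_space[OF bdd])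
  interpret W: weak_path P ?H F "rho_c Py" t normals X idx J
    by (intro weak_path.intro wl pe weak_path_axioms.intro sp)
  \<comment> \<open>Functions in \<open>A\<close> need not belong to the sequence \<open>t\<close>.
    The law of \<open>E.G\<close> on \<open>A\<close> is identified by computing the limit of the
    cosine moments in two ways, by weak convergence and by \<open>hj_fidi\<close>.\<close>
  have char: "(\<integral>\<omega>. cos ((\<Sum>f\<in>A. a f * E.G \<omega> f) + b) \<partial>normals) = exp (- (\<Sum>f\<in>A. \<Sum>g\<in>A. a f * a g * Sig f g) / 2) * cos b"
    if A: "finite A" "A \<subseteq> F" for A a b
  proof (rule LIMSEQ_unique)
    have AF: "f \<in> A \<Longrightarrow> f \<in> F" for f using A by blast
    let ?h = "\<lambda>z. cos ((\<Sum>f\<in>A. a f * z f) + b)"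
    have "(\<lambda>N. outer_expectation P (\<lambda>\<omega>. ?h (?H N \<omega>))) \<longlonglongrightarrow> (\<integral>\<omega>. ?h (E.G \<omega>) \<partial>normals)"
    proof (rule W.weak_Lipschitz[where h="?h" and B=1])
      fix z w assume zw: "z \<in> mspace (linf F)" "w \<in> mspace (linf F)"
      have "\<bar>?h z - ?h w\<bar> \<le> \<bar>\<Sum>f\<in>A. a f * (z f - w f)\<bar>"
        using cos_diff_le[of "(\<Sum>f\<in>A. a f * z f) + b" "(\<Sum>f\<in>A. a f * w f) + b"] by (simp add: right_diff_distrib sum_subtractf)
      also have "\<dots> \<le> (\<Sum>f\<in>A. \<bar>a f\<bar> * mdist (linf F) z w)"
        by (rule order_trans[OF sum_abs]) (auto simp: abs_mult intro!: sum_mono mult_left_mono linf_coordinate zw AF)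
      finally show "\<bar>?h z - ?h w\<bar> \<le> (\<Sum>f\<in>A. \<bar>a f\<bar>) * mdist (linf F) z w" by (simp add: sum_distrib_right)
    qed simp
    moreover have "outer_expectation P (\<lambda>\<omega>. ?h (?H N \<omega>)) = (\<integral>\<omega>. cos ((\<Sum>f\<in>A. a f * hj N \<omega> f) + b) \<partial>P)" for N
    proof -
      have eq: "?h (?H N \<omega>) = cos ((\<Sum>f\<in>A. a f * hj N \<omega> f) + b)" for \<omega>
        using hajek_element_hj[OF AF] by simp
      have "(\<lambda>\<omega>. \<Sum>f\<in>A. a f * hj N \<omega> f) \<in> borel_measurable P"
        by (intro borel_measurable_sum borel_measurable_times borel_measurable_const hj_measurable AF)
      then have "integrable P (\<lambda>\<omega>. cos ((\<Sum>f\<in>A. a f * hj N \<omega> f) + b))"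
        by (intro P.integrable_const_bound[where B=1]) auto
      then show ?thesis unfolding eq by (rule outer_expectation_measurable)
    qed
    ultimately show "(\<lambda>N. \<integral>\<omega>. cos ((\<Sum>f\<in>A. a f * hj N \<omega> f) + b) \<partial>P) \<longlonglongrightarrow> (\<integral>\<omega>. ?h (E.G \<omega>) \<partial>normals)" by simp
    show "(\<lambda>N. \<integral>\<omega>. cos ((\<Sum>f\<in>A. a f * hj N \<omega> f) + b) \<partial>P) \<longlonglongrightarrow> exp (- (\<Sum>f\<in>A. \<Sum>g\<in>A. a f * a g * Sig f g) / 2) * cos b"
      using hj_fidi[of A "\<lambda>f. f" a b, OF A(1) AF] .
  qed
  show ?thesis
  proof (intro exI[of _ E.law] exI[of _ "\<lambda>z. z"] conjI)
    show "prob_space E.law" by (rule E.prob_law)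
    show "zero_mean_gaussian_process E.law F (\<lambda>z. z) Sig"
    proof (rule E.law_gaussian[OF char])
      show "0 \<le> (\<Sum>f\<in>A. \<Sum>g\<in>A. a f * a g * Sig f g)" if "finite A" "A \<subseteq> F" for A a
        by (rule Sig_nonneg[of A "\<lambda>f. f"]) (use that in auto)
    qed (assumption | erule (1) Sig_sym)+
    show "tight_borel_element E.law F (\<lambda>z. z)" by (rule E.law_tight)
    show "weakly_converges P F ?H E.law (\<lambda>z. z)" by (rule E.law_weak[OF W.weak])
    show "AE z in E.law. uniformly_continuous_wrt (rho_c Py) F z" by (rule E.law_uc)
  qed
qed

end

theorem theorem4p1:
  fixes Pyx :: "('y::{banach, second_countable_topology} \<times> 'x::{banach, second_countable_topology}) measure"
    and Pd :: "'d measure" and D :: "'d \<Rightarrow> real"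
    and Pe :: "'e measure" and r :: "'e \<Rightarrow> real"
    and en :: "nat \<Rightarrow> nat \<Rightarrow> nat \<Rightarrow> nat"
    and \<pi> :: "nat \<Rightarrow> nat \<Rightarrow> (nat \<Rightarrow> 'x) \<Rightarrow> real"
    and F :: "('y \<Rightarrow> real) set"
  defines "Py \<equiv> distr Pyx borel fst"
    and "P \<equiv> full_space Pyx Pd Pe"
  assumes "prob_space Pyx" and "sets Pyx = sets borel"
    and "prob_space Pd" and "uniform01_rv Pd D"
    and "prob_space Pe" and "rademacher_rv Pe r"
    and "\<And>N. bij_betw (en N) {..<2 ^ N} ({..<N} \<rightarrow>\<^sub>E {0, 1})"
    and "measurable_poisson_design \<pi>"
    and "F \<subseteq> borel_measurable borel" and "donsker Py F"
    and cond1: "\<exists>f\<in>F. \<exists>C. C \<noteq> 0 \<and> (AE y in Py. f y = C)"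
    and cond2: "\<exists>\<Sigma>'. \<forall>f\<in>F. \<forall>g\<in>F. converges_in_probability P
        (\<lambda>N (z, d, e). design_cov HT_process Pd D en \<pi> f g N z) (\<Sigma>' f g)"
    and cond3: "\<exists>L>0. (\<lambda>N. measure P {(z, d, e) \<in> space P. \<forall>i<N. L \<le> incl_prob \<pi> N z i}) \<longlonglongrightarrow> 1"
  shows "\<exists>\<Sigma>''. (\<forall>f\<in>F. \<forall>g\<in>F. converges_in_probability P
        (\<lambda>N (z, d, e). design_cov centred_HT_process Pd D en \<pi> f g N z) (\<Sigma>'' f g)) \<and>
      (\<exists>(M :: (('y \<Rightarrow> real) \<Rightarrow> real) measure) G.
        prob_space M \<and>
        zero_mean_gaussian_process M F G \<Sigma>'' \<and>
        tight_borel_element M F G \<and>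
        weakly_converges P F (hajek_element F D en \<pi>) M G \<and>
        (AE \<omega> in M. uniformly_continuous_wrt (rho_c Py) F (G \<omega>)))"
proof -
  have PS: "poisson_survey Pyx Pd D Pe en \<pi>" by (rule poisson_survey.intro) (use assms in auto)
  interpret PS: poisson_survey Pyx Pd D Pe en \<pi> by (rule PS)
  have Py: "Py = PS.Py" unfolding Py_def PS.Py_def ..
  obtain f0 C where f0: "f0 \<in> F" "C \<noteq> 0" "AE y in Py. f0 y = C" using cond1 by blast
  obtain \<Sigma>' where \<Sigma>': "\<And>f g. f \<in> F \<Longrightarrow> g \<in> F \<Longrightarrow> converges_in_probability P
        (\<lambda>N (z, d, e). design_cov HT_process Pd D en \<pi> f g N z) (\<Sigma>' f g)" using cond2 by blast
  obtain L where L: "L > 0" "(\<lambda>N. measure P {(z, d, e) \<in> space P. \<forall>i<N. L \<le> incl_prob \<pi> N z i}) \<longlonglongrightarrow> 1" using cond3 by blast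
  have don: "\<And>f. f \<in> F \<Longrightarrow> integrable Py f" "\<And>y. bdd_above ((\<lambda>f. \<bar>f y - integral\<^sup>L Py f\<bar>) ` F)"
    using \<open>donsker Py F\<close> unfolding donsker_def by (auto simp: Py_def)
  obtain M0 :: "(('y \<Rightarrow> real) \<Rightarrow> real) measure" and G0 where M0: "prob_space M0" "tight_borel_element M0 F G0"
    "weakly_converges (Pi\<^sub>M UNIV (\<lambda>_::nat. Py)) F (\<lambda>N z. \<lambda>f\<in>F. 1 / sqrt (real N) * (\<Sum>i<N. f (z i) - integral\<^sup>L Py f)) M0 G0"
    using \<open>donsker Py F\<close> unfolding donsker_def by blast
  have dl: "donsker_limit Py F M0 G0"
    by (rule donsker_limit.intro[OF PS.prob_Py[folded Py] don(1) M0])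
  \<comment> \<open>The event concerns the first factor only, so its probability is that of an event
    of the population space.\<close>
  have Lp: "(\<lambda>N. measure PS.Z {z\<in>space PS.Z. \<forall>i<N. L \<le> incl_prob \<pi> N z i}) \<longlonglongrightarrow> 1"
  proof -
    have "{(z, d, e) \<in> space P. \<forall>i<N. L \<le> incl_prob \<pi> N z i} = {\<omega>\<in>space P. fst \<omega> \<in> {z\<in>space PS.Z. \<forall>i<N. L \<le> incl_prob \<pi> N z i}}" for N
      using measurable_space[OF PS.fst_measurable_P] unfolding P_def by auto
    then show ?thesis using L(2) PS.measure_P_fst[OF PS.lower_bound_sets] unfolding P_def by simp
  qed
  interpret PL: poisson_limit Pyx Pd D Pe en \<pi> F M0 G0 f0 C \<Sigma>' L
  proof (rule poisson_limit.intro[OF PS poisson_limit_axioms.intro])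
    show "donsker_limit PS.Py F M0 G0" using dl unfolding Py_def PS.Py_def .
    show "AE y in PS.Py. f0 y = C" using f0(3) unfolding Py_def PS.Py_def .
    show "converges_in_probability PS.Z (\<lambda>N z. dcov N (incl_prob \<pi> N z) (Y_of z) f g) (\<Sigma>' f g)" if "f \<in> F" "g \<in> F" for f g
      using \<Sigma>'[OF that] unfolding P_def PS.converges_in_probability_fst PS.design_cov_HT .
  qed (use assms f0 L Lp in auto)
  have "\<exists>(M :: (('y \<Rightarrow> real) \<Rightarrow> real) measure) G. prob_space M \<and> zero_mean_gaussian_process M F G PL.Sig \<and>
    tight_borel_element M F G \<and> weakly_converges P F (hajek_element F D en \<pi>) M G \<and>
    (AE \<omega> in M. uniformly_continuous_wrt (rho_c Py) F (G \<omega>))"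
    using PL.hajek_limit don(2) unfolding P_def Py by blast
  then show ?thesis using PL.centred_design_cov unfolding P_def by (intro exI[of _ PL.Sig] conjI ballI)
qed

end
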